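(* Let $k,n$ be positive integers with $k+2\le n$, let $Z\in\mathrm{Mat}^{>0}_{n,k+2}$, and let $\overline{\mathcal T}$ be a bicolored subdivision of type $(k,n)$. Then $$\mathcal V_{\overline{\mathcal T}}:=\bigcup_{\mathcal T}\mathcal V_{\mathcal T}$$ is a cluster variety in $\mathrm{Gr}_{k,k+2}(\mathbb C)$ (with seeds $\Sigma_{\mathcal T}$), where the union is over the bicolored triangulations $\mathcal T$ represented by $\overline{\mathcal T}$. Moreover, the positive part $$\mathcal V^{>0}_{\overline{\mathcal T}}:=\{Y\in\mathcal V_{\overline{\mathcal T}}\ :\ x_{ab}(Y)>0\text{ for all cluster variables }x_{ab}\}$$ is equal to the open positroid tile $Z^\circ_{\hat G(\overline{\mathcal T})}$.
   Context: Grassmannian and tile conventions. $\mathrm{Gr}_{k,n}$ is the real Grassmannian of $k$-planes in $\mathbb R^n$ (row spans of full-rank $k\times n$ matrices), $p_I$ are Plücker coordinates, $\mathrm{Gr}^{\ge0}_{k,n}$ is the set of points with a representative having all $p_I\ge0$. $\mathrm{Mat}^{>0}_{n,k+2}$ is the set of real $n\times(k+2)$ matrices with all maximal minors positive; $Z$ has rows $Z_1,\dots,Z_n$ and induces $\tilde Z:\mathrm{Gr}^{\ge0}_{k,n}\to\mathrm{Gr}_{k,k+2}$, $C\mapsto CZ$. For $Y\in\mathrm{Gr}_{k,k+2}(\mathbb C)$ represented by a matrix with rows $y_1,\dots,y_k$, the twistor coordinate $\langle Yij\rangle$ is the determinant of the matrix with rows $y_1,\dots,y_k,Z_i,Z_j$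 (defined up to a common nonzero scalar). Bicolored subdivisions. Let $\mathbf P_n$ be a convex $n$-gon with vertices $1,\dots,n$ clockwise. A bicolored triangulation of type $(k,n)$ is a triangulation of $\mathbf P_n$ with $k$ black triangles and the rest white; two are equivalent if the unions of their black triangles coincide, and the class of $\mathcal T$ is represented by the bicolored subdivision $\overline{\mathcal T}$ obtained by erasing diagonals separating triangles of the same color. Such $\mathcal T$ are said to be represented by $\overline{\mathcal T}$. A black arc of $\mathcal T$ is a side of a black triangle of $\mathcal T$. For an arc $a\to b$ not crossing arcs of $\overline{\mathcal T}$, $\mathrm{area}(a\to b)$ is the number of black triangles to the left of $a\to b$ (the side containing vertices $a,a+1,\dots,b$ cyclically) in any triangulation of $\overline{\mathcal T}$ that uses $a\to b$. Tile. $S_{\hat G(\overline{\mathcal T})}\subset\mathrm{Gr}^{\ge0}_{k,n}$ is the set of points with $p_I>0$ exactly for those $I\in\binom{[n]}k$ admitting a bijection $\phi$ from $I$ to the black triangles of $\mathcal T$ with $i$ a vertex of $\phi(i)$ for each $i\in I$, and $p_I=0$ otherwise (this depends only on $\overline{\mathcal T}$). $Z^\circ_{\hat G(\overline{\mathcal T})}:=\tilde Z(S_{\hat G(\overline{\mathcal T})})\subset\mathrm{Gr}_{k,k+2}(\mathbb R)\subset\mathrm{Gr}_{k,k+2}(\mathbb C)$. Cluster variables. Let $P_1,\dots,P_r$ be the black polygons of $\overline{\mathcal T}$; for each $P_i$ fix a side $h_i\to j_i$ with $h_i<j_i$, the distinguished boundary arc. For an arc $a\to b$, $a<b$, which is a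 side or diagonal of $P_i$ other than $h_i\to j_i$, put $$x_{ab}:=\frac{(-1)^{\mathrm{area}(a\to b)}\langle Yab\rangle}{(-1)^{\mathrm{area}(h_i\to j_i)}\langle Yh_ij_i\rangle},$$ a rational function on $\mathrm{Gr}_{k,k+2}(\mathbb C)$. All these $x_{ab}$ (including frozen ones) are the cluster variables. Seeds. For $\mathcal T$ represented by $\overline{\mathcal T}$, the quiver $Q_{\mathcal T}$ has a frozen vertex on each boundary arc of $P_1,\dots,P_r$ and a mutable vertex on every other black arc of $\mathcal T$; for each black triangle with arcs $a\to b,b\to c,c\to a$ put arrows between the three corresponding vertices going clockwise around the triangle; then delete the frozen vertices on the distinguished boundary arcs (with all arrows at them) and arrows connecting two frozen vertices. The vertex on arc $a\to b$ is labeled by $x_{ab}$; the collection of labels is the extended cluster $\mathbf x_{\mathcal T}$ (of size $2k$) and $\Sigma_{\mathcal T}=(Q_{\mathcal T},\mathbf x_{\mathcal T})$. Seed tori. $\mathcal V_{\mathcal T}:=\{Y\in\mathrm{Gr}_{k,k+2}(\mathbb C): \prod_{a\to b\text{ black arc of }\mathcal T}\langle Yab\rangle\ne0\}$, a Zariski-open subset. "Cluster variety in $\mathrm{Gr}_{k,k+2}(\mathbb C)$" means here: each $\mathcal V_{\mathcal T}$ is birational to an algebraic torus of dimension $2k$ via $\mathbf x_{\mathcal T}$, with field of rational functions $\mathbb C(\mathbf x_{\mathcal T})$; and the seeds $\Sigma_{\mathcal T}$, for $\mathcal T$ represented by $\overline{\mathcal T}$, are exactly the seeds obtained from any one of them by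 sequences of mutations (flipping a diagonal $a\to b$ inside a black polygon corresponding to mutation at $x_{ab}$). *)

theory Defs
  imports Complex_Main "Jordan_Normal_Form.DL_Rank_Submatrix"
begin

section \<open>Varieties, rational functions and birational maps\<close>

inductive_set poly_functions :: "'i set \<Rightarrow> (('i \<Rightarrow> complex) \<Rightarrow> complex) set"
  for I :: "'i set" where
  const: "(\<lambda>_. c) \<in> poly_functions I"
| coord: "i \<in> I \<Longrightarrow> (\<lambda>z. z i) \<in> poly_functions I"
| add: "F \<in> poly_functions I \<Longrightarrow> G \<in> poly_functions I \<Longrightarrow> (\<lambda>z. F z + G z) \<in> poly_functions I"
| mult: "F \<in> poly_functions I \<Longrightarrow> G \<in> poly_functions I \<Longrightarrow> (\<lambda>z. F z * G z) \<in> poly_functions I"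

inductive hom_poly_function :: "'i set \<Rightarrow> nat \<Rightarrow> (('i \<Rightarrow> complex) \<Rightarrow> complex) \<Rightarrow> bool"
  for I :: "'i set" where
  const: "hom_poly_function I 0 (\<lambda>_. c)"
| coord: "i \<in> I \<Longrightarrow> hom_poly_function I 1 (\<lambda>z. z i)"
| add: "hom_poly_function I d F \<Longrightarrow> hom_poly_function I d G \<Longrightarrow>
          hom_poly_function I d (\<lambda>z. F z + G z)"
| mult: "hom_poly_function I d F \<Longrightarrow> hom_poly_function I e G \<Longrightarrow>
          hom_poly_function I (d + e) (\<lambda>z. F z * G z)"

text \<open>
  A variety is a set of points with, for each degree, a set of ``forms''.  Zariski closed sets are
  common zero loci of forms, and regular functions are locally quotients of two forms of the same
  degree.  In the projective case, the value of a form is taken at a fixed choice of homogeneous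
  coordinates of the point; zero loci and quotients in equal degree do not depend on that choice.
  In the affine case all polynomial functions count as forms of every degree.
\<close>

record 'p variety =
  points :: "'p set"
  forms :: "nat \<Rightarrow> ('p \<Rightarrow> complex) set"

definition zariski_closed :: "'p variety \<Rightarrow> 'p set \<Rightarrow> bool" where
  "zariski_closed X C \<longleftrightarrow>
     (\<exists>S \<subseteq> (\<Union>d. forms X d). C = {p \<in> points X. \<forall>F\<in>S. F p = 0})"

definition zariski_open :: "'p variety \<Rightarrow> 'p set \<Rightarrow> bool" where
  "zariski_open X U \<longleftrightarrow> U \<subseteq> points X \<and> zariski_closed X (points X - U)"

definition dense_open :: "'p variety \<Rightarrow> 'p set \<Rightarrow> bool" where
  "dense_open X U \<longleftrightarrow>
     zariski_open X U \<and> (\<forall>W. zariski_open X W \<and> W \<noteq> {} \<longrightarrow> U \<inter> W \<noteq> {})"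

text \<open>Shrinking the set of points yields the subspace topology and the restricted functions.\<close>

definition open_subvariety :: "'p variety \<Rightarrow> 'p set \<Rightarrow> 'p variety" where
  "open_subvariety X U = X\<lparr>points := U\<rparr>"

definition regular_on :: "'p variety \<Rightarrow> 'p set \<Rightarrow> ('p \<Rightarrow> complex) \<Rightarrow> bool" where
  "regular_on X U f \<longleftrightarrow>
     (\<forall>p\<in>U. \<exists>W. zariski_open X W \<and> p \<in> W \<and> W \<subseteq> U \<and>
        (\<exists>d. \<exists>F\<in>forms X d. \<exists>G\<in>forms X d. \<forall>q\<in>W. G q \<noteq> 0 \<and> f q = F q / G q))"

text \<open>
  Rational functions are represented by total functions that are regular on some dense open set;
  two of them are the same rational function iff they agree on a dense open set.
\<close>

definition rational_function :: "'p variety \<Rightarrow> ('p \<Rightarrow> complex) \<Rightarrow> bool" where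
  "rational_function X f \<longleftrightarrow> (\<exists>U. dense_open X U \<and> regular_on X U f)"

definition rat_eq :: "'p variety \<Rightarrow> ('p \<Rightarrow> complex) \<Rightarrow> ('p \<Rightarrow> complex) \<Rightarrow> bool" where
  "rat_eq X f g \<longleftrightarrow> (\<exists>U. dense_open X U \<and> (\<forall>p\<in>U. f p = g p))"

definition morphism_on ::
  "'p variety \<Rightarrow> 'p set \<Rightarrow> 'q variety \<Rightarrow> 'q set \<Rightarrow> ('p \<Rightarrow> 'q) \<Rightarrow> bool" where
  "morphism_on X U Y W \<phi> \<longleftrightarrow> \<phi> ` U \<subseteq> W \<and>
     (\<forall>W'. zariski_open Y W' \<and> W' \<subseteq> W \<longrightarrow>
        zariski_open X (U \<inter> \<phi> -` W') \<and>
        (\<forall>g. regular_on Y W' g \<longrightarrow> regular_on X (U \<inter> \<phi> -` W') (g \<circ> \<phi>)))"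

definition birational_via :: "'p variety \<Rightarrow> 'q variety \<Rightarrow> ('p \<Rightarrow> 'q) \<Rightarrow> bool" where
  "birational_via X Y \<phi> \<longleftrightarrow>
     (\<exists>U W. dense_open X U \<and> dense_open Y W \<and> bij_betw \<phi> U W \<and>
        morphism_on X U Y W \<phi> \<and> morphism_on Y W X U (inv_into U \<phi>))"

definition algebraic_torus :: "'i set \<Rightarrow> ('i \<Rightarrow> complex) variety" where
  "algebraic_torus I = \<lparr>points = (\<Pi>\<^sub>E i\<in>I. - {0}), forms = (\<lambda>d. poly_functions I)\<rparr>"

text \<open>
  The field of rational functions of \<open>X\<close> is the field of rational functions in the variables
  \<open>x\<^sub>i\<close>: these are algebraically independent over \<open>\<complex>\<close> and generate the field.  (A polynomial over
  \<open>\<complex>\<close> is zero iff its polynomial function is.)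
\<close>

definition function_field_is :: "'p variety \<Rightarrow> 'i set \<Rightarrow> ('i \<Rightarrow> 'p \<Rightarrow> complex) \<Rightarrow> bool" where
  "function_field_is X I x \<longleftrightarrow>
     (\<forall>i\<in>I. rational_function X (x i)) \<and>
     (\<forall>P\<in>poly_functions I. rat_eq X (\<lambda>p. P (\<lambda>i. x i p)) (\<lambda>_. 0) \<longrightarrow> P = (\<lambda>_. 0)) \<and>
     (\<forall>f. rational_function X f \<longrightarrow>
        (\<exists>P\<in>poly_functions I. \<exists>Q\<in>poly_functions I. Q \<noteq> (\<lambda>_. 0) \<and>
           rat_eq X f (\<lambda>p. P (\<lambda>i. x i p) / Q (\<lambda>i. x i p))))"


section \<open>Seeds and mutation\<close>

text \<open>\<open>arrows \<Sigma> u v\<close> is the number of arrows from \<open>u\<close> to \<open>v\<close>.\<close>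

record ('v, 'p) seed =
  frozen :: "'v set"
  mutable :: "'v set"
  arrows :: "'v \<Rightarrow> 'v \<Rightarrow> nat"
  label :: "'v \<Rightarrow> 'p \<Rightarrow> complex"

definition verts :: "('v, 'p) seed \<Rightarrow> 'v set" where
  "verts \<Sigma> = frozen \<Sigma> \<union> mutable \<Sigma>"

text \<open>
  The truncated subtraction cancels oriented 2-cycles.  Arrows between frozen vertices are
  discarded.
\<close>

definition mutate_arrows :: "'v \<Rightarrow> ('v, 'p) seed \<Rightarrow> 'v \<Rightarrow> 'v \<Rightarrow> nat" where
  "mutate_arrows w \<Sigma> u v =
     (if u = w \<or> v = w then arrows \<Sigma> v u
      else if u \<in> frozen \<Sigma> \<and> v \<in> frozen \<Sigma> then 0
      else (arrows \<Sigma> u v + arrows \<Sigma> u w * arrows \<Sigma> w v)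
           - (arrows \<Sigma> v u + arrows \<Sigma> v w * arrows \<Sigma> w u))"

definition exchange :: "'v \<Rightarrow> ('v, 'p) seed \<Rightarrow> 'p \<Rightarrow> complex" where
  "exchange w \<Sigma> p =
     ((\<Prod>u\<in>verts \<Sigma>. label \<Sigma> u p ^ arrows \<Sigma> u w) +
      (\<Prod>u\<in>verts \<Sigma>. label \<Sigma> u p ^ arrows \<Sigma> w u)) / label \<Sigma> w p"

definition mutate :: "'v \<Rightarrow> ('v, 'p) seed \<Rightarrow> ('v, 'p) seed" where
  "mutate w \<Sigma> =
     \<Sigma>\<lparr>arrows := mutate_arrows w \<Sigma>, label := (label \<Sigma>)(w := exchange w \<Sigma>)\<rparr>"

inductive mutation_reachable :: "('v, 'p) seed \<Rightarrow> ('v, 'p) seed \<Rightarrow> bool"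
  for \<Sigma> :: "('v, 'p) seed" where
  refl: "mutation_reachable \<Sigma> \<Sigma>"
| step: "mutation_reachable \<Sigma> \<Sigma>' \<Longrightarrow> w \<in> mutable \<Sigma>' \<Longrightarrow> mutation_reachable \<Sigma> (mutate w \<Sigma>')"

definition seed_iso_via ::
  "'p variety \<Rightarrow> ('v \<Rightarrow> 'w) \<Rightarrow> ('v, 'p) seed \<Rightarrow> ('w, 'p) seed \<Rightarrow> bool" where
  "seed_iso_via X \<sigma> \<Sigma> \<Sigma>' \<longleftrightarrow>
     bij_betw \<sigma> (verts \<Sigma>) (verts \<Sigma>') \<and>
     \<sigma> ` frozen \<Sigma> = frozen \<Sigma>' \<and> \<sigma> ` mutable \<Sigma> = mutable \<Sigma>' \<and>
     (\<forall>u\<in>verts \<Sigma>. \<forall>v\<in>verts \<Sigma>. arrows \<Sigma>' (\<sigma> u) (\<sigma> v) = arrows \<Sigma> u v) \<and>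
     (\<forall>u\<in>verts \<Sigma>. rat_eq X (label \<Sigma> u) (label \<Sigma>' (\<sigma> u)))"

text \<open>
  Two seeds are regarded as equal if they differ only by renaming the vertices of the quiver,
  the attached cluster variables being the same rational functions.
\<close>

definition same_seed :: "'p variety \<Rightarrow> ('v, 'p) seed \<Rightarrow> ('w, 'p) seed \<Rightarrow> bool" where
  "same_seed X \<Sigma> \<Sigma>' \<longleftrightarrow> (\<exists>\<sigma>. seed_iso_via X \<sigma> \<Sigma> \<Sigma>')"

definition is_seed_torus :: "'p variety \<Rightarrow> nat \<Rightarrow> 'p set \<Rightarrow> ('v, 'p) seed \<Rightarrow> bool" where
  "is_seed_torus X d U \<Sigma> \<longleftrightarrow>
     zariski_open X U \<and> finite (verts \<Sigma>) \<and> card (verts \<Sigma>) = d \<and>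
     birational_via (open_subvariety X U) (algebraic_torus (verts \<Sigma>))
       (\<lambda>p. \<lambda>v\<in>verts \<Sigma>. label \<Sigma> v p) \<and>
     function_field_is (open_subvariety X U) (verts \<Sigma>) (label \<Sigma>)"

definition cluster_variety_in ::
  "'p variety \<Rightarrow> nat \<Rightarrow> 't set \<Rightarrow> ('t \<Rightarrow> 'p set) \<Rightarrow> ('t \<Rightarrow> ('v, 'p) seed) \<Rightarrow> 'p set \<Rightarrow> bool" where
  "cluster_variety_in X d A U \<Sigma> V \<longleftrightarrow>
     V = (\<Union>t\<in>A. U t) \<and>
     (\<forall>t\<in>A. is_seed_torus X d (U t) (\<Sigma> t)) \<and>
     (\<forall>s\<in>A.
        (\<forall>\<Sigma>'. mutation_reachable (\<Sigma> s) \<Sigma>' \<longrightarrow> (\<exists>t\<in>A. same_seed X \<Sigma>' (\<Sigma> t))) \<and>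
        (\<forall>t\<in>A. \<exists>\<Sigma>'. mutation_reachable (\<Sigma> s) \<Sigma>' \<and> same_seed X \<Sigma>' (\<Sigma> t)))"


section \<open>Bicolored triangulations and subdivisions\<close>

text \<open>
  The vertices of the \<open>n\<close>-gon are \<open>0, \<dots>, n - 1\<close> in clockwise order.  A convex polygon inscribed in
  it is given by its set of vertices, an arc by the pair of its endpoints, the smaller one first.
\<close>

type_synonym arc = "nat \<times> nat"

definition chords :: "nat set \<Rightarrow> arc set" where
  "chords P = {(a, b). a \<in> P \<and> b \<in> P \<and> a < b}"

definition sides :: "nat set \<Rightarrow> arc set" where
  "sides P = {(a, b) \<in> chords P. P \<inter> {a<..<b} = {} \<or> P \<subseteq> {a..b}}"

fun crosses :: "arc \<Rightarrow> arc \<Rightarrow> bool" where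
  "crosses (a, b) (c, d) \<longleftrightarrow> (a < c \<and> c < b \<and> b < d) \<or> (c < a \<and> a < d \<and> d < b)"

definition triangulation :: "nat \<Rightarrow> arc set \<Rightarrow> bool" where
  "triangulation n D \<longleftrightarrow>
     D \<subseteq> chords {..<n} - sides {..<n} \<and>
     (\<forall>d\<in>D. \<forall>e\<in>D. \<not> crosses d e) \<and>
     (\<forall>d \<in> chords {..<n} - sides {..<n} - D. \<exists>e\<in>D. crosses d e)"

text \<open>
  The polygons into which the \<open>n\<close>-gon is cut by a noncrossing set \<open>E\<close> of diagonals: the maximal
  polygons none of whose chords is crossed by a diagonal in \<open>E\<close>.  They are triangles if \<open>E\<close> is a
  triangulation.
\<close>

definition uncut :: "nat \<Rightarrow> arc set \<Rightarrow> nat set \<Rightarrow> bool" where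
  "uncut n E P \<longleftrightarrow> P \<subseteq> {..<n} \<and> card P \<ge> 3 \<and> (\<forall>c\<in>chords P. \<forall>e\<in>E. \<not> crosses c e)"

definition faces :: "nat \<Rightarrow> arc set \<Rightarrow> nat set set" where
  "faces n E = {P. uncut n E P \<and> (\<forall>P'. uncut n E P' \<and> P \<subseteq> P' \<longrightarrow> P' = P)}"

record bicolored =
  diagonals :: "arc set"
  black :: "nat set set"

definition bicolored_triangulation :: "nat \<Rightarrow> nat \<Rightarrow> bicolored \<Rightarrow> bool" where
  "bicolored_triangulation k n T \<longleftrightarrow>
     triangulation n (diagonals T) \<and> black T \<subseteq> faces n (diagonals T) \<and> card (black T) = k"

text \<open>
  Erase the diagonals separating triangles of the same color; the black polygons of the result are
  those that contain black triangles.
\<close>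

definition kept_diagonals :: "nat \<Rightarrow> bicolored \<Rightarrow> arc set" where
  "kept_diagonals n T =
     {d \<in> diagonals T. \<exists>s \<in> black T. \<exists>t \<in> faces n (diagonals T) - black T.
        d \<in> chords s \<and> d \<in> chords t}"

definition erase_diagonals :: "nat \<Rightarrow> bicolored \<Rightarrow> bicolored" where
  "erase_diagonals n T =
     \<lparr>diagonals = kept_diagonals n T,
      black = {P \<in> faces n (kept_diagonals n T). \<exists>t\<in>black T. t \<subseteq> P}\<rparr>"

definition bicolored_subdivision :: "nat \<Rightarrow> nat \<Rightarrow> bicolored \<Rightarrow> bool" where
  "bicolored_subdivision k n S \<longleftrightarrow>
     (\<exists>T. bicolored_triangulation k n T \<and> S = erase_diagonals n T)"

definition represented_by :: "nat \<Rightarrow> nat \<Rightarrow> bicolored \<Rightarrow> bicolored set" where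
  "represented_by k n S = {T. bicolored_triangulation k n T \<and> erase_diagonals n T = S}"

definition black_arcs :: "bicolored \<Rightarrow> arc set" where
  "black_arcs T = (\<Union>t\<in>black T. chords t)"

text \<open>As \<open>a < b\<close>, the vertices to the left of \<open>a \<rightarrow> b\<close> are those in \<open>{a..b}\<close>.\<close>

definition area_in :: "bicolored \<Rightarrow> arc \<Rightarrow> nat" where
  "area_in T e = card {t \<in> black T. t \<subseteq> {fst e..snd e}}"

definition area :: "nat \<Rightarrow> nat \<Rightarrow> bicolored \<Rightarrow> arc \<Rightarrow> nat" where
  "area k n S e =
     (THE m. \<exists>T \<in> represented_by k n S. e \<in> diagonals T \<union> sides {..<n} \<and> m = area_in T e)"

definition is_flip :: "bicolored \<Rightarrow> arc \<Rightarrow> bicolored \<Rightarrow> arc \<Rightarrow> bool" where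
  "is_flip T e T' e' \<longleftrightarrow>
     e \<in> diagonals T \<and> e' \<notin> diagonals T \<and> diagonals T' = insert e' (diagonals T - {e})"


section \<open>Grassmannians\<close>

text \<open>Points of the Grassmannian are subspaces; \<open>represents k m A V\<close> says that \<open>V\<close> is the row span
  of the full-rank \<open>k \<times> m\<close> matrix \<open>A\<close>.\<close>

definition represents :: "nat \<Rightarrow> nat \<Rightarrow> 'a::field mat \<Rightarrow> 'a vec set \<Rightarrow> bool" where
  "represents k m A V \<longleftrightarrow>
     A \<in> carrier_mat k m \<and> vec_space.rank k A = k \<and> V = vec_space.row_space m A"

definition Gr :: "nat \<Rightarrow> nat \<Rightarrow> 'a::field vec set set" where
  "Gr k m = {V. \<exists>A. represents k m A V}"

definition rep :: "nat \<Rightarrow> nat \<Rightarrow> 'a::field vec set \<Rightarrow> 'a mat" where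
  "rep k m V = (SOME A. represents k m A V)"

definition plucker :: "'a::field mat \<Rightarrow> nat set \<Rightarrow> 'a" where
  "plucker A I = det (submatrix A UNIV I)"

text \<open>The complex Grassmannian as a projective variety in its Pluecker embedding.\<close>

definition Gr_variety :: "nat \<Rightarrow> nat \<Rightarrow> complex vec set variety" where
  "Gr_variety k m =
     \<lparr>points = Gr k m,
      forms = (\<lambda>d. {\<lambda>V. F (plucker (rep k m V)) | F.
                       hom_poly_function {I. I \<subseteq> {..<m} \<and> card I = k} d F})\<rparr>"

definition Mat_pos :: "nat \<Rightarrow> nat \<Rightarrow> real mat set" where
  "Mat_pos n m =
     {Z \<in> carrier_mat n m. \<forall>J. J \<subseteq> {..<n} \<and> card J = m \<longrightarrow> det (submatrix Z J UNIV) > 0}"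

definition twistor :: "nat \<Rightarrow> real mat \<Rightarrow> complex vec set \<Rightarrow> arc \<Rightarrow> complex" where
  "twistor k Z Y e =
     det (rep k (k + 2) Y @\<^sub>r
          mat_of_rows (k + 2) (map (row (map_mat complex_of_real Z)) [fst e, snd e]))"


section \<open>Tiles, cluster variables and seeds\<close>

definition positroid_cell :: "nat \<Rightarrow> nat \<Rightarrow> bicolored \<Rightarrow> real vec set set" where
  "positroid_cell k n T =
     {V. \<exists>A. represents k n A V \<and>
         (\<forall>I. I \<subseteq> {..<n} \<and> card I = k \<longrightarrow>
            (if \<exists>\<phi>. bij_betw \<phi> I (black T) \<and> (\<forall>i\<in>I. i \<in> \<phi> i)
             then plucker A I > 0 else plucker A I = 0))}"

definition Z_tilde :: "nat \<Rightarrow> nat \<Rightarrow> real mat \<Rightarrow> real vec set \<Rightarrow> real vec set" where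
  "Z_tilde k n Z V = vec_space.row_space (k + 2) (rep k n V * Z)"

definition complexify :: "nat \<Rightarrow> nat \<Rightarrow> real vec set \<Rightarrow> complex vec set" where
  "complexify k m V = vec_space.row_space m (map_mat complex_of_real (rep k m V))"

definition open_tile :: "nat \<Rightarrow> nat \<Rightarrow> real mat \<Rightarrow> bicolored \<Rightarrow> complex vec set set" where
  "open_tile k n Z T = complexify k (k + 2) ` Z_tilde k n Z ` positroid_cell k n T"

text \<open>In the following, \<open>\<delta>\<close> assigns to each black polygon of \<open>S\<close> its distinguished boundary arc.\<close>

definition cluster_arcs :: "bicolored \<Rightarrow> (nat set \<Rightarrow> arc) \<Rightarrow> arc set" where
  "cluster_arcs S \<delta> = (\<Union>P\<in>black S. chords P - {\<delta> P})"

definition cluster_variable ::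
  "nat \<Rightarrow> nat \<Rightarrow> real mat \<Rightarrow> bicolored \<Rightarrow> (nat set \<Rightarrow> arc) \<Rightarrow> arc \<Rightarrow> complex vec set \<Rightarrow> complex" where
  "cluster_variable k n Z S \<delta> e Y =
     (let h = \<delta> (THE P. P \<in> black S \<and> e \<in> chords P)
      in ((-1) ^ area k n S e * twistor k Z Y e) / ((-1) ^ area k n S h * twistor k Z Y h))"

definition boundary_arcs :: "bicolored \<Rightarrow> arc set" where
  "boundary_arcs S = (\<Union>P\<in>black S. sides P)"

text \<open>Vertex labels increase clockwise, so the sides of a triangle with vertices \<open>a < b < c\<close>
  in clockwise order are \<open>ab\<close>, \<open>bc\<close>, \<open>ca\<close>.\<close>

definition next_clockwise :: "nat set \<Rightarrow> arc \<Rightarrow> arc \<Rightarrow> bool" where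
  "next_clockwise t u v \<longleftrightarrow>
     (\<exists>a b c. a < b \<and> b < c \<and> t = {a, b, c} \<and>
        (u, v) \<in> {((a, b), (b, c)), ((b, c), (a, c)), ((a, c), (a, b))})"

definition triangulation_seed ::
  "nat \<Rightarrow> nat \<Rightarrow> real mat \<Rightarrow> bicolored \<Rightarrow> (nat set \<Rightarrow> arc) \<Rightarrow> bicolored
     \<Rightarrow> (arc, complex vec set) seed" where
  "triangulation_seed k n Z S \<delta> T =
     (let fr = boundary_arcs S - \<delta> ` black S; mu = black_arcs T - boundary_arcs S
      in \<lparr>frozen = fr,
          mutable = mu,
          arrows = (\<lambda>u v. if u \<in> fr \<union> mu \<and> v \<in> fr \<union> mu \<and> \<not> (u \<in> fr \<and> v \<in> fr)
                          then card {t \<in> black T. next_clockwise t u v} else 0),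
          label = cluster_variable k n Z S \<delta>\<rparr>)"

definition seed_torus :: "nat \<Rightarrow> real mat \<Rightarrow> bicolored \<Rightarrow> complex vec set set" where
  "seed_torus k Z T = {Y \<in> Gr k (k + 2). (\<Prod>e\<in>black_arcs T. twistor k Z Y e) \<noteq> 0}"

definition cluster_space :: "nat \<Rightarrow> nat \<Rightarrow> real mat \<Rightarrow> bicolored \<Rightarrow> complex vec set set" where
  "cluster_space k n Z S = (\<Union>T \<in> represented_by k n S. seed_torus k Z T)"

definition positive_part ::
  "nat \<Rightarrow> nat \<Rightarrow> real mat \<Rightarrow> bicolored \<Rightarrow> (nat set \<Rightarrow> arc) \<Rightarrow> complex vec set set" where
  "positive_part k n Z S \<delta> =
     {Y \<in> cluster_space k n Z S. \<forall>e \<in> cluster_arcs S \<delta>.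
        cluster_variable k n Z S \<delta> e Y \<in> \<real> \<and> Re (cluster_variable k n Z S \<delta> e Y) > 0}"

end

theory Submission
  imports Defs
begin

text \<open>
  Let \<open>Y\<close> be a plane of codimension two. It is the common kernel of two linear forms, and if \<open>l a\<close>, \<open>m a\<close>
  are their values on the row \<open>a\<close> of \<open>Z\<close>, then the twistor coordinates are, up to a common scalar, the
  \<open>2 \<times> 2\<close> minors \<open>l a * m b - m a * l b\<close> (\<open>twistor_functionals\<close>). Two consequences drive everything.

  First, for \<open>a < b < c\<close> the combination of rows \<open>\<langle>bc\<rangle> Z\<^sub>a - \<langle>ac\<rangle> Z\<^sub>b + \<langle>ab\<rangle> Z\<^sub>c\<close> lies in \<open>Y\<close>. Given a
  triangulation \<open>T\<close>, the \<open>k\<close> black triangles yield \<open>k\<close> such vectors, so that \<open>Y\<close> is generically the row space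
  of \<open>M Z\<close>, where \<open>M\<close> has one row per black triangle. A row may be rescaled, hence only the ratios of the
  twistor coordinates of the arcs within one black polygon enter, and these are the cluster variables up to the
  signs given by the area. Conversely, if the three entries of a row are arbitrary nonzero weights, membership of
  the combination in \<open>Y\<close> forces the twistor coordinates of the three sides to be proportional to the weights
  (\<open>triangle_row_iff\<close>). Adjacent triangles share an arc, so the proportionality factor is the same all over a black
  polygon. Therefore \<open>x \<mapsto> row space of M(x) Z\<close> inverts the cluster coordinates (\<open>plane_coords\<close>,
  \<open>coords_plane\<close>), and each \<open>\<V>\<^sub>T\<close> is birational to a torus. The dimension count is that of the arcs:
  a black polygon with \<open>p\<close> vertices has \<open>2 p - 3\<close> arcs, of which one is distinguished, and \<open>p - 2\<close> triangles.

  Second, minors of a \<open>2 \<times> n\<close> matrix satisfy the three-term relation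
  \<open>\<langle>ac\<rangle>\<langle>bd\<rangle> = \<langle>ab\<rangle>\<langle>cd\<rangle> + \<langle>ad\<rangle>\<langle>bc\<rangle>\<close>. The area of the long side of a black triangle is one
  more than the sum of the areas of the short sides (\<open>area_triangle\<close>), so the signs cancel and the cluster
  variables satisfy the relation without signs: it is the exchange relation at the diagonal \<open>ac\<close> or \<open>bd\<close>
  (\<open>xvar_ptolemy\<close>, \<open>flip_iso\<close>). As the triangulations of the black polygons are connected by flips
  (\<open>flip_connected\<close>), the seeds of triangulations are the seeds reachable by mutation.

  For the positive part the point is that the area signs are the right ones. Expand a maximal minor of \<open>M(x)\<close> over
  the ways to choose one vertex in every black triangle. The sign of a term is a product over pairs of triangles,
  and for each pair the contribution of the inversion and of the area signs does not depend on the chosen vertices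
  (\<open>triangle_pair_parity\<close>). So for \<open>x > 0\<close> all terms of all minors have one sign, and \<open>M(x)\<close> represents a point
  of the positroid cell. Conversely, if \<open>C\<close> represents a point of the cell, expand \<open>\<langle>C Z, a, b\<rangle>\<close> by the
  Cauchy-Binet formula: only the index sets \<open>I\<close> avoiding \<open>a\<close> and \<open>b\<close> contribute, and each has exactly
  \<open>area(a \<rightarrow> b)\<close> elements between \<open>a\<close> and \<open>b\<close> if \<open>a \<rightarrow> b\<close> is an arc of \<open>T\<close> (\<open>matched_parity\<close>), so moving the last
  two rows into place shows that \<open>(-1)^area \<langle>ab\<rangle> > 0\<close> (\<open>twistor_sign\<close>). Hence the tile consists of the points where
  the cluster variables of one seed are positive, and the exchange relations propagate positivity to all others.
\<close>

section \<open>Maximal noncrossing sets of arcs of a polygon\<close>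

definition noncrossing :: "arc set \<Rightarrow> bool" where
  "noncrossing E \<longleftrightarrow> (\<forall>d\<in>E. \<forall>e\<in>E. \<not> crosses d e)"

text \<open>The sides of the polygon with vertex set \<open>P\<close> cross nothing, so they belong to every such set. Counting them as arcs lets
the same notion serve the \<open>n\<close>-gon and each of its black polygons.\<close>
definition max_noncrossing :: "nat set \<Rightarrow> arc set \<Rightarrow> bool" where
  "max_noncrossing P E \<longleftrightarrow>
     finite P \<and> E \<subseteq> chords P \<and> noncrossing E \<and> (\<forall>c\<in>chords P - E. \<exists>e\<in>E. crosses c e)"

text \<open>Because the sides of the polygon are among the arcs, three arcs of a noncrossing set that form a cycle bound a triangle of
the triangulation.\<close>
definition triangles :: "arc set \<Rightarrow> nat set set" where
  "triangles E = {{a, b, c} | a b c. a < b \<and> b < c \<and> (a, b) \<in> E \<and> (b, c) \<in> E \<and> (a, c) \<in> E}"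

lemma crosses_sym: "crosses d e = crosses e d"
  by (cases d; cases e) auto

lemma chordsD: "(a, b) \<in> chords P \<Longrightarrow> a \<in> P \<and> b \<in> P \<and> a < b"
  by (simp add: chords_def)

lemma chordsI: "a \<in> P \<Longrightarrow> b \<in> P \<Longrightarrow> a < b \<Longrightarrow> (a, b) \<in> chords P"
  by (simp add: chords_def)

lemma finite_chords: "finite P \<Longrightarrow> finite (chords P)"
  by (rule finite_subset[of _ "P \<times> P"]) (auto simp: chords_def)

lemma chords_mono: "P \<subseteq> Q \<Longrightarrow> chords P \<subseteq> chords Q"
  by (auto simp: chords_def)

lemma max_noncrossingD:
  assumes "max_noncrossing P E"
  shows "finite P" "E \<subseteq> chords P" "noncrossing E" "finite E"
    and "\<And>a b. (a, b) \<in> E \<Longrightarrow> a \<in> P \<and> b \<in> P \<and> a < b"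
    and "\<And>d e. d \<in> E \<Longrightarrow> e \<in> E \<Longrightarrow> \<not> crosses d e"
    and "\<And>c. c \<in> chords P \<Longrightarrow> (\<And>e. e \<in> E \<Longrightarrow> \<not> crosses c e) \<Longrightarrow> c \<in> E"
proof -
  show "finite P" "E \<subseteq> chords P" "noncrossing E" using assms by (auto simp: max_noncrossing_def)
  then show "finite E" using finite_subset[OF _ finite_chords] by blast
  show "\<And>a b. (a, b) \<in> E \<Longrightarrow> a \<in> P \<and> b \<in> P \<and> a < b" using \<open>E \<subseteq> chords P\<close> chordsD by blast
  show "\<And>d e. d \<in> E \<Longrightarrow> e \<in> E \<Longrightarrow> \<not> crosses d e"
    using \<open>noncrossing E\<close> unfolding noncrossing_def by blast
  show "\<And>c. c \<in> chords P \<Longrightarrow> (\<And>e. e \<in> E \<Longrightarrow> \<not> crosses c e) \<Longrightarrow> c \<in> E"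
    using assms unfolding max_noncrossing_def by blast
qed

lemma noncrossingD:
  "noncrossing E \<Longrightarrow> (a, b) \<in> E \<Longrightarrow> (c, d) \<in> E \<Longrightarrow> a < c \<Longrightarrow> c < b \<Longrightarrow> b < d \<Longrightarrow> False"
  unfolding noncrossing_def by fastforce

lemma max_noncrossing_extend:
  assumes "finite P" "K \<subseteq> chords P" "noncrossing K"
  obtains E where "K \<subseteq> E" "max_noncrossing P E"
proof -
  let ?F = "{E. K \<subseteq> E \<and> E \<subseteq> chords P \<and> noncrossing E}"
  have fin: "finite ?F" by (rule finite_subset[of _ "Pow (chords P)"]) (auto simp: finite_chords assms)
  have "K \<in> ?F" using assms by auto
  from finite_has_maximal2[OF fin this] obtain E where E: "E \<in> ?F" "K \<subseteq> E"
    and mx: "\<forall>E'\<in>?F. E \<subseteq> E' \<longrightarrow> E = E'" by blast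
  have "\<exists>e\<in>E. crosses c e" if c: "c \<in> chords P - E" for c
  proof (rule ccontr)
    assume n: "\<not> (\<exists>e\<in>E. crosses c e)"
    have "\<not> crosses c c" by (cases c) auto
    then have "insert c E \<in> ?F" using E c n by (auto simp: noncrossing_def crosses_sym)
    then show False using mx c by auto
  qed
  then have "max_noncrossing P E" using E assms by (auto simp: max_noncrossing_def)
  then show ?thesis using E that by auto
qed

lemma sides_not_crossed:
  assumes "(a, b) \<in> sides P" "e \<in> chords P"
  shows "\<not> crosses (a, b) e" "\<not> crosses e (a, b)"
  using assms unfolding sides_def chords_def
  by (cases e; fastforce simp: disjoint_iff)+

lemma sides_in_max_noncrossing:
  assumes "max_noncrossing P E" shows "sides P \<subseteq> E"
proof
  fix e assume e: "e \<in> sides P"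
  obtain a b where ab: "e = (a, b)" by (cases e)
  show "e \<in> E"
  proof (rule max_noncrossingD(7)[OF assms])
    show "e \<in> chords P" using e by (auto simp: sides_def)
    show "\<not> crosses e f" if "f \<in> E" for f
      using sides_not_crossed(1)[of a b P f] e ab that max_noncrossingD(2)[OF assms] by blast
  qed
qed

lemma side_up_obtain:
  fixes P :: "nat set"
  assumes "finite P" "a \<in> P" "c \<in> P" "a < c"
  obtains s where "s \<in> P" "a < s" "s \<le> c" "P \<inter> {a<..<s} = {}" "(a, s) \<in> sides P"
proof -
  define s where "s = Min {x \<in> P. a < x}"
  have fin: "finite {x \<in> P. a < x}" using assms by auto
  have s: "s \<in> {x \<in> P. a < x}" unfolding s_def by (rule Min_in[OF fin]) (use assms in auto)
  have l: "s \<le> x" if "x \<in> P" "a < x" for x unfolding s_def by (rule Min_le[OF fin]) (use that in auto)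
  have "P \<inter> {a<..<s} = {}" using l by force
  then show ?thesis using that[of s] s l[of c] assms by (auto simp: sides_def chords_def)
qed

text \<open>The third vertex of the triangle on the inner side of an arc: take the longest arc at \<open>a\<close> ending before \<open>b\<close>. An arc crossing
\<open>(c, b)\<close> would have to start at \<open>a\<close> and be longer.\<close>
lemma inner_apex:
  assumes F: "max_noncrossing P E" and ab: "(a, b) \<in> E" and "P \<inter> {a<..<b} \<noteq> {}"
  obtains c where "a < c" "c < b" "(a, c) \<in> E" "(c, b) \<in> E" "c \<in> P"
proof -
  note D = max_noncrossingD[OF F]
  let ?C = "{c \<in> P. (a, c) \<in> E \<and> c < b}"
  obtain x where x: "x \<in> P" "a < x" "x < b" using assms(3) by auto
  have aP: "a \<in> P" "b \<in> P" using D(5)[OF ab] by auto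
  obtain s where s: "s \<in> P" "a < s" "s \<le> x" "(a, s) \<in> sides P"
    using side_up_obtain[OF D(1) aP(1) x(1,2)] by metis
  have fin: "finite ?C" using D(1) by auto
  have "s \<in> ?C" using s x sides_in_max_noncrossing[OF F] by auto
  then have ne: "?C \<noteq> {}" by auto
  define c where "c = Max ?C"
  have c: "c \<in> ?C" unfolding c_def by (rule Max_in[OF fin ne])
  have cm: "y \<le> c" if "y \<in> ?C" for y unfolding c_def by (rule Max_ge[OF fin that])
  have ac: "a < c" using c D(5) by auto
  have "(c, b) \<in> E"
  proof (rule D(7))
    show "(c, b) \<in> chords P" using c aP by (auto simp: chords_def)
    fix e assume e: "e \<in> E"
    obtain p q where pq: "e = (p, q)" by (cases e)
    have pq': "p \<in> P" "q \<in> P" "p < q" using D(5) e pq by auto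
    show "\<not> crosses (c, b) e"
    proof
      assume cr: "crosses (c, b) e"
      have 1: "\<not> crosses (a, c) e" "\<not> crosses (a, b) e" using D(6)[OF ab e] D(6)[of "(a,c)" e] c e by auto
      have "p = a \<and> q < b \<and> c < q" using cr 1 ac unfolding pq by auto
      then show False using cm[of q] e pq pq' by auto
    qed
  qed
  then show ?thesis using that c ac by auto
qed

lemma inner_apex_unique:
  assumes "noncrossing E" "(a, c) \<in> E" "(c, b) \<in> E" "(a, c') \<in> E" "(c', b) \<in> E"
    "a < c" "c < b" "a < c'" "c' < b"
  shows "c = c'"
  using noncrossingD[OF assms(1), of a c c' b] noncrossingD[OF assms(1), of a c' c b] assms
  by (metis linorder_neqE_nat)

lemma full_arc:
  assumes F: "max_noncrossing P E" and "a \<in> P" "b \<in> P" "a < b" "P \<subseteq> {a..b}"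
  shows "(a, b) \<in> E"
  using sides_in_max_noncrossing[OF F] assms by (auto simp: sides_def chords_def)

lemma Min_Max_arc:
  assumes F: "max_noncrossing P E" and ab: "(a, b) \<in> chords P"
  shows "(Min P, Max P) \<in> E" "Min P \<le> a" "b \<le> Max P" "Min P \<in> P" "Max P \<in> P" "Min P < Max P" "P \<subseteq> {Min P..Max P}"
proof -
  have fin: "finite P" using F by (auto simp: max_noncrossing_def)
  have ne: "P \<noteq> {}" "a \<in> P" "b \<in> P" "a < b" using ab by (auto simp: chords_def)
  show 1: "Min P \<le> a" "b \<le> Max P" "Min P \<in> P" "Max P \<in> P" "P \<subseteq> {Min P..Max P}" using fin ne by auto
  show 2: "Min P < Max P" using 1 ne by auto
  show "(Min P, Max P) \<in> E" by (rule full_arc[OF F]) (use 1 2 in auto)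
qed

text \<open>On the outer side, take a shortest arc spanning \<open>(a, b)\<close> and apply the inner construction to it: by minimality its apex
triangle has \<open>(a, b)\<close> as a side.\<close>
lemma outer_apex:
  assumes F: "max_noncrossing P E" and ab: "(a, b) \<in> E" and no: "\<not> P \<subseteq> {a..b}"
  obtains (below) c where "c \<in> P" "c < a" "(c, a) \<in> E" "(c, b) \<in> E"
  | (above) c where "c \<in> P" "b < c" "(b, c) \<in> E" "(a, c) \<in> E"
proof -
  note D = max_noncrossingD[OF F]
  have ab': "(a, b) \<in> chords P" "a \<in> P" "b \<in> P" "a < b" using D(2,5) ab by auto
  note M = Min_Max_arc[OF F ab'(1)]
  have ne: "(a, b) \<noteq> (Min P, Max P)" using no M by auto
  let ?C = "\<lambda>l. \<exists>x y. (x, y) \<in> E \<and> x \<le> a \<and> b \<le> y \<and> (x, y) \<noteq> (a, b) \<and> l = y - x"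
  have "?C (Max P - Min P)" using M ne by blast
  then have "?C (LEAST l. ?C l)" by (rule LeastI)
  then obtain x y where xy: "(x, y) \<in> E" "x \<le> a" "b \<le> y" "(x, y) \<noteq> (a, b)" and l: "(LEAST l. ?C l) = y - x"
    by blast
  have least: "y - x \<le> y' - x'" if "(x', y') \<in> E" "x' \<le> a" "b \<le> y'" "(x', y') \<noteq> (a, b)" for x' y'
    unfolding l[symmetric] by (rule Least_le) (use that in blast)
  have "P \<inter> {x<..<y} \<noteq> {}" using xy ab' by (cases "x = a") auto
  then obtain c where c: "x < c" "c < y" "(x, c) \<in> E" "(c, y) \<in> E" "c \<in> P" using inner_apex[OF F xy(1)] by metis
  have nc: "\<not> crosses (a, b) (x, c)" "\<not> crosses (a, b) (c, y)" using D(6) ab c by auto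
  have "b \<le> c \<or> c \<le> a" using nc c xy ab' by (auto simp: not_less)
  then show ?thesis
  proof
    assume b: "b \<le> c"
    have "(x, c) = (a, b)" using least[of x c] c xy b by fastforce
    then show ?thesis using above[of y] c xy D(5) by blast
  next
    assume b: "c \<le> a"
    have "(c, y) = (a, b)" using least[of c y] c xy b by fastforce
    then show ?thesis using below[of x] c xy D(5) by blast
  qed
qed

lemma outer_apex_unique:
  assumes "noncrossing E" "(a, b) \<in> E" "a < b"
  shows "(c, a) \<in> E \<Longrightarrow> (c, b) \<in> E \<Longrightarrow> (c', a) \<in> E \<Longrightarrow> (c', b) \<in> E \<Longrightarrow> c < a \<Longrightarrow> c' < a \<Longrightarrow> c = c'"
    "(b, c) \<in> E \<Longrightarrow> (a, c) \<in> E \<Longrightarrow> (b, c') \<in> E \<Longrightarrow> (a, c') \<in> E \<Longrightarrow> b < c \<Longrightarrow> b < c' \<Longrightarrow> c = c'"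
    "(c, a) \<in> E \<Longrightarrow> (c, b) \<in> E \<Longrightarrow> (b, c') \<in> E \<Longrightarrow> (a, c') \<in> E \<Longrightarrow> c < a \<Longrightarrow> b < c' \<Longrightarrow> False"
proof -
  note N = noncrossingD[OF assms(1)]
  show "c = c'" if "(c, a) \<in> E" "(c, b) \<in> E" "(c', a) \<in> E" "(c', b) \<in> E" "c < a" "c' < a"
    using N[of c a c' b] N[of c' a c b] that assms by (cases c c' rule: linorder_cases) auto
  show "c = c'" if "(b, c) \<in> E" "(a, c) \<in> E" "(b, c') \<in> E" "(a, c') \<in> E" "b < c" "b < c'"
    using N[of a c b c'] N[of a c' b c] that assms by (cases c c' rule: linorder_cases) auto
  show "False" if "(c, a) \<in> E" "(c, b) \<in> E" "(b, c') \<in> E" "(a, c') \<in> E" "c < a" "b < c'"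
    using N[of c b a c'] that assms by auto
qed

text \<open>Every arc is reached from the arc joining the extreme vertices by passing from the long side of a triangle to its
short sides. This is how statements spread from triangle to adjacent triangle without speaking of the dual tree.\<close>
lemma arc_induct_from_top:
  assumes F: "max_noncrossing P E" and e: "(a, b) \<in> E"
    and top: "Q (Min P) (Max P)"
    and step: "\<And>x y z. x < y \<Longrightarrow> y < z \<Longrightarrow> (x, y) \<in> E \<Longrightarrow> (y, z) \<in> E \<Longrightarrow> (x, z) \<in> E \<Longrightarrow> Q x z \<Longrightarrow> Q x y \<and> Q y z"
  shows "Q a b"
  using e
proof (induction "Max P - Min P - (b - a)" arbitrary: a b rule: less_induct)
  case less
  note D = max_noncrossingD[OF F]
  have ab: "(a, b) \<in> chords P" "a \<in> P" "b \<in> P" "a < b" using less.prems D(2,5) by auto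
  note M = Min_Max_arc[OF F ab(1)]
  show ?case
  proof (cases "P \<subseteq> {a..b}")
    case True
    then have "a = Min P" "b = Max P" using M ab by (metis atLeastAtMost_iff le_antisym subsetD)+
    then show ?thesis using top by simp
  next
    case False
    show ?thesis
    using outer_apex[OF F less.prems False]
    proof cases
      case (1 c)
      have cb: "(c, b) \<in> chords P" using 1 D(2) by auto
      have "Q c b" by (rule less.hyps[OF _ 1(4)]) (use 1 ab Min_Max_arc[OF F cb] in linarith)
      then show ?thesis using step[of c a b] 1 ab less.prems by auto
    next
      case (2 c)
      have cb: "(a, c) \<in> chords P" using 2 D(2) by auto
      have "Q a c" by (rule less.hyps[OF _ 2(4)]) (use 2 ab Min_Max_arc[OF F cb] in linarith)
      then show ?thesis using step[of a b c] 2 ab less.prems by auto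
    qed
  qed
qed

text \<open>In a quadrilateral whose sides are not crossed, the only chord that crosses one diagonal is the other one.\<close>
lemma crosses_diagonal_of_quadrilateral:
  fixes a b c d p q :: nat
  assumes o: "a < b" "b < c" "c < d" "p < q"
    and n: "\<not> crosses (p, q) (a, b)" "\<not> crosses (p, q) (b, c)" "\<not> crosses (p, q) (c, d)" "\<not> crosses (p, q) (a, d)"
  shows "crosses (p, q) (a, c) \<Longrightarrow> (p, q) = (b, d)" "crosses (p, q) (b, d) \<Longrightarrow> (p, q) = (a, c)"
proof -
  assume "crosses (p, q) (a, c)"
  then consider "p < a" "a < q" "q < c" | "a < p" "p < c" "c < q" by auto
  then show "(p, q) = (b, d)"
  proof cases
    case 1 then show ?thesis using o n by (cases q b rule: linorder_cases) simp_all
  next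
    case 2
    then have "p = b" using o n by (cases p b rule: linorder_cases) simp_all
    then show ?thesis using 2 o n by (cases q d rule: linorder_cases) simp_all
  qed
next
  assume "crosses (p, q) (b, d)"
  then consider "p < b" "b < q" "q < d" | "b < p" "p < d" "d < q" by auto
  then show "(p, q) = (a, c)"
  proof cases
    case 2 then show ?thesis using o n by (cases p c rule: linorder_cases) simp_all
  next
    case 1
    then have "q = c" using o n by (cases q c rule: linorder_cases) simp_all
    then show ?thesis using 1 o n by (cases p a rule: linorder_cases) simp_all
  qed
qed

lemma flip_max_noncrossing:
  assumes F: "max_noncrossing P E" and o: "a < b" "b < c" "c < d"
    and s: "(a, b) \<in> E" "(b, c) \<in> E" "(c, d) \<in> E" "(a, d) \<in> E"
  shows "(a, c) \<in> E \<Longrightarrow> max_noncrossing P (insert (b, d) (E - {(a, c)}))"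
    and "(b, d) \<in> E \<Longrightarrow> max_noncrossing P (insert (a, c) (E - {(b, d)}))"
proof -
  note D = max_noncrossingD[OF F]
  have P: "a \<in> P" "b \<in> P" "c \<in> P" "d \<in> P" using D(5) s by auto
  have *: "max_noncrossing P (insert y (E - {x}))"
    if x: "x \<in> E" and xy: "crosses x y" and y: "y \<in> chords P"
     and u: "\<And>p q. p < q \<Longrightarrow> \<not> crosses (p, q) (a, b) \<Longrightarrow> \<not> crosses (p, q) (b, c) \<Longrightarrow> \<not> crosses (p, q) (c, d) \<Longrightarrow> \<not> crosses (p, q) (a, d) \<Longrightarrow>
       (crosses (p, q) x \<longrightarrow> (p, q) = y) \<and> (crosses (p, q) y \<longrightarrow> (p, q) = x)"
     and nin: "x \<notin> {(a,b),(b,c),(c,d),(a,d)}"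
    for x y
  proof -
    have u': "(crosses e x \<longrightarrow> e = y) \<and> (crosses e y \<longrightarrow> e = x)" if "e \<in> chords P"
       "\<not> crosses e (a, b)" "\<not> crosses e (b, c)" "\<not> crosses e (c, d)" "\<not> crosses e (a, d)" for e
      using u[of "fst e" "snd e"] that unfolding chords_def
      by (cases e) (simp del: crosses.simps)
    have uE: "\<not> crosses e x \<and> (crosses e y \<longrightarrow> e = x)" if "e \<in> E" for e
      using u'[of e] D(6)[OF that] D(2) that s x by blast
    have ny: "\<not> crosses y y" by (cases y) auto
    have n: "noncrossing (insert y (E - {x}))"
      unfolding noncrossing_def using uE D(6) ny crosses_sym by blast
    have "\<exists>e\<in>insert y (E - {x}). crosses f e" if f: "f \<in> chords P - insert y (E - {x})" for f
    proof (rule ccontr)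
      assume no: "\<not> ?thesis"
      then have "\<not> crosses f (a, b)" "\<not> crosses f (b, c)" "\<not> crosses f (c, d)" "\<not> crosses f (a, d)"
        using s nin by auto
      from u'[OF _ this] f have "\<not> crosses f x" by auto
      then have "f \<in> E" using D(7)[of f] no f by blast
      then show False using f no xy by auto
    qed
    then show ?thesis using n D(1,2) y by (auto simp: max_noncrossing_def)
  qed
  have q: "(crosses (p, q) (a, c) \<longrightarrow> (p, q) = (b, d)) \<and> (crosses (p, q) (b, d) \<longrightarrow> (p, q) = (a, c))"
    if "p < q" "\<not> crosses (p, q) (a, b)" "\<not> crosses (p, q) (b, c)" "\<not> crosses (p, q) (c, d)" "\<not> crosses (p, q) (a, d)" for p q
    using crosses_diagonal_of_quadrilateral[OF o that] by blast
  show "max_noncrossing P (insert (b, d) (E - {(a, c)}))" if ac: "(a, c) \<in> E"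
  proof (rule *[OF ac])
    show "crosses (a, c) (b, d)" "(b, d) \<in> chords P" "(a, c) \<notin> {(a, b), (b, c), (c, d), (a, d)}"
      using o P by (simp_all add: chords_def)
  qed (rule q)
  show "max_noncrossing P (insert (a, c) (E - {(b, d)}))" if bd: "(b, d) \<in> E"
  proof (rule *[OF bd])
    show "crosses (b, d) (a, c)" "(a, c) \<in> chords P" "(b, d) \<notin> {(a, b), (b, c), (c, d), (a, d)}"
      using o P by (simp_all add: chords_def)
    show "(crosses (p, q) (b, d) \<longrightarrow> (p, q) = (a, c)) \<and> (crosses (p, q) (a, c) \<longrightarrow> (p, q) = (b, d))"
      if "p < q" "\<not> crosses (p, q) (a, b)" "\<not> crosses (p, q) (b, c)" "\<not> crosses (p, q) (c, d)" "\<not> crosses (p, q) (a, d)" for p q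
      using q[OF that] by blast
  qed
qed

definition mid :: "nat set \<Rightarrow> nat" where "mid t = Min (t - {Min t})"

text \<open>Vertices are numbers, so the vertices of a triangle are recovered as its minimum, its middle element and its maximum.\<close>
lemma triangle_simps:
  fixes a b c :: nat
  assumes "a < b" "b < c"
  shows "Min {a, b, c} = a" "Max {a, b, c} = c" "mid {a, b, c} = b" "card {a, b, c} = 3"
    "chords {a, b, c} = {(a, b), (b, c), (a, c)}"
proof -
  show m: "Min {a, b, c} = a" "Max {a, b, c} = c" using assms by auto
  have "{a, b, c} - {a} = {b, c}" using assms by auto
  then show "mid {a, b, c} = b" unfolding mid_def m using assms by auto
  show "card {a, b, c} = 3" using assms by auto
  show "chords {a, b, c} = {(a, b), (b, c), (a, c)}" using assms by (auto simp: chords_def)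
qed

lemma trianglesE:
  assumes "t \<in> triangles E"
  obtains a b c where "t = {a, b, c}" "a < b" "b < c" "(a, b) \<in> E" "(b, c) \<in> E" "(a, c) \<in> E"
    "Min t = a" "mid t = b" "Max t = c" "finite t" "card t = 3" "chords t = {(a, b), (b, c), (a, c)}"
  using assms triangle_simps unfolding triangles_def by auto

lemma trianglesI:
  "a < b \<Longrightarrow> b < c \<Longrightarrow> (a, b) \<in> E \<Longrightarrow> (b, c) \<in> E \<Longrightarrow> (a, c) \<in> E \<Longrightarrow> {a, b, c} \<in> triangles E"
  unfolding triangles_def by blast

lemma three_set_obtain:
  fixes t :: "nat set"
  assumes "card t = 3"
  obtains a b c where "t = {a, b, c}" "a < b" "b < c"
proof -
  have fin: "finite t" using assms card.infinite by fastforce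
  have "length (sorted_list_of_set t) = Suc (Suc (Suc 0))" using assms by simp
  then obtain a b c where l: "sorted_list_of_set t = [a, b, c]" by (metis length_0_conv length_Suc_conv)
  have "set [a, b, c] = t" "sorted_wrt (<) [a, b, c]"
    using fin unfolding l[symmetric] by (simp_all add: strict_sorted_iff)
  then show ?thesis using that[of a b c] by auto
qed

lemma mid_inj: assumes n: "noncrossing E" shows "inj_on mid (triangles E)"
proof (rule inj_onI)
  fix s t assume s: "s \<in> triangles E" and t: "t \<in> triangles E" and e: "mid s = mid t"
  from s obtain x v z where s': "s = {x, v, z}" "x < v" "v < z" "(x, v) \<in> E" "(v, z) \<in> E" "(x, z) \<in> E" "mid s = v"
    by (rule trianglesE)
  from t obtain x' v' z' where t': "t = {x', v', z'}" "x' < v'" "v' < z'" "(x', v') \<in> E" "(v', z') \<in> E" "(x', z') \<in> E" "mid t = v'"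
    by (rule trianglesE)
  have v: "v' = v" using e s' t' by simp
  note N = noncrossingD[OF n]
  have "x = x'" using N[of x v x' z'] N[of x' v x z] s' t' v by (cases x x' rule: linorder_cases) auto
  moreover have "z = z'" using N[of x z v z'] N[of x' z' v z] s' t' v by (cases z z' rule: linorder_cases) auto
  ultimately show "s = t" using s' t' v by simp
qed

text \<open>The triangle on the inner side of a shortest arc spanning \<open>v\<close> has its apex at \<open>v\<close>.\<close>
lemma mid_surj:
  assumes F: "max_noncrossing P E" and v: "v \<in> P" "a \<in> P" "b \<in> P" "a < v" "v < b"
  obtains t where "t \<in> triangles E" "mid t = v" "t \<subseteq> P"
proof -
  note D = max_noncrossingD[OF F]
  have ab: "(a, b) \<in> chords P" using v by (auto simp: chords_def)
  note M = Min_Max_arc[OF F ab]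
  let ?C = "\<lambda>l. \<exists>x y. (x, y) \<in> E \<and> x < v \<and> v < y \<and> l = y - x"
  have "Min P < v" "v < Max P" using M v by auto
  then have "?C (Max P - Min P)" using M(1) by blast
  then have "?C (LEAST l. ?C l)" by (rule LeastI)
  then obtain x y where xy: "(x, y) \<in> E" "x < v" "v < y" and l: "(LEAST l. ?C l) = y - x"
    by blast
  have least: "y - x \<le> y' - x'" if "(x', y') \<in> E" "x' < v" "v < y'" for x' y'
    unfolding l[symmetric] by (rule Least_le) (use that in blast)
  have "P \<inter> {x<..<y} \<noteq> {}" using xy v by auto
  then obtain c where c: "x < c" "c < y" "(x, c) \<in> E" "(c, y) \<in> E" "c \<in> P" using inner_apex[OF F xy(1)] by metis
  have "c = v" using least[of x c] least[of c y] c xy by (cases c v rule: linorder_cases) auto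
  then show ?thesis using that[of "{x, v, y}"] c xy triangle_simps[of x v y] D(5)[OF xy(1)] v trianglesI[of x v y E] by auto
qed

lemma triangles_subset:
  assumes "E \<subseteq> chords P" "t \<in> triangles E" shows "t \<subseteq> P"
  using assms(2) by (rule trianglesE) (use assms(1) chordsD in blast)

lemma finite_triangles: assumes "finite P" "E \<subseteq> chords P" shows "finite (triangles E)"
proof (rule finite_subset[of _ "Pow P"])
  show "triangles E \<subseteq> Pow P" using triangles_subset[OF assms(2)] by blast
qed (use assms in auto)

text \<open>The middle vertex identifies the triangles with the vertices of the polygon other than the two extreme ones. This gives
their number without an induction over polygons.\<close>
lemma mid_bij:
  assumes F: "max_noncrossing P E"
  shows "bij_betw mid (triangles E) (P - {Min P, Max P})"
proof -
  note D = max_noncrossingD[OF F]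
  have "mid ` triangles E = P - {Min P, Max P}"
  proof (intro equalityI subsetI)
    fix v assume "v \<in> mid ` triangles E"
    then obtain t where "t \<in> triangles E" "v = mid t" by auto
    from this(1) obtain a b c where t: "a < b" "b < c" "(a, b) \<in> E" "(b, c) \<in> E" "(a, c) \<in> E" "mid t = b"
      by (rule trianglesE)
    have abc: "a \<in> P" "b \<in> P" "c \<in> P" using t D(5) by auto
    have "Min P \<le> a" "c \<le> Max P" using abc D(1) by auto
    then show "v \<in> P - {Min P, Max P}" using t abc \<open>v = mid t\<close> by auto
  next
    fix v assume v: "v \<in> P - {Min P, Max P}"
    then have ne: "P \<noteq> {}" by auto
    have 1: "Min P \<in> P" "Max P \<in> P" "Min P \<le> v" "v \<le> Max P" using D(1) ne v by auto
    have 2: "Min P < v" "v < Max P" using 1 v by auto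
    from mid_surj[OF F _ 1(1,2) 2] v obtain t where "t \<in> triangles E" "mid t = v" by auto
    then show "v \<in> mid ` triangles E" by auto
  qed
  then show ?thesis using mid_inj[OF D(3)] by (simp add: bij_betw_def)
qed

lemma card_triangles:
  assumes F: "max_noncrossing P E"
  shows "card (triangles E) = card P - 2"
proof (cases "card P \<ge> 2")
  case True
  have fin: "finite P" using F by (simp add: max_noncrossing_def)
  have ne: "P \<noteq> {}" using True by auto
  have "Min P \<noteq> Max P"
  proof
    assume e: "Min P = Max P"
    have "P \<subseteq> {Min P}"
    proof
      fix x assume "x \<in> P"
      then have "Min P \<le> x" "x \<le> Max P" using fin by auto
      then show "x \<in> {Min P}" using e by auto
    qed
    then have "card P \<le> card {Min P}" by (intro card_mono) auto
    then show False using True by auto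
  qed
  moreover have "Min P \<in> P" "Max P \<in> P" using fin ne by auto
  ultimately have "card (P - {Min P, Max P}) = card P - 2"
    using fin by (subst card_Diff_subset) auto
  then show ?thesis using bij_betw_same_card[OF mid_bij[OF F]] by simp
next
  case False
  have "triangles E = {}"
  proof (rule equals0I)
    fix t assume t: "t \<in> triangles E"
    then have "card t = 3" by (rule trianglesE)
    moreover have "card t \<le> card P" using triangles_subset[OF _ t, of P] F by (auto simp: max_noncrossing_def intro: card_mono)
    ultimately show False using False by simp
  qed
  then show ?thesis using False by simp
qed

text \<open>Each arc other than the one joining the extreme vertices is a short side of exactly one triangle, and every triangle has two
short sides.\<close>
lemma card_max_noncrossing:
  assumes F: "max_noncrossing P E" and c: "card P \<ge> 2"
  shows "card E = 2 * card P - 3"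
proof -
  note D = max_noncrossingD[OF F]
  obtain x y where xy: "x \<in> P" "y \<in> P" "x \<noteq> y"
  proof -
    have "\<not> is_singleton P" "P \<noteq> {}" using c by (auto simp: is_singleton_def)
    then show ?thesis using that by (metis is_singletonI' )
  qed
  then have "(x, y) \<in> chords P \<or> (y, x) \<in> chords P" by (auto simp: chords_def)
  then obtain u w where uw: "(u, w) \<in> chords P" by auto
  note M = Min_Max_arc[OF F uw]
  \<comment> \<open>\<open>f\<close> maps a triangle and a choice of one of its short sides to that side.\<close>
  define f where "f = (\<lambda>(t, s). if s then (Min t, mid t) else (mid t, Max t))"
  have inj: "inj_on f (triangles E \<times> UNIV)"
  proof (rule inj_onI, clarify)
    fix t s t' s' assume t: "t \<in> triangles E" and t': "t' \<in> triangles E" and e: "f (t, s) = f (t', s')"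
    from t obtain a b c where tt: "a < b" "b < c" "(a, b) \<in> E" "(b, c) \<in> E" "(a, c) \<in> E" "Min t = a" "mid t = b" "Max t = c"
      by (rule trianglesE)
    from t' obtain a' b' c' where tt': "a' < b'" "b' < c'" "(a', b') \<in> E" "(b', c') \<in> E" "(a', c') \<in> E" "Min t' = a'" "mid t' = b'" "Max t' = c'"
      by (rule trianglesE)
    have "s = s' \<and> mid t = mid t'"
      using e tt tt' noncrossingD[OF D(3), of a' c' a c] noncrossingD[OF D(3), of a c a' c']
      unfolding f_def by (auto split: if_splits)
    then show "t = t' \<and> s = s'" using mid_inj[OF D(3)] t t' by (auto dest: inj_onD)
  qed
  have img: "f ` (triangles E \<times> UNIV) = E - {(Min P, Max P)}"
  proof (intro equalityI subsetI)
    fix e assume "e \<in> f ` (triangles E \<times> UNIV)"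
    then obtain t s where t: "t \<in> triangles E" and e: "e = f (t, s)" by auto
    from t obtain a b c where tt: "a < b" "b < c" "(a, b) \<in> E" "(b, c) \<in> E" "(a, c) \<in> E" "Min t = a" "mid t = b" "Max t = c"
      by (rule trianglesE)
    have "a \<in> P" "c \<in> P" using tt D(5) by auto
    then have "Min P \<le> a" "c \<le> Max P" using D(1) by auto
    then show "e \<in> E - {(Min P, Max P)}" using tt e by (auto simp: f_def)
  next
    fix e assume e: "e \<in> E - {(Min P, Max P)}"
    obtain a b where ab: "e = (a, b)" by (cases e)
    have abE: "(a, b) \<in> E" "a \<in> P" "b \<in> P" "a < b" using e D(5) ab by auto
    have no: "\<not> P \<subseteq> {a..b}"
    proof
      assume s: "P \<subseteq> {a..b}"
      have "Min P \<le> a" "b \<le> Max P" using abE D(1) by auto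
      moreover have "a \<le> Min P" "Max P \<le> b" using s M by auto
      ultimately show False using e ab by auto
    qed
    show "e \<in> f ` (triangles E \<times> UNIV)"
      using outer_apex[OF F abE(1) no]
    proof cases
      case (1 c)
      have "f ({c, a, b}, False) = e" using triangle_simps[OF 1(2) abE(4)] by (simp add: f_def ab)
      then show ?thesis using trianglesI[of c a b E] 1 abE by (metis UNIV_I image_eqI mem_Sigma_iff)
    next
      case (2 c)
      have "f ({a, b, c}, True) = e" using triangle_simps[OF abE(4) 2(2)] by (simp add: f_def ab)
      then show ?thesis using trianglesI[of a b c E] 2 abE by (metis UNIV_I image_eqI mem_Sigma_iff)
    qed
  qed
  have "card E = card (E - {(Min P, Max P)}) + 1"
    using D(4) M(1) by (metis Suc_eq_plus1 card.remove)
  also have "card (E - {(Min P, Max P)}) = card (triangles E) * 2"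
    using card_image[OF inj] by (simp add: img card_cartesian_product)
  finally show ?thesis using card_triangles[OF F] c by simp
qed

lemma triangles_restrict: "triangles (E \<inter> chords Q) = {t \<in> triangles E. t \<subseteq> Q}"
proof (intro equalityI subsetI)
  fix t assume t: "t \<in> triangles (E \<inter> chords Q)"
  then have "t \<subseteq> Q" by (rule triangles_subset[rotated]) auto
  moreover have "t \<in> triangles E" using t by (rule trianglesE) (auto intro!: trianglesI)
  ultimately show "t \<in> {t \<in> triangles E. t \<subseteq> Q}" by auto
next
  fix t assume t: "t \<in> {t \<in> triangles E. t \<subseteq> Q}"
  then have "t \<in> triangles E" "t \<subseteq> Q" by auto
  then show "t \<in> triangles (E \<inter> chords Q)"
    by (elim trianglesE) (auto intro!: trianglesI chordsI)
qed

lemma noncrossing_subset: "noncrossing E \<Longrightarrow> F \<subseteq> E \<Longrightarrow> noncrossing F"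
  by (auto simp: noncrossing_def)

lemma triangle_arc_side:
  assumes n: "noncrossing E" and ab: "(a, b) \<in> E" and t: "t \<in> triangles E"
  shows "t \<subseteq> {a..b} \<or> t \<inter> {a<..<b} = {}"
proof -
  note N = noncrossingD[OF n]
  from t obtain x y z where t: "t = {x, y, z}" "x < y" "y < z" "(x, y) \<in> E" "(y, z) \<in> E" "(x, z) \<in> E"
    by (rule trianglesE)
  have c: "u \<in> {a<..<b} \<Longrightarrow> w \<in> {a..b}" if "(u, w) \<in> E \<and> u < w \<or> (w, u) \<in> E \<and> w < u" for u w
    using that N[OF ab, of u w] N[OF _ ab, of w u] by (auto simp: not_less[symmetric])
  show ?thesis using c[of x y] c[of y x] c[of y z] c[of z y] c[of x z] c[of z x] t by auto
qed

text \<open>The vertex of \<open>t\<close> opposite to the side that faces the arc \<open>(a, b)\<close>. Walking away from \<open>(a, b)\<close> through adjacent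
triangles, it is the vertex that appears for the first time in \<open>t\<close>.\<close>
definition far_vertex :: "nat \<Rightarrow> nat \<Rightarrow> nat set \<Rightarrow> nat" where
  "far_vertex a b t = (if Min t \<le> a \<and> b \<le> mid t then Max t else if mid t \<le> a \<and> b \<le> Max t then Min t else mid t)"

lemma far_vertex_props:
  assumes n: "noncrossing E" and ab: "(a, b) \<in> E" "a < b" and t: "t \<in> triangles E"
  shows "far_vertex a b t \<in> t" "far_vertex a b t \<noteq> a" "far_vertex a b t \<noteq> b"
proof -
  have s: "t \<subseteq> {a..b} \<or> t \<inter> {a<..<b} = {}" by (rule triangle_arc_side[OF n ab(1) t])
  from t obtain x y z where t: "t = {x, y, z}" "x < y" "y < z" "(x, y) \<in> E" "(y, z) \<in> E" "(x, z) \<in> E"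
     "Min t = x" "mid t = y" "Max t = z"
    by (rule trianglesE)
  show "far_vertex a b t \<in> t" unfolding far_vertex_def t(7-9) using t(1) by auto
  show "far_vertex a b t \<noteq> a" "far_vertex a b t \<noteq> b" unfolding far_vertex_def t(7-9) using t(1-3) s ab by (auto simp: not_le)
qed

text \<open>Distinct triangles have distinct far vertices, since each triangle met on the way from \<open>(a, b)\<close> adds a new vertex. The proof
compares the position of both triangles relative to \<open>(a, b)\<close>: the far vertex is the maximum, the minimum or the middle
element according to whether the arc lies below the first half, below the second half or elsewhere. If the cases agree, the
triangles have the same middle vertex.\<close>
lemma far_vertex_inj:
  assumes n: "noncrossing E" and ab: "(a, b) \<in> E" "a < b"
  shows "inj_on (far_vertex a b) (triangles E)"
proof -
  note N = noncrossingD[OF n]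
  have arc: "\<And>u w. (u, w) \<in> E \<Longrightarrow> u < w \<Longrightarrow> \<not> (u < a \<and> a < w \<and> w < b) \<and> \<not> (a < u \<and> u < b \<and> b < w)"
    using N[OF ab(1)] N[OF _ ab(1)] by blast
  have "s = t" if s: "s \<in> triangles E" and t: "t \<in> triangles E" and e: "far_vertex a b s = far_vertex a b t" for s t
  proof -
    have ss: "s \<subseteq> {a..b} \<or> s \<inter> {a<..<b} = {}" by (rule triangle_arc_side[OF n ab(1) s])
    have st: "t \<subseteq> {a..b} \<or> t \<inter> {a<..<b} = {}" by (rule triangle_arc_side[OF n ab(1) t])
    from s obtain x v z where s': "s = {x, v, z}" "x < v" "v < z" "(x, v) \<in> E" "(v, z) \<in> E" "(x, z) \<in> E"
      "Min s = x" "mid s = v" "Max s = z"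
      by (rule trianglesE)
    from t obtain x' v' z' where t': "t = {x', v', z'}" "x' < v'" "v' < z'" "(x', v') \<in> E" "(v', z') \<in> E" "(x', z') \<in> E"
      "Min t = x'" "mid t = v'" "Max t = z'"
      by (rule trianglesE)
    have fs: "(x \<le> a \<and> b \<le> v \<and> far_vertex a b s = z) \<or> (v \<le> a \<and> b \<le> z \<and> far_vertex a b s = x)
      \<or> (\<not> (x \<le> a \<and> b \<le> v) \<and> \<not> (v \<le> a \<and> b \<le> z) \<and> far_vertex a b s = v)"
      unfolding far_vertex_def s'(7-9) by auto
    have ft: "(x' \<le> a \<and> b \<le> v' \<and> far_vertex a b t = z') \<or> (v' \<le> a \<and> b \<le> z' \<and> far_vertex a b t = x')
      \<or> (\<not> (x' \<le> a \<and> b \<le> v') \<and> \<not> (v' \<le> a \<and> b \<le> z') \<and> far_vertex a b t = v')"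
      unfolding far_vertex_def t'(7-9) by auto
    note o = s'(2,3) t'(2,3) ab(2)
    \<comment> \<open>An arc spanning \<open>(a, b)\<close> does not end at the middle vertex of a triangle whose short sides do not span \<open>(a, b)\<close>.\<close>
    have far_mid: False
      if m: "\<not> (p \<le> a \<and> b \<le> q)" "\<not> (q \<le> a \<and> b \<le> r)" "p < q" "q < r" "(p, r) \<in> E"
      and u: "u < w" "(u, w) \<in> E" "u \<le> a" "b \<le> w" "q = u \<or> q = w" for p q r u w
      using u(5)
    proof
      assume "q = u"
      then have "r < b" using m u by auto
      then have "r \<le> a" using arc[OF m(5)] m u \<open>q = u\<close> by (auto simp: not_less[symmetric])
      then show False using N[OF m(5) u(2)] \<open>q = u\<close> m u ab by auto
    next
      assume "q = w"
      then have "a < p" using m u by auto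
      then have "b \<le> p" using arc[OF m(5)] m u \<open>q = w\<close> by (auto simp: not_less[symmetric])
      then show False using N[OF u(2) m(5)] \<open>q = w\<close> m u ab by auto
    qed
    have "x \<le> a \<and> b \<le> v \<and> x' \<le> a \<and> b \<le> v' \<and> z = z'
      \<or> v \<le> a \<and> b \<le> z \<and> v' \<le> a \<and> b \<le> z' \<and> x = x' \<or> v = v'"
    proof -
      consider (sA) "x \<le> a \<and> b \<le> v" "far_vertex a b s = z" | (sB) "v \<le> a \<and> b \<le> z" "far_vertex a b s = x"
        | (sM) "\<not> (x \<le> a \<and> b \<le> v)" "\<not> (v \<le> a \<and> b \<le> z)" "far_vertex a b s = v" using fs by blast
      note sc = this
      consider (tA) "x' \<le> a \<and> b \<le> v'" "far_vertex a b t = z'" | (tB) "v' \<le> a \<and> b \<le> z'" "far_vertex a b t = x'"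
        | (tM) "\<not> (x' \<le> a \<and> b \<le> v')" "\<not> (v' \<le> a \<and> b \<le> z')" "far_vertex a b t = v'" using ft by blast
      note tc = this
      show ?thesis
      proof (cases rule: sc)
        case sA
        have xz: "x \<le> a" "b \<le> z" "x < z" using sA o by linarith+
        show ?thesis
        proof (cases rule: tc)
          case tA then show ?thesis using sA e by simp
        next
          case tB then show ?thesis using sA e o by linarith
        next
          case tM then show ?thesis using far_mid[OF tM(1,2) t'(2,3,6) xz(3) s'(6) xz(1,2)] sA e by simp
        qed
      next
        case sB
        have xz: "x \<le> a" "b \<le> z" "x < z" using sB o by linarith+
        show ?thesis
        proof (cases rule: tc)
          case tA then show ?thesis using sB e o by linarith
        next
          case tB then show ?thesis using sB e by simp
        next
          case tM then show ?thesis using far_mid[OF tM(1,2) t'(2,3,6) xz(3) s'(6) xz(1,2)] sB e by simp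
        qed
      next
        case sM
        show ?thesis
        proof (cases rule: tc)
          case tA
          then have xz: "x' \<le> a" "b \<le> z'" "x' < z'" using o by linarith+
          show ?thesis using far_mid[OF sM(1,2) s'(2,3,6) xz(3) t'(6) xz(1,2)] tA sM e by simp
        next
          case tB
          then have xz: "x' \<le> a" "b \<le> z'" "x' < z'" using o by linarith+
          show ?thesis using far_mid[OF sM(1,2) s'(2,3,6) xz(3) t'(6) xz(1,2)] tB sM e by simp
        next
          case tM then show ?thesis using sM e by simp
        qed
      qed
    qed
    then consider "x \<le> a" "b \<le> v" "x' \<le> a" "b \<le> v'" "z = z'"
      | "v \<le> a" "b \<le> z" "v' \<le> a" "b \<le> z'" "x = x'"
      | "v = v'" by blast
    then have "x = x' \<and> v = v' \<and> z = z' \<or> v = v'"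
    proof cases
      case 1
      have "x = x'" using N[of x v x' z] N[of x' v' x z] 1 s'(2-6) t'(2-6) ab by (cases x x' rule: linorder_cases) auto
      moreover have "v = v'" using N[of x v' v z] N[of x v v' z] 1 s'(2-6) t'(2-6) ab calculation by (cases v v' rule: linorder_cases) auto
      ultimately show ?thesis using 1 by auto
    next
      case 2
      have "v = v'" using N[of x v' v z] N[of x v v' z'] 2 s'(2-6) t'(2-6) ab by (cases v v' rule: linorder_cases) auto
      then show ?thesis by auto
    qed auto
    then have "mid s = mid t" using s' t' by auto
    then show ?thesis using mid_inj[OF n] s t by (auto dest: inj_onD)
  qed
  then show ?thesis by (auto intro: inj_onI)
qed

section \<open>Faces of a noncrossing set of diagonals\<close>

text \<open>From here on crossings are unfolded only where the inequalities between vertices matter.\<close>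

declare crosses.simps [simp del]

text \<open>Diagonals and sides together, so that triangulations become maximal noncrossing sets of arcs.\<close>
abbreviation arcs_of :: "nat \<Rightarrow> bicolored \<Rightarrow> arc set" where
  "arcs_of n T \<equiv> diagonals T \<union> sides {..<n}"

lemma triangulation_max_noncrossing:
  assumes "triangulation n D" shows "max_noncrossing {..<n} (D \<union> sides {..<n})" "D = (D \<union> sides {..<n}) - sides {..<n}"
proof -
  have D: "D \<subseteq> chords {..<n}" "sides {..<n} \<subseteq> chords {..<n}" and n: "\<forall>d\<in>D. \<forall>e\<in>D. \<not> crosses d e"
    and m: "\<forall>d \<in> chords {..<n} - sides {..<n} - D. \<exists>e\<in>D. crosses d e"
    using assms by (auto simp: triangulation_def sides_def)
  have s: "\<not> crosses x e" "\<not> crosses e x" if "x \<in> sides {..<n}" "e \<in> chords {..<n}" for x e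
    using sides_not_crossed[of "fst x" "snd x" "{..<n}" e] that by auto
  show "max_noncrossing {..<n} (D \<union> sides {..<n})" unfolding max_noncrossing_def noncrossing_def
    using D n m s by blast
  show "D = (D \<union> sides {..<n}) - sides {..<n}" using assms by (auto simp: triangulation_def)
qed

lemma max_noncrossing_triangulation:
  assumes F: "max_noncrossing {..<n} E" shows "triangulation n (E - sides {..<n})" "(E - sides {..<n}) \<union> sides {..<n} = E"
proof -
  note D = max_noncrossingD[OF F]
  have s: "\<not> crosses e x" if "x \<in> sides {..<n}" "e \<in> chords {..<n}" for x e
    using sides_not_crossed[of "fst x" "snd x" "{..<n}" e] that by auto
  show "triangulation n (E - sides {..<n})"
    unfolding triangulation_def
  proof (intro conjI ballI)
    show "E - sides {..<n} \<subseteq> chords {..<n} - sides {..<n}" using D(2) by auto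
    show "\<not> crosses d e" if "d \<in> E - sides {..<n}" "e \<in> E - sides {..<n}" for d e using D(6) that by auto
    fix d assume d: "d \<in> chords {..<n} - sides {..<n} - (E - sides {..<n})"
    then obtain e where "e \<in> E" "crosses d e" using F unfolding max_noncrossing_def by blast
    then show "\<exists>e\<in>E - sides {..<n}. crosses d e" using s d by blast
  qed
  show "(E - sides {..<n}) \<union> sides {..<n} = E" using sides_in_max_noncrossing[OF F] by auto
qed

text \<open>A chord crossed by nothing belongs to a maximal noncrossing set; so an uncut polygon has all its chords among the arcs.\<close>
lemma uncut_max_noncrossing:
  assumes F: "max_noncrossing {..<n} (D \<union> sides {..<n})"
  shows "uncut n D P \<longleftrightarrow> P \<subseteq> {..<n} \<and> card P \<ge> 3 \<and> chords P \<subseteq> D \<union> sides {..<n}"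
proof -
  note DD = max_noncrossingD[OF F]
  have s: "\<not> crosses e x" if "x \<in> sides {..<n}" "e \<in> chords {..<n}" for x e
    using sides_not_crossed[of "fst x" "snd x" "{..<n}" e] that by auto
  show ?thesis
  proof
    assume u: "uncut n D P"
    then have P: "P \<subseteq> {..<n}" "card P \<ge> 3" by (auto simp: uncut_def)
    have "c \<in> D \<union> sides {..<n}" if c: "c \<in> chords P" for c
    proof (rule DD(7))
      show cn: "c \<in> chords {..<n}" using c chords_mono[OF P(1)] by auto
      show "\<not> crosses c e" if "e \<in> D \<union> sides {..<n}" for e
        using that u c s[of e c] cn unfolding uncut_def by blast
    qed
    then show "P \<subseteq> {..<n} \<and> card P \<ge> 3 \<and> chords P \<subseteq> D \<union> sides {..<n}" using P by auto
  next
    assume a: "P \<subseteq> {..<n} \<and> card P \<ge> 3 \<and> chords P \<subseteq> D \<union> sides {..<n}"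
    then show "uncut n D P" using DD(6) unfolding uncut_def by blast
  qed
qed

text \<open>Four vertices all of whose chords are arcs would give two crossing diagonals.\<close>
lemma faces_max_noncrossing:
  assumes F: "max_noncrossing {..<n} (D \<union> sides {..<n})"
  shows "faces n D = triangles (D \<union> sides {..<n})" (is "_ = triangles ?E")
proof -
  note DD = max_noncrossingD[OF F]
  note U = uncut_max_noncrossing[OF F]
  have c3: "card P = 3" if u: "uncut n D P" for P
  proof (rule ccontr)
    assume "card P \<noteq> 3"
    then have c4: "card P \<ge> 4" and P: "chords P \<subseteq> ?E" "P \<subseteq> {..<n}" using u U by auto
    have fin: "finite P" using P(2) finite_subset by blast
    define xs where "xs = sorted_list_of_set P"
    have xs: "set xs = P" "sorted_wrt (<) xs" "length xs = card P"
      using fin by (auto simp: xs_def)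
    have lt: "xs ! 0 < xs ! 1" "xs ! 1 < xs ! 2" "xs ! 2 < xs ! 3"
      using xs(2,3) c4 by (auto simp: sorted_wrt_iff_nth_less)
    have m: "xs ! i \<in> P" if "i < 4" for i using xs c4 that by (metis nth_mem order_less_le_trans)
    have "(xs ! 0, xs ! 2) \<in> ?E" "(xs ! 1, xs ! 3) \<in> ?E"
      by (rule subsetD[OF P(1)]; use m lt in \<open>auto intro!: chordsI\<close>)+
    then show False using noncrossingD[OF DD(3), of "xs!0" "xs!2" "xs!1" "xs!3"] lt by auto
  qed
  have tri: "P \<in> triangles ?E" if u: "uncut n D P" for P
  proof -
    from three_set_obtain[OF c3[OF u]] obtain a b c where P: "P = {a, b, c}" "a < b" "b < c" .
    then show ?thesis using u U triangle_simps(5)[OF P(2,3)] by (auto intro!: trianglesI)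
  qed
  have unc: "uncut n D P" if t: "P \<in> triangles ?E" for P
  proof -
    have "P \<subseteq> {..<n}" by (rule triangles_subset[OF DD(2) t])
    then show ?thesis using t U by (elim trianglesE) auto
  qed
  show ?thesis
  proof (intro equalityI subsetI)
    fix P assume "P \<in> faces n D" then show "P \<in> triangles ?E" using tri by (auto simp: faces_def)
  next
    fix P assume P: "P \<in> triangles ?E"
    have "P' = P" if "uncut n D P'" "P \<subseteq> P'" for P'
      by (rule sym, rule card_subset_eq) (use that c3[of P'] c3[OF unc[OF P]] card.infinite[of P'] in force)+
    then show "P \<in> faces n D" using unc[OF P] by (auto simp: faces_def)
  qed
qed

lemma uncut_in_face:
  assumes "uncut n K P" obtains Q where "Q \<in> faces n K" "P \<subseteq> Q"
proof -
  let ?F = "{Q. uncut n K Q}"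
  have fin: "finite ?F" by (rule finite_subset[of _ "Pow {..<n}"]) (auto simp: uncut_def)
  from finite_has_maximal2[OF fin, of P] assms obtain Q where "uncut n K Q" "P \<subseteq> Q" "\<forall>Q'. uncut n K Q' \<longrightarrow> Q \<subseteq> Q' \<longrightarrow> Q = Q'"
    by auto
  then show ?thesis using that[of Q] by (auto simp: faces_def)
qed

text \<open>A point outside a convex polygon is separated from it by a side.\<close>
lemma beyond_side:
  fixes P :: "nat set"
  assumes fin: "finite P" and c: "(u, w) \<in> chords P" and p: "p \<notin> P"
  obtains (between) s1 s2 where "(s1, s2) \<in> sides P" "s1 < p" "p < s2" "P \<inter> {s1<..<s2} = {}"
  | (outside) s1 s2 where "(s1, s2) \<in> sides P" "p < s1 \<or> s2 < p" "P \<subseteq> {s1..s2}"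
proof -
  have P: "u \<in> P" "w \<in> P" "u < w" using c by (auto simp: chords_def)
  have "P \<noteq> {}" using P by auto
  then have M: "Min P \<in> P" "Max P \<in> P" "P \<subseteq> {Min P..Max P}" using fin by auto
  have "Min P \<le> u" "w \<le> Max P" using M P by auto
  then have MM: "Min P < Max P" using P by linarith
  show ?thesis
  proof (cases "p < Min P \<or> Max P < p")
    case True
    have "(Min P, Max P) \<in> sides P" using M MM by (auto simp: sides_def chords_def)
    then show ?thesis using outside[of "Min P" "Max P"] True M(3) by simp
  next
    case False
    then have "Min P \<le> p" "p \<le> Max P" by linarith+
    then have l: "Min P < p" "p < Max P" using p M by (auto simp: order.order_iff_strict)
    let ?L = "{x \<in> P. x < p}"
    have "finite ?L" "?L \<noteq> {}" using fin M l by auto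
    then have 1: "Max ?L \<in> ?L" "\<And>x. x \<in> ?L \<Longrightarrow> x \<le> Max ?L" using Max_in Max_ge by blast+
    have 2: "Max ?L \<in> P" "Max ?L < p" using 1(1) by auto
    from side_up_obtain[OF fin 2(1) M(2)] 2 l obtain s where s: "s \<in> P" "Max ?L < s" "P \<inter> {Max ?L<..<s} = {}" "(Max ?L, s) \<in> sides P"
      by auto
    have "p < s"
    proof (rule ccontr)
      assume "\<not> p < s"
      then have "s \<in> ?L" using s(1) p by (cases "s = p") auto
      then show False using 1(2)[of s] s(2) by linarith
    qed
    then show ?thesis by (intro between[OF s(4) 2(2) _ s(3)])
  qed
qed

text \<open>If a side of a face were neither a diagonal in \<open>K\<close> nor a side of the \<open>n\<close>-gon, extend \<open>K\<close> with that side to a triangulation.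
The vertex of its triangle beyond the side can be added to the face without any chord being cut, contradicting maximality.\<close>
lemma face_sides:
  assumes K: "K \<subseteq> chords {..<n}" "noncrossing K" and P: "P \<in> faces n K"
  shows "sides P \<subseteq> K \<union> sides {..<n}"
proof (rule subsetI, rule ccontr)
  fix e assume e: "e \<in> sides P" "e \<notin> K \<union> sides {..<n}"
  obtain s1 s2 where s: "e = (s1, s2)" by (cases e)
  have u: "uncut n K P" and mx: "\<And>P'. uncut n K P' \<Longrightarrow> P \<subseteq> P' \<Longrightarrow> P' = P" using P by (auto simp: faces_def)
  have Pn: "P \<subseteq> {..<n}" and fin: "finite P" using u finite_subset by (auto simp: uncut_def)
  have s': "s1 \<in> P" "s2 \<in> P" "s1 < s2" "(s1, s2) \<in> chords P" using e s by (auto simp: sides_def chords_def)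
  have nK: "\<not> crosses c d" if "c \<in> chords P" "d \<in> K" for c d using u that by (auto simp: uncut_def)
  have "\<not> crosses (s1, s2) (s1, s2)" by (simp add: crosses.simps)
  then have nc: "noncrossing (insert (s1, s2) K)" using nK[OF s'(4)] K(2) unfolding noncrossing_def by (auto simp: crosses_sym)
  have "insert (s1, s2) K \<subseteq> chords {..<n}" using K(1) s' chords_mono[OF Pn] by auto
  then obtain E where E: "insert (s1, s2) K \<subseteq> E" and F: "max_noncrossing {..<n} E"
    using max_noncrossing_extend[OF finite_lessThan _ nc] by metis
  note D = max_noncrossingD[OF F]
  have sE: "(s1, s2) \<in> E" using E by auto
  \<comment> \<open>A vertex that sees all of \<open>P\<close> without crossing \<open>K\<close> contradicts the maximality of \<open>P\<close>.\<close>
  have fin3: False if v: "v \<notin> P" "v < n" and va: "\<And>p. p \<in> P \<Longrightarrow> p \<noteq> v \<and> (\<forall>d\<in>K. \<not> crosses (min v p, max v p) d)" for v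
  proof -
    have "\<forall>c\<in>chords (insert v P). \<forall>d\<in>K. \<not> crosses c d"
    proof (intro ballI)
      fix c d assume c: "c \<in> chords (insert v P)" and d: "d \<in> K"
      obtain x y where xy: "c = (x, y)" by (cases c)
      have "x \<in> insert v P" "y \<in> insert v P" "x < y" using c xy by (auto simp: chords_def)
      then consider "c \<in> chords P" | "x = v" "y \<in> P" | "y = v" "x \<in> P" using xy by (auto simp: chords_def)
      then have "c \<in> chords P \<or> (\<exists>p\<in>P. c = (min v p, max v p))"
      proof cases
        case 2 then show ?thesis using xy \<open>x < y\<close> by (intro disjI2 bexI[of _ y]) simp_all
      next
        case 3 then show ?thesis using xy \<open>x < y\<close> by (intro disjI2 bexI[of _ x]) simp_all
      qed auto
      then show "\<not> crosses c d" using nK[of c d] va d by blast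
    qed
    moreover have "card (insert v P) \<ge> 3" using u fin v by (auto simp: uncut_def)
    ultimately have "uncut n K (insert v P)" using v Pn by (auto simp: uncut_def)
    from mx[OF this] v show False by auto
  qed
  have dK: "fst d < snd d" "d \<in> E" "d \<noteq> (s1, s2)" if "d \<in> K" for d
    using that E D(5)[of "fst d" "snd d"] e s by auto
  \<comment> \<open>There are vertices of the \<open>n\<close>-gon on both sides of \<open>(s1, s2)\<close>.\<close>
  have nsd: "\<not> ({..<n} \<inter> {s1<..<s2} = {} \<or> {..<n} \<subseteq> {s1..s2})"
    using e s s' Pn by (auto simp: sides_def chords_def)
  show False
  proof (cases "P \<inter> {s1<..<s2} = {}")
    case True
    from inner_apex[OF F sE] nsd obtain v where v: "s1 < v" "v < s2" "(s1, v) \<in> E" "(v, s2) \<in> E" by metis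
    show False
    proof (rule fin3)
      show "v \<notin> P" using True v by auto
      show "v < n" using v s' Pn by auto
      fix p assume p: "p \<in> P"
      have "\<not> crosses (min v p, max v p) d" if d: "d \<in> K" for d
      proof
        assume cr: "crosses (min v p, max v p) d"
        obtain x y where xy: "d = (x, y)" by (cases d)
        note dd = dK[OF d, unfolded xy fst_conv snd_conv]
        have n1: "\<not> crosses d (s1, v)" "\<not> crosses d (v, s2)" using D(6) dd v xy by auto
        have n2: "p < s1 \<Longrightarrow> \<not> crosses d (p, s1)" "p < s2 \<Longrightarrow> \<not> crosses d (p, s2)" "s2 < p \<Longrightarrow> \<not> crosses d (s2, p)" "s1 < p \<Longrightarrow> \<not> crosses d (s1, p)"
          using nK[OF chordsI d] p s' by (auto simp: crosses_sym)
        consider "p < s1" | "p = s1" | "p = s2" | "s2 < p" using True p by force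
        then show False
        proof cases
          case 1
          have "(x, y) = (s1, s2)"
            by (rule crosses_diagonal_of_quadrilateral(1)[of p s1 v s2]) (use 1 v n1 n2 xy dd cr s' in \<open>auto simp: min_def max_def crosses_sym\<close>)
          then show False using dd by simp
        next
          case 4
          have "(x, y) = (s1, s2)"
            by (rule crosses_diagonal_of_quadrilateral(2)[of s1 v s2 p]) (use 4 v n1 n2 xy dd cr s' in \<open>auto simp: min_def max_def crosses_sym\<close>)
          then show False using dd by simp
        qed (use cr n1 v s' in \<open>simp_all add: crosses_sym\<close>)
      qed
      then show "p \<noteq> v \<and> (\<forall>d\<in>K. \<not> crosses (min v p, max v p) d)" using p True v by auto
    qed
  next
    case False
    then have Ps: "P \<subseteq> {s1..s2}" using e s by (auto simp: sides_def)
    have ns: "\<not> {..<n} \<subseteq> {s1..s2}" using nsd by blast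
    have "\<exists>v. (v < s1 \<or> s2 < v) \<and> v < n \<and> (min v s1, max v s1) \<in> E \<and> (min v s2, max v s2) \<in> E"
      using outer_apex[OF F sE ns]
    proof cases
      case (1 c) then show ?thesis using s' D(5)[OF 1(3)] by (intro exI[of _ c]) (auto simp: min_def max_def)
    next
      case (2 c) then show ?thesis using s' D(5)[OF 2(3)] by (intro exI[of _ c]) (auto simp: min_def max_def)
    qed
    then obtain v where v: "v < s1 \<or> s2 < v" "v < n" "(min v s1, max v s1) \<in> E" "(min v s2, max v s2) \<in> E"
      by blast
    show False
    proof (rule fin3)
      show "v \<notin> P" using Ps v by auto
      show "v < n" using v by auto
      fix p assume p: "p \<in> P"
      have ps: "s1 \<le> p" "p \<le> s2" using p Ps by auto
      have "\<not> crosses (min v p, max v p) d" if d: "d \<in> K" for d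
      proof
        assume cr: "crosses (min v p, max v p) d"
        obtain x y where xy: "d = (x, y)" by (cases d)
        note dd = dK[OF d, unfolded xy fst_conv snd_conv]
        have n1: "\<not> crosses d (min v s1, max v s1)" "\<not> crosses d (min v s2, max v s2)" using D(6) dd v xy by auto
        have n2: "p < s2 \<Longrightarrow> \<not> crosses d (p, s2)" "s1 < p \<Longrightarrow> \<not> crosses d (s1, p)"
          using nK[OF chordsI d] p s' by (auto simp: crosses_sym)
        consider "p = s1" | "p = s2" | "s1 < p" "p < s2" "v < s1" | "s1 < p" "p < s2" "s2 < v" using v ps by force
        then show False
        proof cases
          case 3
          have "(x, y) = (s1, s2)"
            by (rule crosses_diagonal_of_quadrilateral(1)[of v s1 p s2]) (use 3 v n1 n2 xy dd cr s' in \<open>auto simp: min_def max_def crosses_sym\<close>)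
          then show False using dd by simp
        next
          case 4
          have "(x, y) = (s1, s2)"
            by (rule crosses_diagonal_of_quadrilateral(2)[of s1 p s2 v]) (use 4 v n1 n2 xy dd cr s' in \<open>auto simp: min_def max_def crosses_sym\<close>)
          then show False using dd by simp
        qed (use cr n1 v s' in \<open>simp_all add: crosses_sym\<close>)
      qed
      then show "p \<noteq> v \<and> (\<forall>d\<in>K. \<not> crosses (min v p, max v p) d)" using ps v by auto
    qed
  qed
qed

text \<open>A triangulation refining \<open>K\<close> restricts to a triangulation of each face. An arc that crosses a chord of the face crosses no
side of it, hence has both ends in the face.\<close>
lemma face_max_noncrossing:
  assumes K: "K \<subseteq> E" and F: "max_noncrossing {..<n} E" and P: "P \<in> faces n K"
  shows "max_noncrossing P (E \<inter> chords P)"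
proof -
  note D = max_noncrossingD[OF F]
  have Pn: "P \<subseteq> {..<n}" and fin: "finite P" using P finite_subset by (auto simp: uncut_def faces_def)
  have K': "K \<subseteq> chords {..<n}" "noncrossing K" using K D(2) noncrossing_subset[OF D(3) K] by auto
  have sE: "sides P \<subseteq> E" using face_sides[OF K' P] K sides_in_max_noncrossing[OF F] by auto
  have key: "p \<in> P" if cr: "crosses (u, w) e" and e: "e \<in> E" "p = fst e \<or> p = snd e" and uw: "(u, w) \<in> chords P" for u w e p
  proof (rule ccontr)
    assume p: "p \<notin> P"
    obtain x y where xy: "e = (x, y)" by (cases e)
    have uw': "u \<in> P" "w \<in> P" "u < w" using uw by (auto simp: chords_def)
    have xy': "x < y" using D(5) e xy by auto
    show False
      using beyond_side[OF fin uw p]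
    proof cases
      case (1 s1 s2)
      have "\<not> crosses (s1, s2) e" using D(6)[of "(s1, s2)" e] sE 1 e by auto
      moreover have "\<not> (s1 < u \<and> u < s2)" "\<not> (s1 < w \<and> w < s2)" using 1 uw' by auto
      ultimately show False using cr 1(2,3) e xy xy' uw' by (auto simp: crosses.simps)
    next
      case (2 s1 s2)
      have "\<not> crosses (s1, s2) e" using D(6)[of "(s1, s2)" e] sE 2 e by auto
      moreover have "s1 \<le> u" "u \<le> s2" "s1 \<le> w" "w \<le> s2" using 2 uw' by auto
      ultimately show False using cr 2(2) e xy xy' uw' by (auto simp: crosses.simps)
    qed
  qed
  have "\<exists>e\<in>E \<inter> chords P. crosses c e" if c: "c \<in> chords P - E \<inter> chords P" for c
  proof -
    have "c \<in> chords {..<n} - E" using c chords_mono[OF Pn] by auto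
    then obtain e where e: "e \<in> E" "crosses c e" using F unfolding max_noncrossing_def by blast
    have "fst e \<in> P" "snd e \<in> P" using key[of "fst c" "snd c" e] e c by auto
    then have "e \<in> chords P" using D(5)[of "fst e" "snd e"] e by (auto simp: chords_def)
    then show ?thesis using e by auto
  qed
  then show ?thesis using fin noncrossing_subset[OF D(3)] unfolding max_noncrossing_def by blast
qed

lemma faceD:
  assumes "P \<in> faces n K"
  shows "P \<subseteq> {..<n}" "finite P" "card P \<ge> 3" "\<And>c d. c \<in> chords P \<Longrightarrow> d \<in> K \<Longrightarrow> \<not> crosses c d"
    "\<And>P'. P' \<in> faces n K \<Longrightarrow> P \<subseteq> P' \<Longrightarrow> P' = P"
  using assms finite_subset[of P "{..<n}"] by (auto simp: faces_def uncut_def)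

text \<open>A vertex of \<open>P'\<close> outside \<open>P\<close> lies beyond a side of \<open>P\<close>; this side is in \<open>K\<close>, so no chord of \<open>P'\<close> crosses it.\<close>
lemma faces_meet_in_side:
  assumes K: "K \<subseteq> chords {..<n}" "noncrossing K" and P: "P \<in> faces n K" and P': "P' \<in> faces n K" "P \<noteq> P'"
  obtains s1 s2 where "(s1, s2) \<in> K" "(s1, s2) \<in> sides P" "P \<inter> P' \<subseteq> {s1, s2}"
proof -
  note D = faceD[OF P] and D' = faceD[OF P'(1)]
  have "\<not> P' \<subseteq> P" using D'(5)[OF P] P'(2) by auto
  then obtain p where p: "p \<in> P'" "p \<notin> P" by auto
  obtain u w where uw: "(u, w) \<in> chords P"
  proof -
    have "card P \<noteq> 1" "card P \<noteq> 0" using D(3) by auto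
    then obtain x where "x \<in> P" using D(2) by fastforce
    have "P \<noteq> {x}" using \<open>card P \<noteq> 1\<close> by auto
    then obtain y where "y \<in> P" "y \<noteq> x" using \<open>x \<in> P\<close> by auto
    then have "(x, y) \<in> chords P \<or> (y, x) \<in> chords P" using \<open>x \<in> P\<close> by (auto simp: chords_def)
    then show ?thesis using that by auto
  qed
  have pn: "p < n" using p D'(1) by auto
  have no2: "\<not> P \<subseteq> {s, s'}" for s s'
  proof
    assume "P \<subseteq> {s, s'}"
    then have "card P \<le> card {s, s'}" by (intro card_mono) auto
    then show False using D(3) by (simp add: card_insert_if split: if_splits)
  qed
  have cr: "P \<inter> P' \<subseteq> {s1, s2}" if s: "(s1, s2) \<in> K" "\<And>v. v \<in> P \<Longrightarrow> v \<noteq> s1 \<Longrightarrow> v \<noteq> s2 \<Longrightarrow> crosses (min v p, max v p) (s1, s2)" for s1 s2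
  proof (rule ccontr)
    assume "\<not> P \<inter> P' \<subseteq> {s1, s2}"
    then obtain v where v: "v \<in> P" "v \<in> P'" "v \<noteq> s1" "v \<noteq> s2" by auto
    have "v \<noteq> p" using v p by auto
    then have "(min v p, max v p) \<in> chords P'" using v p by (auto simp: chords_def min_def max_def)
    then show False using D'(4) s v by blast
  qed
  note FS = face_sides[OF K P]
  show ?thesis
    using beyond_side[OF D(2) uw p(2)]
  proof cases
    case (1 s1 s2)
    have s: "s1 \<in> P" "s2 \<in> P" using 1 by (auto simp: sides_def chords_def)
    have o: "v < s1 \<or> s2 < v" if "v \<in> P" "v \<noteq> s1" "v \<noteq> s2" for v
      using 1(4) that by (auto simp: disjoint_iff)
    have "(s1, s2) \<notin> sides {..<n}"
    proof
      assume a: "(s1, s2) \<in> sides {..<n}"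
      have "{..<n} \<inter> {s1<..<s2} \<noteq> {}" using 1 pn by auto
      then have "{..<n} \<subseteq> {s1..s2}" using a by (auto simp: sides_def)
      then have "P \<subseteq> {s1..s2}" using D(1) by auto
      then have "P \<subseteq> {s1, s2}" using o by fastforce
      then show False using no2 by blast
    qed
    then have k: "(s1, s2) \<in> K" using FS 1 by auto
    have "P \<inter> P' \<subseteq> {s1, s2}"
      by (rule cr[OF k], frule o) (use 1 in \<open>auto simp: crosses.simps min_def max_def\<close>)
    then show ?thesis using that k 1 by auto
  next
    case (2 s1 s2)
    have o: "s1 < v \<and> v < s2" if "v \<in> P" "v \<noteq> s1" "v \<noteq> s2" for v
      using 2(3) that by (metis atLeastAtMost_iff le_neq_implies_less subsetD)
    have "(s1, s2) \<notin> sides {..<n}"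
    proof
      assume a: "(s1, s2) \<in> sides {..<n}"
      have "\<not> {..<n} \<subseteq> {s1..s2}" using 2 pn by auto
      then have "{..<n} \<inter> {s1<..<s2} = {}" using a by (auto simp: sides_def)
      then have "P \<subseteq> {s1, s2}" using o D(1) by fastforce
      then show False using no2 by blast
    qed
    then have k: "(s1, s2) \<in> K" using FS 2 by auto
    have "P \<inter> P' \<subseteq> {s1, s2}"
      by (rule cr[OF k], frule o) (use 2 in \<open>auto simp: crosses.simps min_def max_def\<close>)
    then show ?thesis using that k 2 by auto
  qed
qed

lemma faces_share_triangle:
  assumes K: "K \<subseteq> chords {..<n}" "noncrossing K" and P: "P \<in> faces n K" and P': "P' \<in> faces n K"
    and t: "t \<subseteq> P" "t \<subseteq> P'" "card t = 3"
  shows "P = P'"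
proof (rule ccontr)
  assume "P \<noteq> P'"
  from faces_meet_in_side[OF K P P' this] obtain s1 s2 where "P \<inter> P' \<subseteq> {s1, s2}" by metis
  then have "card t \<le> card {s1, s2}" using t by (intro card_mono) auto
  then show False using t(3) by (simp add: card_insert_if split: if_splits)
qed

text \<open>An arc bounds at most one triangle on each of its two sides; the triangle is on the inner side iff the arc is its long
side.\<close>
lemma arc_triangle_unique:
  assumes n: "noncrossing E" and s: "s \<in> triangles E" "(a, b) \<in> chords s" and t: "t \<in> triangles E" "(a, b) \<in> chords t"
    and e: "(Min s = a \<and> Max s = b) = (Min t = a \<and> Max t = b)"
  shows "s = t"
proof -
  from s(1) obtain x y z where s': "s = {x, y, z}" "x < y" "y < z" "(x, y) \<in> E" "(y, z) \<in> E" "(x, z) \<in> E"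
      "Min s = x" "mid s = y" "Max s = z" "chords s = {(x, y), (y, z), (x, z)}"
      by (rule trianglesE)
  from t(1) obtain x' y' z' where t': "t = {x', y', z'}" "x' < y'" "y' < z'" "(x', y') \<in> E" "(y', z') \<in> E" "(x', z') \<in> E"
      "Min t = x'" "mid t = y'" "Max t = z'" "chords t = {(x', y'), (y', z'), (x', z')}"
      by (rule trianglesE)
  show ?thesis
  proof (cases "Min s = a \<and> Max s = b")
    case True
    then have "x = x'" "z = z'" using e s' t' by auto
    then have "y = y'" using inner_apex_unique[OF n s'(4,5), of y'] t' s' by auto
    then show ?thesis using s' t' \<open>x = x'\<close> \<open>z = z'\<close> by auto
  next
    case False
    have ab: "(a, b) \<in> E" "a < b" using s(2) s' by auto
    have cs: "a = x \<and> b = y \<or> a = y \<and> b = z" using False s(2) s' by auto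
    have ct: "a = x' \<and> b = y' \<or> a = y' \<and> b = z'" using False e t(2) t' by auto
    note U = outer_apex_unique[OF n ab]
    show ?thesis using cs ct
    proof (elim disjE conjE)
      assume "a = x" "b = y" "a = x'" "b = y'"
      then show ?thesis using U(2)[of z z'] s' t' by auto
    next
      assume "a = x" "b = y" "a = y'" "b = z'"
      then show ?thesis using U(3)[of x' z] s' t' by auto
    next
      assume "a = y" "b = z" "a = x'" "b = y'"
      then show ?thesis using U(3)[of x z'] s' t' by auto
    next
      assume "a = y" "b = z" "a = y'" "b = z'"
      then show ?thesis using U(1)[of x x'] s' t' by auto
    qed
  qed
qed

lemma triangle_at_arc:
  assumes F: "max_noncrossing P E" and e: "(a, b) \<in> E"
  shows "card P \<ge> 3 \<Longrightarrow> \<exists>t\<in>triangles E. (a, b) \<in> chords t"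
    and "P \<inter> {a<..<b} \<noteq> {} \<Longrightarrow> \<exists>t\<in>triangles E. (a, b) \<in> chords t \<and> Min t = a \<and> Max t = b"
    and "\<not> P \<subseteq> {a..b} \<Longrightarrow> \<exists>t\<in>triangles E. (a, b) \<in> chords t \<and> \<not> (Min t = a \<and> Max t = b)"
proof -
  note D = max_noncrossingD[OF F]
  have ab: "a < b" "a \<in> P" "b \<in> P" using D(5)[OF e] by auto
  show inn: "\<exists>t\<in>triangles E. (a, b) \<in> chords t \<and> Min t = a \<and> Max t = b" if "P \<inter> {a<..<b} \<noteq> {}"
  proof -
    from inner_apex[OF F e that] obtain c where c: "a < c" "c < b" "(a, c) \<in> E" "(c, b) \<in> E" by metis
    then show ?thesis using triangle_simps[OF c(1,2)] trianglesI[OF c e] by (intro bexI[of _ "{a, c, b}"]) auto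
  qed
  show out: "\<exists>t\<in>triangles E. (a, b) \<in> chords t \<and> \<not> (Min t = a \<and> Max t = b)" if "\<not> P \<subseteq> {a..b}"
    using outer_apex[OF F e that]
  proof cases
    case (1 c)
    then show ?thesis using triangle_simps[OF 1(2) ab(1)] trianglesI[OF 1(2) ab(1) 1(3) e 1(4)] by (intro bexI[of _ "{c, a, b}"]) auto
  next
    case (2 c)
    then show ?thesis using triangle_simps[OF ab(1) 2(2)] trianglesI[OF ab(1) 2(2) e 2(3,4)] ab by (intro bexI[of _ "{a, b, c}"]) auto
  qed
  show "\<exists>t\<in>triangles E. (a, b) \<in> chords t" if c: "card P \<ge> 3"
  proof (cases "P \<subseteq> {a..b}")
    case True
    have "P \<inter> {a<..<b} \<noteq> {}"
    proof
      assume "P \<inter> {a<..<b} = {}"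
      then have "P \<subseteq> {a, b}" using True by fastforce
      then have "card P \<le> card {a, b}" by (intro card_mono) auto
      then show False using c ab by simp
    qed
    then show ?thesis using inn by blast
  qed (use out in blast)
qed

section \<open>Connectedness by flips\<close>

text \<open>The flip that brings a triangulation closer to a missing chord \<open>(p, q)\<close>: let \<open>(p, x)\<close> be the longest arc from \<open>p\<close> that ends
before \<open>q\<close>. The triangle on the outer side of \<open>(p, x)\<close> has a side through \<open>(p, q)\<close>, and flipping this side replaces it by
an arc that starts or ends at \<open>p\<close> and therefore does not cross \<open>(p, q)\<close>.\<close>
lemma reducing_flip:
  assumes F: "max_noncrossing P E" and f: "(p, q) \<in> chords P" "(p, q) \<notin> E"
  obtains e e' where "e \<in> E" "crosses e (p, q)" "e' \<notin> E" "\<not> crosses e' (p, q)"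
    "max_noncrossing P (insert e' (E - {e}))"
proof -
  note D = max_noncrossingD[OF F]
  have pq: "p \<in> P" "q \<in> P" "p < q" using f by (auto simp: chords_def)
  have ne: "P \<inter> {p<..<q} \<noteq> {}"
  proof
    assume "P \<inter> {p<..<q} = {}"
    then have "(p, q) \<in> sides P" using pq by (auto simp: sides_def chords_def)
    then show False using sides_in_max_noncrossing[OF F] f by auto
  qed
  let ?C = "{x. (p, x) \<in> E \<and> x < q}"
  have fin: "finite ?C" by auto
  obtain u where u: "u \<in> P" "p < u" "u < q" using ne by auto
  from side_up_obtain[OF D(1) pq(1) u(1,2)] obtain s where "s \<le> u" "(p, s) \<in> sides P" by metis
  then have "s \<in> ?C" using sides_in_max_noncrossing[OF F] u by auto
  then have "?C \<noteq> {}" by auto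
  define x where "x = Max ?C"
  have "x \<in> ?C" unfolding x_def by (rule Max_in[OF fin \<open>?C \<noteq> {}\<close>])
  then have px: "(p, x) \<in> E" "p < x" "x < q" "x \<in> P" using D(5) by auto
  have xm: "y \<le> x" if "(p, y) \<in> E" "y < q" for y unfolding x_def by (rule Max_ge[OF fin]) (use that in auto)
  have "\<not> P \<subseteq> {p..x}" using pq px by auto
  have nc: "(u, w) \<notin> E" if "(v, y) \<in> E" "u < v \<and> v < w \<and> w < y \<or> v < u \<and> u < y \<and> y < w" for u v w y
    using noncrossingD[OF D(3)] that by blast
  show ?thesis
    using outer_apex[OF F px(1) \<open>\<not> P \<subseteq> {p..x}\<close>]
  proof cases
    case (2 c)
    have c: "q < c" using xm[of c] 2 f by (metis linorder_neqE_nat not_le)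
    then have "P \<inter> {x<..<c} \<noteq> {}" using pq px by auto
    from inner_apex[OF F 2(3) this] obtain z where z: "x < z" "z < c" "(x, z) \<in> E" "(z, c) \<in> E" by metis
    show ?thesis
    proof (rule that[of "(x, c)" "(p, z)"])
      show "max_noncrossing P (insert (p, z) (E - {(x, c)}))"
        by (rule flip_max_noncrossing(2)[of P E p x z c]) (use F px z 2 in auto)
      show "(p, z) \<notin> E" by (rule nc[OF 2(3)]) (use px z in auto)
    qed (use 2 c px z in \<open>auto simp: crosses.simps\<close>)
  next
    case (1 c)
    have "\<not> P \<subseteq> {c..x}" using pq px by auto
    from outer_apex[OF F 1(4) this] show ?thesis
    proof cases
      case z: (1 z)
      show ?thesis
      proof (rule that[of "(c, x)" "(z, p)"])
        show "max_noncrossing P (insert (z, p) (E - {(c, x)}))"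
          by (rule flip_max_noncrossing(2)[of P E z c p x]) (use F px z 1 in auto)
        show "(z, p) \<notin> E" by (rule nc[OF 1(4)]) (use px z 1 in auto)
      qed (use 1 px z in \<open>auto simp: crosses.simps\<close>)
    next
      case z: (2 z)
      show ?thesis
      proof (rule that[of "(c, x)" "(p, z)"])
        show "max_noncrossing P (insert (p, z) (E - {(c, x)}))"
          by (rule flip_max_noncrossing(1)[of P E c p x z]) (use F px z 1 in auto)
        show "(p, z) \<notin> E" by (rule nc[OF 1(4)]) (use px z 1 in auto)
      qed (use 1 px z in \<open>auto simp: crosses.simps\<close>)
    qed
  qed
qed

text \<open>Induction on the number of arcs that cross \<open>f\<close>.\<close>
lemma flips_to_arc:
  assumes F: "max_noncrossing P D" and f: "f \<in> chords P" and K: "K \<subseteq> D" "\<And>e. e \<in> K \<Longrightarrow> \<not> crosses e f" and \<Phi>: "\<Phi> D"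
    and step: "\<And>D e e'. K \<subseteq> D \<Longrightarrow> max_noncrossing P D \<Longrightarrow> \<Phi> D \<Longrightarrow> e \<in> D \<Longrightarrow> e \<notin> K \<Longrightarrow> e' \<notin> D \<Longrightarrow>
        max_noncrossing P (insert e' (D - {e})) \<Longrightarrow> \<Phi> (insert e' (D - {e}))"
  shows "\<exists>D'. max_noncrossing P D' \<and> insert f K \<subseteq> D' \<and> \<Phi> D'"
  using F K(1) \<Phi>
proof (induction "card {e \<in> D. crosses e f}" arbitrary: D rule: less_induct)
  case less
  note DD = max_noncrossingD[OF less.prems(1)]
  show ?case
  proof (cases "f \<in> D")
    case True then show ?thesis using less.prems by blast
  next
    case False
    obtain p q where pq: "f = (p, q)" by (cases f)
    from reducing_flip[OF less.prems(1) f[unfolded pq] False[unfolded pq]] obtain e e' where e: "e \<in> D" "crosses e f" "e' \<notin> D" "\<not> crosses e' f"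
      and F': "max_noncrossing P (insert e' (D - {e}))" unfolding pq by blast
    have eK: "e \<notin> K" using K(2)[of e] e by blast
    show ?thesis
    proof (rule less.hyps[OF _ F'])
      have "{x \<in> insert e' (D - {e}). crosses x f} \<subseteq> {e \<in> D. crosses e f} - {e}" using e by blast
      then have "{x \<in> insert e' (D - {e}). crosses x f} \<subset> {e \<in> D. crosses e f}" using e by blast
      then show "card {x \<in> insert e' (D - {e}). crosses x f} < card {e \<in> D. crosses e f}"
        using DD(4) by (intro psubset_card_mono) simp_all
      show "K \<subseteq> insert e' (D - {e})" using less.prems(2) eK by blast
      show "\<Phi> (insert e' (D - {e}))"
        by (rule step[OF less.prems(2,1,3) e(1) eK e(3) F'])
    qed
  qed
qed

text \<open>Triangulations with a common subset \<open>K\<close> of arcs are connected by flips outside \<open>K\<close>: create the arcs of the target one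
after the other, adding each to the arcs that are kept. The statement is an induction principle, with \<open>\<Phi>\<close> invariant under
flips, because that is the form in which connectedness is used.\<close>
lemma flip_connected:
  assumes F: "max_noncrossing P D1" "max_noncrossing P D2" and K: "K \<subseteq> D1" "K \<subseteq> D2" and \<Phi>: "\<Phi> D1"
    and step: "\<And>D e e'. K \<subseteq> D \<Longrightarrow> max_noncrossing P D \<Longrightarrow> \<Phi> D \<Longrightarrow> e \<in> D \<Longrightarrow> e \<notin> K \<Longrightarrow> e' \<notin> D \<Longrightarrow>
        max_noncrossing P (insert e' (D - {e})) \<Longrightarrow> \<Phi> (insert e' (D - {e}))"
  shows "\<Phi> D2"
  using F(1) K \<Phi> step
proof (induction "card (D2 - K)" arbitrary: D1 K rule: less_induct)
  case less
  note D2 = max_noncrossingD[OF F(2)] and D1 = max_noncrossingD[OF less.prems(1)]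
  show ?case
  proof (cases "D2 \<subseteq> K")
    case True
    then have "D2 \<subseteq> D1" using less.prems by auto
    moreover have "D1 \<subseteq> D2" using D2(7) D1(2,6) \<open>D2 \<subseteq> D1\<close> by blast
    ultimately show ?thesis using less.prems by auto
  next
    case False
    then obtain f where f: "f \<in> D2" "f \<notin> K" by auto
    have "\<exists>D'. max_noncrossing P D' \<and> insert f K \<subseteq> D' \<and> \<Phi> D'"
      by (rule flips_to_arc[OF less.prems(1) _ less.prems(2) _ less.prems(4,5)]) (use f less.prems(3) D2(2,6) in blast)+
    then obtain D' where D': "max_noncrossing P D'" "insert f K \<subseteq> D'" "\<Phi> D'" by auto
    show ?thesis
    proof (rule less.hyps[OF _ D'(1,2) _ D'(3)])
      have "D2 - insert f K \<subset> D2 - K" using f by auto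
      then show "card (D2 - insert f K) < card (D2 - K)" using D2(4) by (intro psubset_card_mono) auto
      show "insert f K \<subseteq> D2" using less.prems f by auto
    qed (use less.prems(5) in blast)
  qed
qed

section \<open>Black polygons and the triangulations of a subdivision\<close>

text \<open>Cutting along a chord that is not crossed leaves a triangulation of the part on its inner side, so that triangles
below an arc can be counted like the triangles of a polygon.\<close>
lemma max_noncrossing_below:
  assumes F: "max_noncrossing P E" and ab: "\<And>e. e \<in> E \<Longrightarrow> \<not> crosses (a, b) e"
  shows "max_noncrossing (P \<inter> {a..b}) (E \<inter> chords (P \<inter> {a..b}))"
  unfolding max_noncrossing_def
proof (intro conjI ballI)
  note D = max_noncrossingD[OF F]
  show "finite (P \<inter> {a..b})" "E \<inter> chords (P \<inter> {a..b}) \<subseteq> chords (P \<inter> {a..b})" using D(1) by auto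
  show "noncrossing (E \<inter> chords (P \<inter> {a..b}))" using noncrossing_subset[OF D(3)] by blast
  fix c assume c: "c \<in> chords (P \<inter> {a..b}) - E \<inter> chords (P \<inter> {a..b})"
  then have "c \<in> chords P - E" using chords_mono[of "P \<inter> {a..b}" P] by auto
  then obtain e where e: "e \<in> E" "crosses c e" using F unfolding max_noncrossing_def by blast
  obtain p q u v where pq: "e = (p, q)" "c = (u, v)" by (cases e, cases c)
  have "p \<in> P" "q \<in> P" "p < q" using e pq D(5) by auto
  moreover have "\<not> crosses (a, b) e" using ab[OF e(1)] .
  moreover have "a \<le> u" "v \<le> b" "u < v" using c pq by (auto simp: chords_def)
  ultimately have "e \<in> chords (P \<inter> {a..b})" using e(2) pq by (auto simp: chords_def crosses.simps)
  then show "\<exists>e\<in>E \<inter> chords (P \<inter> {a..b}). crosses c e" using e by auto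
qed

lemma triangles_mono: "E \<subseteq> E' \<Longrightarrow> triangles E \<subseteq> triangles E'"
  unfolding triangles_def by blast

text \<open>A characterization of sides that does not mention the polygon: an arc is a diagonal iff it lies on two triangles.\<close>
lemma not_side_triangles:
  assumes F: "max_noncrossing P E" and e: "(a, b) \<in> E"
  shows "(a, b) \<notin> sides P \<longleftrightarrow> (\<exists>s\<in>triangles E. \<exists>t\<in>triangles E. (a, b) \<in> chords s \<and> (a, b) \<in> chords t \<and> s \<noteq> t)"
proof -
  note D = max_noncrossingD[OF F]
  have ab: "a \<in> P" "b \<in> P" "a < b" using D(5)[OF e] by auto
  show ?thesis
  proof
    assume "(a, b) \<notin> sides P"
    then have "P \<inter> {a<..<b} \<noteq> {}" "\<not> P \<subseteq> {a..b}" using ab by (auto simp: sides_def chords_def)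
    from triangle_at_arc(2)[OF F e this(1)] triangle_at_arc(3)[OF F e this(2)]
    show "\<exists>s\<in>triangles E. \<exists>t\<in>triangles E. (a, b) \<in> chords s \<and> (a, b) \<in> chords t \<and> s \<noteq> t" by metis
  next
    have *: "P \<inter> {a<..<b} \<noteq> {} \<and> \<not> P \<subseteq> {a..b}"
      if s: "s \<in> triangles E" "(a, b) \<in> chords s" and t: "t \<in> triangles E" "(a, b) \<in> chords t"
      and i: "Min s = a \<and> Max s = b" and o: "\<not> (Min t = a \<and> Max t = b)" for s t
    proof
      from s(1) obtain x y z where s': "s = {x, y, z}" "x < y" "y < z" "Min s = x" "Max s = z" by (rule trianglesE)
      have "s \<subseteq> P" by (rule triangles_subset[OF D(2) s(1)])
      then show "P \<inter> {a<..<b} \<noteq> {}" using s' i by auto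
      from t(1) obtain x y z where t': "t = {x, y, z}" "x < y" "y < z" "Min t = x" "Max t = z" "chords t = {(x, y), (y, z), (x, z)}" by (rule trianglesE)
      have "t \<subseteq> P" by (rule triangles_subset[OF D(2) t(1)])
      moreover have "z > b \<or> x < a" using t' t(2) o by auto
      ultimately show "\<not> P \<subseteq> {a..b}" using t' by fastforce
    qed
    assume "\<exists>s\<in>triangles E. \<exists>t\<in>triangles E. (a, b) \<in> chords s \<and> (a, b) \<in> chords t \<and> s \<noteq> t"
    then obtain s t where st: "s \<in> triangles E" "t \<in> triangles E" "(a, b) \<in> chords s" "(a, b) \<in> chords t" "s \<noteq> t" by auto
    have "(Min s = a \<and> Max s = b) \<noteq> (Min t = a \<and> Max t = b)"
      using arc_triangle_unique[OF D(3) st(1,3,2,4)] st(5) by auto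
    then have "P \<inter> {a<..<b} \<noteq> {} \<and> \<not> P \<subseteq> {a..b}" using *[OF st(1,3,2,4)] *[OF st(2,4,1,3)] by argo
    then show "(a, b) \<notin> sides P" by (auto simp: sides_def)
  qed
qed

lemma at_most_two_triangles:
  assumes n: "noncrossing E" and "r \<in> triangles E" "s \<in> triangles E" "t \<in> triangles E"
    and "e \<in> chords r" "e \<in> chords s" "e \<in> chords t" "r \<noteq> s" "r \<noteq> t"
  shows "s = t"
  using arc_triangle_unique[OF n, of _ "fst e" "snd e"] assms(2-) unfolding prod.collapse by metis

lemma triangle_uncut:
  assumes F: "max_noncrossing {..<n} E" and K: "K \<subseteq> E" and t: "t \<in> triangles E"
  shows "uncut n K t"
proof -
  note D = max_noncrossingD[OF F]
  have "t \<subseteq> {..<n}" by (rule triangles_subset[OF D(2) t])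
  moreover have "chords t \<subseteq> E" "card t = 3" using t by (elim trianglesE; auto)+
  moreover have "\<forall>c\<in>chords t. \<forall>e\<in>K. \<not> crosses c e" using \<open>chords t \<subseteq> E\<close> K D(6) by blast
  ultimately show ?thesis unfolding uncut_def by simp
qed

lemma face_chord_side:
  assumes P: "P \<in> faces n K" and e: "(a, b) \<in> K" "(a, b) \<in> chords P"
  shows "(a, b) \<in> sides P"
proof (rule ccontr)
  assume "(a, b) \<notin> sides P"
  then have "P \<inter> {a<..<b} \<noteq> {}" "\<not> P \<subseteq> {a..b}" using e by (auto simp: sides_def)
  then obtain p where p: "p \<in> P" "a < p" "p < b" by auto
  obtain q where q: "q \<in> P" "q < a \<or> b < q" using \<open>\<not> P \<subseteq> {a..b}\<close> by (meson atLeastAtMost_iff not_le subsetI)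
  have "(min p q, max p q) \<in> chords P" using p q by (auto simp: chords_def min_def max_def)
  moreover have "crosses (min p q, max p q) (a, b)" using p q by (auto simp: crosses.simps min_def max_def)
  ultimately show False using faceD(4)[OF P] e by blast
qed

text \<open>The properties of a bicolored subdivision that are used below: the black polygons are faces of a noncrossing set
of diagonals, they do not share arcs (adjacent black triangles are not separated), and each diagonal borders a black polygon.\<close>
locale dissection =
  fixes n :: nat and K :: "arc set" and B :: "nat set set"
  assumes K_diag: "K \<subseteq> chords {..<n} - sides {..<n}" and K_nc: "noncrossing K" and B_faces: "B \<subseteq> faces n K"
    and B_disj: "P \<in> B \<Longrightarrow> P' \<in> B \<Longrightarrow> e \<in> chords P \<Longrightarrow> e \<in> chords P' \<Longrightarrow> P = P'"
    and K_B: "d \<in> K \<Longrightarrow> \<exists>P\<in>B. d \<in> chords P"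
begin

definition black_of :: "arc set \<Rightarrow> nat set set" where
  "black_of E = {t \<in> triangles E. \<exists>P\<in>B. t \<subseteq> P}"

lemma K_chords: "K \<subseteq> chords {..<n}" using K_diag by auto

lemma finite_B: "finite B"
  by (rule finite_subset[of _ "Pow {..<n}"]) (use B_faces in \<open>auto simp: faces_def uncut_def\<close>)

lemma black_polygonD:
  assumes "P \<in> B" shows "P \<subseteq> {..<n}" "finite P" "card P \<ge> 3" "P \<in> faces n K"
  using assms B_faces faceD[of P n K] by auto

context
  fixes E assumes KE: "K \<subseteq> E" and F: "max_noncrossing {..<n} E"
begin

lemma poly: "P \<in> B \<Longrightarrow> max_noncrossing P (E \<inter> chords P)"
  using face_max_noncrossing[OF KE F] black_polygonD(4) by auto

lemma poly_sides: assumes "P \<in> B" shows "sides P \<subseteq> E" "sides P \<subseteq> K \<union> sides {..<n}"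
  using face_sides[OF K_chords K_nc black_polygonD(4)[OF assms]] KE sides_in_max_noncrossing[OF F] by auto

lemma black_of_Union: "black_of E = (\<Union>P\<in>B. triangles (E \<inter> chords P))"
  unfolding black_of_def triangles_restrict by auto

lemma black_unique: "P \<in> B \<Longrightarrow> P' \<in> B \<Longrightarrow> t \<in> triangles E \<Longrightarrow> t \<subseteq> P \<Longrightarrow> t \<subseteq> P' \<Longrightarrow> P = P'"
  using faces_share_triangle[OF K_chords K_nc black_polygonD(4) black_polygonD(4), of P P' t] by (auto elim: trianglesE)

lemma finite_black_of: "finite (black_of E)"
  by (rule finite_subset[OF _ finite_triangles[OF finite_lessThan max_noncrossingD(2)[OF F]]]) (auto simp: black_of_def)

text \<open>The count on the right does not depend on the triangulation. This is why \<open>area\<close> is well defined.\<close>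
lemma card_black_below:
  assumes ab: "\<And>e. e \<in> E \<Longrightarrow> \<not> crosses (a, b) e"
  shows "card {t \<in> black_of E. t \<subseteq> {a..b}} = (\<Sum>P\<in>B. card (P \<inter> {a..b}) - 2)"
proof -
  have "{t \<in> black_of E. t \<subseteq> {a..b}} = (\<Union>P\<in>B. triangles (E \<inter> chords P \<inter> chords (P \<inter> {a..b})))"
    unfolding black_of_def triangles_restrict by blast
  also have "card \<dots> = (\<Sum>P\<in>B. card (triangles (E \<inter> chords P \<inter> chords (P \<inter> {a..b}))))"
  proof (rule card_UN_disjoint[OF finite_B])
    show "\<forall>i\<in>B. finite (triangles (E \<inter> chords i \<inter> chords (i \<inter> {a..b})))"
    proof
      fix P assume "P \<in> B"
      show "finite (triangles (E \<inter> chords P \<inter> chords (P \<inter> {a..b})))"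
        by (rule finite_triangles[OF black_polygonD(2)[OF \<open>P \<in> B\<close>]]) auto
    qed
    show "\<forall>i\<in>B. \<forall>j\<in>B. i \<noteq> j \<longrightarrow> triangles (E \<inter> chords i \<inter> chords (i \<inter> {a..b})) \<inter> triangles (E \<inter> chords j \<inter> chords (j \<inter> {a..b})) = {}"
    proof (intro ballI impI equals0I)
      fix P P' t assume P: "P \<in> B" "P' \<in> B" "P \<noteq> P'"
        and "t \<in> triangles (E \<inter> chords P \<inter> chords (P \<inter> {a..b})) \<inter> triangles (E \<inter> chords P' \<inter> chords (P' \<inter> {a..b}))"
      then have "t \<in> triangles E" "t \<subseteq> P" "t \<subseteq> P'" by (simp_all add: triangles_restrict)
      then show False using black_unique P by blast
    qed
  qed
  also have "\<dots> = (\<Sum>P\<in>B. card (P \<inter> {a..b}) - 2)"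
  proof (rule sum.cong[OF HOL.refl])
    fix P assume "P \<in> B"
    show "card (triangles (E \<inter> chords P \<inter> chords (P \<inter> {a..b}))) = card (P \<inter> {a..b}) - 2"
      by (rule card_triangles[OF max_noncrossing_below[OF poly[OF \<open>P \<in> B\<close>]]]) (use ab in blast)
  qed
  finally show ?thesis .
qed

lemma card_black_of: "card (black_of E) = (\<Sum>P\<in>B. card P - 2)"
proof -
  have "black_of E = {t \<in> black_of E. t \<subseteq> {0..n}}"
    using triangles_subset[OF max_noncrossingD(2)[OF F]] by (fastforce simp: black_of_def)
  moreover have "card {t \<in> black_of E. t \<subseteq> {0..n}} = (\<Sum>P\<in>B. card (P \<inter> {0..n}) - 2)"
    by (rule card_black_below) (use max_noncrossingD(5)[OF F] in \<open>fastforce simp: crosses.simps\<close>)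
  moreover have "P \<inter> {0..n} = P" if "P \<in> B" for P using black_polygonD(1)[OF that] by auto
  ultimately show ?thesis by simp
qed

lemma black_arcs_of: "(\<Union>t\<in>black_of E. chords t) = (\<Union>P\<in>B. E \<inter> chords P)"
proof (intro equalityI subsetI)
  fix e assume "e \<in> (\<Union>t\<in>black_of E. chords t)"
  then obtain t P where t: "t \<in> triangles E" "t \<subseteq> P" "P \<in> B" "e \<in> chords t" by (auto simp: black_of_def)
  then have "e \<in> E" by (auto elim: trianglesE)
  then show "e \<in> (\<Union>P\<in>B. E \<inter> chords P)" using t chords_mono by blast
next
  fix e assume "e \<in> (\<Union>P\<in>B. E \<inter> chords P)"
  then obtain P where P: "P \<in> B" "e \<in> E \<inter> chords P" by auto
  from triangle_at_arc(1)[OF poly[OF P(1)] _ black_polygonD(3)[OF P(1)], of "fst e" "snd e"] P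
  obtain t where "t \<in> triangles (E \<inter> chords P)" "e \<in> chords t" by auto
  then show "e \<in> (\<Union>t\<in>black_of E. chords t)" using P by (auto simp: black_of_Union)
qed

lemma card_black_arcs_of: "card (\<Union>P\<in>B. E \<inter> chords P) = (\<Sum>P\<in>B. 2 * card P - 3)"
proof -
  have "card (\<Union>P\<in>B. E \<inter> chords P) = (\<Sum>P\<in>B. card (E \<inter> chords P))"
  proof (rule card_UN_disjoint[OF finite_B])
    show "\<forall>P\<in>B. finite (E \<inter> chords P)" using black_polygonD(2) finite_chords by blast
    show "\<forall>P\<in>B. \<forall>j\<in>B. P \<noteq> j \<longrightarrow> E \<inter> chords P \<inter> (E \<inter> chords j) = {}" using B_disj by blast
  qed
  also have "\<dots> = (\<Sum>P\<in>B. 2 * card P - 3)"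
    by (rule sum.cong[OF HOL.refl]) (use card_max_noncrossing[OF poly] black_polygonD(3) in force)
  finally show ?thesis .
qed

text \<open>A diagonal of a black polygon has its two triangles inside that polygon.\<close>
lemma triangle_at_inner_arc:
  assumes P: "P \<in> B" and e: "(a, b) \<in> E" "(a, b) \<in> chords P" and t: "t \<in> triangles E" "(a, b) \<in> chords t"
    and s: "(a, b) \<notin> sides P"
  shows "t \<subseteq> P"
proof -
  have eP: "(a, b) \<in> E \<inter> chords P" using e by auto
  from not_side_triangles[OF poly[OF P] eP] s obtain r r' where r: "r \<in> triangles (E \<inter> chords P)" "r' \<in> triangles (E \<inter> chords P)"
    "(a, b) \<in> chords r" "(a, b) \<in> chords r'" "r \<noteq> r'" by auto
  then have r': "r \<in> triangles E" "r' \<in> triangles E" "r \<subseteq> P" "r' \<subseteq> P" by (auto simp: triangles_restrict)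
  have "t = r \<or> t = r'" using at_most_two_triangles[OF max_noncrossingD(3)[OF F] r'(1,2) t(1) r(3,4) t(2)] r(5) by auto
  then show ?thesis using r' by auto
qed

end

end

lemma arcs_triangulation:
  assumes "bicolored_triangulation k n T"
  shows "max_noncrossing {..<n} (arcs_of n T)" "faces n (diagonals T) = triangles (arcs_of n T)"
    "black T \<subseteq> triangles (arcs_of n T)" "card (black T) = k" "diagonals T \<subseteq> chords {..<n} - sides {..<n}" "noncrossing (diagonals T)"
proof -
  have t: "triangulation n (diagonals T)" "black T \<subseteq> faces n (diagonals T)" "card (black T) = k"
    using assms by (auto simp: bicolored_triangulation_def)
  show "max_noncrossing {..<n} (arcs_of n T)" by (rule triangulation_max_noncrossing[OF t(1)])
  from faces_max_noncrossing[OF this] show f: "faces n (diagonals T) = triangles (arcs_of n T)" .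
  show "black T \<subseteq> triangles (arcs_of n T)" "card (black T) = k" using t f by auto
  show "diagonals T \<subseteq> chords {..<n} - sides {..<n}" "noncrossing (diagonals T)"
    using t(1) by (auto simp: triangulation_def noncrossing_def)
qed

text \<open>Neighbouring triangles within a face have the same color, as their common arc would otherwise have been kept. The color
then spreads over the face from the triangle at its extreme vertices.\<close>
lemma polygon_monochromatic:
  assumes T: "bicolored_triangulation k n T" and P: "P \<in> faces n (kept_diagonals n T)"
    and st: "s \<in> triangles (arcs_of n T \<inter> chords P)" "t \<in> triangles (arcs_of n T \<inter> chords P)"
  shows "s \<in> black T \<longleftrightarrow> t \<in> black T"
proof -
  let ?E = "arcs_of n T" and ?K = "kept_diagonals n T"
  note A = arcs_triangulation[OF T]
  have KE: "?K \<subseteq> ?E" by (auto simp: kept_diagonals_def)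
  have F: "max_noncrossing P (?E \<inter> chords P)" by (rule face_max_noncrossing[OF KE A(1) P])
  note D = max_noncrossingD[OF F] and PD = faceD[OF P]
  let ?EP = "?E \<inter> chords P"
  have col: "u \<in> black T \<longleftrightarrow> v \<in> black T"
    if u: "u \<in> triangles ?EP" "(x, y) \<in> chords u" and v: "v \<in> triangles ?EP" "(x, y) \<in> chords v" and ne: "u \<noteq> v" for u v x y
  proof -
    have e: "(x, y) \<in> ?EP" using u by (auto elim!: trianglesE)
    then have "(x, y) \<notin> sides P" using not_side_triangles[OF F e] u v ne by blast
    then have "(x, y) \<notin> ?K" using face_chord_side[OF P] e by blast
    have uE: "u \<in> triangles ?E" "v \<in> triangles ?E" using u v triangles_mono[of ?EP ?E] by auto
    then have "(x, y) \<notin> sides {..<n}" using not_side_triangles[OF A(1), of x y] e u v ne by blast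
    then have "(x, y) \<in> diagonals T" using e by auto
    then show ?thesis using \<open>(x, y) \<notin> ?K\<close> u v uE A(2) unfolding kept_diagonals_def by blast
  qed
  from st(1) obtain x0 y0 z0 where "(x0, y0) \<in> ?EP" by (rule trianglesE)
  then have ch: "(x0, y0) \<in> chords P" by auto
  note M = Min_Max_arc[OF F ch]
  have nt: "P \<inter> {Min P<..<Max P} \<noteq> {}"
  proof
    assume "P \<inter> {Min P<..<Max P} = {}"
    then have "P \<subseteq> {Min P, Max P}" using M(7) by fastforce
    then have "card P \<le> card {Min P, Max P}" by (intro card_mono) auto
    then show False using PD(3) M(6) by simp
  qed
  from triangle_at_arc(2)[OF F M(1) nt] obtain s0 where s0: "s0 \<in> triangles ?EP" "(Min P, Max P) \<in> chords s0" "Min s0 = Min P" "Max s0 = Max P" by blast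
  define Q where "Q x y \<longleftrightarrow> (\<forall>t\<in>triangles ?EP. Min t = x \<and> Max t = y \<longrightarrow> (t \<in> black T \<longleftrightarrow> s0 \<in> black T))" for x y
  have mm: "(Min t, Max t) \<in> chords t" "(Min t, Max t) \<in> ?EP" if "t \<in> triangles ?EP" for t
    using that by (auto elim!: trianglesE)
  have Q: "Q x y" if "(x, y) \<in> ?EP" for x y
  proof (rule arc_induct_from_top[OF F that])
    show "Q (Min P) (Max P)"
      unfolding Q_def using arc_triangle_unique[OF D(3) _ _ s0(1,2)] mm s0 by metis
    fix x y z assume xyz: "x < y" "y < z" "(x, y) \<in> ?EP" "(y, z) \<in> ?EP" "(x, z) \<in> ?EP" and q: "Q x z"
    let ?u = "{x, y, z}"
    note ts = triangle_simps[OF xyz(1,2)]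
    have u: "?u \<in> triangles ?EP" by (rule trianglesI[OF xyz])
    have uc: "?u \<in> black T \<longleftrightarrow> s0 \<in> black T" using q u ts unfolding Q_def by blast
    have *: "t \<in> black T \<longleftrightarrow> s0 \<in> black T" if t: "t \<in> triangles ?EP" "(Min t, Max t) \<in> chords ?u" "(Min t, Max t) \<noteq> (x, z)" for t
    proof -
      have "t \<noteq> ?u" using t ts by auto
      then show ?thesis using col[OF t(1) mm(1)[OF t(1)] u t(2)] uc by simp
    qed
    show "Q x y \<and> Q y z" unfolding Q_def
      by (intro conjI ballI impI; rule *) (use xyz in \<open>auto simp: ts(5)\<close>)
  qed
  show ?thesis using Q[OF mm(2)[OF st(1)]] Q[OF mm(2)[OF st(2)]] st unfolding Q_def by blast
qed

text \<open>If two black polygons had a common chord, then by \<open>faces_meet_in_side\<close> it would be a kept diagonal. It lies on one triangle of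
each polygon, both black, and on a white one; but an arc lies on at most two triangles.\<close>
lemma erase_dissection:
  assumes T: "bicolored_triangulation k n T"
  shows "dissection n (kept_diagonals n T) (black (erase_diagonals n T))" (is "dissection n ?K ?B")
    and "black T = dissection.black_of (black (erase_diagonals n T)) (arcs_of n T)"
proof -
  let ?E = "arcs_of n T"
  note A = arcs_triangulation[OF T]
  note DD = max_noncrossingD[OF A(1)]
  have KD: "?K \<subseteq> diagonals T" by (auto simp: kept_diagonals_def)
  then have K: "?K \<subseteq> chords {..<n} - sides {..<n}" "noncrossing ?K" "?K \<subseteq> ?E" "?K \<subseteq> chords {..<n}"
    using A(5) noncrossing_subset[OF A(6)] by auto
  have B: "?B = {P \<in> faces n ?K. \<exists>t\<in>black T. t \<subseteq> P}" by (simp add: erase_diagonals_def)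
  have poly: "max_noncrossing P (?E \<inter> chords P)" if "P \<in> faces n ?K" for P by (rule face_max_noncrossing[OF K(3) A(1) that])
  have blk: "t \<in> black T" if P: "P \<in> ?B" and t: "t \<in> triangles ?E" "t \<subseteq> P" for P t
  proof -
    obtain t0 where "t0 \<in> black T" "t0 \<subseteq> P" "P \<in> faces n ?K" using P B by auto
    then have "P \<in> faces n ?K" "t0 \<in> triangles (?E \<inter> chords P)" "t \<in> triangles (?E \<inter> chords P)"
      using t subsetD[OF A(3)] unfolding triangles_restrict by simp_all
    from polygon_monochromatic[OF T this] show ?thesis using \<open>t0 \<in> black T\<close> by simp
  qed
  have in_face: "\<exists>P\<in>?B. t \<subseteq> P" if t: "t \<in> black T" for t
  proof -
    have "uncut n ?K t" using triangle_uncut[OF A(1) K(3)] t A(3) by blast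
    then obtain Q where "Q \<in> faces n ?K" "t \<subseteq> Q" using uncut_in_face by blast
    then show ?thesis using t B by blast
  qed
  show "dissection n ?K ?B"
  proof
    show "?K \<subseteq> chords {..<n} - sides {..<n}" "noncrossing ?K" "?B \<subseteq> faces n ?K" using K B by auto
    show "\<exists>P\<in>?B. d \<in> chords P" if dk: "d \<in> ?K" for d
    proof -
      obtain s where s: "s \<in> black T" "d \<in> chords s" using dk unfolding kept_diagonals_def by blast
      obtain P where "P \<in> ?B" "s \<subseteq> P" using in_face[OF s(1)] by blast
      then show ?thesis using s(2) chords_mono[of s P] by blast
    qed
    fix P P' e assume P: "P \<in> ?B" "P' \<in> ?B" "e \<in> chords P" "e \<in> chords P'"
    show "P = P'"
    proof (rule ccontr)
      assume ne: "P \<noteq> P'"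
      have Pf: "P \<in> faces n ?K" "P' \<in> faces n ?K" using P B by auto
      from faces_meet_in_side[OF K(4,2) Pf ne] obtain s1 s2 where s: "(s1, s2) \<in> ?K" "P \<inter> P' \<subseteq> {s1, s2}" by metis
      have "s1 < s2" using DD(5)[of s1 s2] K(3) s(1) by blast
      moreover have "{fst e, snd e} \<subseteq> {s1, s2}" "fst e < snd e" using P(3,4) s(2) by (auto simp: chords_def)
      ultimately have "e = (s1, s2)" by (cases e) auto
      then have ek: "e \<in> ?K" using s by simp
      then have "\<exists>t\<in>faces n (diagonals T) - black T. e \<in> chords t"
        unfolding kept_diagonals_def by (elim CollectE conjE bexE) (rule bexI)
      then obtain t where t: "t \<in> triangles ?E" "t \<notin> black T" "e \<in> chords t"
        unfolding A(2) by (elim bexE DiffE)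
      have ex: "\<exists>r. r \<in> triangles ?E \<and> e \<in> chords r \<and> r \<subseteq> Q \<and> r \<in> black T" if Q: "Q \<in> ?B" "e \<in> chords Q" for Q
      proof -
        have "e \<in> ?E \<inter> chords Q" using Q ek K by auto
        then obtain r where "r \<in> triangles (?E \<inter> chords Q)" "e \<in> chords r"
          using triangle_at_arc(1)[OF poly, of Q "fst e" "snd e"] Q B faceD(3)[of Q n ?K] by auto
        then have "r \<in> triangles ?E" "r \<subseteq> Q" "e \<in> chords r" unfolding triangles_restrict by blast+
        then show ?thesis using blk[OF Q(1)] by blast
      qed
      obtain r where r: "r \<in> triangles ?E" "e \<in> chords r" "r \<subseteq> P" "r \<in> black T" using ex[OF P(1,3)] by blast
      obtain r' where r': "r' \<in> triangles ?E" "e \<in> chords r'" "r' \<subseteq> P'" "r' \<in> black T" using ex[OF P(2,4)] by blast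
      have "t \<noteq> r" "t \<noteq> r'" using t(2) r(4) r'(4) by auto
      then have "r = r'" by (rule at_most_two_triangles[OF DD(3) t(1) r(1) r'(1) t(3) r(2) r'(2)])
      moreover have "card r = 3" using r(1) by (rule trianglesE)
      ultimately show False using faces_share_triangle[OF K(4,2) Pf r(3)] r' ne by auto
    qed
  qed
  then interpret dissection n ?K ?B .
  show "black T = black_of ?E"
  proof (intro equalityI subsetI)
    fix t assume t: "t \<in> black T"
    obtain P where "P \<in> ?B" "t \<subseteq> P" using in_face[OF t] by (elim bexE)
    then show "t \<in> black_of ?E" using t A(3) unfolding black_of_def by (simp add: subset_iff) blast
  next
    fix t assume "t \<in> black_of ?E"
    then obtain P where "P \<in> ?B" "t \<in> triangles ?E" "t \<subseteq> P" unfolding black_of_def by (elim CollectE conjE bexE)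
    then show "t \<in> black T" by (rule blk)
  qed
qed

locale subdivision =
  dissection n "diagonals S" "black S" for k n :: nat and S :: bicolored +
  assumes k_sum: "k = (\<Sum>P\<in>black S. card P - 2)"

lemma subdivisionI:
  assumes "bicolored_subdivision k n S" shows "subdivision k n S"
proof -
  obtain T where T: "bicolored_triangulation k n T" "S = erase_diagonals n T"
    using assms by (auto simp: bicolored_subdivision_def)
  note E = erase_dissection[OF T(1)] and A = arcs_triangulation[OF T(1)]
  have S: "diagonals S = kept_diagonals n T" by (simp add: T(2) erase_diagonals_def)
  interpret dissection n "diagonals S" "black S" using E(1) by (simp add: S T(2)[symmetric])
  have "diagonals S \<subseteq> arcs_of n T" unfolding S kept_diagonals_def by auto
  from card_black_of[OF this A(1)] have "k = (\<Sum>P\<in>black S. card P - 2)"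
    using A(4) E(2) by (simp add: T(2)[symmetric])
  then show ?thesis by unfold_locales
qed

context subdivision
begin

text \<open>The triangulations represented by a subdivision are its refinements, with colors determined by the black polygons. The point
is that erasing the diagonals between equally colored triangles gives back the subdivision: a diagonal of \<open>S\<close> separates a
black triangle from a white one because black polygons do not share arcs.\<close>
lemma represented_iff:
  "T \<in> represented_by k n S \<longleftrightarrow>
     triangulation n (diagonals T) \<and> diagonals S \<subseteq> diagonals T \<and> black T = black_of (arcs_of n T)"
proof
  assume "T \<in> represented_by k n S"
  then have T: "bicolored_triangulation k n T" "erase_diagonals n T = S" by (auto simp: represented_by_def)
  have S: "diagonals S = kept_diagonals n T" by (simp add: T(2)[symmetric] erase_diagonals_def)
  show "triangulation n (diagonals T) \<and> diagonals S \<subseteq> diagonals T \<and> black T = black_of (arcs_of n T)"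
    using T(1) erase_dissection(2)[OF T(1)] unfolding T(2) S by (auto simp: bicolored_triangulation_def kept_diagonals_def)
next
  let ?E = "arcs_of n T" and ?K = "diagonals S"
  assume a: "triangulation n (diagonals T) \<and> ?K \<subseteq> diagonals T \<and> black T = black_of ?E"
  then have KD: "?K \<subseteq> diagonals T" and bl: "black T = black_of ?E" by auto
  have KE: "?K \<subseteq> ?E" using KD by auto
  have F: "max_noncrossing {..<n} ?E" using triangulation_max_noncrossing a by auto
  note DD = max_noncrossingD[OF F]
  have fc: "faces n (diagonals T) = triangles ?E" by (rule faces_max_noncrossing[OF F])
  have bt: "black T \<subseteq> triangles ?E" unfolding bl black_of_def by auto
  have bic: "bicolored_triangulation k n T"
    unfolding bicolored_triangulation_def using a bt fc card_black_of[OF KE F] k_sum by simp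
  have nsd: "e \<notin> sides {..<n}" if "e \<in> diagonals T" for e using arcs_triangulation(5)[OF bic] that by auto
  have kept: "kept_diagonals n T = ?K"
  proof (intro equalityI subsetI)
    fix d assume "d \<in> kept_diagonals n T"
    then obtain s t where d: "d \<in> diagonals T" and s: "s \<in> black T" "d \<in> chords s" and t: "t \<in> triangles ?E" "t \<notin> black T" "d \<in> chords t"
      unfolding kept_diagonals_def fc by blast
    obtain P where P: "P \<in> black S" "s \<subseteq> P" using s bl by (auto simp: black_of_def)
    obtain a b where ab: "d = (a, b)" by (cases d)
    have dP: "(a, b) \<in> chords P" using s P chords_mono ab by blast
    show "d \<in> ?K"
    proof (cases "(a, b) \<in> sides P")
      case True then show ?thesis using poly_sides(2)[OF KE F P(1)] nsd[OF d] ab by auto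
    next
      case False
      have "t \<subseteq> P" by (rule triangle_at_inner_arc[OF KE F P(1) _ dP t(1) _ False]) (use d t ab in auto)
      then show ?thesis using t P bl unfolding black_of_def by blast
    qed
  next
    fix d assume d: "d \<in> ?K"
    obtain a b where ab: "d = (a, b)" by (cases d)
    obtain P where P: "P \<in> black S" "d \<in> chords P" using K_B[OF d] by auto
    have dE: "(a, b) \<in> ?E" "(a, b) \<notin> sides {..<n}" using d KD nsd ab by auto
    have dP: "(a, b) \<in> ?E \<inter> chords P" using P d KE ab by auto
    from triangle_at_arc(1)[OF poly[OF KE F P(1)] dP black_polygonD(3)[OF P(1)]] obtain s
      where s: "s \<in> triangles ?E" "s \<subseteq> P" "(a, b) \<in> chords s" by (auto simp: triangles_restrict)
    from not_side_triangles[OF F dE(1)] dE(2) obtain r r' where "r \<in> triangles ?E" "r' \<in> triangles ?E" "(a, b) \<in> chords r" "(a, b) \<in> chords r'" "r \<noteq> r'"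
      by auto
    then obtain t where t: "t \<in> triangles ?E" "(a, b) \<in> chords t" "t \<noteq> s" by metis
    have "(a, b) \<in> sides P" by (rule face_chord_side[OF black_polygonD(4)[OF P(1)]]) (use d P ab in auto)
    then have nt: "\<not> t \<subseteq> P" using not_side_triangles[OF poly[OF KE F P(1)] dP] s t unfolding triangles_restrict by blast
    have "t \<notin> black T"
    proof
      assume "t \<in> black T"
      then obtain P' where P': "P' \<in> black S" "t \<subseteq> P'" using bl by (auto simp: black_of_def)
      have "P' = P" by (rule B_disj[OF P'(1) P(1), of d]) (use P P' t ab chords_mono in blast)+
      then show False using nt P' by simp
    qed
    moreover have "s \<in> black T" using s P unfolding bl black_of_def by blast
    ultimately show "d \<in> kept_diagonals n T" using d KD s t ab unfolding kept_diagonals_def fc by blast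
  qed
  have "{P \<in> faces n ?K. \<exists>t\<in>black T. t \<subseteq> P} = black S"
  proof (intro equalityI subsetI)
    fix P assume "P \<in> {P \<in> faces n ?K. \<exists>t\<in>black T. t \<subseteq> P}"
    then obtain t P' where P: "P \<in> faces n ?K" "t \<in> triangles ?E" "t \<subseteq> P" "P' \<in> black S" "t \<subseteq> P'"
      unfolding bl black_of_def by auto
    have "card t = 3" using P(2) by (rule trianglesE)
    then have "P = P'" using faces_share_triangle[OF K_chords K_nc P(1) black_polygonD(4)[OF P(4)] P(3,5)] by simp
    then show "P \<in> black S" using P by simp
  next
    fix P assume P: "P \<in> black S"
    have "card (triangles (?E \<inter> chords P)) \<noteq> 0" using card_triangles[OF poly[OF KE F P]] black_polygonD(3)[OF P] by simp
    then have "triangles (?E \<inter> chords P) \<noteq> {}" by auto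
    then obtain t where "t \<in> triangles ?E" "t \<subseteq> P" unfolding triangles_restrict by blast
    then show "P \<in> {P \<in> faces n ?K. \<exists>t\<in>black T. t \<subseteq> P}" using P black_polygonD(4)[OF P] unfolding bl black_of_def by blast
  qed
  then have "erase_diagonals n T = S" unfolding erase_diagonals_def kept by simp
  then show "T \<in> represented_by k n S" using bic by (simp add: represented_by_def)
qed

lemma representedD:
  assumes "T \<in> represented_by k n S"
  shows "max_noncrossing {..<n} (arcs_of n T)" "diagonals S \<subseteq> arcs_of n T" "black T = black_of (arcs_of n T)"
    "bicolored_triangulation k n T" "black T \<subseteq> triangles (arcs_of n T)" "card (black T) = k" "finite (black T)"
    "diagonals T \<inter> sides {..<n} = {}" "noncrossing (arcs_of n T)"
proof -
  show b: "bicolored_triangulation k n T" using assms by (simp add: represented_by_def)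
  show F: "max_noncrossing {..<n} (arcs_of n T)" using arcs_triangulation[OF b] by simp
  show K: "diagonals S \<subseteq> arcs_of n T" "black T = black_of (arcs_of n T)" using assms represented_iff by auto
  show "black T \<subseteq> triangles (arcs_of n T)" "card (black T) = k" using arcs_triangulation[OF b] by auto
  show "finite (black T)" using finite_black_of[OF K(1) F] K(2) by simp
  show "diagonals T \<inter> sides {..<n} = {}" using arcs_triangulation(5)[OF b] by auto
  show "noncrossing (arcs_of n T)" by (rule max_noncrossingD(3)[OF F])
qed

definition coloring :: "arc set \<Rightarrow> bicolored" where
  "coloring E = \<lparr>diagonals = E - sides {..<n}, black = black_of E\<rparr>"

lemma coloring_represented:
  assumes F: "max_noncrossing {..<n} E" and K: "diagonals S \<subseteq> E"
  shows "coloring E \<in> represented_by k n S" "arcs_of n (coloring E) = E" "black (coloring E) = black_of E"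
    "diagonals (coloring E) = E - sides {..<n}"
  using max_noncrossing_triangulation[OF F] K K_diag unfolding represented_iff coloring_def by auto

lemma represented_eq_coloring: "T \<in> represented_by k n S \<Longrightarrow> T = coloring (arcs_of n T)"
  using representedD(3,8)[of T] unfolding coloring_def by (cases T) auto

lemma chord_in_represented:
  assumes P: "P \<in> black S" and e: "e \<in> chords P"
  obtains T where "T \<in> represented_by k n S" "e \<in> arcs_of n T"
proof -
  have nc: "\<not> crosses e d" if "d \<in> diagonals S" for d using faceD(4)[OF black_polygonD(4)[OF P] e that] .
  have "\<not> crosses e e" by (cases e) (simp add: crosses.simps)
  then have "noncrossing (insert e (diagonals S))" using nc K_nc unfolding noncrossing_def by (auto simp: crosses_sym)
  moreover have "insert e (diagonals S) \<subseteq> chords {..<n}" using K_chords e chords_mono[OF black_polygonD(1)[OF P]] by auto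
  ultimately obtain E where "insert e (diagonals S) \<subseteq> E" "max_noncrossing {..<n} E"
    using max_noncrossing_extend[OF finite_lessThan] by metis
  then show ?thesis using that[of "coloring E"] coloring_represented[of E] by auto
qed

lemma area_eq:
  assumes T: "T \<in> represented_by k n S" and e: "e \<in> arcs_of n T"
  shows "area k n S e = area_in T e"
proof -
  have *: "area_in T' e = (\<Sum>P\<in>black S. card (P \<inter> {fst e..snd e}) - 2)" if T': "T' \<in> represented_by k n S" "e \<in> arcs_of n T'" for T'
    unfolding area_in_def representedD(3)[OF T'(1)]
  proof (rule card_black_below[OF representedD(2,1)[OF T'(1)]])
    show "\<not> crosses (fst e, snd e) d" if "d \<in> arcs_of n T'" for d
      using max_noncrossingD(6)[OF representedD(1)[OF T'(1)] T'(2) that] by simp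
  qed
  show ?thesis unfolding area_def
    by (rule the_equality) (use * T e in \<open>blast, force\<close>)
qed

end

section \<open>Flips inside the black polygons\<close>

text \<open>A diagonal lies on two triangles, which together form a quadrilateral.\<close>
lemma quad_at_arc:
  assumes F: "max_noncrossing P E" and e: "e \<in> E" "e \<notin> sides P"
  obtains a b c d where "a < b" "b < c" "c < d" "(a, b) \<in> E" "(b, c) \<in> E" "(c, d) \<in> E" "(a, d) \<in> E"
    "e = (a, c) \<or> e = (b, d)"
proof -
  obtain x y where xy: "e = (x, y)" by (cases e)
  have E: "(x, y) \<in> E" "x \<in> P" "y \<in> P" "x < y" using e xy max_noncrossingD(5)[OF F] by auto
  then have "P \<inter> {x<..<y} \<noteq> {}" and o: "\<not> P \<subseteq> {x..y}" using e xy by (auto simp: sides_def chords_def)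
  from inner_apex[OF F E(1) this(1)] obtain i where i: "x < i" "i < y" "(x, i) \<in> E" "(i, y) \<in> E" by metis
  from outer_apex[OF F E(1) o] show ?thesis
  proof cases
    case (1 z) then show ?thesis using that[of z x i y] i xy by simp
  next
    case (2 z) then show ?thesis using that[of x i y z] i xy by simp
  qed
qed

text \<open>The quadrilateral provides two triangles at the diagonal, before and after the flip, and an arc lies on at most two. All other
triangles avoid both diagonals.\<close>
lemma triangles_flip:
  assumes F: "max_noncrossing P E" and o: "a < b" "b < c" "c < d"
    and s: "(a, b) \<in> E" "(b, c) \<in> E" "(c, d) \<in> E" "(a, d) \<in> E"
    and e: "e = (a, c) \<and> e' = (b, d) \<and> N = {{a, b, c}, {a, c, d}} \<and> N' = {{a, b, d}, {b, c, d}} \<or>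
            e = (b, d) \<and> e' = (a, c) \<and> N' = {{a, b, c}, {a, c, d}} \<and> N = {{a, b, d}, {b, c, d}}"
    and eE: "e \<in> E"
  shows "triangles E = {t \<in> triangles E. e \<notin> chords t} \<union> N"
    and "triangles (insert e' (E - {e})) = {t \<in> triangles E. e \<notin> chords t} \<union> N'"
    and "max_noncrossing P (insert e' (E - {e}))" "e' \<notin> E" "e' \<in> chords P"
proof -
  note D = max_noncrossingD[OF F]
  show F': "max_noncrossing P (insert e' (E - {e}))" using e flip_max_noncrossing[OF F o s] eE by auto
  note D' = max_noncrossingD[OF F']
  show "e' \<in> chords P" using D'(2) by auto
  have "crosses e e'" using e o by (auto simp: crosses.simps)
  then show e'E: "e' \<notin> E" using D(6)[OF eE] by blast
  have ee: "e' \<noteq> e" using e'E eE by auto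
  have *: "triangles G = {t \<in> triangles G. f \<notin> chords t} \<union> M"
    if G: "max_noncrossing P G" "f \<in> G" and M: "f = (a, c) \<and> M = {{a, b, c}, {a, c, d}} \<or> f = (b, d) \<and> M = {{a, b, d}, {b, c, d}}"
     and s: "(a, b) \<in> G" "(b, c) \<in> G" "(c, d) \<in> G" "(a, d) \<in> G" for G f M
  proof -
    have T: "{a, b, c} \<in> triangles G \<and> {a, c, d} \<in> triangles G \<and> (a, c) \<in> chords {a, b, c} \<and> (a, c) \<in> chords {a, c, d} \<and> {a, b, c} \<noteq> {a, c, d}" if "f = (a, c)"
    proof (intro conjI)
      show "{a, b, c} \<in> triangles G" "{a, c, d} \<in> triangles G" using o s G(2) that by (auto intro!: trianglesI)
    qed (use o in \<open>auto simp: chords_def\<close>)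
    have T': "{a, b, d} \<in> triangles G \<and> {b, c, d} \<in> triangles G \<and> (b, d) \<in> chords {a, b, d} \<and> (b, d) \<in> chords {b, c, d} \<and> {a, b, d} \<noteq> {b, c, d}" if "f = (b, d)"
    proof (intro conjI)
      show "{a, b, d} \<in> triangles G" "{b, c, d} \<in> triangles G" using o s G(2) that by (auto intro!: trianglesI)
    qed (use o in \<open>auto simp: chords_def\<close>)
    have "M \<subseteq> triangles G" using M T T' by auto
    moreover have "t \<in> M" if t: "t \<in> triangles G" "f \<in> chords t" for t
    proof (rule ccontr)
      assume n: "t \<notin> M"
      obtain r s where rs: "M = {r, s}" "r \<in> triangles G" "s \<in> triangles G" "f \<in> chords r" "f \<in> chords s" "r \<noteq> s"
        using M
      proof (elim disjE conjE)
        assume "f = (a, c)" "M = {{a, b, c}, {a, c, d}}"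
        then show ?thesis using T that[of "{a, b, c}" "{a, c, d}"] by simp
      next
        assume "f = (b, d)" "M = {{a, b, d}, {b, c, d}}"
        then show ?thesis using T' that[of "{a, b, d}" "{b, c, d}"] by simp
      qed
      have "t \<noteq> r" "t \<noteq> s" using n rs(1) by auto
      from at_most_two_triangles[OF max_noncrossingD(3)[OF G(1)] t(1) rs(2,3) t(2) rs(4,5) this] rs(6)
      show False by simp
    qed
    ultimately show ?thesis by blast
  qed
  show "triangles E = {t \<in> triangles E. e \<notin> chords t} \<union> N"
    by (rule *[OF F eE _ s]) (use e in auto)
  have "triangles (insert e' (E - {e})) = {t \<in> triangles (insert e' (E - {e})). e' \<notin> chords t} \<union> N'"
    by (rule *[OF F']) (use e s o in auto)
  moreover have "{t \<in> triangles (insert e' (E - {e})). e' \<notin> chords t} = {t \<in> triangles E. e \<notin> chords t}"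
  proof (intro equalityI subsetI)
    fix t assume t: "t \<in> {t \<in> triangles (insert e' (E - {e})). e' \<notin> chords t}"
    then have "t \<in> triangles (insert e' (E - {e}))" by auto
    then obtain x y z where tt: "t = {x, y, z}" "x < y" "y < z" "(x, y) \<in> insert e' (E - {e})" "(y, z) \<in> insert e' (E - {e})" "(x, z) \<in> insert e' (E - {e})"
      "chords t = {(x, y), (y, z), (x, z)}" by (rule trianglesE)
    then show "t \<in> {t \<in> triangles E. e \<notin> chords t}" using t ee by (auto intro!: trianglesI)
  next
    fix t assume t: "t \<in> {t \<in> triangles E. e \<notin> chords t}"
    then have "t \<in> triangles E" by auto
    then obtain x y z where tt: "t = {x, y, z}" "x < y" "y < z" "(x, y) \<in> E" "(y, z) \<in> E" "(x, z) \<in> E"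
      "chords t = {(x, y), (y, z), (x, z)}" by (rule trianglesE)
    then show "t \<in> {t \<in> triangles (insert e' (E - {e})). e' \<notin> chords t}" using t e'E by (auto intro!: trianglesI)
  qed
  ultimately show "triangles (insert e' (E - {e})) = {t \<in> triangles E. e \<notin> chords t} \<union> N'" by simp
qed

lemma flip_unique:
  assumes F: "max_noncrossing P E" "max_noncrossing P (insert e' (E - {e}))" "max_noncrossing P (insert e'' (E - {e}))"
    and o: "a < b" "b < c" "c < d"
    and s: "(a, b) \<in> E" "(b, c) \<in> E" "(c, d) \<in> E" "(a, d) \<in> E"
    and e: "e = (a, c) \<and> e' = (b, d) \<or> e = (b, d) \<and> e' = (a, c)" and e'': "e'' \<notin> E"
  shows "e'' = e'"
proof -
  note D'' = max_noncrossingD[OF F(3)] and D = max_noncrossingD[OF F(1)]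
  have "e'' \<in> chords P" using D'' by auto
  then obtain f where f: "f \<in> E" "crosses e'' f" using e'' F(1) unfolding max_noncrossing_def by blast
  have "f = e" using D''(6)[of e'' f] f by blast
  have "(a, b) \<in> E - {e}" "(b, c) \<in> E - {e}" "(c, d) \<in> E - {e}" "(a, d) \<in> E - {e}" using s o e by auto
  then have n: "\<not> crosses e'' (a, b)" "\<not> crosses e'' (b, c)" "\<not> crosses e'' (c, d)" "\<not> crosses e'' (a, d)"
    using D''(6)[of e''] by blast+
  obtain p q where pq: "e'' = (p, q)" by (cases e'')
  have "p < q" using D''(5)[of p q] pq by auto
  then show ?thesis using crosses_diagonal_of_quadrilateral[OF o _ n[unfolded pq]] e f \<open>f = e\<close> pq by blast
qed

context subdivision
begin

lemma black_arcs_eq: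
  assumes T: "T \<in> represented_by k n S"
  shows "black_arcs T = (\<Union>P\<in>black S. arcs_of n T \<inter> chords P)"
  unfolding black_arcs_def using black_arcs_of[OF representedD(2,1)[OF T]] representedD(3)[OF T] by simp

lemma black_arcsD:
  assumes T: "T \<in> represented_by k n S"
  shows "black_arcs T \<subseteq> arcs_of n T" "boundary_arcs S \<subseteq> black_arcs T" "finite (black_arcs T)"
    "card (black_arcs T) = (\<Sum>P\<in>black S. 2 * card P - 3)"
proof -
  show 1: "black_arcs T \<subseteq> arcs_of n T" unfolding black_arcs_eq[OF T] by auto
  show "boundary_arcs S \<subseteq> black_arcs T"
  proof
    fix e assume "e \<in> boundary_arcs S"
    then obtain P where P: "P \<in> black S" "e \<in> sides P" unfolding boundary_arcs_def by blast
    then have "e \<in> arcs_of n T \<inter> chords P"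
      using poly_sides(1)[OF representedD(2,1)[OF T] P(1)] by (auto simp: sides_def)
    then show "e \<in> black_arcs T" using P(1) unfolding black_arcs_eq[OF T] by blast
  qed
  show "finite (black_arcs T)" using finite_subset[OF 1] max_noncrossingD(4)[OF representedD(1)[OF T]] by blast
  show "card (black_arcs T) = (\<Sum>P\<in>black S. 2 * card P - 3)"
    unfolding black_arcs_eq[OF T] by (rule card_black_arcs_of[OF representedD(2,1)[OF T]])
qed

text \<open>All the combinatorial data of a flip in a black polygon: the quadrilateral \<open>a < b < c < d\<close>, the two triangles that
disappear and the two that appear.\<close>
lemma flip_black:
  assumes T: "T \<in> represented_by k n S" and e: "e \<in> black_arcs T - boundary_arcs S"
  obtains a b c d e' P where "a < b" "b < c" "c < d" "P \<in> black S" "{a, b, c, d} \<subseteq> P"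
    "e = (a, c) \<and> e' = (b, d) \<or> e = (b, d) \<and> e' = (a, c)"
    "(a, b) \<in> arcs_of n T" "(b, c) \<in> arcs_of n T" "(c, d) \<in> arcs_of n T" "(a, d) \<in> arcs_of n T"
    "e' \<notin> arcs_of n T"
    "black T = {t \<in> black T. e \<notin> chords t} \<union> (if e = (a, c) then {{a, b, c}, {a, c, d}} else {{a, b, d}, {b, c, d}})"
    "\<exists>T'\<in>represented_by k n S. is_flip T e T' e'"
    "\<And>T' f. T' \<in> represented_by k n S \<Longrightarrow> is_flip T e T' f \<Longrightarrow> f = e' \<and> arcs_of n T' = insert e' (arcs_of n T - {e}) \<and>
      black T' = {t \<in> black T. e \<notin> chords t} \<union> (if e = (a, c) then {{a, b, d}, {b, c, d}} else {{a, b, c}, {a, c, d}})"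
proof -
  let ?E = "arcs_of n T"
  note R = representedD[OF T]
  obtain P where P: "P \<in> black S" "e \<in> ?E \<inter> chords P" using e black_arcs_eq[OF T] by auto
  have FP: "max_noncrossing P (?E \<inter> chords P)" by (rule poly[OF R(2,1) P(1)])
  have es: "e \<notin> sides P" using e P by (auto simp: boundary_arcs_def)
  obtain a b c d where o: "a < b" "b < c" "c < d" and s: "(a, b) \<in> ?E \<inter> chords P" "(b, c) \<in> ?E \<inter> chords P" "(c, d) \<in> ?E \<inter> chords P" "(a, d) \<in> ?E \<inter> chords P"
    and ed: "e = (a, c) \<or> e = (b, d)" using quad_at_arc[OF FP P(2) es] by metis
  define e' where "e' = (if e = (a, c) then (b, d) else (a, c))"
  define N where "N = (if e = (a, c) then {{a, b, c}, {a, c, d}} else {{a, b, d}, {b, c, d}})"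
  define N' where "N' = (if e = (a, c) then {{a, b, d}, {b, c, d}} else {{a, b, c}, {a, c, d}})"
  have ee: "e = (a, c) \<and> e' = (b, d) \<or> e = (b, d) \<and> e' = (a, c)" using ed o unfolding e'_def by auto
  have eN: "e = (a, c) \<and> e' = (b, d) \<and> N = {{a, b, c}, {a, c, d}} \<and> N' = {{a, b, d}, {b, c, d}} \<or>
            e = (b, d) \<and> e' = (a, c) \<and> N' = {{a, b, c}, {a, c, d}} \<and> N = {{a, b, d}, {b, c, d}}"
    using ed o unfolding e'_def N_def N'_def by auto
  have s': "(a, b) \<in> ?E" "(b, c) \<in> ?E" "(c, d) \<in> ?E" "(a, d) \<in> ?E" and eE: "e \<in> ?E" and abcd: "{a, b, c, d} \<subseteq> P"
    using s P by (auto simp: chords_def)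
  note TF = triangles_flip[OF R(1) o s' eN eE]
  let ?E' = "insert e' (?E - {e})"
  have eK: "e \<notin> diagonals S" using face_chord_side[OF black_polygonD(4)[OF P(1)], of "fst e" "snd e"] es P by auto
  have e'n: "e' \<notin> sides {..<n}" using TF(4) sides_in_max_noncrossing[OF R(1)] by auto
  have en: "e \<notin> sides {..<n}"
    using es P(2) black_polygonD(1)[OF P(1)] by (fastforce simp: sides_def)
  have K': "diagonals S \<subseteq> ?E'" using R(2) eK by auto
  note C = coloring_represented[OF TF(3) K']
  have fl: "is_flip T e (coloring ?E') e'"
    unfolding is_flip_def C(4) using eE en TF(4) e'n R(8) by auto
  have "N \<union> N' = {{a, b, c}, {a, c, d}, {a, b, d}, {b, c, d}}" using eN by (elim disjE conjE) auto
  then have tP: "t \<subseteq> P" if "t \<in> N \<union> N'" for t using that abcd by auto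
  define A where "A = {t \<in> triangles ?E. e \<notin> chords t}"
  have sel: "{t \<in> A \<union> M. \<exists>P\<in>black S. t \<subseteq> P} = {t \<in> black T. e \<notin> chords t} \<union> M" if M: "M \<subseteq> N \<union> N'" for M
  proof -
    have "{t \<in> M. \<exists>P\<in>black S. t \<subseteq> P} = M" using tP P(1) M by blast
    moreover have "{t \<in> A. \<exists>P\<in>black S. t \<subseteq> P} = {t \<in> black T. e \<notin> chords t}"
      unfolding A_def R(3) black_of_def by blast
    moreover have "{t \<in> A \<union> M. \<exists>P\<in>black S. t \<subseteq> P} = {t \<in> A. \<exists>P\<in>black S. t \<subseteq> P} \<union> {t \<in> M. \<exists>P\<in>black S. t \<subseteq> P}" by blast
    ultimately show ?thesis by simp
  qed
  have b1: "black T = {t \<in> A \<union> N. \<exists>P\<in>black S. t \<subseteq> P}"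
    using R(3) TF(1)[folded A_def] unfolding black_of_def by simp
  have bl: "black T = {t \<in> black T. e \<notin> chords t} \<union> N" by (rule trans[OF b1 sel]) blast
  have b2: "black_of ?E' = {t \<in> A \<union> N'. \<exists>P\<in>black S. t \<subseteq> P}"
    using TF(2)[folded A_def] unfolding black_of_def by simp
  have bl': "black_of ?E' = {t \<in> black T. e \<notin> chords t} \<union> N'" by (rule trans[OF b2 sel]) blast
  have uni: "f = e' \<and> arcs_of n T' = ?E' \<and> black T' = {t \<in> black T. e \<notin> chords t} \<union> N'"
    if T': "T' \<in> represented_by k n S" "is_flip T e T' f" for T' f
  proof -
    note R' = representedD[OF T'(1)]
    have f: "f \<notin> diagonals T" "diagonals T' = insert f (diagonals T - {e})" using T'(2) by (auto simp: is_flip_def)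
    then have fE: "f \<notin> ?E" using R'(8) by auto
    have a: "arcs_of n T' = insert f (?E - {e})" using f en by auto
    have "f = e'" by (rule flip_unique[OF R(1) TF(3) R'(1)[unfolded a] o s' ee fE])
    then show ?thesis using a R'(3) bl' by simp
  qed
  show ?thesis
  proof (rule that[OF o P(1) abcd ee s' TF(4)])
    show "black T = {t \<in> black T. e \<notin> chords t} \<union> (if e = (a, c) then {{a, b, c}, {a, c, d}} else {{a, b, d}, {b, c, d}})"
      using bl unfolding N_def .
    show "\<exists>T'\<in>represented_by k n S. is_flip T e T' e'" using fl C(1) by (rule bexI)
  qed (use uni N'_def in simp)
qed

text \<open>Flips outside the black polygons change neither the black triangles nor the seed, so an induction along flips needs only
the flips of black diagonals.\<close>
lemma represented_induct:
  assumes T: "T \<in> represented_by k n S" "T' \<in> represented_by k n S" and \<Phi>: "\<Phi> T"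
    and same: "\<And>T1 T2. T1 \<in> represented_by k n S \<Longrightarrow> T2 \<in> represented_by k n S \<Longrightarrow> \<Phi> T1 \<Longrightarrow> black T2 = black T1 \<Longrightarrow> \<Phi> T2"
    and flip: "\<And>T1 T2 e e'. T1 \<in> represented_by k n S \<Longrightarrow> T2 \<in> represented_by k n S \<Longrightarrow> \<Phi> T1 \<Longrightarrow>
       e \<in> black_arcs T1 - boundary_arcs S \<Longrightarrow> is_flip T1 e T2 e' \<Longrightarrow> \<Phi> T2"
  shows "\<Phi> T'"
proof -
  note R = representedD[OF T(1)] and R' = representedD[OF T(2)]
  have K: "diagonals S \<union> sides {..<n} \<subseteq> arcs_of n X" if "X \<in> represented_by k n S" for X using representedD(2)[OF that] by auto
  have "\<Phi> (coloring (arcs_of n T'))"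
  proof (rule flip_connected[where \<Phi> = "\<lambda>E. \<Phi> (coloring E)", OF R(1) R'(1) K[OF T(1)] K[OF T(2)]])
    show "\<Phi> (coloring (arcs_of n T))" using \<Phi> represented_eq_coloring[OF T(1)] by simp
    fix D e e' assume KD: "diagonals S \<union> sides {..<n} \<subseteq> D" and F: "max_noncrossing {..<n} D" and \<Phi>D: "\<Phi> (coloring D)"
      and e: "e \<in> D" "e \<notin> diagonals S \<union> sides {..<n}" "e' \<notin> D" and F': "max_noncrossing {..<n} (insert e' (D - {e}))"
    let ?D' = "insert e' (D - {e})"
    have KD1: "diagonals S \<subseteq> D" "diagonals S \<subseteq> ?D'" using KD e by auto
    note C = coloring_represented[OF F KD1(1)] and C' = coloring_represented[OF F' KD1(2)]
    have fl: "is_flip (coloring D) e (coloring ?D') e'"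
      unfolding is_flip_def C(4) C'(4) using e KD by auto
    show "\<Phi> (coloring ?D')"
    proof (cases "e \<in> black_arcs (coloring D)")
      case True
      have "e \<notin> boundary_arcs S"
        using poly_sides(2)[OF KD1(1) F] e(2) unfolding boundary_arcs_def by blast
      then show ?thesis using flip[OF C(1) C'(1) \<Phi>D _ fl] True by blast
    next
      case False
      \<comment> \<open>A new arc inside a black polygon could only have replaced an arc of the same polygon.\<close>
      have e'c: "e' \<notin> chords P" if P: "P \<in> black S" for P
      proof
        assume p: "e' \<in> chords P"
        have "e' \<in> chords P - D \<inter> chords P" using p e by auto
        then obtain f where f: "f \<in> D \<inter> chords P" "crosses e' f" using poly[OF KD1(1) F P] unfolding max_noncrossing_def by blast
        have "f = e" using max_noncrossingD(6)[OF F', of e' f] f by blast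
        then have "e \<in> black_arcs (coloring D)" using f P black_arcs_eq[OF C(1)] C(2) by auto
        then show False using False by simp
      qed
      have ec: "e \<notin> chords P" if P: "P \<in> black S" for P using False e P black_arcs_eq[OF C(1)] C(2) by auto
      have "?D' \<inter> chords P = D \<inter> chords P" if "P \<in> black S" for P using ec[OF that] e'c[OF that] by auto
      then have "black_of ?D' = black_of D" unfolding black_of_Union[OF KD1(1) F] black_of_Union[OF KD1(2) F'] by simp
      then show ?thesis using same[OF C(1) C'(1) \<Phi>D] C(3) C'(3) by simp
    qed
  qed
  then show ?thesis using represented_eq_coloring[OF T(2)] by simp
qed

end

section \<open>Determinants as functions of their rows\<close>

text \<open>The number of pairs in the wrong order; its parity is the sign of the sorting permutation.\<close>
fun inversions :: "nat list \<Rightarrow> nat" where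
  "inversions [] = 0"
| "inversions (x # xs) = length (filter (\<lambda>y. y < x) xs) + inversions xs"

lemma inversions_snoc: "inversions (xs @ [y]) = inversions xs + length (filter (\<lambda>x. y < x) xs)"
  by (induction xs) auto

lemma inversions_map: "inversions (map f [0..<k]) = (\<Sum>j<k. \<Sum>i<j. of_bool (f j < f i))"
proof (induction k)
  case (Suc k)
  have "length (filter (\<lambda>x. z < x) (map f [0..<k])) = (\<Sum>i<k. of_bool (z < f i))" for z
    by (induction k) (auto simp del: sum_of_bool_eq)
  then show ?case using Suc by (simp add: inversions_snoc del: sum_of_bool_eq filter_map)
qed simp

lemma alternating_insort:
  fixes g :: "nat list \<Rightarrow> 'a::comm_ring_1"
  assumes alt: "\<And>us x y vs. g (us @ x # y # vs) = - g (us @ y # x # vs)"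
  shows "sorted ys \<Longrightarrow> g (us @ x # ys) = (-1) ^ length (filter (\<lambda>y. y < x) ys) * g (us @ insort x ys)"
proof (induction ys arbitrary: us)
  case (Cons y ys)
  show ?case
  proof (cases "x \<le> y")
    case True
    then have "filter (\<lambda>y. y < x) (y # ys) = []" using Cons.prems by (auto simp: filter_empty_conv)
    then show ?thesis using True by simp
  next
    case False
    have "g (us @ x # y # ys) = - g ((us @ [y]) @ x # ys)" using alt[of us x y ys] by simp
    also have "\<dots> = - ((-1) ^ length (filter (\<lambda>y. y < x) ys) * g ((us @ [y]) @ insort x ys))"
      using Cons.IH[of "us @ [y]"] Cons.prems by simp
    finally show ?thesis using False by simp
  qed
qed simp

text \<open>A function of lists that changes sign under adjacent transpositions changes by the parity of the inversions under
insertion sort.\<close>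
lemma alternating_sort:
  fixes g :: "nat list \<Rightarrow> 'a::comm_ring_1"
  assumes alt: "\<And>us x y vs. g (us @ x # y # vs) = - g (us @ y # x # vs)"
  shows "g (us @ xs) = (-1) ^ inversions xs * g (us @ sort xs)"
proof (induction xs arbitrary: us)
  case (Cons x xs)
  have len: "length (filter (\<lambda>y. y < x) (sort xs)) = length (filter (\<lambda>y. y < x) xs)"
    by (metis filter_sort length_sort)
  have "g (us @ x # xs) = (-1) ^ inversions xs * g (us @ x # sort xs)"
    using Cons[of "us @ [x]"] by simp
  also have "g (us @ x # sort xs) = (-1) ^ length (filter (\<lambda>y. y < x) xs) * g (us @ insort x (sort xs))"
    using alternating_insort[of g "sort xs" us x, OF alt] len by simp
  finally show ?case by (simp add: power_add mult_ac)
qed simp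

text \<open>Rows as functions and matrices as lists of rows: this makes it easy to replace, swap and append rows.\<close>
definition rowdet :: "(nat \<Rightarrow> 'a::comm_ring_1) list \<Rightarrow> 'a" where
  "rowdet rs = det (mat (length rs) (length rs) (\<lambda>(i, j). (rs ! i) j))"

text \<open>Laplace expansion along one row, with coefficients that do not depend on that row.\<close>
lemma rowdet_linear_form:
  "\<exists>K. \<forall>r. rowdet (us @ r # ws) = (\<Sum>j<length us + length ws + 1. r j * K j)"
proof -
  let ?N = "length us + length ws + 1" and ?i = "length us"
  let ?A = "\<lambda>r. mat ?N ?N (\<lambda>(i, j). ((us @ r # ws) ! i) j)"
  have cof: "cofactor (?A r) ?i j = cofactor (?A (\<lambda>_. 0)) ?i j" if "j < ?N" for r j
  proof -
    have other: "(us @ r # ws) ! x = (us @ (\<lambda>_. 0) # ws) ! x" if "x \<noteq> length us" for x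
      using that by (cases "x < length us") (simp_all add: nth_append nth_Cons')
    have "mat_delete (?A r) ?i j = mat_delete (?A (\<lambda>_. 0)) ?i j"
    proof (rule eq_matI)
      fix x y assume xy: "x < dim_row (mat_delete (?A (\<lambda>_. 0)) ?i j)" "y < dim_col (mat_delete (?A (\<lambda>_. 0)) ?i j)"
      have "(if x < ?i then x else Suc x) \<noteq> ?i" by simp
      from other[OF this] xy show "mat_delete (?A r) ?i j $$ (x, y) = mat_delete (?A (\<lambda>_. 0)) ?i j $$ (x, y)"
        unfolding mat_delete_def by simp
    qed (simp_all add: mat_delete_def)
    then show ?thesis by (simp add: cofactor_def)
  qed
  have "rowdet (us @ r # ws) = (\<Sum>j<?N. r j * cofactor (?A (\<lambda>_. 0)) ?i j)" for r
  proof -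
    have "rowdet (us @ r # ws) = det (?A r)" by (simp add: rowdet_def)
    also have "\<dots> = (\<Sum>j<?N. ?A r $$ (?i, j) * cofactor (?A r) ?i j)"
      by (rule laplace_expansion_row) auto
    also have "\<dots> = (\<Sum>j<?N. r j * cofactor (?A (\<lambda>_. 0)) ?i j)"
    proof (rule sum.cong[OF HOL.refl])
      fix j assume j: "j \<in> {..<?N}"
      then have "?A r $$ (?i, j) = r j" by simp
      with cof[of j r] j show "?A r $$ (?i, j) * cofactor (?A r) ?i j = r j * cofactor (?A (\<lambda>_. 0)) ?i j"
        by (simp only: lessThan_iff)
    qed
    finally show ?thesis .
  qed
  then show ?thesis by blast
qed

lemma rowdet_sum:
  "rowdet (us @ (\<lambda>j. \<Sum>s\<in>A. c s * v s j) # ws) = (\<Sum>s\<in>A. c s * rowdet (us @ v s # ws))"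
proof -
  obtain K where K: "\<And>r. rowdet (us @ r # ws) = (\<Sum>j<length us + length ws + 1. r j * K j)"
    using rowdet_linear_form[of us ws] by blast
  show ?thesis unfolding K sum_distrib_left sum_distrib_right
    by (subst sum.swap) (simp add: mult_ac)
qed

lemma rowdet_swap: "rowdet (us @ x # y # vs) = - rowdet (us @ y # x # vs)"
proof -
  let ?N = "length us + length vs + 2" and ?k = "length us"
  let ?A = "\<lambda>x y. mat ?N ?N (\<lambda>(i, j). ((us @ x # y # vs) ! i) j)"
  have "swaprows ?k (Suc ?k) (?A y x) = ?A x y"
    by (rule eq_matI) (auto simp: nth_append nth_Cons' split: if_splits)
  moreover have "det (swaprows ?k (Suc ?k) (?A y x)) = - det (?A y x)"
    by (rule det_swaprows[of _ ?N]) auto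
  ultimately show ?thesis by (simp add: rowdet_def)
qed

lemma rowdet_identical:
  assumes "i < length rs" "j < length rs" "i \<noteq> j" "rs ! i = rs ! j"
  shows "rowdet rs = 0"
  unfolding rowdet_def
  by (rule det_identical_rows[of _ "length rs" i j]) (use assms in \<open>auto intro!: eq_vecI\<close>)

lemma rowdet_zero_row:
  assumes "i < length rs" "\<And>j. j < length rs \<Longrightarrow> (rs ! i) j = 0"
  shows "rowdet rs = 0"
proof -
  obtain us ws where rs: "rs = us @ (rs ! i) # ws" "length us = i"
    by (rule that[of "take i rs" "drop (Suc i) rs"]) (use assms in \<open>auto simp: id_take_nth_drop[symmetric]\<close>)
  obtain K where K: "\<And>r. rowdet (us @ r # ws) = (\<Sum>j<length us + length ws + 1. r j * K j)"
    using rowdet_linear_form[of us ws] by blast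
  have "length rs = length us + length ws + 1" using rs(1) by (metis add.assoc length_Cons length_append Suc_eq_plus1)
  then have "rowdet (us @ (rs ! i) # ws) = 0" unfolding K using assms(2) by simp
  then show ?thesis using rs by simp
qed

lemma rowdet_sort:
  "rowdet (map v xs @ ws) = (-1) ^ inversions xs * rowdet (map v (sort xs) @ ws)"
proof -
  have "rowdet (map v (us @ x # y # vs) @ ws) = - rowdet (map v (us @ y # x # vs) @ ws)" for us x y vs
    using rowdet_swap[of "map v us" "v x" "v y" "map v vs @ ws"] by simp
  from alternating_sort[of "\<lambda>xs. rowdet (map v xs @ ws)", OF this, of "[]" xs] show ?thesis by simp
qed

lemma rowdet_not_distinct:
  assumes "\<not> distinct xs" shows "rowdet (map v xs @ ws) = 0"
proof -
  obtain i j where "i < length xs" "j < length xs" "i \<noteq> j" "xs ! i = xs ! j"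
    using assms distinct_conv_nth by metis
  then show ?thesis by (intro rowdet_identical[of i _ j]) (auto simp: nth_append)
qed

lemma lists_of_length_Suc: "{xs. set xs \<subseteq> A \<and> length xs = Suc n} = (\<lambda>(x, xs). x # xs) ` (A \<times> {xs. set xs \<subseteq> A \<and> length xs = n})"
  by (auto simp: length_Suc_conv image_iff)

lemma rowdet_expand:
  assumes "finite A"
  shows "rowdet (us @ map (\<lambda>c j. \<Sum>s\<in>A. c s * v s j) cs @ ws) =
    (\<Sum>xs\<in>{xs. set xs \<subseteq> A \<and> length xs = length cs}. (\<Prod>i<length cs. (cs ! i) (xs ! i)) * rowdet (us @ map v xs @ ws))"
proof (induction cs arbitrary: us)
  case Nil
  have "{xs. set xs \<subseteq> A \<and> length xs = 0} = {[]}" by auto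
  then show ?case by simp
next
  case (Cons c cs)
  let ?L = "\<lambda>k. {xs. set xs \<subseteq> A \<and> length xs = k}"
  have "rowdet (us @ map (\<lambda>c j. \<Sum>s\<in>A. c s * v s j) (c # cs) @ ws) =
     (\<Sum>s\<in>A. c s * rowdet ((us @ [v s]) @ map (\<lambda>c j. \<Sum>s\<in>A. c s * v s j) cs @ ws))"
    using rowdet_sum[of us c v A "map (\<lambda>c j. \<Sum>s\<in>A. c s * v s j) cs @ ws"] by simp
  also have "\<dots> = (\<Sum>s\<in>A. \<Sum>xs\<in>?L (length cs). c s * ((\<Prod>i<length cs. (cs ! i) (xs ! i)) * rowdet (us @ map v (s # xs) @ ws)))"
    unfolding Cons.IH sum_distrib_left by simp
  also have "\<dots> = (\<Sum>(s, xs)\<in>A \<times> ?L (length cs). c s * ((\<Prod>i<length cs. (cs ! i) (xs ! i)) * rowdet (us @ map v (s # xs) @ ws)))"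
    by (rule sum.cartesian_product)
  also have "\<dots> = (\<Sum>xs\<in>?L (length (c # cs)). (\<Prod>i<length (c # cs). ((c # cs) ! i) (xs ! i)) * rowdet (us @ map v xs @ ws))"
  proof -
    have inj: "inj_on (\<lambda>(x, xs). x # xs) (A \<times> ?L (length cs))" by (auto simp: inj_on_def)
    show ?thesis
      unfolding length_Cons lists_of_length_Suc sum.reindex[OF inj]
      by (rule sum.cong[OF HOL.refl]) (auto simp: prod.lessThan_Suc_shift mult.assoc simp del: prod.lessThan_Suc)
  qed
  finally show ?case .
qed

text \<open>The enumerations of \<open>I\<close>. They index the terms of the Leibniz expansion of a minor with columns \<open>I\<close>.\<close>
definition orderings :: "'a set \<Rightarrow> 'a list set" where
  "orderings I = {xs. distinct xs \<and> set xs = I}"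

definition signed_minor :: "(nat \<Rightarrow> 'a::comm_ring_1) list \<Rightarrow> nat set \<Rightarrow> 'a" where
  "signed_minor cs I = (\<Sum>xs\<in>orderings I. (-1) ^ inversions xs * (\<Prod>i<length cs. (cs ! i) (xs ! i)))"

text \<open>Expand multilinearly over all lists of indices, drop the lists with a repetition and sort the others; the signs collect to the
minors of the coefficients. The extra rows \<open>ws\<close> are carried along, which gives the expansion of twistor coordinates at no
extra cost.\<close>
lemma rowdet_cauchy_binet:
  assumes A: "finite A"
  shows "rowdet (map (\<lambda>c j. \<Sum>s\<in>A. c s * v s j) cs @ ws) =
    (\<Sum>I\<in>{I. I \<subseteq> A \<and> card I = length cs}. signed_minor cs I * rowdet (map v (sorted_list_of_set I) @ ws))"
proof -
  let ?L = "{xs. set xs \<subseteq> A \<and> length xs = length cs}" and ?J = "{I. I \<subseteq> A \<and> card I = length cs}"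
  let ?f = "\<lambda>xs. (\<Prod>i<length cs. (cs ! i) (xs ! i))"
  have finL: "finite ?L" by (rule finite_lists_length_eq[OF A])
  have finJ: "finite ?J" using A by auto
  have U: "{xs \<in> ?L. distinct xs} = (\<Union>I\<in>?J. orderings I)"
    unfolding orderings_def using distinct_card by fastforce
  have "rowdet (map (\<lambda>c j. \<Sum>s\<in>A. c s * v s j) cs @ ws) = (\<Sum>xs\<in>?L. ?f xs * rowdet (map v xs @ ws))"
    using rowdet_expand[OF A, of "[]" v cs ws] by simp
  also have "\<dots> = (\<Sum>xs\<in>{xs \<in> ?L. distinct xs}. ?f xs * rowdet (map v xs @ ws))"
    by (rule sum.mono_neutral_right[OF finL]) (auto simp: rowdet_not_distinct)
  also have "\<dots> = (\<Sum>I\<in>?J. \<Sum>xs\<in>orderings I. ?f xs * rowdet (map v xs @ ws))"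
    unfolding U
  proof (rule sum.UNION_disjoint[OF finJ])
    show "\<forall>I\<in>?J. finite (orderings I)"
    proof
      fix I assume "I \<in> ?J"
      then have "orderings I \<subseteq> {xs \<in> ?L. distinct xs}" unfolding U by blast
      then show "finite (orderings I)" by (rule finite_subset) (rule finite_subset[OF _ finL], blast)
    qed
    show "\<forall>I\<in>?J. \<forall>I'\<in>?J. I \<noteq> I' \<longrightarrow> orderings I \<inter> orderings I' = {}" by (auto simp: orderings_def)
  qed
  also have "\<dots> = (\<Sum>I\<in>?J. signed_minor cs I * rowdet (map v (sorted_list_of_set I) @ ws))"
  proof (rule sum.cong[OF HOL.refl])
    fix I assume "I \<in> ?J"
    have s: "sort xs = sorted_list_of_set I" if "xs \<in> orderings I" for xs
      using that by (auto simp: orderings_def sorted_list_of_set_sort_remdups distinct_remdups_id)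
    have "(\<Sum>xs\<in>orderings I. ?f xs * rowdet (map v xs @ ws)) =
       (\<Sum>xs\<in>orderings I. (-1) ^ inversions xs * ?f xs * rowdet (map v (sorted_list_of_set I) @ ws))"
    proof (rule sum.cong[OF HOL.refl])
      fix xs assume xs: "xs \<in> orderings I"
      have "rowdet (map v xs @ ws) = (-1) ^ inversions xs * rowdet (map v (sorted_list_of_set I) @ ws)"
        using rowdet_sort[of v xs ws] s[OF xs] by simp
      then show "?f xs * rowdet (map v xs @ ws) = (-1) ^ inversions xs * ?f xs * rowdet (map v (sorted_list_of_set I) @ ws)"
        by (simp add: mult_ac)
    qed
    then show "(\<Sum>xs\<in>orderings I. ?f xs * rowdet (map v xs @ ws)) = signed_minor cs I * rowdet (map v (sorted_list_of_set I) @ ws)"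
      by (simp add: signed_minor_def sum_distrib_right)
  qed
  finally show ?thesis .
qed

lemma rowdet_unit: "rowdet (map (\<lambda>i j. of_bool (i = j)) [0..<k]) = 1"
proof -
  have "mat k k (\<lambda>(i, j). ((map (\<lambda>i j. of_bool (i = j)) [0..<k]) ! i) j) = (1\<^sub>m k :: 'a mat)"
    by (rule eq_matI) auto
  then show ?thesis by (simp add: rowdet_def)
qed

lemma pick_sorted_list_of_set:
  assumes "finite I" "i < card I" shows "pick I i = sorted_list_of_set I ! i"
proof -
  let ?l = "sorted_list_of_set I"
  have l: "length ?l = card I" "sorted_wrt (<) ?l" "set ?l = I" "distinct ?l" using assms by auto
  have "{a \<in> I. a < ?l ! i} = (\<lambda>j. ?l ! j) ` {..<i}"
  proof (intro equalityI subsetI)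
    fix a assume a: "a \<in> {a \<in> I. a < ?l ! i}"
    then obtain j where j: "j < card I" "a = ?l ! j" using l by (metis (no_types, lifting) in_set_conv_nth mem_Collect_eq)
    have "j < i"
    proof (rule ccontr)
      assume "\<not> j < i"
      then have "?l ! i \<le> ?l ! j" using l(1,2) j by (cases "i = j") (auto simp: sorted_wrt_iff_nth_less less_imp_le)
      then show False using a j by auto
    qed
    then show "a \<in> (\<lambda>j. ?l ! j) ` {..<i}" using j by auto
  next
    fix a assume "a \<in> (\<lambda>j. ?l ! j) ` {..<i}"
    then obtain j where j: "j < i" "a = ?l ! j" by auto
    have "j < length ?l" using j assms l by simp
    then have "?l ! j \<in> I" using l(3) nth_mem by blast
    then show "a \<in> {a \<in> I. a < ?l ! i}" using j assms l(1,2) by (auto simp: sorted_wrt_iff_nth_less)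
  qed
  moreover have "inj_on (\<lambda>j. ?l ! j) {..<i}" using l(1,4) assms by (auto simp: inj_on_def nth_eq_iff_index_eq)
  ultimately have "card {a \<in> I. a < ?l ! i} = i" by (simp add: card_image)
  moreover have "?l ! i \<in> I" using l(1,3) assms(2) nth_mem by metis
  ultimately show ?thesis using pick_card_in_set[of "?l ! i" I] by simp
qed

lemma plucker_rowdet:
  assumes "A \<in> carrier_mat k m" "I \<subseteq> {..<m}" "card I = k"
  shows "plucker A I = rowdet (map (\<lambda>i j. A $$ (i, sorted_list_of_set I ! j)) [0..<k])"
proof -
  have fin: "finite I" using assms(2) finite_subset by blast
  have c: "{j. j < m \<and> j \<in> I} = I" using assms(2) by auto
  have "submatrix A UNIV I = mat k k (\<lambda>(i, j). A $$ (i, sorted_list_of_set I ! j))"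
    by (rule eq_matI) (use assms fin in \<open>auto simp: submatrix_def c pick_UNIV pick_sorted_list_of_set\<close>)
  moreover have "mat k k (\<lambda>(i, j). (map (\<lambda>i j. A $$ (i, sorted_list_of_set I ! j)) [0..<k] ! i) j) = mat k k (\<lambda>(i, j). A $$ (i, sorted_list_of_set I ! j))"
    by (rule eq_matI) auto
  ultimately show ?thesis by (simp add: plucker_def rowdet_def)
qed

text \<open>Apply the Cauchy-Binet expansion to coordinate vectors: all summands but one have a zero row.\<close>
lemma plucker_signed_minor:
  fixes A :: "'a::field mat"
  assumes A: "A \<in> carrier_mat k m" "I \<subseteq> {..<m}" "card I = k"
  shows "plucker A I = signed_minor (map (\<lambda>i j. A $$ (i, j)) [0..<k]) I"
proof -
  let ?l = "sorted_list_of_set I"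
  have fin: "finite I" using assms(2) finite_subset by blast
  have l: "length ?l = k" "set ?l = I" "distinct ?l" using A fin by auto
  \<comment> \<open>The vectors \<open>v s\<close> select the columns in \<open>I\<close>.\<close>
  define v :: "nat \<Rightarrow> nat \<Rightarrow> 'a" where "v s j = of_bool (s = ?l ! j)" for s j
  have entry: "(\<Sum>s<m. c s * v s j) = c (?l ! j)" if "j < k" for j and c :: "nat \<Rightarrow> 'a"
  proof -
    have "?l ! j < m" using that l A(2) nth_mem[of j ?l] by auto
    then show ?thesis by (simp add: v_def sum.delta of_bool_def if_distrib[of "\<lambda>x. c _ * x"] cong: if_cong)
  qed
  have "plucker A I = rowdet (map (\<lambda>c j. \<Sum>s<m. c s * v s j) (map (\<lambda>i j. A $$ (i, j)) [0..<k]) @ [])"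
    unfolding plucker_rowdet[OF A] rowdet_def
    by (rule arg_cong[of _ _ det], rule eq_matI) (auto simp: entry)
  also have "\<dots> = (\<Sum>J\<in>{J. J \<subseteq> {..<m} \<and> card J = k}. signed_minor (map (\<lambda>i j. A $$ (i, j)) [0..<k]) J * rowdet (map v (sorted_list_of_set J)))"
    by (subst rowdet_cauchy_binet) auto
  also have "\<dots> = (\<Sum>J\<in>{I}. signed_minor (map (\<lambda>i j. A $$ (i, j)) [0..<k]) J * rowdet (map v (sorted_list_of_set J)))"
  proof (rule sum.mono_neutral_right)
    show "finite {J. J \<subseteq> {..<m} \<and> card J = k}" by simp
    show "{I} \<subseteq> {J. J \<subseteq> {..<m} \<and> card J = k}" using A by simp
    show "\<forall>J\<in>{J. J \<subseteq> {..<m} \<and> card J = k} - {I}. signed_minor (map (\<lambda>i j. A $$ (i, j)) [0..<k]) J * rowdet (map v (sorted_list_of_set J)) = 0"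
    proof
      fix J assume J: "J \<in> {J. J \<subseteq> {..<m} \<and> card J = k} - {I}"
      have finJ: "finite J" using J finite_subset by blast
      have "\<not> J \<subseteq> I" using card_subset_eq[OF fin, of J] J A(3) by auto
      then obtain s where s: "s \<in> J" "s \<notin> I" by auto
      then obtain i where i: "i < card J" "sorted_list_of_set J ! i = s"
        using finJ by (metis in_set_conv_nth length_sorted_list_of_set set_sorted_list_of_set)
      have "rowdet (map v (sorted_list_of_set J)) = 0"
        by (rule rowdet_zero_row[of i]) (use i s l J nth_mem[of _ ?l] in \<open>auto simp: v_def\<close>)
      then show "signed_minor (map (\<lambda>i j. A $$ (i, j)) [0..<k]) J * rowdet (map v (sorted_list_of_set J)) = 0" by simp
    qed
  qed
  finally have p: "plucker A I = (\<Sum>J\<in>{I}. signed_minor (map (\<lambda>i j. A $$ (i, j)) [0..<k]) J * rowdet (map v (sorted_list_of_set J)))" .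
  have "rowdet (map v ?l) = 1"
  proof -
    have "rowdet (map v ?l) = rowdet (map (\<lambda>i j. of_bool (i = j)) [0..<k] :: (nat \<Rightarrow> 'a) list)"
      unfolding rowdet_def by (rule arg_cong[of _ _ det], rule eq_matI) (use l in \<open>auto simp: v_def nth_eq_iff_index_eq\<close>)
    then show ?thesis by (simp add: rowdet_unit)
  qed
  then show ?thesis using p by simp
qed

section \<open>Row spaces and Pluecker coordinates\<close>

lemma rowdet_cong:
  assumes "length rs = length ss" "\<And>i j. i < length rs \<Longrightarrow> j < length rs \<Longrightarrow> (rs ! i) j = (ss ! i) j"
  shows "rowdet rs = rowdet ss"
  unfolding rowdet_def by (rule arg_cong[of _ _ det], rule eq_matI) (use assms in auto)

definition rowfun :: "'a mat \<Rightarrow> nat \<Rightarrow> nat \<Rightarrow> 'a" where "rowfun A i j = A $$ (i, j)"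

definition rowfuns :: "'a mat \<Rightarrow> (nat \<Rightarrow> 'a) list" where "rowfuns A = map (rowfun A) [0..<dim_row A]"

lemma length_rowfuns [simp]: "length (rowfuns A) = dim_row A" by (simp add: rowfuns_def)

lemma rowfuns_nth [simp]: "i < dim_row A \<Longrightarrow> rowfuns A ! i = rowfun A i" by (simp add: rowfuns_def)

lemma det_rowfuns: "A \<in> carrier_mat k k \<Longrightarrow> det A = rowdet (rowfuns A)"
  unfolding rowdet_def by (rule arg_cong[of _ _ det], rule eq_matI) (auto simp: rowfun_def)

text \<open>The twistor coordinate of two vectors with respect to the rows of \<open>A\<close>.\<close>
definition omega :: "'a::comm_ring_1 mat \<Rightarrow> (nat \<Rightarrow> 'a) \<Rightarrow> (nat \<Rightarrow> 'a) \<Rightarrow> 'a" where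
  "omega A f g = rowdet (rowfuns A @ [f, g])"

lemma det_append_two_rows:
  assumes A: "A \<in> carrier_mat k (k + 2)" and v: "v \<in> carrier_vec (k + 2)" "w \<in> carrier_vec (k + 2)"
  shows "det (A @\<^sub>r mat_of_rows (k + 2) [v, w]) = omega A (($) v) (($) w)"
proof -
  have "A @\<^sub>r mat_of_rows (k + 2) [v, w] = mat (k + 2) (k + 2) (\<lambda>(i, j). ((rowfuns A @ [($) v, ($) w]) ! i) j)"
    by (rule eq_matI)
       (use assms in \<open>auto simp: append_rows_def nth_append mat_of_rows_index rowfun_def nth_Cons'\<close>)
  then show ?thesis using A by (simp add: omega_def rowdet_def)
qed

lemma rowfuns_mult:
  fixes C :: "'a::comm_ring_1 mat"
  assumes C: "C \<in> carrier_mat k n" and M: "M \<in> carrier_mat n m"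
  shows "i < k \<Longrightarrow> j < m \<Longrightarrow> rowfun (C * M) i j = (\<Sum>s<n. rowfun C i s * rowfun M s j)"
  using assms by (simp add: rowfun_def scalar_prod_def atLeast0LessThan)

lemma cauchy_binet:
  fixes C :: "'a::field mat"
  assumes C: "C \<in> carrier_mat k n" and M: "M \<in> carrier_mat n m" and m: "m = k + length ws"
  shows "rowdet (rowfuns (C * M) @ ws) =
    (\<Sum>I\<in>{I. I \<subseteq> {..<n} \<and> card I = k}. plucker C I * rowdet (map (rowfun M) (sorted_list_of_set I) @ ws))"
proof -
  have "rowdet (rowfuns (C * M) @ ws) = rowdet (map (\<lambda>c j. \<Sum>s<n. c s * rowfun M s j) (rowfuns C) @ ws)"
    by (rule rowdet_cong) (use C M m rowfuns_mult[OF C M] in \<open>auto simp: nth_append\<close>)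
  also have "\<dots> = (\<Sum>I\<in>{I. I \<subseteq> {..<n} \<and> card I = k}. signed_minor (rowfuns C) I * rowdet (map (rowfun M) (sorted_list_of_set I) @ ws))"
    by (subst rowdet_cauchy_binet) (use C in auto)
  also have "\<dots> = (\<Sum>I\<in>{I. I \<subseteq> {..<n} \<and> card I = k}. plucker C I * rowdet (map (rowfun M) (sorted_list_of_set I) @ ws))"
    by (rule sum.cong[OF HOL.refl]) (use C in \<open>auto simp: plucker_signed_minor rowfuns_def rowfun_def[abs_def]\<close>)
  finally show ?thesis .
qed

text \<open>The coefficients of the twistor coordinate as a linear function of the Pluecker coordinates.\<close>
definition omega_coeff :: "nat \<Rightarrow> (nat \<Rightarrow> 'a::field) \<Rightarrow> (nat \<Rightarrow> 'a) \<Rightarrow> nat set \<Rightarrow> 'a" where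
  "omega_coeff m f g I = rowdet (map (rowfun (1\<^sub>m m)) (sorted_list_of_set I) @ [f, g])"

lemma omega_plucker:
  fixes A :: "'a::field mat"
  assumes A: "A \<in> carrier_mat k (k + 2)"
  shows "omega A f g = (\<Sum>I\<in>{I. I \<subseteq> {..<k + 2} \<and> card I = k}. plucker A I * omega_coeff (k + 2) f g I)"
  using cauchy_binet[OF A one_carrier_mat, of "[f, g]"] A by (simp add: omega_def omega_coeff_def)

lemma omega_linear1: "omega A (\<lambda>j. \<Sum>s\<in>S. c s * v s j) g = (\<Sum>s\<in>S. c s * omega A (v s) g)"
  using rowdet_sum[of "rowfuns A" c v S "[g]"] by (simp add: omega_def)

lemma omega_linear2: "omega A f (\<lambda>j. \<Sum>s\<in>S. c s * v s j) = (\<Sum>s\<in>S. c s * omega A f (v s))"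
  using rowdet_sum[of "rowfuns A @ [f]" c v S "[]"] by (simp add: omega_def)

lemma omega_swap: "omega A f g = - omega A g f"
  using rowdet_swap[of "rowfuns A" f g "[]"] by (simp add: omega_def)

lemma omega_cong:
  assumes "A \<in> carrier_mat k (k + 2)" "\<And>j. j < k + 2 \<Longrightarrow> f j = f' j" "\<And>j. j < k + 2 \<Longrightarrow> g j = g' j"
  shows "omega A f g = omega A f' g'"
  unfolding omega_def by (rule rowdet_cong) (use assms in \<open>auto simp: nth_append nth_Cons'\<close>)

lemma omega_self: "omega A f f = 0"
  unfolding omega_def by (rule rowdet_identical[of "dim_row A" _ "Suc (dim_row A)"]) (auto simp: nth_append)

lemma omega_row: assumes "i < dim_row A" shows "omega A (rowfun A i) g = 0" "omega A f (rowfun A i) = 0"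
proof -
  show "omega A f (rowfun A i) = 0" for f
    unfolding omega_def by (rule rowdet_identical[of i _ "Suc (dim_row A)"]) (use assms in \<open>auto simp: nth_append\<close>)
  from this[of g] show "omega A (rowfun A i) g = 0" using omega_swap[of A "rowfun A i" g] by simp
qed

lemma plucker_mult:
  fixes A :: "'a::field mat"
  assumes G: "G \<in> carrier_mat k k" and A: "A \<in> carrier_mat k m" and I: "I \<subseteq> {..<m}" "card I = k"
  shows "plucker (G * A) I = det G * plucker A I"
proof -
  have fin: "finite I" using I finite_subset by blast
  have c: "{j. j < m \<and> j \<in> I} = I" using I by auto
  have p: "pick I j < m" if "j < k" for j
    using that I fin by (metis c pick_le)
  have "submatrix (G * A) UNIV I = G * submatrix A UNIV I"
  proof (rule eq_matI)
    fix i j assume ij: "i < dim_row (G * submatrix A UNIV I)" "j < dim_col (G * submatrix A UNIV I)"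
    then have ij': "i < k" "j < k" using G A by (auto simp: dim_submatrix c I)
    then show "submatrix (G * A) UNIV I $$ (i, j) = (G * submatrix A UNIV I) $$ (i, j)"
      using G A p[OF ij'(2)] by (auto simp: submatrix_def c I pick_UNIV scalar_prod_def)
  qed (use G A in \<open>auto simp: dim_submatrix c I\<close>)
  moreover have "submatrix A UNIV I \<in> carrier_mat k k" using A I by (auto simp: dim_submatrix c)
  ultimately show ?thesis using det_mult[OF G] by (simp add: plucker_def)
qed

lemma omega_mult:
  fixes A :: "'a::field mat"
  assumes G: "G \<in> carrier_mat k k" and A: "A \<in> carrier_mat k (k + 2)"
  shows "omega (G * A) f g = det G * omega A f g"
proof -
  have "G * A \<in> carrier_mat k (k + 2)" using G A by auto
  then show ?thesis unfolding omega_plucker[OF A] omega_plucker[OF \<open>G * A \<in> _\<close>] sum_distrib_left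
    by (intro sum.cong[OF HOL.refl]) (auto simp: plucker_mult[OF G A])
qed

text \<open>If the columns span, \<open>A\<close> has a right inverse, and the Cauchy-Binet formula for the identity matrix has a nonzero term.\<close>
lemma full_rank_plucker:
  fixes A :: "'a::field mat"
  assumes A: "A \<in> carrier_mat k m"
  shows "vec_space.rank k A = k \<longleftrightarrow> (\<exists>I. I \<subseteq> {..<m} \<and> card I = k \<and> plucker A I \<noteq> 0)"
proof
  interpret vec_space "TYPE('a)" k .
  assume "\<exists>I. I \<subseteq> {..<m} \<and> card I = k \<and> plucker A I \<noteq> 0"
  then obtain I where I: "I \<subseteq> {..<m}" "card I = k" "plucker A I \<noteq> 0" by auto
  have "{j. j < m \<and> j \<in> I} = I" using I by auto
  then have "k \<le> rank A" using rank_gt_minor[OF A, of UNIV I] I by (simp add: plucker_def)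
  moreover have "rank A \<le> k"
  proof -
    obtain S where S: "maximal S (\<lambda>T. T \<subseteq> set (cols A) \<and> lin_indpt T)"
      using maximal_exists_superset[of "set (cols A)" "\<lambda>T. T \<subseteq> set (cols A) \<and> lin_indpt T" "{}"]
      by (auto simp: lin_dep_def)
    have "set (cols A) \<subseteq> carrier_vec k" using A cols_dim by blast
    then have "S \<subseteq> carrier_vec k" "lin_indpt S" using S by (auto simp: maximal_def)
    then have "card S \<le> dim" using li_le_dim(2)[OF fin_dim, of S] by auto
    then show ?thesis using rank_card_indpt[OF A S] by (simp add: dim_is_n)
  qed
  ultimately show "rank A = k" by simp
next
  interpret vec_space "TYPE('a)" k .
  assume r: "rank A = k"
  have ca: "set (cols A) \<subseteq> carrier_vec k" using A cols_dim by blast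
  obtain S where S: "maximal S (\<lambda>T. T \<subseteq> set (cols A) \<and> lin_indpt T)"
    using maximal_exists_superset[of "set (cols A)" "\<lambda>T. T \<subseteq> set (cols A) \<and> lin_indpt T" "{}"]
    by (auto simp: lin_dep_def)
  then have S': "S \<subseteq> set (cols A)" "lin_indpt S" by (auto simp: maximal_def)
  have "card S = k" using rank_card_indpt[OF A S] r by simp
  have "finite S" using S'(1) finite_subset by blast
  have "basis S" by (rule dim_li_is_basis[OF fin_dim \<open>finite S\<close>]) (use S' ca \<open>card S = k\<close> in \<open>auto simp: dim_is_n\<close>)
  then have "span S = carrier_vec k" by (simp add: basis_def)
  then have "carrier_vec k \<subseteq> span (set (cols A))" using span_is_monotone[OF S'(1)] by auto
  then have cs: "carrier_vec k \<subseteq> col_space A" by (simp add: col_space_def)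
  have "\<exists>x. x \<in> carrier_vec m \<and> A *\<^sub>v x = unit_vec k i" if "i < k" for i
  proof -
    have "unit_vec k i \<in> col_space A" using cs by auto
    then show ?thesis using col_space_eq[OF A] A by auto
  qed
  then obtain x where x: "\<And>i. i < k \<Longrightarrow> x i \<in> carrier_vec m" "\<And>i. i < k \<Longrightarrow> A *\<^sub>v x i = unit_vec k i" by metis
  define X where "X = mat m k (\<lambda>(s, i). x i $ s)"
  have X: "X \<in> carrier_mat m k" by (simp add: X_def)
  have "A * X = 1\<^sub>m k"
  proof (rule eq_matI)
    fix i j assume "i < dim_row (1\<^sub>m k :: 'a mat)" "j < dim_col (1\<^sub>m k :: 'a mat)"
    then have ij: "i < k" "j < k" by auto
    have "col X j = x j" by (rule eq_vecI) (use ij x(1)[OF ij(2)] in \<open>auto simp: X_def\<close>)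
    then have "(A * X) $$ (i, j) = (A *\<^sub>v x j) $ i" using ij A X by simp
    then show "(A * X) $$ (i, j) = 1\<^sub>m k $$ (i, j)" using ij x by simp
  qed (use A X in auto)
  then have "rowdet (rowfuns (A * X) @ []) = 1" using det_rowfuns[of "1\<^sub>m k :: 'a mat" k] by simp
  then have "(\<Sum>I\<in>{I. I \<subseteq> {..<m} \<and> card I = k}. plucker A I * rowdet (map (rowfun X) (sorted_list_of_set I) @ [])) \<noteq> 0"
    using cauchy_binet[OF A X, of "[]"] by simp
  then obtain I where "I \<in> {I. I \<subseteq> {..<m} \<and> card I = k}" "plucker A I * rowdet (map (rowfun X) (sorted_list_of_set I) @ []) \<noteq> 0"
    by (meson sum.not_neutral_contains_not_neutral)
  then show "\<exists>I. I \<subseteq> {..<m} \<and> card I = k \<and> plucker A I \<noteq> 0" by auto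
qed

lemma row_space_iff:
  fixes A :: "'a::field mat"
  assumes A: "A \<in> carrier_mat k m"
  shows "v \<in> vec_space.row_space m A \<longleftrightarrow> v \<in> carrier_vec m \<and> (\<exists>c. \<forall>j<m. v $ j = (\<Sum>s<k. c s * rowfun A s j))"
proof -
  interpret vec_space "TYPE('a)" m .
  have "v \<in> row_space A \<longleftrightarrow> v \<in> carrier_vec m \<and> (\<exists>y\<in>carrier_vec k. A\<^sup>T *\<^sub>v y = v)"
    unfolding row_space_eq[OF A] using A by auto
  also have "\<dots> \<longleftrightarrow> v \<in> carrier_vec m \<and> (\<exists>c. \<forall>j<m. v $ j = (\<Sum>s<k. c s * rowfun A s j))"
  proof (intro conj_cong HOL.refl iffI)
    assume "v \<in> carrier_vec m" "\<exists>y\<in>carrier_vec k. A\<^sup>T *\<^sub>v y = v"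
    then obtain y where y: "y \<in> carrier_vec k" "A\<^sup>T *\<^sub>v y = v" by auto
    have "\<forall>j<m. v $ j = (\<Sum>s<k. y $ s * rowfun A s j)"
      unfolding y(2)[symmetric] using A y(1) by (simp add: scalar_prod_def rowfun_def atLeast0LessThan mult.commute)
    then show "\<exists>c. \<forall>j<m. v $ j = (\<Sum>s<k. c s * rowfun A s j)" by blast
  next
    assume v: "v \<in> carrier_vec m" "\<exists>c. \<forall>j<m. v $ j = (\<Sum>s<k. c s * rowfun A s j)"
    then obtain c where c: "\<forall>j<m. v $ j = (\<Sum>s<k. c s * rowfun A s j)" by auto
    have "A\<^sup>T *\<^sub>v vec k c = v"
      by (rule eq_vecI) (use A v c in \<open>auto simp: scalar_prod_def rowfun_def atLeast0LessThan mult.commute\<close>)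
    then show "\<exists>y\<in>carrier_vec k. A\<^sup>T *\<^sub>v y = v" by (intro bexI[of _ "vec k c"]) auto
  qed
  finally show ?thesis .
qed

lemma rows_in_row_space:
  fixes A :: "'a::field mat"
  assumes A: "A \<in> carrier_mat k m" and B: "B \<in> carrier_mat l m"
    and r: "\<And>i. i < l \<Longrightarrow> vec m (rowfun B i) \<in> vec_space.row_space m A"
  obtains G where "G \<in> carrier_mat l k" "B = G * A"
proof -
  have "\<exists>c. \<forall>j<m. rowfun B i j = (\<Sum>s<k. c s * rowfun A s j)" if "i < l" for i
    using r[OF that] unfolding row_space_iff[OF A] by auto
  then obtain c where c: "\<And>i j. i < l \<Longrightarrow> j < m \<Longrightarrow> rowfun B i j = (\<Sum>s<k. c i s * rowfun A s j)" by metis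
  define G where "G = mat l k (\<lambda>(i, s). c i s)"
  have G: "G \<in> carrier_mat l k" by (simp add: G_def)
  have "B = G * A"
  proof (rule eq_matI)
    fix i j assume "i < dim_row (G * A)" "j < dim_col (G * A)"
    then have ij: "i < l" "j < m" using G A by auto
    show "B $$ (i, j) = (G * A) $$ (i, j)"
      using rowfuns_mult[OF G A ij] c[OF ij] ij by (simp add: rowfun_def G_def)
  qed (use B G A in auto)
  then show ?thesis using that G by blast
qed

lemma row_space_mult_unit:
  fixes A :: "'a::field mat"
  assumes A: "A \<in> carrier_mat k m" and G: "G \<in> carrier_mat k k" "det G \<noteq> 0"
  shows "vec_space.row_space m (G * A) = vec_space.row_space m A"
proof -
  have "G \<in> Units (ring_mat TYPE('a) k ())" by (rule det_non_zero_imp_unit[OF G])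
  then obtain H where "H \<in> carrier_mat k k" "H * G = 1\<^sub>m k" "G * H = 1\<^sub>m k"
    unfolding Units_def ring_mat_def by auto
  then have "invertible_mat G" using G unfolding invertible_mat_def inverts_mat_def by auto
  then show ?thesis by (rule vec_space.row_space_is_preserved[OF _ G(1) A])
qed

text \<open>Vectors of a \<open>k\<close>-dimensional space that form a matrix of rank \<open>k\<close> span it.\<close>
lemma represents_of_rows:
  fixes A :: "'a::field mat"
  assumes V: "represents k m A V" and B: "B \<in> carrier_mat k m" "vec_space.rank k B = k"
    and r: "\<And>i. i < k \<Longrightarrow> vec m (rowfun B i) \<in> V"
  shows "represents k m B V" "\<exists>G\<in>carrier_mat k k. det G \<noteq> 0 \<and> B = G * A"
proof -
  have A: "A \<in> carrier_mat k m" "V = vec_space.row_space m A" using V by (auto simp: represents_def)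
  obtain G where G: "G \<in> carrier_mat k k" "B = G * A"
    using rows_in_row_space[OF A(1) B(1)] r A(2) by metis
  obtain I where I: "I \<subseteq> {..<m}" "card I = k" "plucker B I \<noteq> 0" using full_rank_plucker[OF B(1)] B(2) by auto
  then have d: "det G \<noteq> 0" using plucker_mult[OF G(1) A(1) I(1,2)] G(2) by auto
  then show "\<exists>G\<in>carrier_mat k k. det G \<noteq> 0 \<and> B = G * A" using G by blast
  show "represents k m B V" using B row_space_mult_unit[OF A(1) G(1) d] A G by (simp add: represents_def)
qed

lemma sum_select: "(i::nat) < k \<Longrightarrow> (\<Sum>s<k. (if s = i then 1 else 0) * f s) = (f i :: 'a::semiring_1)"
proof -
  assume "i < k"
  have "(\<Sum>s<k. (if s = i then 1 else 0) * f s) = (\<Sum>s<k. if s = i then f s else 0)"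
    by (rule sum.cong) auto
  then show ?thesis using \<open>i < k\<close> by (simp add: sum.delta)
qed

lemma row_in_row_space:
  fixes A :: "'a::field mat"
  assumes A: "A \<in> carrier_mat k m" and i: "i < k"
  shows "vec m (rowfun A i) \<in> vec_space.row_space m A"
proof -
  have "\<forall>j<m. vec m (rowfun A i) $ j = (\<Sum>s<k. (if s = i then 1 else 0) * rowfun A s j)"
    using sum_select[OF i, of "\<lambda>s. rowfun A s _"] by simp
  then show ?thesis unfolding row_space_iff[OF A] by (intro conjI exI[of _ "\<lambda>s. if s = i then 1 else 0"]) simp_all
qed

lemma represents_unique:
  fixes A :: "'a::field mat"
  assumes V: "represents k m A V" and W: "represents k m B V"
  obtains G where "G \<in> carrier_mat k k" "det G \<noteq> 0" "B = G * A"
proof -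
  have B: "B \<in> carrier_mat k m" "vec_space.rank k B = k" "V = vec_space.row_space m B" using W by (auto simp: represents_def)
  from represents_of_rows(2)[OF V B(1,2)] row_in_row_space[OF B(1)] B(3) that show ?thesis by blast
qed

lemma rep_represents: "V \<in> Gr k m \<Longrightarrow> represents k m (rep k m V) V"
  unfolding Gr_def rep_def by (auto intro: someI)

lemma rep_unique:
  fixes A :: "'a::field mat"
  assumes "represents k m A V"
  obtains G where "G \<in> carrier_mat k k" "det G \<noteq> 0" "rep k m V = G * A"
proof -
  have "V \<in> Gr k m" using assms by (auto simp: Gr_def)
  from represents_unique[OF assms rep_represents[OF this]] that show ?thesis by blast
qed

lemma omega_full_rank:
  fixes A :: "'a::field mat"
  assumes A: "A \<in> carrier_mat k (k + 2)" and o: "omega A f g \<noteq> 0"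
  shows "vec_space.rank k A = k"
proof -
  have "\<exists>I\<in>{I. I \<subseteq> {..<k + 2} \<and> card I = k}. plucker A I * omega_coeff (k + 2) f g I \<noteq> 0"
    using o unfolding omega_plucker[OF A] by (meson sum.not_neutral_contains_not_neutral)
  then show ?thesis using full_rank_plucker[OF A] by auto
qed

lemma omega_nonzero:
  fixes A :: "'a::field mat"
  assumes A: "A \<in> carrier_mat k (k + 2)" and r: "vec_space.rank k A = k"
  obtains f g where "omega A f g \<noteq> 0"
proof -
  let ?m = "k + 2"
  obtain J where J: "J \<subseteq> {..<?m}" "card J = k" "plucker A J \<noteq> 0" using full_rank_plucker[OF A] r by auto
  have finJ: "finite J" using J finite_subset by blast
  have "card ({..<?m} - J) = 2" using J finJ by (simp add: card_Diff_subset)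
  then obtain p q where pq: "{..<?m} - J = {p, q}" "p \<noteq> q" by (auto simp: card_2_iff)
  let ?e = "rowfun (1\<^sub>m ?m) :: nat \<Rightarrow> nat \<Rightarrow> 'a"
  have 0: "omega_coeff ?m (?e p) (?e q) I = 0" if I: "I \<subseteq> {..<?m}" "card I = k" "I \<noteq> J" for I
  proof -
    have finI: "finite I" using I finite_subset by blast
    have "\<not> I \<subseteq> J" using card_subset_eq[OF finJ, of I] I J by auto
    then have "p \<in> I \<or> q \<in> I" using I pq by auto
    then have "\<not> distinct (sorted_list_of_set I @ [p, q])" using finI by auto
    from rowdet_not_distinct[OF this, of ?e "[]"] show ?thesis by (simp add: omega_coeff_def)
  qed
  have "omega A (?e p) (?e q) = (\<Sum>I\<in>{J}. plucker A I * omega_coeff ?m (?e p) (?e q) I)"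
    unfolding omega_plucker[OF A] by (rule sum.mono_neutral_right) (use J 0 in auto)
  moreover have "omega_coeff ?m (?e p) (?e q) J \<noteq> 0"
  proof -
    have s: "sort (sorted_list_of_set J @ [p, q]) = [0..<?m]"
    proof (rule sorted_distinct_set_unique)
      show "distinct (sort (sorted_list_of_set J @ [p, q]))" using finJ pq by auto
      have "J \<union> {p, q} = {..<?m}" using pq J by auto
      then show "set (sort (sorted_list_of_set J @ [p, q])) = set [0..<?m]"
        by (simp only: set_sort set_append set_sorted_list_of_set[OF finJ] list.set set_upt atLeast0LessThan)
      show "sorted [0..<?m]" by (rule sorted_upt)
    qed (simp_all del: upt_Suc)
    have "rowdet (map ?e [0..<?m]) = 1"
      using det_rowfuns[of "1\<^sub>m ?m :: 'a mat" ?m] by (simp add: rowfuns_def del: upt_Suc)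
    then have "rowdet (map ?e (sorted_list_of_set J @ [p, q]) @ []) \<noteq> 0"
      unfolding rowdet_sort[of ?e "sorted_list_of_set J @ [p, q]"] s by simp
    then show ?thesis by (simp add: omega_coeff_def)
  qed
  ultimately have "omega A (?e p) (?e q) \<noteq> 0" using J(3) by simp
  then show ?thesis by (rule that)
qed

text \<open>Complete the rows of \<open>A\<close> to a basis by two vectors \<open>u\<close>, \<open>w\<close>. The form \<open>omega A\<close> is alternating and vanishes on the rows, so it
is the determinant of the last two coordinates in that basis, while the row space is where both of them vanish.\<close>
lemma omega_rank_two:
  fixes A :: "'a::field mat"
  assumes A: "A \<in> carrier_mat k (k + 2)" and r: "vec_space.rank k A = k"
  obtains l m where
    "\<And>f g. omega A f g = (\<Sum>j<k+2. f j * l j) * (\<Sum>j<k+2. g j * m j) - (\<Sum>j<k+2. f j * m j) * (\<Sum>j<k+2. g j * l j)"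
    "\<And>f. vec (k + 2) f \<in> vec_space.row_space (k + 2) A \<longleftrightarrow> (\<Sum>j<k+2. f j * l j) = 0 \<and> (\<Sum>j<k+2. f j * m j) = 0"
proof -
  let ?n = "k + 2"
  obtain u w where uw: "omega A u w \<noteq> 0" using omega_nonzero[OF A r] .
  define G where "G = mat ?n ?n (\<lambda>(i, j). ((rowfuns A @ [u, w]) ! i) j)"
  have G: "G \<in> carrier_mat ?n ?n" by (simp add: G_def)
  have dG: "det G = omega A u w" using A by (simp add: G_def omega_def rowdet_def)
  then have "G \<in> Units (ring_mat TYPE('a) ?n ())" using uw by (intro det_non_zero_imp_unit[OF G]) simp
  then obtain H where H: "H \<in> carrier_mat ?n ?n" "H * G = 1\<^sub>m ?n" "G * H = 1\<^sub>m ?n"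
    unfolding Units_def ring_mat_def by auto
  have dk: "dim_row A = k" using A by simp
  have rG: "rowfun G i j = (if i < k then rowfun A i j else if i = k then u j else w j)" if "i < ?n" "j < ?n" for i j
    using that A by (auto simp: rowfun_def G_def nth_append nth_Cons')
  \<comment> \<open>\<open>c f s\<close> is the coordinate of \<open>f\<close> at the row \<open>s\<close> of the basis \<open>G\<close>.\<close>
  define c where "c f s = (\<Sum>j<?n. f j * H $$ (j, s))" for f s
  have dec: "f j = (\<Sum>s<?n. c f s * rowfun G s j)" if j: "j < ?n" for f j
  proof -
    have "(\<Sum>s<?n. c f s * rowfun G s j) = (\<Sum>i<?n. f i * (\<Sum>s<?n. H $$ (i, s) * rowfun G s j))"
      unfolding c_def sum_distrib_left sum_distrib_right by (subst sum.swap) (simp add: mult.assoc)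
    also have "\<dots> = (\<Sum>i<?n. f i * rowfun (1\<^sub>m ?n) i j)"
      using rowfuns_mult[OF H(1) G _ j] H(2) by (intro sum.cong[OF HOL.refl]) (simp add: rowfun_def)
    also have "\<dots> = f j" using j by (simp add: rowfun_def if_distrib[of "\<lambda>x. _ * x"] cong: if_cong)
    finally show ?thesis by simp
  qed
  have dec2: "f j = (\<Sum>s<k. c f s * rowfun A s j) + c f k * u j + c f (Suc k) * w j" if j: "j < ?n" for f j
    using dec[OF j, of f] rG[OF _ j] by simp
  have key: "omega A f g = (c f k * c g (Suc k) - c f (Suc k) * c g k) * omega A u w" for f g
  proof -
    have row0: "omega A (rowfun G s) h = 0" "omega A h (rowfun G s) = 0" if "s < k" for s h
      using omega_row[of s A] omega_cong[OF A, of "rowfun G s" "rowfun A s" h h] omega_cong[OF A, of h h "rowfun G s" "rowfun A s"] rG that dk by auto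
    have ru: "omega A (rowfun G k) h = omega A u h" "omega A (rowfun G (Suc k)) h = omega A w h"
      "omega A h (rowfun G k) = omega A h u" "omega A h (rowfun G (Suc k)) = omega A h w" for h
      by (rule omega_cong[OF A]; simp add: rG)+
    have "omega A f g = omega A (\<lambda>j. \<Sum>s<?n. c f s * rowfun G s j) (\<lambda>j. \<Sum>s<?n. c g s * rowfun G s j)"
      by (rule omega_cong[OF A]) (use dec in auto)
    also have "\<dots> = (\<Sum>s<?n. c f s * (\<Sum>t<?n. c g t * omega A (rowfun G s) (rowfun G t)))"
      unfolding omega_linear1 omega_linear2 ..
    also have "\<dots> = (c f k * c g (Suc k) - c f (Suc k) * c g k) * omega A u w"
      using omega_self[of A u] omega_self[of A w] omega_swap[of A w u] by (simp add: row0 ru algebra_simps)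
    finally show ?thesis .
  qed
  define l where "l j = H $$ (j, k) * omega A u w" for j
  define m where "m j = H $$ (j, Suc k)" for j
  have cl: "(\<Sum>j<?n. f j * l j) = c f k * omega A u w" "(\<Sum>j<?n. f j * m j) = c f (Suc k)" for f
    unfolding c_def l_def m_def sum_distrib_right by (simp_all add: mult.assoc)
  show ?thesis
  proof (rule that[of l m])
    show "omega A f g = (\<Sum>j<?n. f j * l j) * (\<Sum>j<?n. g j * m j) - (\<Sum>j<?n. f j * m j) * (\<Sum>j<?n. g j * l j)" for f g
      unfolding cl by (subst key) (simp add: algebra_simps)
    show "vec ?n f \<in> vec_space.row_space ?n A \<longleftrightarrow> (\<Sum>j<?n. f j * l j) = 0 \<and> (\<Sum>j<?n. f j * m j) = 0" for f
    proof
      assume "vec ?n f \<in> vec_space.row_space ?n A"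
      then obtain d where d: "\<And>j. j < ?n \<Longrightarrow> f j = (\<Sum>s<k. d s * rowfun A s j)" unfolding row_space_iff[OF A] by auto
      have z: "omega A f g = 0" for g
      proof -
        have "omega A f g = omega A (\<lambda>j. \<Sum>s<k. d s * rowfun A s j) g" by (rule omega_cong[OF A]) (use d in auto)
        then show ?thesis unfolding omega_linear1 using omega_row(1)[of _ A g] dk by simp
      qed
      have "c u s = of_bool (s = k)" "c w s = of_bool (s = Suc k)" if "s < ?n" for s
      proof -
        have "c (rowfun G i) s = of_bool (s = i)" if "i < ?n" for i
        proof -
          have "c (rowfun G i) s = rowfun (G * H) i s" using rowfuns_mult[OF G H(1) that \<open>s < ?n\<close>] by (simp add: c_def rowfun_def)
          then show ?thesis using H(3) that \<open>s < ?n\<close> by (simp add: rowfun_def)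
        qed
        from this[of k] this[of "Suc k"]
        show "c u s = of_bool (s = k)" "c w s = of_bool (s = Suc k)" by (simp_all add: c_def rG)
      qed
      from this[of k] this[of "Suc k"]
      have "omega A f w = c f k * omega A u w" "omega A u f = c f (Suc k) * omega A u w"
        using key[of f w] key[of u f] by simp_all
      then show "(\<Sum>j<?n. f j * l j) = 0 \<and> (\<Sum>j<?n. f j * m j) = 0"
        unfolding cl using z omega_swap[of A u f] uw by auto
    next
      assume "(\<Sum>j<?n. f j * l j) = 0 \<and> (\<Sum>j<?n. f j * m j) = 0"
      then have "c f k = 0" "c f (Suc k) = 0" unfolding cl using uw by auto
      then show "vec ?n f \<in> vec_space.row_space ?n A" unfolding row_space_iff[OF A] using dec2[of _ f] by auto
    qed
  qed
qed

section \<open>Signs of the relations attached to triangles\<close>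

text \<open>The weight of the side opposite to \<open>v\<close>.\<close>
definition triangle_weight :: "(arc \<Rightarrow> 'a::zero) \<Rightarrow> nat set \<Rightarrow> nat \<Rightarrow> 'a" where
  "triangle_weight x t v = (if v = Min t then x (mid t, Max t) else if v = mid t then x (Min t, Max t)
     else if v = Max t then x (Min t, mid t) else 0)"

text \<open>The coefficients of the relation \<open>x\<^sub>b\<^sub>c Z\<^sub>a - x\<^sub>a\<^sub>c Z\<^sub>b + x\<^sub>a\<^sub>b Z\<^sub>c\<close> of the triangle \<open>a < b < c\<close>.\<close>
definition triangle_relation :: "(arc \<Rightarrow> 'a::ab_group_add) \<Rightarrow> nat set \<Rightarrow> nat \<Rightarrow> 'a" where
  "triangle_relation x t v = (if v = mid t then - triangle_weight x t v else triangle_weight x t v)"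

definition relation_matrix :: "nat \<Rightarrow> nat \<Rightarrow> (nat \<Rightarrow> nat set) \<Rightarrow> (arc \<Rightarrow> 'a::ab_group_add) \<Rightarrow> 'a mat" where
  "relation_matrix k n \<tau> x = mat k n (\<lambda>(i, v). triangle_relation x (\<tau> i) v)"

text \<open>The area for a bare set of triangles, so that signs can be studied before subdivisions enter.\<close>
definition area_of :: "nat set set \<Rightarrow> arc \<Rightarrow> nat" where
  "area_of B e = card {t \<in> B. t \<subseteq> {fst e..snd e}}"

text \<open>The condition on index sets in the definition of the positroid cell.\<close>
definition matched :: "nat set set \<Rightarrow> nat set \<Rightarrow> bool" where
  "matched B I \<longleftrightarrow> (\<exists>\<phi>. bij_betw \<phi> I B \<and> (\<forall>i\<in>I. i \<in> \<phi> i))"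

text \<open>The number of times \<open>t'\<close> is counted in the exponent of the sign of the entry of \<open>t\<close> in column \<open>v\<close>, that is, in the area of
the side opposite to \<open>v\<close>. For the middle vertex this side is the long one; its area is one more than that of the two short
sides, and the additional \<open>1\<close> compensates for the minus sign in the relation.\<close>
definition hides :: "nat set \<Rightarrow> nat set \<Rightarrow> nat \<Rightarrow> nat" where
  "hides t t' v = (if v = Min t then of_bool (t' \<subseteq> {mid t..Max t})
     else if v = mid t then of_bool (t' \<subseteq> {Min t..mid t}) + of_bool (t' \<subseteq> {mid t..Max t})
     else of_bool (t' \<subseteq> {Min t..mid t}))"

text \<open>Two triangles of a triangulation are separated by a side of one of them.\<close>
lemma triangle_positions:
  assumes n: "noncrossing E" and o: "a < b" "b < c" "a' < b'" "b' < c'"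
    and t: "{a, b, c} \<in> triangles E" and t': "{a', b', c'} \<in> triangles E" and ne: "{a, b, c} \<noteq> {a', b', c'}"
  shows "(a \<le> a' \<and> c' \<le> b) \<or> (b \<le> a' \<and> c' \<le> c) \<or> (a' \<le> a \<and> c \<le> b') \<or> (b' \<le> a \<and> c \<le> c') \<or> c \<le> a' \<or> c' \<le> a"
proof -
  have arcs: "(a, b) \<in> E" "(b, c) \<in> E" "(a, c) \<in> E"
    using t by (auto elim!: trianglesE simp: triangle_simps[OF o(1,2)] dest: arg_cong[of _ _ chords])
  have arcs': "(a', b') \<in> E" "(b', c') \<in> E" "(a', c') \<in> E"
    using t' by (auto elim!: trianglesE simp: triangle_simps[OF o(3,4)] dest: arg_cong[of _ _ chords])
  note N = noncrossingD[OF n]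
  have ne': "\<not> (a = a' \<and> b = b' \<and> c = c')" using ne by auto
  have 1: "\<not> (a' < a \<and> a < c' \<and> c' < b)" using N[of a' c' a b] arcs arcs' by blast
  show ?thesis
  proof (rule ccontr)
    assume no: "\<not> ?thesis"
    have s: "{a', b', c'} \<subseteq> {u..w} \<or> {a', b', c'} \<inter> {u<..<w} = {}" if "(u, w) \<in> E" for u w
      by (rule triangle_arc_side[OF n that t'])
    have s': "{a, b, c} \<subseteq> {u..w} \<or> {a, b, c} \<inter> {u<..<w} = {}" if "(u, w) \<in> E" for u w
      by (rule triangle_arc_side[OF n that t])
    have d1: "{a', b', c'} \<inter> {a<..<b} = {}" using s[OF arcs(1)] no o by auto
    have d2: "{a', b', c'} \<inter> {b<..<c} = {}" using s[OF arcs(2)] no o by auto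
    have d3: "{a', b', c'} \<subseteq> {a..c} \<or> {a', b', c'} \<inter> {a<..<c} = {}" by (rule s[OF arcs(3)])
    have d1': "{a, b, c} \<inter> {a'<..<b'} = {}" using s'[OF arcs'(1)] no o by auto
    have d2': "{a, b, c} \<inter> {b'<..<c'} = {}" using s'[OF arcs'(2)] no o by auto
    have "a' < c" "a < c'" using no by auto
    have A: "a' \<le> a \<or> a' = b" using d1 d2 \<open>a' < c\<close> by (auto simp: not_less)
    have C: "c' = b \<or> c \<le> c'" using d1 d2 \<open>a < c'\<close> by (auto simp: not_less)
    show False
      using A C d1 d2 d3 d1' d2' no o ne' by (elim disjE) (auto simp: not_le not_less)
  qed
qed

text \<open>The key sign computation. When one vertex is chosen in each of two triangles, the order of the two vertices and the area
signs caused by the other triangle vary together: their total parity depends on the relative position of the triangles only.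
In each of the six positions this is a check of the nine choices.\<close>
lemma triangle_pair_parity:
  assumes n: "noncrossing E" and t: "t \<in> triangles E" "t' \<in> triangles E" "t \<noteq> t'"
  obtains \<kappa> :: nat where "\<And>v v'. v \<in> t \<Longrightarrow> v' \<in> t' \<Longrightarrow> v \<noteq> v' \<Longrightarrow>
    even (of_bool (v' < v) + hides t t' v + hides t' t v' + \<kappa>)"
proof -
  from t(1) obtain a b c where a: "t = {a, b, c}" "a < b" "b < c" "Min t = a" "mid t = b" "Max t = c" by (rule trianglesE)
  from t(2) obtain a' b' c' where a': "t' = {a', b', c'}" "a' < b'" "b' < c'" "Min t' = a'" "mid t' = b'" "Max t' = c'" by (rule trianglesE)
  have h: "hides t t' v = (if v = a then of_bool (b \<le> a' \<and> c' \<le> c)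
     else if v = b then of_bool (a \<le> a' \<and> c' \<le> b) + of_bool (b \<le> a' \<and> c' \<le> c)
     else of_bool (a \<le> a' \<and> c' \<le> b))" for v
    unfolding hides_def a(4-6) a'(1) using a'(2,3) by auto
  have h': "hides t' t v = (if v = a' then of_bool (b' \<le> a \<and> c \<le> c')
     else if v = b' then of_bool (a' \<le> a \<and> c \<le> b') + of_bool (b' \<le> a \<and> c \<le> c')
     else of_bool (a' \<le> a \<and> c \<le> b'))" for v
    unfolding hides_def a'(4-6) a(1) using a(2,3) by auto
  note o = a(2,3) a'(2,3)
  have tt: "v = a \<or> v = b \<or> v = c" if "v \<in> t" for v using that a by auto
  have tt': "v = a' \<or> v = b' \<or> v = c'" if "v \<in> t'" for v using that a' by auto
  consider "a \<le> a'" "c' \<le> b" | "b \<le> a'" "c' \<le> c" | "a' \<le> a" "c \<le> b'" | "b' \<le> a" "c \<le> c'" | "c \<le> a'" | "c' \<le> a"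
    using triangle_positions[OF n o, folded a(1) a'(1), OF t] by blast
  then show ?thesis
  proof cases
    case 1
    show ?thesis by (rule that[of 0], drule tt, drule tt') (use 1 o in \<open>elim disjE; simp add: h h'\<close>)
  next
    case 2
    show ?thesis by (rule that[of 1], drule tt, drule tt') (use 2 o in \<open>elim disjE; simp add: h h'\<close>)
  next
    case 3
    show ?thesis by (rule that[of 1], drule tt, drule tt') (use 3 o in \<open>elim disjE; simp add: h h'\<close>)
  next
    case 4
    show ?thesis by (rule that[of 0], drule tt, drule tt') (use 4 o in \<open>elim disjE; simp add: h h'\<close>)
  next
    case 5
    show ?thesis by (rule that[of 0], drule tt, drule tt') (use 5 o in \<open>elim disjE; simp add: h h'\<close>)
  next
    case 6
    show ?thesis by (rule that[of 1], drule tt, drule tt') (use 6 o in \<open>elim disjE; simp add: h h'\<close>)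
  qed
qed

text \<open>The triangles below the long side lie below one of the short sides, or are \<open>t\<close> itself.\<close>
lemma area_triangle:
  assumes n: "noncrossing E" and B: "B \<subseteq> triangles E" "finite B" and t: "t \<in> B"
  shows "area_of B (Min t, Max t) = area_of B (Min t, mid t) + area_of B (mid t, Max t) + 1"
proof -
  have "t \<in> triangles E" using t B by auto
  then obtain a b c where a: "t = {a, b, c}" "a < b" "b < c" "(a, b) \<in> E" "(b, c) \<in> E" "(a, c) \<in> E" "Min t = a" "mid t = b" "Max t = c"
    by (rule trianglesE)
  have S: "{s \<in> B. s \<subseteq> {a..c}} = {s \<in> B. s \<subseteq> {a..b}} \<union> {s \<in> B. s \<subseteq> {b..c}} \<union> {t}"
  proof (intro equalityI subsetI)
    fix s assume s: "s \<in> {s \<in> B. s \<subseteq> {a..c}}"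
    then have "s \<in> triangles E" using B by auto
    then obtain x y z where x: "s = {x, y, z}" "x < y" "y < z" by (rule trianglesE)
    have "s = t \<or> s \<subseteq> {a..b} \<or> s \<subseteq> {b..c}"
    proof (rule ccontr)
      assume no: "\<not> ?thesis"
      then have ne: "{a, b, c} \<noteq> {x, y, z}" using a(1) x(1) by auto
      have "a \<le> x" "z \<le> c" using s x by auto
      moreover have "\<not> z \<le> b" "\<not> b \<le> x" using no x calculation by auto
      ultimately show False
        using triangle_positions[OF n a(2,3) x(2,3) _ _ ne] x a s \<open>s \<in> triangles E\<close> \<open>t \<in> triangles E\<close> by auto
    qed
    then show "s \<in> {s \<in> B. s \<subseteq> {a..b}} \<union> {s \<in> B. s \<subseteq> {b..c}} \<union> {t}" using s by auto
  qed (use a t in auto)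
  have d1: "{s \<in> B. s \<subseteq> {a..b}} \<inter> {s \<in> B. s \<subseteq> {b..c}} = {}"
  proof (rule equals0I)
    fix s assume s: "s \<in> {s \<in> B. s \<subseteq> {a..b}} \<inter> {s \<in> B. s \<subseteq> {b..c}}"
    then have "s \<in> triangles E" using B by auto
    then obtain x y z where x: "s = {x, y, z}" "x < y" "y < z" by (rule trianglesE)
    then show False using s by auto
  qed
  have d2: "({s \<in> B. s \<subseteq> {a..b}} \<union> {s \<in> B. s \<subseteq> {b..c}}) \<inter> {t} = {}" using a by auto
  have "card {s \<in> B. s \<subseteq> {a..c}} = card {s \<in> B. s \<subseteq> {a..b}} + card {s \<in> B. s \<subseteq> {b..c}} + 1"
    unfolding S using B(2) d1 d2 by (subst card_Un_disjoint; simp add: card_Un_disjoint)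
  then show ?thesis unfolding area_of_def a(7-9) by simp
qed

text \<open>The middle column is the delicate one: by \<open>area_triangle\<close> the sign of the long side and the minus sign of the relation
combine to the signs of the two short sides.\<close>
lemma triangle_relation_sign:
  fixes x :: "arc \<Rightarrow> real"
  assumes n: "noncrossing E" and B: "B \<subseteq> triangles E" "finite B" and t: "t \<in> B" and v: "v \<in> t"
  shows "triangle_relation (\<lambda>e. (-1) ^ area_of B e * x e) t v = (\<Prod>t'\<in>B. (-1) ^ hides t t' v) * triangle_weight x t v"
proof -
  have "t \<in> triangles E" using t B by auto
  then obtain a b c where a: "t = {a, b, c}" "a < b" "b < c" "Min t = a" "mid t = b" "Max t = c"
    by (rule trianglesE)
  have ar: "area_of B (u, w) = (\<Sum>t'\<in>B. of_bool (t' \<subseteq> {u..w}))" for u w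
    unfolding area_of_def using B(2) by (simp add: Int_def)
  have h: "(\<Prod>t'\<in>B. (-1::real) ^ hides t t' v) = (-1) ^ (\<Sum>t'\<in>B. hides t t' v)" by (simp add: power_sum)
  have "v = a \<or> v = b \<or> v = c" using v a by auto
  then show ?thesis
  proof (elim disjE)
    assume "v = a"
    then show ?thesis unfolding h using a by (simp add: triangle_relation_def triangle_weight_def hides_def ar[of b c])
  next
    assume "v = c"
    then show ?thesis unfolding h using a by (simp add: triangle_relation_def triangle_weight_def hides_def ar[of a b])
  next
    assume v: "v = b"
    have "(\<Sum>t'\<in>B. hides t t' v) = area_of B (a, b) + area_of B (b, c)"
      unfolding ar sum.distrib[symmetric] using v a by (intro sum.cong) (auto simp: hides_def)
    moreover have "area_of B (a, c) = area_of B (a, b) + area_of B (b, c) + 1" using area_triangle[OF n B t] a by simp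
    ultimately show ?thesis unfolding h using a v by (simp add: triangle_relation_def triangle_weight_def)
  qed
qed

text \<open>A product over ordered pairs, grouped by unordered pairs.\<close>
lemma prod_square:
  fixes g :: "nat \<Rightarrow> nat \<Rightarrow> 'a::comm_monoid_mult"
  shows "(\<Prod>i<k. \<Prod>j<k. g i j) = (\<Prod>j<k. \<Prod>i<j. g i j * g j i) * (\<Prod>i<k. g i i)"
  by (induction k) (simp_all add: prod.distrib mult_ac)

lemma hides_self: "t \<in> triangles E \<Longrightarrow> hides t t v = 0"
  by (erule trianglesE) (auto simp: hides_def)

locale black_triangles =
  fixes E :: "arc set" and B :: "nat set set" and k n :: nat and \<tau> :: "nat \<Rightarrow> nat set"
  assumes nE: "noncrossing E" and BE: "B \<subseteq> triangles E" and \<tau>: "bij_betw \<tau> {..<k} B" and En: "E \<subseteq> chords {..<n}"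
begin

lemma fin: "finite B" using \<tau> by (simp add: bij_betw_finite[symmetric])

lemma \<tau>B: "i < k \<Longrightarrow> \<tau> i \<in> B" using \<tau> by (auto simp: bij_betw_def)

lemma \<tau>E: "i < k \<Longrightarrow> \<tau> i \<in> triangles E" using \<tau>B BE by auto

lemma B_vertices: "t \<in> B \<Longrightarrow> t \<subseteq> {..<n}" using BE triangles_subset[OF En] by blast

text \<open>Each term of the Leibniz expansion of a minor of the relation matrix has the same sign \<open>\<sigma>\<close>, whichever minor it belongs to:
by \<open>triangle_pair_parity\<close> the pair of triangles \<open>i < j\<close> contributes the fixed sign \<open>(-1) ^ \<kappa> i j\<close>.\<close>
lemma term_sign:
  obtains \<sigma> :: real where "\<sigma> = 1 \<or> \<sigma> = -1"
    and "\<And>(x :: arc \<Rightarrow> real) f. (\<And>i. i < k \<Longrightarrow> f i \<in> \<tau> i) \<Longrightarrow> inj_on f {..<k} \<Longrightarrow>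
      (-1) ^ inversions (map f [0..<k]) * (\<Prod>i<k. triangle_relation (\<lambda>e. (-1) ^ area_of B e * x e) (\<tau> i) (f i))
      = \<sigma> * (\<Prod>i<k. triangle_weight x (\<tau> i) (f i))"
proof -
  have "\<exists>\<kappa>::nat. \<forall>v v'. v \<in> \<tau> i \<longrightarrow> v' \<in> \<tau> j \<longrightarrow> v \<noteq> v' \<longrightarrow> even (of_bool (v' < v) + hides (\<tau> i) (\<tau> j) v + hides (\<tau> j) (\<tau> i) v' + \<kappa>)"
    if "i < j" "j < k" for i j
  proof -
    have "\<tau> i \<noteq> \<tau> j" using inj_onD[OF bij_betw_imp_inj_on[OF \<tau>], of i j] that by auto
    then show ?thesis using triangle_pair_parity[OF nE \<tau>E[of i] \<tau>E[of j]] that by (metis less_trans)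
  qed
  then obtain \<kappa> :: "nat \<Rightarrow> nat \<Rightarrow> nat" where \<kappa>: "\<And>i j v v'. i < j \<Longrightarrow> j < k \<Longrightarrow> v \<in> \<tau> i \<Longrightarrow> v' \<in> \<tau> j \<Longrightarrow> v \<noteq> v' \<Longrightarrow>
     even (of_bool (v' < v) + hides (\<tau> i) (\<tau> j) v + hides (\<tau> j) (\<tau> i) v' + \<kappa> i j)" by metis
  \<comment> \<open>The signs of the pairs of triangles multiply to the common sign of all terms.\<close>
  define \<sigma> :: real where "\<sigma> = (\<Prod>j<k. \<Prod>i<j. (-1) ^ \<kappa> i j)"
  have s1: "\<sigma> = 1 \<or> \<sigma> = -1"
  proof -
    have "\<sigma> = (-1) ^ (\<Sum>j<k. \<Sum>i<j. \<kappa> i j)" unfolding \<sigma>_def by (simp add: power_sum)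
    then show ?thesis by (metis minus_one_power_iff)
  qed
  show ?thesis
  proof (rule that[OF s1])
    fix x :: "arc \<Rightarrow> real" and f assume f: "\<And>i. i < k \<Longrightarrow> f i \<in> \<tau> i" and inj: "inj_on f {..<k}"
    let ?h = "\<lambda>i j. (-1::real) ^ hides (\<tau> i) (\<tau> j) (f i)"
    have "(\<Prod>i<k. triangle_relation (\<lambda>e. (-1) ^ area_of B e * x e) (\<tau> i) (f i)) =
       (\<Prod>i<k. (\<Prod>j<k. ?h i j) * triangle_weight x (\<tau> i) (f i))"
    proof (rule prod.cong[OF HOL.refl])
      fix i assume i: "i \<in> {..<k}"
      have "(\<Prod>t'\<in>B. (-1::real) ^ hides (\<tau> i) t' (f i)) = (\<Prod>j<k. ?h i j)"
        using prod.reindex_bij_betw[OF \<tau>, of "\<lambda>t'. (-1::real) ^ hides (\<tau> i) t' (f i)"] by simp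
      then show "triangle_relation (\<lambda>e. (-1) ^ area_of B e * x e) (\<tau> i) (f i) = (\<Prod>j<k. ?h i j) * triangle_weight x (\<tau> i) (f i)"
        using triangle_relation_sign[OF nE BE fin, of "\<tau> i" "f i" x] \<tau>B f i by simp
    qed
    also have "\<dots> = (\<Prod>i<k. \<Prod>j<k. ?h i j) * (\<Prod>i<k. triangle_weight x (\<tau> i) (f i))" by (rule prod.distrib)
    also have "(\<Prod>i<k. \<Prod>j<k. ?h i j) = (\<Prod>j<k. \<Prod>i<j. ?h i j * ?h j i)"
    proof -
      have "(\<Prod>i<k. ?h i i) = 1" by (rule prod.neutral) (simp add: hides_self[OF \<tau>E])
      then show ?thesis unfolding prod_square by simp
    qed
    finally have p: "(\<Prod>i<k. triangle_relation (\<lambda>e. (-1) ^ area_of B e * x e) (\<tau> i) (f i)) =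
       (\<Prod>j<k. \<Prod>i<j. ?h i j * ?h j i) * (\<Prod>i<k. triangle_weight x (\<tau> i) (f i))" .
    have "(-1::real) ^ inversions (map f [0..<k]) * (\<Prod>j<k. \<Prod>i<j. ?h i j * ?h j i) =
       (\<Prod>j<k. \<Prod>i<j. (-1) ^ of_bool (f j < f i) * (?h i j * ?h j i))"
      unfolding inversions_map by (simp add: power_sum prod.distrib del: sum_of_bool_eq)
    also have "\<dots> = \<sigma>"
      unfolding \<sigma>_def
    proof (intro prod.cong[OF HOL.refl])
      fix j i assume ij: "j \<in> {..<k}" "i \<in> {..<j}"
      have "f i \<noteq> f j" using inj ij by (auto simp: inj_on_def)
      then have "even (of_bool (f j < f i) + hides (\<tau> i) (\<tau> j) (f i) + hides (\<tau> j) (\<tau> i) (f j) + \<kappa> i j)"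
        using \<kappa>[of i j "f i" "f j"] f ij by auto
      then have "(-1::real) ^ (of_bool (f j < f i) + hides (\<tau> i) (\<tau> j) (f i) + hides (\<tau> j) (\<tau> i) (f j)) = (-1) ^ \<kappa> i j"
        by (simp only: minus_one_power_iff even_add)
      then show "(-1) ^ of_bool (f j < f i) * (?h i j * ?h j i) = (-1) ^ \<kappa> i j" by (simp only: power_add mult.assoc)
    qed
    finally show "(-1) ^ inversions (map f [0..<k]) * (\<Prod>i<k. triangle_relation (\<lambda>e. (-1) ^ area_of B e * x e) (\<tau> i) (f i))
      = \<sigma> * (\<Prod>i<k. triangle_weight x (\<tau> i) (f i))"
      unfolding p by (simp only: mult.assoc[symmetric])
  qed
qed

end

lemma plucker_orderings:
  fixes M :: "'a::field mat"
  assumes "M \<in> carrier_mat k n" "I \<subseteq> {..<n}" "card I = k"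
  shows "plucker M I = (\<Sum>xs\<in>orderings I. (-1) ^ inversions xs * (\<Prod>i<k. M $$ (i, xs ! i)))"
  unfolding plucker_signed_minor[OF assms] signed_minor_def by simp

lemma finite_orderings: "finite I \<Longrightarrow> finite (orderings I)"
  by (rule finite_subset[OF _ finite_lists_length_eq[of I "card I"]]) (auto simp: orderings_def distinct_card)

lemma minor_rows:
  assumes Z: "Z \<in> carrier_mat n m" and J: "J \<subseteq> {..<n}" "card J = m"
  shows "det (submatrix Z J UNIV) = rowdet (map (rowfun Z) (sorted_list_of_set J))"
proof -
  have fin: "finite J" using J(1) finite_subset by blast
  have c: "{j. j < n \<and> j \<in> J} = J" using J by auto
  have "submatrix Z J UNIV = mat m m (\<lambda>(i, j). (map (rowfun Z) (sorted_list_of_set J) ! i) j)"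
    by (rule eq_matI) (use Z J fin in \<open>auto simp: submatrix_def c pick_UNIV pick_sorted_list_of_set rowfun_def\<close>)
  then show ?thesis using J fin by (simp add: rowdet_def)
qed

context black_triangles
begin

lemma triangle_weight_pos:
  assumes t: "t \<in> B" and x: "\<And>e. e \<in> (\<Union>t\<in>B. chords t) \<Longrightarrow> (x e :: real) > 0"
  shows "v \<in> t \<Longrightarrow> triangle_weight x t v > 0" "v \<notin> t \<Longrightarrow> triangle_weight x t v = 0"
proof -
  have "t \<in> triangles E" using t BE by auto
  then obtain a b c where a: "t = {a, b, c}" "a < b" "b < c" "Min t = a" "mid t = b" "Max t = c" "chords t = {(a, b), (b, c), (a, c)}"
    by (rule trianglesE)
  have "x (a, b) > 0" "x (b, c) > 0" "x (a, c) > 0" using x t a by blast+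
  then show "v \<in> t \<Longrightarrow> triangle_weight x t v > 0" "v \<notin> t \<Longrightarrow> triangle_weight x t v = 0"
    using a by (auto simp: triangle_weight_def)
qed

lemma matched_iff_ordering:
  assumes "finite I" "card I = k"
  shows "matched B I \<longleftrightarrow> (\<exists>xs\<in>orderings I. \<forall>i<k. xs ! i \<in> \<tau> i)"
proof
  assume "matched B I"
  then obtain \<phi> where \<phi>: "bij_betw \<phi> I B" "\<forall>i\<in>I. i \<in> \<phi> i" by (auto simp: matched_def)
  define f where "f i = inv_into I \<phi> (\<tau> i)" for i
  have b: "bij_betw f {..<k} I" unfolding f_def[abs_def]
    using bij_betw_trans[OF \<tau> bij_betw_inv_into[OF \<phi>(1)]] by (simp add: comp_def)
  have "map f [0..<k] \<in> orderings I"
    using b by (auto simp: orderings_def distinct_map bij_betw_def atLeast0LessThan)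
  moreover have "f i \<in> \<tau> i" if "i < k" for i
  proof -
    have "\<phi> (f i) = \<tau> i" unfolding f_def using bij_betw_inv_into_right[OF \<phi>(1) \<tau>B[OF that]] .
    moreover have "f i \<in> I" using b that by (auto simp: bij_betw_def)
    ultimately show ?thesis using \<phi>(2) by metis
  qed
  ultimately show "\<exists>xs\<in>orderings I. \<forall>i<k. xs ! i \<in> \<tau> i" by (intro bexI[of _ "map f [0..<k]"]) auto
next
  assume "\<exists>xs\<in>orderings I. \<forall>i<k. xs ! i \<in> \<tau> i"
  then obtain xs where xs: "distinct xs" "set xs = I" "\<And>i. i < k \<Longrightarrow> xs ! i \<in> \<tau> i" by (auto simp: orderings_def)
  have len: "length xs = k" using xs assms distinct_card by fastforce
  have b: "bij_betw ((!) xs) {..<k} I" using bij_betw_nth[OF xs(1)] xs(2) len by auto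
  have "bij_betw (\<tau> \<circ> inv_into {..<k} ((!) xs)) I B" by (rule bij_betw_trans[OF bij_betw_inv_into[OF b] \<tau>])
  moreover have "\<forall>v\<in>I. v \<in> (\<tau> \<circ> inv_into {..<k} ((!) xs)) v"
  proof
    fix v assume v: "v \<in> I"
    have "xs ! inv_into {..<k} ((!) xs) v = v" using bij_betw_inv_into_right[OF b v] .
    moreover have "inv_into {..<k} ((!) xs) v < k" using bij_betw_inv_into[OF b] v by (auto simp: bij_betw_def)
    ultimately show "v \<in> (\<tau> \<circ> inv_into {..<k} ((!) xs)) v" using xs(3) by (metis comp_apply)
  qed
  ultimately show "matched B I" unfolding matched_def by blast
qed

text \<open>With positive weights the terms of a minor cannot cancel, so the minor vanishes only if there is no term at all, which
means that the columns cannot be matched to the black triangles.\<close>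
lemma relation_matrix_pluckers:
  obtains \<sigma> :: real where "\<sigma> = 1 \<or> \<sigma> = -1"
    and "\<And>x I. (\<And>e. e \<in> (\<Union>t\<in>B. chords t) \<Longrightarrow> (x e :: real) > 0) \<Longrightarrow> I \<subseteq> {..<n} \<Longrightarrow> card I = k \<Longrightarrow>
      (matched B I \<longrightarrow> \<sigma> * plucker (relation_matrix k n \<tau> (\<lambda>e. (-1) ^ area_of B e * x e)) I > 0) \<and>
      (\<not> matched B I \<longrightarrow> plucker (relation_matrix k n \<tau> (\<lambda>e. (-1) ^ area_of B e * x e)) I = 0)"
proof -
  from term_sign obtain \<sigma> :: real where s: "\<sigma> = 1 \<or> \<sigma> = -1"
    and T: "\<And>(x :: arc \<Rightarrow> real) f. (\<And>i. i < k \<Longrightarrow> f i \<in> \<tau> i) \<Longrightarrow> inj_on f {..<k} \<Longrightarrow>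
      (-1) ^ inversions (map f [0..<k]) * (\<Prod>i<k. triangle_relation (\<lambda>e. (-1) ^ area_of B e * x e) (\<tau> i) (f i))
      = \<sigma> * (\<Prod>i<k. triangle_weight x (\<tau> i) (f i))" by blast
  show ?thesis
  proof (rule that[OF s])
    fix x :: "arc \<Rightarrow> real" and I
    assume x: "\<And>e. e \<in> (\<Union>t\<in>B. chords t) \<Longrightarrow> x e > 0" and I: "I \<subseteq> {..<n}" "card I = k"
    let ?w = "\<lambda>e. (-1) ^ area_of B e * x e"
    let ?M = "relation_matrix k n \<tau> ?w"
    have fin: "finite I" using I finite_subset by blast
    have M: "?M \<in> carrier_mat k n" by (simp add: relation_matrix_def)
    have len: "length xs = k" if "xs \<in> orderings I" for xs using that I distinct_card by (fastforce simp: orderings_def)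
    have entry: "?M $$ (i, xs ! i) = triangle_relation ?w (\<tau> i) (xs ! i)" if "xs \<in> orderings I" "i < k" for xs i
    proof -
      have "xs ! i \<in> I" using that len[OF that(1)] by (auto simp: orderings_def)
      then show ?thesis using that I by (auto simp: relation_matrix_def)
    qed
    have tm: "(-1) ^ inversions xs * (\<Prod>i<k. ?M $$ (i, xs ! i)) = \<sigma> * (\<Prod>i<k. triangle_weight x (\<tau> i) (xs ! i))"
      if xs: "xs \<in> orderings I" for xs
    proof (cases "\<forall>i<k. xs ! i \<in> \<tau> i")
      case True
      have "inj_on ((!) xs) {..<k}" using xs len[OF xs] by (auto simp: orderings_def inj_on_def nth_eq_iff_index_eq)
      moreover have "map ((!) xs) [0..<k] = xs" using len[OF xs] map_nth by metis
      ultimately show ?thesis using T[of "(!) xs" x] True entry[OF xs] by simp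
    next
      case False
      then obtain i where i: "i < k" "xs ! i \<notin> \<tau> i" by auto
      have z: "triangle_weight y (\<tau> i) (xs ! i) = 0" for y :: "arc \<Rightarrow> real"
        using \<tau>E[OF i(1)] i(2) by (elim trianglesE) (auto simp: triangle_weight_def)
      have "?M $$ (i, xs ! i) = 0" unfolding entry[OF xs i(1)] triangle_relation_def z by simp
      then have z1: "(\<Prod>i<k. ?M $$ (i, xs ! i)) = 0" using i by (intro prod_zero) auto
      have z2: "(\<Prod>i<k. triangle_weight x (\<tau> i) (xs ! i)) = 0" using i z by (intro prod_zero) auto
      show ?thesis unfolding z1 z2 by simp
    qed
    have p: "plucker ?M I = \<sigma> * (\<Sum>xs\<in>orderings I. \<Prod>i<k. triangle_weight x (\<tau> i) (xs ! i))"
      unfolding plucker_orderings[OF M I] sum_distrib_left by (rule sum.cong[OF HOL.refl tm])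
    have nn: "(\<Prod>i<k. triangle_weight x (\<tau> i) (xs ! i)) \<ge> 0" for xs
    proof (rule prod_nonneg)
      fix i assume "i \<in> {..<k}"
      then show "triangle_weight x (\<tau> i) (xs ! i) \<ge> 0"
        using triangle_weight_pos[OF \<tau>B[of i] x] by (cases "xs ! i \<in> \<tau> i") (auto simp: less_imp_le)
    qed
    have ss: "\<sigma> * \<sigma> = 1" using s by auto
    show "(matched B I \<longrightarrow> \<sigma> * plucker ?M I > 0) \<and> (\<not> matched B I \<longrightarrow> plucker ?M I = 0)"
    proof (intro conjI impI)
      assume "matched B I"
      then obtain xs where xs: "xs \<in> orderings I" "\<forall>i<k. xs ! i \<in> \<tau> i" using matched_iff_ordering[OF fin I(2)] by auto
      have "(\<Prod>i<k. triangle_weight x (\<tau> i) (xs ! i)) > 0"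
        by (rule prod_pos) (use xs(2) triangle_weight_pos(1)[OF \<tau>B x] in auto)
      then have "(\<Sum>xs\<in>orderings I. \<Prod>i<k. triangle_weight x (\<tau> i) (xs ! i)) > 0"
        by (intro sum_pos2[OF finite_orderings[OF fin] xs(1)]) (use nn in auto)
      then show "\<sigma> * plucker ?M I > 0" unfolding p mult.assoc[symmetric] ss by simp
    next
      assume nm: "\<not> matched B I"
      have "(\<Prod>i<k. triangle_weight x (\<tau> i) (xs ! i)) = 0" if xs: "xs \<in> orderings I" for xs
      proof -
        obtain i where i: "i < k" "xs ! i \<notin> \<tau> i" using nm xs matched_iff_ordering[OF fin I(2)] by blast
        then have "triangle_weight x (\<tau> i) (xs ! i) = 0" using triangle_weight_pos(2)[OF \<tau>B x] by auto
        then show ?thesis using i by auto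
      qed
      then show "plucker ?M I = 0" unfolding p by simp
    qed
  qed
qed

text \<open>A triangle lies on one side of the arc. So the vertices strictly between \<open>a\<close> and \<open>b\<close> are matched exactly to the triangles
below the arc.\<close>
lemma matched_parity:
  assumes ab: "(a, b) \<in> E" and I: "matched B I" "finite I" "a \<notin> I" "b \<notin> I"
  shows "card (I \<inter> {a<..<b}) = area_of B (a, b)"
proof -
  obtain \<phi> where \<phi>: "bij_betw \<phi> I B" "\<forall>i\<in>I. i \<in> \<phi> i" using I(1) by (auto simp: matched_def)
  have "\<phi> ` (I \<inter> {a<..<b}) = {t \<in> B. t \<subseteq> {a..b}}"
  proof (intro equalityI subsetI)
    fix t assume "t \<in> \<phi> ` (I \<inter> {a<..<b})"
    then obtain i where i: "i \<in> I" "a < i" "i < b" "t = \<phi> i" by auto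
    have "t \<in> B" "i \<in> t" using i \<phi> by (auto simp: bij_betw_def)
    moreover have "t \<subseteq> {a..b} \<or> t \<inter> {a<..<b} = {}" using triangle_arc_side[OF nE ab] BE \<open>t \<in> B\<close> by blast
    ultimately show "t \<in> {t \<in> B. t \<subseteq> {a..b}}" using i by auto
  next
    fix t assume t: "t \<in> {t \<in> B. t \<subseteq> {a..b}}"
    then obtain i where i: "i \<in> I" "t = \<phi> i" using \<phi>(1) by (auto simp: bij_betw_def)
    have "i \<in> {a..b}" "i \<noteq> a" "i \<noteq> b" using t i \<phi>(2) I by auto
    then show "t \<in> \<phi> ` (I \<inter> {a<..<b})" using i by auto
  qed
  moreover have "inj_on \<phi> (I \<inter> {a<..<b})" using \<phi>(1) by (auto simp: bij_betw_def inj_on_def)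
  ultimately show ?thesis unfolding area_of_def using card_image by fastforce
qed

text \<open>Matching each triangle to its far vertex never uses the ends of the arc. Without such an index set the sum in the
Cauchy-Binet formula could be empty.\<close>
lemma matched_avoiding:
  assumes ab: "(a, b) \<in> E"
  obtains I where "I \<subseteq> {..<n}" "card I = k" "matched B I" "a \<notin> I" "b \<notin> I"
proof -
  have lt: "a < b" using ab En chordsD by blast
  define I where "I = far_vertex a b ` B"
  have inj: "inj_on (far_vertex a b) B" using far_vertex_inj[OF nE ab lt] BE inj_on_subset by blast
  note P = far_vertex_props[OF nE ab lt]
  have c: "card B = k" using bij_betw_same_card[OF \<tau>] by simp
  show ?thesis
  proof (rule that[of I])
    show "I \<subseteq> {..<n}" unfolding I_def using P(1) BE B_vertices by blast
    show "card I = k" unfolding I_def using card_image[OF inj] c by simp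
    show "a \<notin> I" "b \<notin> I" unfolding I_def using P(2,3)[OF subsetD[OF BE]] by force+
    have bb: "bij_betw (far_vertex a b) B I" using inj by (simp add: I_def bij_betw_def)
    show "matched B I" unfolding matched_def
    proof (intro exI conjI ballI)
      show "bij_betw (inv_into B (far_vertex a b)) I B" by (rule bij_betw_inv_into[OF bb])
      fix v assume v: "v \<in> I"
      then obtain t where t: "t \<in> B" "v = far_vertex a b t" unfolding I_def by auto
      have "inv_into B (far_vertex a b) v = t" using t inj by simp
      then show "v \<in> inv_into B (far_vertex a b) v" using P(1)[of t] t BE by auto
    qed
  qed
qed

lemma inversions_append_two:
  assumes "sorted xs" "a < b" "a \<notin> set xs" "b \<notin> set xs" "distinct xs"
  shows "even (inversions (xs @ [a, b]) + card (set xs \<inter> {a<..<b}))"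
proof -
  have s0: "inversions xs = 0" using assms(1)
    by (induction xs) (auto simp: filter_empty_conv not_less)
  have "inversions ((xs @ [a]) @ [b]) = length (filter (\<lambda>x. a < x) xs) + length (filter (\<lambda>x. b < x) xs)"
    unfolding inversions_snoc s0 using assms(2) by simp
  also have "length (filter (\<lambda>x. a < x) xs) = card (set xs \<inter> {a<..})"
    using distinct_length_filter[OF assms(5)] by (simp add: greaterThan_def Int_commute)
  also have "length (filter (\<lambda>x. b < x) xs) = card (set xs \<inter> {b<..})"
    using distinct_length_filter[OF assms(5)] by (simp add: greaterThan_def Int_commute)
  also have "card (set xs \<inter> {a<..}) = card (set xs \<inter> {a<..<b}) + card (set xs \<inter> {b<..})"
  proof -
    have "set xs \<inter> {a<..} = (set xs \<inter> {a<..<b}) \<union> (set xs \<inter> {b<..})"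
      using assms by (auto simp: not_less order.order_iff_strict)
    then show ?thesis by (simp add: card_Un_disjoint disjoint_iff)
  qed
  finally have "inversions (xs @ [a, b]) + card (set xs \<inter> {a<..<b}) = 2 * (card (set xs \<inter> {a<..<b}) + card (set xs \<inter> {b<..}))"
    by simp
  then show ?thesis by (metis dvd_triv_left)
qed

text \<open>In the Cauchy-Binet expansion the index set \<open>I\<close> contributes its Pluecker coordinate times the maximal minor of \<open>Z\<close> in
the rows \<open>I\<close>, \<open>a\<close>, \<open>b\<close>, up to the sign of sorting \<open>a\<close> and \<open>b\<close> into \<open>I\<close>. The latter is given by the number of elements between
them, which is the area.\<close>
lemma twistor_sign:
  fixes C Z :: "real mat"
  assumes C: "C \<in> carrier_mat k n"
    and p: "\<And>I. I \<subseteq> {..<n} \<Longrightarrow> card I = k \<Longrightarrow> (matched B I \<longrightarrow> plucker C I > 0) \<and> (\<not> matched B I \<longrightarrow> plucker C I = 0)"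
    and Z: "Z \<in> Mat_pos n (k + 2)" and ab: "(a, b) \<in> E"
  shows "(-1) ^ area_of B (a, b) * omega (C * Z) (rowfun Z a) (rowfun Z b) > 0"
proof -
  have Zc: "Z \<in> carrier_mat n (k + 2)" using Z by (simp add: Mat_pos_def)
  have abn: "a < n" "b < n" "a < b" using ab En chordsD[of a b "{..<n}"] by auto
  let ?J = "{I. I \<subseteq> {..<n} \<and> card I = k}"
  let ?f = "\<lambda>I. (-1) ^ area_of B (a, b) * (plucker C I * rowdet (map (rowfun Z) (sorted_list_of_set I) @ [rowfun Z a, rowfun Z b]))"
  have e: "(-1) ^ area_of B (a, b) * omega (C * Z) (rowfun Z a) (rowfun Z b) = (\<Sum>I\<in>?J. ?f I)"
    using cauchy_binet[OF C Zc, of "[rowfun Z a, rowfun Z b]"] by (simp add: omega_def sum_distrib_left)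
  have pos: "?f I > 0" if I: "I \<in> ?J" "matched B I" "a \<notin> I" "b \<notin> I" for I
  proof -
    have fin: "finite I" using I(1) finite_subset by blast
    let ?xs = "sorted_list_of_set I"
    let ?K = "insert a (insert b I)"
    have K: "?K \<subseteq> {..<n}" "card ?K = k + 2" using I abn fin by auto
    have srt: "sort (?xs @ [a, b]) = sorted_list_of_set ?K"
    proof (rule sorted_distinct_set_unique)
      show "distinct (sort (?xs @ [a, b]))" unfolding distinct_sort using fin I abn by simp
      show "set (sort (?xs @ [a, b])) = set (sorted_list_of_set ?K)" unfolding set_sort using fin
        by (subst set_sorted_list_of_set) auto
    qed (simp_all only: sorted_sort sorted_sorted_list_of_set distinct_sorted_list_of_set)
    have "rowdet (map (rowfun Z) (?xs @ [a, b]) @ []) = (-1) ^ inversions (?xs @ [a, b]) * det (submatrix Z ?K UNIV)"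
      unfolding rowdet_sort[of "rowfun Z" "?xs @ [a, b]"] srt minor_rows[OF Zc K] by simp
    moreover have "(-1::real) ^ inversions (?xs @ [a, b]) = (-1) ^ area_of B (a, b)"
    proof -
      have "even (inversions (?xs @ [a, b]) + card (set ?xs \<inter> {a<..<b}))"
        by (rule inversions_append_two) (use fin I abn in auto)
      then have "even (inversions (?xs @ [a, b]) + area_of B (a, b))" using matched_parity[OF ab I(2) fin I(3,4)] fin by simp
      then show ?thesis by (simp add: minus_one_power_iff)
    qed
    moreover have "det (submatrix Z ?K UNIV) > 0" using Z K by (auto simp: Mat_pos_def)
    moreover have "plucker C I > 0" using p I by auto
    moreover have "(-1::real) ^ area_of B (a, b) * (-1) ^ area_of B (a, b) = 1" by (simp flip: power_add)
    ultimately show ?thesis by (simp add: mult_ac)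
  qed
  have nn: "?f I \<ge> 0" if I: "I \<in> ?J" for I
  proof (cases "matched B I \<and> a \<notin> I \<and> b \<notin> I")
    case True then show ?thesis using pos[OF I] by simp
  next
    case False
    have fin: "finite I" using I finite_subset by blast
    have "plucker C I = 0 \<or> rowdet (map (rowfun Z) (sorted_list_of_set I @ [a, b]) @ []) = 0"
    proof (cases "matched B I")
      case True
      then have "\<not> distinct (sorted_list_of_set I @ [a, b])" using False fin by auto
      then show ?thesis using rowdet_not_distinct by blast
    qed (use p I in auto)
    then show ?thesis by auto
  qed
  obtain I where I: "I \<subseteq> {..<n}" "card I = k" "matched B I" "a \<notin> I" "b \<notin> I" using matched_avoiding[OF ab] .
  have "(\<Sum>I\<in>?J. ?f I) > 0"
    by (rule sum_pos2[of _ I]) (use I pos nn in auto)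
  then show ?thesis using e by simp
qed

end

section \<open>Polynomial functions, the Zariski topology and birational maps\<close>

lemma poly_functions_cong:
  "F \<in> poly_functions I \<Longrightarrow> (\<And>i. i \<in> I \<Longrightarrow> z i = z' i) \<Longrightarrow> F z = F z'"
  by (induction rule: poly_functions.induct) simp_all

lemma poly_functions_sum: "finite S \<Longrightarrow> (\<And>s. s \<in> S \<Longrightarrow> F s \<in> poly_functions I) \<Longrightarrow> (\<lambda>z. \<Sum>s\<in>S. F s z) \<in> poly_functions I"
  by (induction S rule: finite_induct) (auto intro: poly_functions.intros)

lemma poly_functions_prod: "finite S \<Longrightarrow> (\<And>s. s \<in> S \<Longrightarrow> F s \<in> poly_functions I) \<Longrightarrow> (\<lambda>z. \<Prod>s\<in>S. F s z) \<in> poly_functions I"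
  by (induction S rule: finite_induct) (auto intro: poly_functions.intros)

lemma poly_functions_cmult: "F \<in> poly_functions I \<Longrightarrow> (\<lambda>z. c * F z) \<in> poly_functions I"
  by (intro poly_functions.mult poly_functions.const)

lemma poly_functions_compose:
  "F \<in> poly_functions I \<Longrightarrow> (\<And>i. i \<in> I \<Longrightarrow> (\<lambda>z. g z i) \<in> poly_functions J) \<Longrightarrow> (\<lambda>z. F (g z)) \<in> poly_functions J"
  by (induction rule: poly_functions.induct) (auto intro: poly_functions.intros)

lemma poly_functions_line:
  "F \<in> poly_functions I \<Longrightarrow> \<exists>p. \<forall>t. F (\<lambda>i. a i + t * b i) = poly p t"
proof (induction rule: poly_functions.induct)
  case (const c) show ?case by (rule exI[of _ "[:c:]"]) simp
next
  case (coord i) show ?case by (rule exI[of _ "[:a i, b i:]"]) simp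
next
  case (add F G)
  then obtain p q where "\<forall>t. F (\<lambda>i. a i + t * b i) = poly p t" "\<forall>t. G (\<lambda>i. a i + t * b i) = poly q t" by blast
  then show ?case by (intro exI[of _ "p + q"]) simp
next
  case (mult F G)
  then obtain p q where "\<forall>t. F (\<lambda>i. a i + t * b i) = poly p t" "\<forall>t. G (\<lambda>i. a i + t * b i) = poly q t" by blast
  then show ?case by (intro exI[of _ "p * q"]) simp
qed

text \<open>Irreducibility of affine space, with an arbitrary set of coordinates: restrict both functions to the line through the two
points and use that nonzero polynomials in one variable have a nonzero product.\<close>
lemma poly_functions_common_nonzero:
  assumes F: "F \<in> poly_functions I" "F x \<noteq> 0" and G: "G \<in> poly_functions I" "G y \<noteq> 0"
  shows "\<exists>z. F z \<noteq> 0 \<and> G z \<noteq> 0"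
proof -
  let ?l = "\<lambda>t i. x i + t * (y i - x i)"
  obtain p q where p: "\<And>t. F (?l t) = poly p t" and q: "\<And>t. G (?l t) = poly q t"
    using poly_functions_line[OF F(1)] poly_functions_line[OF G(1)] by metis
  have "poly p 0 \<noteq> 0" "poly q 1 \<noteq> 0" using p[of 0] q[of 1] F(2) G(2) by simp_all
  then have "p * q \<noteq> 0" by auto
  then obtain t where "poly (p * q) t \<noteq> 0" using poly_all_0_iff_0 by blast
  then show ?thesis using p[of t] q[of t] by (intro exI[of _ "?l t"]) simp
qed

lemma det_poly_function:
  assumes "\<And>i j. i < n \<Longrightarrow> j < n \<Longrightarrow> (\<lambda>z. A z i j) \<in> poly_functions I"
  shows "(\<lambda>z. det (mat n n (\<lambda>(i, j). A z i j))) \<in> poly_functions I"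
proof -
  have "det (mat n n (\<lambda>(i, j). A z i j)) = (\<Sum>p\<in>{p. p permutes {0..<n}}. signof p * (\<Prod>i\<in>{0..<n}. A z i (p i)))" for z
  proof -
    have "(\<Prod>i = 0..<n. mat n n (\<lambda>(i, j). A z i j) $$ (i, p i)) = (\<Prod>i\<in>{0..<n}. A z i (p i))" if "p permutes {0..<n}" for p
      by (rule prod.cong[OF HOL.refl]) (use permutes_in_image[OF that] in auto)
    then show ?thesis by (simp add: det_def)
  qed
  then show ?thesis
    using assms permutes_in_image by (fastforce intro!: poly_functions_sum poly_functions_cmult poly_functions_prod simp: finite_permutations)
qed

lemma hom_poly_poly_function: "hom_poly_function I d F \<Longrightarrow> F \<in> poly_functions I"
  by (induction rule: hom_poly_function.induct) (auto intro: poly_functions.intros)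

lemma hom_poly_scale:
  "hom_poly_function I d F \<Longrightarrow> (\<And>i. i \<in> I \<Longrightarrow> z' i = c * z i) \<Longrightarrow> F z' = c ^ d * F z"
proof (induction rule: hom_poly_function.induct)
  case (add d F G) then show ?case by (simp add: algebra_simps)
next
  case (mult d F e G) then show ?case by (simp add: algebra_simps power_add)
qed simp_all

lemma hom_poly_linear:
  assumes "finite S" "S \<noteq> {}" "S \<subseteq> I" shows "hom_poly_function I 1 (\<lambda>z. \<Sum>s\<in>S. z s * c s)"
proof -
  have *: "hom_poly_function I 1 (\<lambda>z. z s * c s)" if "s \<in> I" for s
    using hom_poly_function.mult[OF hom_poly_function.coord[OF that] hom_poly_function.const[of I "c s"]] by simp
  show ?thesis using assms
  proof (induction S rule: finite_ne_induct)
    case (singleton s) then show ?case using * by simp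
  next
    case (insert s S)
    then show ?case using hom_poly_function.add[OF *[of s], of "\<lambda>z. \<Sum>s\<in>S. z s * c s"] by simp
  qed
qed

text \<open>The nonvanishing sets of forms are a basis of the topology.\<close>
lemma zariski_open_iff:
  "zariski_open X U \<longleftrightarrow> U \<subseteq> points X \<and>
     (\<forall>p\<in>U. \<exists>d. \<exists>f\<in>forms X d. f p \<noteq> 0 \<and> (\<forall>q\<in>points X. f q \<noteq> 0 \<longrightarrow> q \<in> U))"
proof
  assume "zariski_open X U"
  then obtain S where S: "U \<subseteq> points X" "S \<subseteq> (\<Union>d. forms X d)" "points X - U = {p \<in> points X. \<forall>F\<in>S. F p = 0}"
    by (auto simp: zariski_open_def zariski_closed_def)
  show "U \<subseteq> points X \<and> (\<forall>p\<in>U. \<exists>d. \<exists>f\<in>forms X d. f p \<noteq> 0 \<and> (\<forall>q\<in>points X. f q \<noteq> 0 \<longrightarrow> q \<in> U))"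
  proof (intro conjI ballI S(1))
    fix p assume "p \<in> U"
    then have "p \<in> points X" "p \<notin> points X - U" using S(1) by auto
    then obtain F where F: "F \<in> S" "F p \<noteq> 0" using S(3) by blast
    then obtain d where "F \<in> forms X d" using S(2) by auto
    moreover have "\<forall>q\<in>points X. F q \<noteq> 0 \<longrightarrow> q \<in> U" using S(3) F(1) by blast
    ultimately show "\<exists>d. \<exists>f\<in>forms X d. f p \<noteq> 0 \<and> (\<forall>q\<in>points X. f q \<noteq> 0 \<longrightarrow> q \<in> U)" using F(2) by blast
  qed
next
  assume a: "U \<subseteq> points X \<and> (\<forall>p\<in>U. \<exists>d. \<exists>f\<in>forms X d. f p \<noteq> 0 \<and> (\<forall>q\<in>points X. f q \<noteq> 0 \<longrightarrow> q \<in> U))"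
  let ?S = "{f \<in> (\<Union>d. forms X d). \<forall>q\<in>points X. f q \<noteq> 0 \<longrightarrow> q \<in> U}"
  have "points X - U = {p \<in> points X. \<forall>F\<in>?S. F p = 0}" using a by blast
  then have "zariski_closed X (points X - U)" unfolding zariski_closed_def by (intro exI[of _ ?S]) blast
  then show "zariski_open X U" using a by (simp add: zariski_open_def)
qed

text \<open>The closure properties of the forms of a graded ring; this is all of the algebra that the topological arguments need.\<close>
definition graded :: "'p variety \<Rightarrow> bool" where
  "graded X \<longleftrightarrow> (\<forall>c. (\<lambda>_. c) \<in> forms X 0) \<and>
     (\<forall>d f g. f \<in> forms X d \<longrightarrow> g \<in> forms X d \<longrightarrow> (\<lambda>p. f p + g p) \<in> forms X d) \<and>
     (\<forall>d e f g. f \<in> forms X d \<longrightarrow> g \<in> forms X e \<longrightarrow> (\<lambda>p. f p * g p) \<in> forms X (d + e))"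

text \<open>Two nonempty open sets meet, expressed by forms.\<close>
definition irreducible_variety :: "'p variety \<Rightarrow> bool" where
  "irreducible_variety X \<longleftrightarrow> (\<forall>d e. \<forall>f\<in>forms X d. \<forall>g\<in>forms X e. \<forall>p\<in>points X. \<forall>q\<in>points X.
     f p \<noteq> 0 \<longrightarrow> g q \<noteq> 0 \<longrightarrow> (\<exists>r\<in>points X. f r \<noteq> 0 \<and> g r \<noteq> 0))"

lemma gradedD:
  assumes "graded X"
  shows "(\<lambda>_. c) \<in> forms X 0" "f \<in> forms X d \<Longrightarrow> g \<in> forms X d \<Longrightarrow> (\<lambda>p. f p + g p) \<in> forms X d"
    "f \<in> forms X d \<Longrightarrow> g \<in> forms X e \<Longrightarrow> (\<lambda>p. f p * g p) \<in> forms X (d + e)"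
  using assms by (auto simp: graded_def)

lemma graded_prod:
  assumes X: "graded X" and "finite S" "\<And>s. s \<in> S \<Longrightarrow> f s \<in> forms X d"
  shows "(\<lambda>p. \<Prod>s\<in>S. f s p) \<in> forms X (d * card S)"
  using assms(2,3) by (induction S rule: finite_induct) (auto intro: gradedD[OF X])

lemma zariski_open_nonvanishing:
  assumes X: "graded X" and U: "zariski_open X U" and f: "f \<in> forms X d"
  shows "zariski_open X {p \<in> U. f p \<noteq> 0}"
  unfolding zariski_open_iff
proof (intro conjI ballI)
  show "{p \<in> U. f p \<noteq> 0} \<subseteq> points X" using U by (auto simp: zariski_open_def)
  fix p assume p: "p \<in> {p \<in> U. f p \<noteq> 0}"
  then obtain e h where h: "h \<in> forms X e" "h p \<noteq> 0" "\<forall>q\<in>points X. h q \<noteq> 0 \<longrightarrow> q \<in> U" using U unfolding zariski_open_iff by blast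
  show "\<exists>d. \<exists>f'\<in>forms X d. f' p \<noteq> 0 \<and> (\<forall>q\<in>points X. f' q \<noteq> 0 \<longrightarrow> q \<in> {p \<in> U. f p \<noteq> 0})"
    by (rule exI[of _ "d + e"], rule bexI[OF _ gradedD(3)[OF X f h(1)]]) (use p h in auto)
qed

lemma zariski_open_points: "graded X \<Longrightarrow> zariski_open X (points X)"
  unfolding zariski_open_iff by (auto intro!: exI[of _ 0] bexI[of _ "\<lambda>_. 1"] gradedD)

lemma zariski_open_Int:
  assumes X: "graded X" and U: "zariski_open X U" and W: "zariski_open X W"
  shows "zariski_open X (U \<inter> W)"
  unfolding zariski_open_iff
proof (intro conjI ballI)
  show "U \<inter> W \<subseteq> points X" using U by (auto simp: zariski_open_def)
  fix p assume p: "p \<in> U \<inter> W"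
  obtain e h where h: "h \<in> forms X e" "h p \<noteq> 0" "\<forall>q\<in>points X. h q \<noteq> 0 \<longrightarrow> q \<in> U" using U p unfolding zariski_open_iff by blast
  obtain d f where f: "f \<in> forms X d" "f p \<noteq> 0" "\<forall>q\<in>points X. f q \<noteq> 0 \<longrightarrow> q \<in> W" using W p unfolding zariski_open_iff by blast
  show "\<exists>d. \<exists>f\<in>forms X d. f p \<noteq> 0 \<and> (\<forall>q\<in>points X. f q \<noteq> 0 \<longrightarrow> q \<in> U \<inter> W)"
    by (rule exI[of _ "d + e"], rule bexI[OF _ gradedD(3)[OF X f(1) h(1)]]) (use f h in auto)
qed

lemma dense_openI:
  assumes X: "irreducible_variety X" and U: "zariski_open X U" "U \<noteq> {}"
  shows "dense_open X U"
  unfolding dense_open_def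
proof (intro conjI allI impI U(1))
  fix W assume W: "zariski_open X W \<and> W \<noteq> {}"
  obtain p q where pq: "p \<in> U" "q \<in> W" using U W by auto
  have pts: "p \<in> points X" "q \<in> points X" using pq U W by (auto simp: zariski_open_def)
  obtain e h where h: "h \<in> forms X e" "h p \<noteq> 0" "\<forall>q\<in>points X. h q \<noteq> 0 \<longrightarrow> q \<in> U" using U pq unfolding zariski_open_iff by blast
  obtain d f where f: "f \<in> forms X d" "f q \<noteq> 0" "\<forall>q\<in>points X. f q \<noteq> 0 \<longrightarrow> q \<in> W" using W pq unfolding zariski_open_iff by blast
  obtain r where "r \<in> points X" "h r \<noteq> 0" "f r \<noteq> 0" using X h f pts unfolding irreducible_variety_def by metis
  then show "U \<inter> W \<noteq> {}" using h f by auto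
qed

lemma points_open_subvariety [simp]: "points (open_subvariety X U) = U" and forms_open_subvariety [simp]: "forms (open_subvariety X U) = forms X"
  by (simp_all add: open_subvariety_def)

lemma graded_open_subvariety: "graded X \<Longrightarrow> graded (open_subvariety X U)"
  by (simp add: graded_def)

lemma irreducible_open_subvariety:
  assumes X: "graded X" "irreducible_variety X" and U: "zariski_open X U"
  shows "irreducible_variety (open_subvariety X U)"
  unfolding irreducible_variety_def
proof (intro allI ballI impI)
  fix d e f g p q assume f: "f \<in> forms (open_subvariety X U) d" and g: "g \<in> forms (open_subvariety X U) e"
    and p: "p \<in> points (open_subvariety X U)" and q: "q \<in> points (open_subvariety X U)" and fp: "f p \<noteq> 0" and gq: "g q \<noteq> 0"
  have pts: "p \<in> U" "q \<in> U" "p \<in> points X" "q \<in> points X" using p q U by (auto simp: zariski_open_def)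
  obtain c h where h: "h \<in> forms X c" "h p \<noteq> 0" "\<forall>q\<in>points X. h q \<noteq> 0 \<longrightarrow> q \<in> U" using U pts unfolding zariski_open_iff by blast
  have fh: "(\<lambda>p. f p * h p) \<in> forms X (d + c)" using gradedD(3)[OF X(1)] f h by auto
  have gX: "g \<in> forms X e" using g by simp
  from X(2)[unfolded irreducible_variety_def, rule_format, OF fh gX pts(3,4)] fp h(2) gq obtain r where
    "r \<in> points X" "f r * h r \<noteq> 0" "g r \<noteq> 0" by auto
  then show "\<exists>r\<in>points (open_subvariety X U). f r \<noteq> 0 \<and> g r \<noteq> 0" using h(3) by auto
qed

lemma rat_eqI:
  assumes "irreducible_variety X" "zariski_open X U" "U \<noteq> {}" "\<And>p. p \<in> U \<Longrightarrow> f p = g p"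
  shows "rat_eq X f g"
  unfolding rat_eq_def using dense_openI[OF assms(1-3)] assms(4) by blast

lemma dense_open_Int:
  assumes X: "graded X" and U: "dense_open X U" and W: "dense_open X W"
  shows "dense_open X (U \<inter> W)"
  unfolding dense_open_def
proof (intro conjI allI impI)
  show "zariski_open X (U \<inter> W)" using zariski_open_Int[OF X] U W by (auto simp: dense_open_def)
  fix V assume V: "zariski_open X V \<and> V \<noteq> {}"
  then have "zariski_open X (W \<inter> V)" "W \<inter> V \<noteq> {}" using zariski_open_Int[OF X] W by (auto simp: dense_open_def)
  then have "U \<inter> (W \<inter> V) \<noteq> {}" using U by (auto simp: dense_open_def)
  then show "U \<inter> W \<inter> V \<noteq> {}" by (simp add: Int_assoc)
qed

lemma dense_open_points: "graded X \<Longrightarrow> dense_open X (points X)"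
  using zariski_open_points[of X] by (auto simp: dense_open_def) (auto simp: zariski_open_def)

lemma rat_eq_refl: "graded X \<Longrightarrow> rat_eq X f f"
  unfolding rat_eq_def using dense_open_points by blast

lemma rat_eq_trans: assumes X: "graded X" and "rat_eq X f g" "rat_eq X g h" shows "rat_eq X f h"
proof -
  obtain U W where U: "dense_open X U" "\<forall>p\<in>U. f p = g p" and W: "dense_open X W" "\<forall>p\<in>W. g p = h p"
    using assms by (auto simp: rat_eq_def)
  then show ?thesis unfolding rat_eq_def using dense_open_Int[OF X U(1) W(1)] by auto
qed

lemma rat_eq_common:
  assumes X: "graded X" and S: "finite S" "\<And>s. s \<in> S \<Longrightarrow> rat_eq X (f s) (g s)"
  obtains U where "dense_open X U" "\<And>s p. s \<in> S \<Longrightarrow> p \<in> U \<Longrightarrow> f s p = g s p"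
proof -
  have "\<exists>U. dense_open X U \<and> (\<forall>s\<in>S. \<forall>p\<in>U. f s p = g s p)"
    using S
  proof (induction S rule: finite_induct)
    case empty then show ?case using dense_open_points[OF X] by auto
  next
    case (insert s S)
    then obtain U where U: "dense_open X U" "\<forall>s\<in>S. \<forall>p\<in>U. f s p = g s p" by auto
    obtain W where W: "dense_open X W" "\<forall>p\<in>W. f s p = g s p" using insert.prems[of s] by (auto simp: rat_eq_def)
    then show ?case using dense_open_Int[OF X U(1) W(1)] U by (intro exI[of _ "U \<inter> W"]) auto
  qed
  then show ?thesis using that by blast
qed

text \<open>A quotient of two forms of equal degree on \<open>Y\<close> becomes such a quotient on \<open>X\<close>. Both for homogeneous coordinates and for torus
coordinates this can be verified for the global formula that defines the map, without covering \<open>U\<close> by open sets.\<close>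
definition pulls_back :: "'p variety \<Rightarrow> 'p set \<Rightarrow> 'q variety \<Rightarrow> ('p \<Rightarrow> 'q) \<Rightarrow> bool" where
  "pulls_back X U Y \<phi> \<longleftrightarrow> (\<forall>d. \<forall>F\<in>forms Y d. \<forall>G\<in>forms Y d. \<exists>e. \<exists>F'\<in>forms X e. \<exists>G'\<in>forms X e.
     \<forall>p\<in>U. (G' p = 0 \<longleftrightarrow> G (\<phi> p) = 0) \<and> (G (\<phi> p) \<noteq> 0 \<longrightarrow> F (\<phi> p) / G (\<phi> p) = F' p / G' p))"

text \<open>Open sets are unions of nonvanishing sets of forms, and these pull back to nonvanishing sets.\<close>
lemma morphism_onI:
  assumes X: "graded X" and U: "zariski_open X U" and W: "W \<subseteq> points Y" and \<phi>: "\<phi> ` U \<subseteq> W" and pb: "pulls_back X U Y \<phi>"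
  shows "morphism_on X U Y W \<phi>"
proof -
  have op: "zariski_open X (U \<inter> \<phi> -` W')" if W': "zariski_open Y W'" "W' \<subseteq> W" for W'
    unfolding zariski_open_iff
  proof (intro conjI ballI)
    show "U \<inter> \<phi> -` W' \<subseteq> points X" using U by (auto simp: zariski_open_def)
    fix p assume p: "p \<in> U \<inter> \<phi> -` W'"
    obtain d G where G: "G \<in> forms Y d" "G (\<phi> p) \<noteq> 0" "\<forall>q\<in>points Y. G q \<noteq> 0 \<longrightarrow> q \<in> W'"
      using W'(1) p unfolding zariski_open_iff by blast
    obtain e G' where G': "G' \<in> forms X e" "\<forall>p\<in>U. G' p = 0 \<longleftrightarrow> G (\<phi> p) = 0"
      using pb G(1) unfolding pulls_back_def by metis
    have "zariski_open X {p \<in> U. G' p \<noteq> 0}" by (rule zariski_open_nonvanishing[OF X U G'(1)])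
    moreover have "p \<in> {p \<in> U. G' p \<noteq> 0}" using p G G' by auto
    ultimately obtain c h where h: "h \<in> forms X c" "h p \<noteq> 0" "\<forall>q\<in>points X. h q \<noteq> 0 \<longrightarrow> q \<in> {p \<in> U. G' p \<noteq> 0}"
      unfolding zariski_open_iff by blast
    have "{p \<in> U. G' p \<noteq> 0} \<subseteq> U \<inter> \<phi> -` W'" using G(3) G'(2) \<phi> W by blast
    then show "\<exists>d. \<exists>f\<in>forms X d. f p \<noteq> 0 \<and> (\<forall>q\<in>points X. f q \<noteq> 0 \<longrightarrow> q \<in> U \<inter> \<phi> -` W')" using h by blast
  qed
  have rg: "regular_on X (U \<inter> \<phi> -` W') (g \<circ> \<phi>)" if W': "zariski_open Y W'" "W' \<subseteq> W" and g: "regular_on Y W' g" for W' g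
    unfolding regular_on_def
  proof (intro ballI)
    fix p assume p: "p \<in> U \<inter> \<phi> -` W'"
    then obtain V d F G where V: "zariski_open Y V" "\<phi> p \<in> V" "V \<subseteq> W'" and F: "F \<in> forms Y d" "G \<in> forms Y d" "\<forall>q\<in>V. G q \<noteq> 0 \<and> g q = F q / G q"
      using g unfolding regular_on_def by blast
    obtain e F' G' where F': "F' \<in> forms X e" "G' \<in> forms X e"
      and c: "\<forall>p\<in>U. (G' p = 0 \<longleftrightarrow> G (\<phi> p) = 0) \<and> (G (\<phi> p) \<noteq> 0 \<longrightarrow> F (\<phi> p) / G (\<phi> p) = F' p / G' p)"
      using pb F(1,2) unfolding pulls_back_def by blast
    have "V \<subseteq> W" using V W' by auto
    show "\<exists>Wa. zariski_open X Wa \<and> p \<in> Wa \<and> Wa \<subseteq> U \<inter> \<phi> -` W' \<and>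
       (\<exists>d. \<exists>F\<in>forms X d. \<exists>G\<in>forms X d. \<forall>q\<in>Wa. G q \<noteq> 0 \<and> (g \<circ> \<phi>) q = F q / G q)"
    proof (intro exI[of _ "U \<inter> \<phi> -` V"] conjI)
      show "zariski_open X (U \<inter> \<phi> -` V)" by (rule op[OF V(1) \<open>V \<subseteq> W\<close>])
      show "p \<in> U \<inter> \<phi> -` V" "U \<inter> \<phi> -` V \<subseteq> U \<inter> \<phi> -` W'" using p V by auto
      have "\<forall>q\<in>U \<inter> \<phi> -` V. G' q \<noteq> 0 \<and> (g \<circ> \<phi>) q = F' q / G' q" using c F(3) by auto
      then show "\<exists>d. \<exists>F\<in>forms X d. \<exists>G\<in>forms X d. \<forall>q\<in>U \<inter> \<phi> -` V. G q \<noteq> 0 \<and> (g \<circ> \<phi>) q = F q / G q"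
        using F' by blast
    qed
  qed
  show ?thesis unfolding morphism_on_def using \<phi> op rg by blast
qed

lemma pulls_back_cong: "(\<And>p. p \<in> U \<Longrightarrow> \<phi> p = \<psi> p) \<Longrightarrow> pulls_back X U Y \<phi> \<longleftrightarrow> pulls_back X U Y \<psi>"
  unfolding pulls_back_def by (simp cong: ball_cong)

lemma birational_viaI:
  assumes X: "graded X" "irreducible_variety X" and Y: "graded Y" "irreducible_variety Y"
    and U: "zariski_open X U" "U \<noteq> {}" and W: "zariski_open Y W"
    and \<phi>: "\<And>p. p \<in> U \<Longrightarrow> \<phi> p \<in> W \<and> \<psi> (\<phi> p) = p" and \<psi>: "\<And>q. q \<in> W \<Longrightarrow> \<psi> q \<in> U \<and> \<phi> (\<psi> q) = q"
    and pb: "pulls_back X U Y \<phi>" "pulls_back Y W X \<psi>"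
  shows "birational_via X Y \<phi>"
proof -
  have bij: "bij_betw \<phi> U W" by (rule bij_betw_byWitness[of _ \<psi>]) (use \<phi> \<psi> in auto)
  have inv: "inv_into U \<phi> q = \<psi> q" if "q \<in> W" for q
    using bij \<psi>[OF that] by (metis bij_betw_inv_into_left)
  have "W \<noteq> {}" using U \<phi> by auto
  show ?thesis unfolding birational_via_def
  proof (intro exI conjI)
    show "dense_open X U" by (rule dense_openI[OF X(2) U])
    show "dense_open Y W" by (rule dense_openI[OF Y(2) W \<open>W \<noteq> {}\<close>])
    show "bij_betw \<phi> U W" by (rule bij)
    show "morphism_on X U Y W \<phi>" by (rule morphism_onI[OF X(1) U(1)]) (use W \<phi> pb in \<open>auto simp: zariski_open_def\<close>)
    show "morphism_on Y W X U (inv_into U \<phi>)"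
    proof (rule morphism_onI[OF Y(1) W])
      show "pulls_back Y W X (inv_into U \<phi>)" using pb(2) pulls_back_cong[of W "inv_into U \<phi>" \<psi>] inv by blast
      show "inv_into U \<phi> ` W \<subseteq> U" using inv \<psi> by auto
      show "U \<subseteq> points X" using U by (auto simp: zariski_open_def)
    qed
  qed
qed

lemma graded_torus: "graded (algebraic_torus I)"
  by (auto simp: graded_def algebraic_torus_def intro: poly_functions.intros)

text \<open>The torus is the nonvanishing set of the product of the coordinates.\<close>
lemma torus_point_nonzero:
  assumes I: "finite I" and F: "F \<in> poly_functions I" "F z \<noteq> 0" and G: "G \<in> poly_functions I" "G y \<noteq> 0"
  obtains w where "w \<in> points (algebraic_torus I)" "F w \<noteq> 0" "G w \<noteq> 0"
proof -
  have c: "(\<lambda>z. \<Prod>i\<in>I. z i) \<in> poly_functions I" using I by (intro poly_functions_prod poly_functions.coord)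
  obtain z1 where "F z1 * G z1 \<noteq> 0" using poly_functions_common_nonzero[OF F G] by auto
  then obtain z2 where z2: "F z2 * G z2 \<noteq> 0" "(\<Prod>i\<in>I. z2 i) \<noteq> 0"
    using poly_functions_common_nonzero[OF poly_functions.mult[OF F(1) G(1)] _ c, of z1 "\<lambda>_. 1"] by auto
  have "F (restrict z2 I) = F z2" "G (restrict z2 I) = G z2" using poly_functions_cong F(1) G(1) by (metis restrict_apply')+
  then show ?thesis using that[of "restrict z2 I"] z2 I by (auto simp: algebraic_torus_def)
qed

lemma irreducible_torus: assumes "finite I" shows "irreducible_variety (algebraic_torus I)"
  unfolding irreducible_variety_def
proof (intro allI ballI impI)
  fix d e f g p q assume "f \<in> forms (algebraic_torus I) d" "g \<in> forms (algebraic_torus I) e" "f p \<noteq> 0" "g q \<noteq> 0"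
  then have "f \<in> poly_functions I" "g \<in> poly_functions I" "f p \<noteq> 0" "g q \<noteq> 0" by (auto simp: algebraic_torus_def)
  then show "\<exists>r\<in>points (algebraic_torus I). f r \<noteq> 0 \<and> g r \<noteq> 0" using torus_point_nonzero[OF assms] by metis
qed

text \<open>A polynomial in quotients of linear forms is a quotient of two forms of equal degree, by induction over the polynomial.\<close>
lemma pulls_back_coordinates:
  assumes X: "graded X" and x: "\<And>i. i \<in> I \<Longrightarrow> N i \<in> forms X 1 \<and> M i \<in> forms X 1 \<and> (\<forall>p\<in>U. M i p \<noteq> 0 \<and> x i p = N i p / M i p)"
  shows "pulls_back X U (algebraic_torus I) (\<lambda>p. \<lambda>i\<in>I. x i p)"
proof -
  have *: "\<exists>d. \<exists>F'\<in>forms X d. \<exists>D\<in>forms X d. \<forall>p\<in>U. D p \<noteq> 0 \<and> F (\<lambda>i\<in>I. x i p) = F' p / D p" if "F \<in> poly_functions I" for F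
    using that
  proof (induction rule: poly_functions.induct)
    case (const c)
    show ?case by (intro exI[of _ 0] bexI[of _ "\<lambda>_. c"] bexI[of _ "\<lambda>_. 1"]) (auto intro: gradedD[OF X])
  next
    case (coord i)
    then show ?case using x[of i] by (intro exI[of _ 1] bexI[of _ "N i"] bexI[of _ "M i"]) auto
  next
    case (add F G)
    then obtain d F' D e G' D' where *: "F' \<in> forms X d" "D \<in> forms X d" "\<forall>p\<in>U. D p \<noteq> 0 \<and> F (\<lambda>i\<in>I. x i p) = F' p / D p"
      "G' \<in> forms X e" "D' \<in> forms X e" "\<forall>p\<in>U. D' p \<noteq> 0 \<and> G (\<lambda>i\<in>I. x i p) = G' p / D' p" by blast
    have 1: "(\<lambda>p. F' p * D' p) \<in> forms X (d + e)" "(\<lambda>p. G' p * D p) \<in> forms X (d + e)" "(\<lambda>p. D p * D' p) \<in> forms X (d + e)"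
      using gradedD(3)[OF X *(1,5)] gradedD(3)[OF X *(4,2)] gradedD(3)[OF X *(2,5)] by (simp_all add: add.commute)
    show ?case
    proof (rule exI[of _ "d + e"], rule bexI[OF _ gradedD(2)[OF X 1(1,2)]], rule bexI[OF _ 1(3)], rule ballI)
      fix p assume "p \<in> U"
      then have "D p \<noteq> 0" "D' p \<noteq> 0" and e: "F (\<lambda>i\<in>I. x i p) = F' p / D p" "G (\<lambda>i\<in>I. x i p) = G' p / D' p"
        using *(3,6) by blast+
      then show "D p * D' p \<noteq> 0 \<and> F (\<lambda>i\<in>I. x i p) + G (\<lambda>i\<in>I. x i p) = (F' p * D' p + G' p * D p) / (D p * D' p)"
        unfolding e by (simp add: add_frac_eq)
    qed
  next
    case (mult F G)
    then obtain d F' D e G' D' where *: "F' \<in> forms X d" "D \<in> forms X d" "\<forall>p\<in>U. D p \<noteq> 0 \<and> F (\<lambda>i\<in>I. x i p) = F' p / D p"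
      "G' \<in> forms X e" "D' \<in> forms X e" "\<forall>p\<in>U. D' p \<noteq> 0 \<and> G (\<lambda>i\<in>I. x i p) = G' p / D' p" by blast
    have 1: "(\<lambda>p. F' p * G' p) \<in> forms X (d + e)" "(\<lambda>p. D p * D' p) \<in> forms X (d + e)"
      using * gradedD(3)[OF X] by auto
    show ?case
    proof (rule exI[of _ "d + e"], rule bexI[OF _ 1(1)], rule bexI[OF _ 1(2)], rule ballI)
      fix p assume "p \<in> U"
      then have "D p \<noteq> 0" "D' p \<noteq> 0" and e: "F (\<lambda>i\<in>I. x i p) = F' p / D p" "G (\<lambda>i\<in>I. x i p) = G' p / D' p"
        using *(3,6) by blast+
      then show "D p * D' p \<noteq> 0 \<and> F (\<lambda>i\<in>I. x i p) * G (\<lambda>i\<in>I. x i p) = (F' p * G' p) / (D p * D' p)"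
        unfolding e by simp
    qed
  qed
  show ?thesis unfolding pulls_back_def
  proof (intro allI ballI)
    fix d F G assume "F \<in> forms (algebraic_torus I) d" "G \<in> forms (algebraic_torus I) d"
    then have FG: "F \<in> poly_functions I" "G \<in> poly_functions I" by (auto simp: algebraic_torus_def)
    obtain d F' D where F: "F' \<in> forms X d" "D \<in> forms X d" "\<forall>p\<in>U. D p \<noteq> 0 \<and> F (\<lambda>i\<in>I. x i p) = F' p / D p" using *[OF FG(1)] by blast
    obtain e G' D' where G: "G' \<in> forms X e" "D' \<in> forms X e" "\<forall>p\<in>U. D' p \<noteq> 0 \<and> G (\<lambda>i\<in>I. x i p) = G' p / D' p" using *[OF FG(2)] by blast
    have 1: "(\<lambda>p. F' p * D' p) \<in> forms X (d + e)" "(\<lambda>p. D p * G' p) \<in> forms X (d + e)"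
      using F G gradedD(3)[OF X] by auto
    show "\<exists>e. \<exists>F'\<in>forms X e. \<exists>G'\<in>forms X e. \<forall>p\<in>U. (G' p = 0) = (G (\<lambda>i\<in>I. x i p) = 0) \<and>
       (G (\<lambda>i\<in>I. x i p) \<noteq> 0 \<longrightarrow> F (\<lambda>i\<in>I. x i p) / G (\<lambda>i\<in>I. x i p) = F' p / G' p)"
    proof (rule exI[of _ "d + e"], rule bexI[OF _ 1(1)], rule bexI[OF _ 1(2)], rule ballI)
      fix p assume "p \<in> U"
      then have "D p \<noteq> 0" "D' p \<noteq> 0" and e: "F (\<lambda>i\<in>I. x i p) = F' p / D p" "G (\<lambda>i\<in>I. x i p) = G' p / D' p"
        using F(3) G(3) by blast+
      then show "(D p * G' p = 0) = (G (\<lambda>i\<in>I. x i p) = 0) \<and> (G (\<lambda>i\<in>I. x i p) \<noteq> 0 \<longrightarrow>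
          F (\<lambda>i\<in>I. x i p) / G (\<lambda>i\<in>I. x i p) = F' p * D' p / (D p * G' p))"
        unfolding e by simp
    qed
  qed
qed

text \<open>If the coordinates \<open>x\<close> have an inverse \<open>\<psi>\<close> on open sets, the map is birational; pulling back along it identifies
the rational functions with quotients of polynomials in the \<open>x i\<close>, and a polynomial that vanishes on a nonempty open set of the torus
is zero.\<close>
lemma torus_chart:
  assumes I: "finite I" and X: "graded X" "irreducible_variety X"
    and U: "zariski_open X U" "U \<noteq> {}" and W: "zariski_open (algebraic_torus I) W"
    and \<phi>: "\<And>p. p \<in> U \<Longrightarrow> (\<lambda>i\<in>I. x i p) \<in> W \<and> \<psi> (\<lambda>i\<in>I. x i p) = p" and \<psi>: "\<And>q. q \<in> W \<Longrightarrow> \<psi> q \<in> U \<and> (\<lambda>i\<in>I. x i (\<psi> q)) = q"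
    and pb: "pulls_back X U (algebraic_torus I) (\<lambda>p. \<lambda>i\<in>I. x i p)" "pulls_back (algebraic_torus I) W X \<psi>"
  shows "birational_via X (algebraic_torus I) (\<lambda>p. \<lambda>i\<in>I. x i p)" "function_field_is X I x"
proof -
  show "birational_via X (algebraic_torus I) (\<lambda>p. \<lambda>i\<in>I. x i p)"
    by (rule birational_viaI[OF X graded_torus irreducible_torus[OF I] U W \<phi> \<psi> pb])
  let ?\<phi> = "\<lambda>p. \<lambda>i\<in>I. x i p"
  have Pc: "P (\<lambda>i. x i p) = P (?\<phi> p)" if "P \<in> poly_functions I" for P p
    using poly_functions_cong[OF that, of "\<lambda>i. x i p" "?\<phi> p"] by simp
  have fm: "P \<in> forms (algebraic_torus I) d \<longleftrightarrow> P \<in> poly_functions I" for P d by (simp add: algebraic_torus_def)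
  show "function_field_is X I x" unfolding function_field_is_def
  proof (intro conjI ballI allI impI)
    fix i assume i: "i \<in> I"
    obtain e F' G' where F': "F' \<in> forms X e" "G' \<in> forms X e"
      "\<forall>p\<in>U. (G' p = 0 \<longleftrightarrow> (1::complex) = 0) \<and> ((1::complex) \<noteq> 0 \<longrightarrow> ?\<phi> p i / 1 = F' p / G' p)"
      using pb(1)[unfolded pulls_back_def, rule_format, of "\<lambda>z. z i" 0 "\<lambda>_. 1"] i poly_functions.coord[OF i] poly_functions.const
      unfolding fm by blast
    have "regular_on X U (x i)" unfolding regular_on_def
    proof
      fix p assume "p \<in> U"
      have "\<forall>q\<in>U. G' q \<noteq> 0 \<and> x i q = F' q / G' q" using F'(3) i by auto
      then show "\<exists>W. zariski_open X W \<and> p \<in> W \<and> W \<subseteq> U \<and> (\<exists>d. \<exists>F\<in>forms X d. \<exists>G\<in>forms X d. \<forall>q\<in>W. G q \<noteq> 0 \<and> x i q = F q / G q)"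
        using U(1) \<open>p \<in> U\<close> F'(1,2) by blast
    qed
    then show "rational_function X (x i)" unfolding rational_function_def using dense_openI[OF X(2) U] by blast
  next
    fix P assume P: "P \<in> poly_functions I" and z: "rat_eq X (\<lambda>p. P (\<lambda>i. x i p)) (\<lambda>_. 0)"
    show "P = (\<lambda>_. 0)"
    proof (rule ccontr)
      assume "P \<noteq> (\<lambda>_. 0)"
      then obtain w where "P w \<noteq> 0" by auto
      then obtain w where w: "w \<in> points (algebraic_torus I)" "P w \<noteq> 0"
        using torus_point_nonzero[OF I P _ poly_functions.const[of 1], of w] by auto
      have PT: "P \<in> forms (algebraic_torus I) 0" using P fm by auto
      let ?V = "{w \<in> points (algebraic_torus I). P w \<noteq> 0}"
      have V: "zariski_open (algebraic_torus I) ?V"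
        by (rule zariski_open_nonvanishing[OF graded_torus zariski_open_points[OF graded_torus] PT])
      have "W \<noteq> {}" using U \<phi> by auto
      then have "W \<inter> ?V \<noteq> {}" using dense_openI[OF irreducible_torus[OF I] W] V w unfolding dense_open_def by blast
      then obtain v where v: "v \<in> W" "P v \<noteq> 0" by auto
      obtain e P' where P': "P' \<in> forms X e" "\<forall>p\<in>U. P' p = 0 \<longleftrightarrow> P (?\<phi> p) = 0"
        using pb(1) PT unfolding pulls_back_def by metis
      have op: "zariski_open X {p \<in> U. P' p \<noteq> 0}" by (rule zariski_open_nonvanishing[OF X(1) U(1) P'(1)])
      have "\<psi> v \<in> {p \<in> U. P' p \<noteq> 0}" using \<psi>[OF v(1)] v(2) P'(2) by auto
      then obtain U0 where U0: "dense_open X U0" "\<forall>p\<in>U0. P (\<lambda>i. x i p) = 0" "U0 \<inter> {p \<in> U. P' p \<noteq> 0} \<noteq> {}"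
        using z op unfolding rat_eq_def dense_open_def by blast
      then obtain p where "p \<in> U0" "p \<in> U" "P' p \<noteq> 0" by blast
      then show False using U0(2) P'(2) Pc[OF P] by auto
    qed
  next
    fix f assume "rational_function X f"
    then obtain U0 where U0: "dense_open X U0" "regular_on X U0 f" by (auto simp: rational_function_def)
    obtain p where p: "p \<in> U0" "p \<in> U" using U0(1) U unfolding dense_open_def by blast
    obtain V d F G where V: "zariski_open X V" "p \<in> V" "V \<subseteq> U0" and F: "F \<in> forms X d" "G \<in> forms X d" "\<forall>q\<in>V. G q \<noteq> 0 \<and> f q = F q / G q"
      using U0(2) p unfolding regular_on_def by blast
    obtain e P Q where "P \<in> forms (algebraic_torus I) e" "Q \<in> forms (algebraic_torus I) e" and
      P3: "\<forall>w\<in>W. (Q w = 0 \<longleftrightarrow> G (\<psi> w) = 0) \<and> (G (\<psi> w) \<noteq> 0 \<longrightarrow> F (\<psi> w) / G (\<psi> w) = P w / Q w)"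
      using pb(2)[unfolded pulls_back_def, rule_format, OF F(1,2)] by (elim exE bexE)
    then have P: "P \<in> poly_functions I" "Q \<in> poly_functions I"
      "\<forall>w\<in>W. (Q w = 0 \<longleftrightarrow> G (\<psi> w) = 0) \<and> (G (\<psi> w) \<noteq> 0 \<longrightarrow> F (\<psi> w) / G (\<psi> w) = P w / Q w)"
      unfolding fm by blast+
    have VU: "zariski_open X (V \<inter> U)" by (rule zariski_open_Int[OF X(1) V(1) U(1)])
    have eq: "Q (?\<phi> q) \<noteq> 0 \<and> f q = P (?\<phi> q) / Q (?\<phi> q)" if q: "q \<in> V \<inter> U" for q
    proof -
      have "?\<phi> q \<in> W" "\<psi> (?\<phi> q) = q" using \<phi> q by auto
      then show ?thesis using P(3)[rule_format, of "?\<phi> q"] F(3) q by auto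
    qed
    have "Q \<noteq> (\<lambda>_. 0)" using eq[of p] p V by auto
    moreover have "rat_eq X f (\<lambda>p. P (\<lambda>i. x i p) / Q (\<lambda>i. x i p))"
    proof (rule rat_eqI[OF X(2) VU])
      show "V \<inter> U \<noteq> {}" using p V by blast
      show "f q = P (\<lambda>i. x i q) / Q (\<lambda>i. x i q)" if "q \<in> V \<inter> U" for q
        using eq[OF that] unfolding Pc[OF P(1)] Pc[OF P(2)] by blast
    qed
    ultimately show "\<exists>P\<in>poly_functions I. \<exists>Q\<in>poly_functions I. Q \<noteq> (\<lambda>_. 0) \<and> rat_eq X f (\<lambda>p. P (\<lambda>i. x i p) / Q (\<lambda>i. x i p))"
      using P(1,2) by blast
  qed
qed

section \<open>The complex Grassmannian and its twistor coordinates\<close>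

lemma graded_Gr: "graded (Gr_variety k m)"
  unfolding graded_def
proof (intro conjI allI impI)
  fix c show "(\<lambda>_. c) \<in> forms (Gr_variety k m) 0"
    unfolding Gr_variety_def using hom_poly_function.const by fastforce
next
  fix d f g assume "f \<in> forms (Gr_variety k m) d" "g \<in> forms (Gr_variety k m) d"
  then obtain F G where F: "hom_poly_function {I. I \<subseteq> {..<m} \<and> card I = k} d F" "f = (\<lambda>V. F (plucker (rep k m V)))"
    and G: "hom_poly_function {I. I \<subseteq> {..<m} \<and> card I = k} d G" "g = (\<lambda>V. G (plucker (rep k m V)))"
    by (auto simp: Gr_variety_def)
  show "(\<lambda>p. f p + g p) \<in> forms (Gr_variety k m) d"
    using hom_poly_function.add[OF F(1) G(1)] unfolding F(2) G(2) Gr_variety_def by auto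
next
  fix d e f g assume "f \<in> forms (Gr_variety k m) d" "g \<in> forms (Gr_variety k m) e"
  then obtain F G where F: "hom_poly_function {I. I \<subseteq> {..<m} \<and> card I = k} d F" "f = (\<lambda>V. F (plucker (rep k m V)))"
    and G: "hom_poly_function {I. I \<subseteq> {..<m} \<and> card I = k} e G" "g = (\<lambda>V. G (plucker (rep k m V)))"
    by (auto simp: Gr_variety_def)
  show "(\<lambda>p. f p * g p) \<in> forms (Gr_variety k m) (d + e)"
    using hom_poly_function.mult[OF F(1) G(1)] unfolding F(2) G(2) Gr_variety_def by auto
qed

lemma points_Gr [simp]: "points (Gr_variety k m) = Gr k m"
  by (simp add: Gr_variety_def)

lemma forms_GrE:
  assumes "f \<in> forms (Gr_variety k m) d"
  obtains F where "hom_poly_function {I. I \<subseteq> {..<m} \<and> card I = k} d F" "f = (\<lambda>V. F (plucker (rep k m V)))"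
  using assms by (auto simp: Gr_variety_def)

text \<open>Forms are defined through the chosen representative \<open>rep\<close>; a different representative changes the values by powers of one
scalar.\<close>
lemma form_at_representative:
  assumes A: "represents k m A V"
  obtains c :: complex where "c \<noteq> 0"
    "\<And>d F. hom_poly_function {I. I \<subseteq> {..<m} \<and> card I = k} d F \<Longrightarrow> F (plucker (rep k m V)) = c ^ d * F (plucker A)"
proof -
  obtain G where G: "G \<in> carrier_mat k k" "det G \<noteq> 0" "rep k m V = G * A" using rep_unique[OF A] .
  have Ac: "A \<in> carrier_mat k m" using A by (simp add: represents_def)
  show ?thesis
    by (rule that[OF G(2)], erule hom_poly_scale) (use plucker_mult[OF G(1) Ac] G(3) in auto)
qed

lemma plucker_poly_function:
  assumes I: "I \<subseteq> {..<m}" "card I = k" and A: "\<And>i j. i < k \<Longrightarrow> j < m \<Longrightarrow> (\<lambda>z. A z i j) \<in> poly_functions J"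
  shows "(\<lambda>z. plucker (mat k m (\<lambda>(i, j). A z i j)) I) \<in> poly_functions J"
proof -
  have fin: "finite I" using I finite_subset by blast
  have lt: "sorted_list_of_set I ! j < m" if "j < k" for j
    using that I fin nth_mem[of j "sorted_list_of_set I"] by auto
  have e: "plucker (mat k m (\<lambda>(i, j). A z i j)) I = det (mat k k (\<lambda>(i, j). A z i (sorted_list_of_set I ! j)))" for z
    unfolding plucker_rowdet[OF mat_carrier I] rowdet_def
    by (rule arg_cong[of _ _ det], rule eq_matI) (use lt in auto)
  show ?thesis unfolding e by (rule det_poly_function) (use A lt in auto)
qed

text \<open>The Grassmannian is covered by the space of matrices: forms pull back to polynomials in the matrix entries, and multiplying
by a Pluecker coordinate ensures that the common nonzero point has full rank.\<close>
lemma irreducible_Gr: "irreducible_variety (Gr_variety k m)"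
  unfolding irreducible_variety_def
proof (intro allI ballI impI)
  fix d e f g p q
  assume f: "f \<in> forms (Gr_variety k m) d" and g: "g \<in> forms (Gr_variety k m) e" and p: "p \<in> points (Gr_variety k m)" and q: "q \<in> points (Gr_variety k m)"
    and fp: "f p \<noteq> 0" and gq: "g q \<noteq> 0"
  let ?Is = "{I. I \<subseteq> {..<m} \<and> card I = k}"
  obtain F where F: "hom_poly_function ?Is d F" "f = (\<lambda>V. F (plucker (rep k m V)))" using forms_GrE[OF f] .
  obtain G where G: "hom_poly_function ?Is e G" "g = (\<lambda>V. G (plucker (rep k m V)))" using forms_GrE[OF g] .
  let ?A = "\<lambda>z. mat k m (\<lambda>(i, j). z (i, j))"
  let ?J = "{..<k} \<times> {..<m}"
  have pl: "(\<lambda>z. plucker (?A z) I) \<in> poly_functions ?J" if "I \<in> ?Is" for I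
    using that by (intro plucker_poly_function[of I m k "\<lambda>z i j. z (i, j)"]) (auto intro: poly_functions.coord)
  have Fz: "(\<lambda>z. F (plucker (?A z))) \<in> poly_functions ?J"
    by (rule poly_functions_compose[OF hom_poly_poly_function[OF F(1)]]) (rule pl)
  have Gz: "(\<lambda>z. G (plucker (?A z))) \<in> poly_functions ?J"
    by (rule poly_functions_compose[OF hom_poly_poly_function[OF G(1)]]) (rule pl)
  have rp: "represents k m (rep k m p) p" "represents k m (rep k m q) q" using p q rep_represents by auto
  have mat_back: "?A (\<lambda>(i, j). B $$ (i, j)) = B" if "B \<in> carrier_mat k m" for B using that by (intro eq_matI) auto
  have cm: "rep k m p \<in> carrier_mat k m" "rep k m q \<in> carrier_mat k m" using rp by (auto simp: represents_def)
  obtain I where I: "I \<in> ?Is" "plucker (rep k m p) I \<noteq> 0"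
    using full_rank_plucker[OF cm(1)] rp(1) by (auto simp: represents_def)
  \<comment> \<open>The given points, as points of the affine space of matrices.\<close>
  define z1 where "z1 = (\<lambda>(i, j). rep k m p $$ (i, j))"
  have z1: "F (plucker (?A z1)) * plucker (?A z1) I \<noteq> 0"
    unfolding z1_def mat_back[OF cm(1)] using fp I(2) F(2) by simp
  define z2 where "z2 = (\<lambda>(i, j). rep k m q $$ (i, j))"
  have z2: "G (plucker (?A z2)) \<noteq> 0" unfolding z2_def mat_back[OF cm(2)] using gq G(2) by simp
  obtain z where z: "F (plucker (?A z)) * plucker (?A z) I \<noteq> 0" "G (plucker (?A z)) \<noteq> 0"
    using poly_functions_common_nonzero[of "\<lambda>z. F (plucker (?A z)) * plucker (?A z) I" ?J z1 "\<lambda>z. G (plucker (?A z))" z2,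
      OF poly_functions.mult[OF Fz pl[OF I(1)]] z1 Gz z2] by (elim exE conjE)
  define V where "V = vec_space.row_space m (?A z)"
  have "vec_space.rank k (?A z) = k" using full_rank_plucker[of "?A z" k m] z(1) I(1) by auto
  then have V: "represents k m (?A z) V" by (simp add: represents_def V_def)
  obtain c where c: "c \<noteq> 0" "\<And>d F. hom_poly_function ?Is d F \<Longrightarrow> F (plucker (rep k m V)) = c ^ d * F (plucker (?A z))"
    using form_at_representative[OF V] by blast
  have "f V \<noteq> 0" "g V \<noteq> 0" unfolding F(2) G(2) c(2)[OF F(1)] c(2)[OF G(1)] using c(1) z by auto
  moreover have "V \<in> points (Gr_variety k m)" using V by (auto simp: Gr_def)
  ultimately show "\<exists>r\<in>points (Gr_variety k m). f r \<noteq> 0 \<and> g r \<noteq> 0" by blast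
qed

abbreviation cmat :: "real mat \<Rightarrow> complex mat" where "cmat \<equiv> map_mat complex_of_real"

text \<open>The twistor coordinate computed from a given representative \<open>A\<close> in place of the chosen one.\<close>
definition tw :: "complex mat \<Rightarrow> real mat \<Rightarrow> arc \<Rightarrow> complex" where
  "tw A Z e = omega A (rowfun (cmat Z) (fst e)) (rowfun (cmat Z) (snd e))"

lemma det_append_rows_tw:
  assumes Z: "Z \<in> carrier_mat n (k + 2)" and e: "fst e < n" "snd e < n" and A: "A \<in> carrier_mat k (k + 2)"
  shows "det (A @\<^sub>r mat_of_rows (k + 2) (map (row (cmat Z)) [fst e, snd e])) = tw A Z e"
proof -
  have c: "row (cmat Z) i \<in> carrier_vec (k + 2)" for i using Z by (intro carrier_vecI) simp
  have "det (A @\<^sub>r mat_of_rows (k + 2) [row (cmat Z) (fst e), row (cmat Z) (snd e)]) = omega A (($) (row (cmat Z) (fst e))) (($) (row (cmat Z) (snd e)))"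
    by (rule det_append_two_rows[OF A c c])
  also have "\<dots> = tw A Z e" unfolding tw_def
    by (rule omega_cong[OF A]) (use Z e in \<open>auto simp: rowfun_def\<close>)
  finally show ?thesis by simp
qed

lemma twistor_tw:
  assumes Z: "Z \<in> carrier_mat n (k + 2)" and e: "fst e < n" "snd e < n" and Y: "Y \<in> Gr k (k + 2)"
  shows "twistor k Z Y e = tw (rep k (k + 2) Y) Z e"
  unfolding twistor_def using det_append_rows_tw[OF Z e] rep_represents[OF Y] by (simp add: represents_def)

lemma twistor_representative:
  assumes Z: "Z \<in> carrier_mat n (k + 2)" and A: "represents k (k + 2) A Y"
  obtains c where "c \<noteq> 0" "\<And>e. fst e < n \<Longrightarrow> snd e < n \<Longrightarrow> twistor k Z Y e = c * tw A Z e"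
proof -
  obtain G where G: "G \<in> carrier_mat k k" "det G \<noteq> 0" "rep k (k + 2) Y = G * A" using rep_unique[OF A] .
  have Y: "Y \<in> Gr k (k + 2)" and Ac: "A \<in> carrier_mat k (k + 2)" using A by (auto simp: Gr_def represents_def)
  show ?thesis
    by (rule that[OF G(2)]) (simp only: twistor_tw[OF Z _ _ Y] G(3) tw_def omega_mult[OF G(1) Ac])
qed

lemma twistor_form:
  assumes Z: "Z \<in> carrier_mat n (k + 2)" and e: "fst e < n" "snd e < n"
  obtains f where "f \<in> forms (Gr_variety k (k + 2)) 1" "\<And>Y. Y \<in> Gr k (k + 2) \<Longrightarrow> f Y = twistor k Z Y e"
proof -
  let ?Is = "{I. I \<subseteq> {..<k + 2} \<and> card I = k}"
  let ?c = "omega_coeff (k + 2) (rowfun (cmat Z) (fst e)) (rowfun (cmat Z) (snd e))"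
  have "{..<k} \<in> ?Is" by auto
  then have ne: "?Is \<noteq> {}" by blast
  have h: "hom_poly_function ?Is 1 (\<lambda>z. \<Sum>I\<in>?Is. z I * ?c I)"
    by (rule hom_poly_linear[OF _ ne]) auto
  show ?thesis
  proof (rule that)
    show "(\<lambda>V. \<Sum>I\<in>?Is. plucker (rep k (k + 2) V) I * ?c I) \<in> forms (Gr_variety k (k + 2)) 1"
      unfolding Gr_variety_def using h by auto
    fix Y :: "complex vec set" assume Y: "Y \<in> Gr k (k + 2)"
    have "rep k (k + 2) Y \<in> carrier_mat k (k + 2)" using rep_represents[OF Y] by (simp add: represents_def)
    then show "(\<Sum>I\<in>?Is. plucker (rep k (k + 2) Y) I * ?c I) = twistor k Z Y e"
      unfolding twistor_tw[OF Z e Y] tw_def by (rule omega_plucker[symmetric])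
  qed
qed

text \<open>Twistor coordinates are the \<open>2 \<times> 2\<close> minors of the values of two linear forms that cut out \<open>Y\<close>.\<close>
lemma twistor_functionals:
  assumes Z: "Z \<in> carrier_mat n (k + 2)" and Y: "Y \<in> Gr k (k + 2)"
  obtains l m where
    "\<And>a b. a < n \<Longrightarrow> b < n \<Longrightarrow> twistor k Z Y (a, b) = l a * m b - m a * l b"
    "\<And>S c. finite S \<Longrightarrow> S \<subseteq> {..<n} \<Longrightarrow> vec (k + 2) (\<lambda>j. \<Sum>v\<in>S. c v * rowfun (cmat Z) v j) \<in> Y \<longleftrightarrow>
       (\<Sum>v\<in>S. c v * l v) = 0 \<and> (\<Sum>v\<in>S. c v * m v) = 0"
proof -
  let ?A = "rep k (k + 2) Y"
  have A: "?A \<in> carrier_mat k (k + 2)" "vec_space.rank k ?A = k" "Y = vec_space.row_space (k + 2) ?A"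
    using rep_represents[OF Y] by (auto simp: represents_def)
  obtain l m where o: "\<And>f g. omega ?A f g = (\<Sum>j<k+2. f j * l j) * (\<Sum>j<k+2. g j * m j) - (\<Sum>j<k+2. f j * m j) * (\<Sum>j<k+2. g j * l j)"
    and s: "\<And>f. vec (k + 2) f \<in> vec_space.row_space (k + 2) ?A \<longleftrightarrow> (\<Sum>j<k+2. f j * l j) = 0 \<and> (\<Sum>j<k+2. f j * m j) = 0"
    using omega_rank_two[OF A(1,2)] by blast
  have lin: "(\<Sum>j<k+2. (\<Sum>v\<in>S. c v * rowfun (cmat Z) v j) * h j) = (\<Sum>v\<in>S. c v * (\<Sum>j<k+2. rowfun (cmat Z) v j * h j))" for S c h
    unfolding sum_distrib_left sum_distrib_right by (subst sum.swap) (simp add: mult.assoc)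
  show ?thesis
  proof (rule that)
    show "twistor k Z Y (a, b) = (\<Sum>j<k+2. rowfun (cmat Z) a j * l j) * (\<Sum>j<k+2. rowfun (cmat Z) b j * m j) -
      (\<Sum>j<k+2. rowfun (cmat Z) a j * m j) * (\<Sum>j<k+2. rowfun (cmat Z) b j * l j)" if "a < n" "b < n" for a b
      using twistor_tw[OF Z _ _ Y, of "(a, b)"] that by (simp only: tw_def o fst_conv snd_conv)
    show "vec (k + 2) (\<lambda>j. \<Sum>v\<in>S. c v * rowfun (cmat Z) v j) \<in> Y \<longleftrightarrow>
       (\<Sum>v\<in>S. c v * (\<Sum>j<k+2. rowfun (cmat Z) v j * l j)) = 0 \<and> (\<Sum>v\<in>S. c v * (\<Sum>j<k+2. rowfun (cmat Z) v j * m j)) = 0"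
      if "finite S" "S \<subseteq> {..<n}" for S c
      using s[of "\<lambda>j. \<Sum>v\<in>S. c v * rowfun (cmat Z) v j"] unfolding A(3)[symmetric] lin .
  qed
qed

text \<open>The three-term relation between the minors of a \<open>2 \<times> 4\<close> matrix.\<close>
lemma twistor_ptolemy:
  assumes Z: "Z \<in> carrier_mat n (k + 2)" and Y: "Y \<in> Gr k (k + 2)" and "a < n" "b < n" "c < n" "d < n"
  shows "twistor k Z Y (a, c) * twistor k Z Y (b, d) = twistor k Z Y (a, b) * twistor k Z Y (c, d) + twistor k Z Y (a, d) * twistor k Z Y (b, c)"
proof -
  obtain l m where t: "\<And>a b. a < n \<Longrightarrow> b < n \<Longrightarrow> twistor k Z Y (a, b) = l a * m b - m a * l b"
    using twistor_functionals[OF Z Y] by metis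
  show ?thesis unfolding t[OF assms(3,4)] t[OF assms(3,5)] t[OF assms(3,6)] t[OF assms(4,5)] t[OF assms(4,6)] t[OF assms(5,6)]
    by (simp add: algebra_simps)
qed

lemma rowdet_of_real: "rowdet (map (\<lambda>r j. complex_of_real (r j)) rs) = complex_of_real (rowdet rs)"
proof -
  have "mat (length rs) (length rs) (\<lambda>(i, j). (map (\<lambda>r j. complex_of_real (r j)) rs ! i) j) = cmat (mat (length rs) (length rs) (\<lambda>(i, j). (rs ! i) j))"
    by (rule eq_matI) auto
  then show ?thesis unfolding rowdet_def by (simp add: of_real_hom.hom_det)
qed

lemma tw_cmat:
  assumes "A \<in> carrier_mat k (k + 2)" "Z \<in> carrier_mat n (k + 2)" "fst e < n" "snd e < n"
  shows "tw (cmat A) Z e = complex_of_real (omega A (rowfun Z (fst e)) (rowfun Z (snd e)))"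
  unfolding tw_def omega_def rowdet_of_real[symmetric]
  by (rule rowdet_cong) (use assms in \<open>auto simp: nth_append nth_Cons' rowfun_def\<close>)

section \<open>The torus chart of a triangulation\<close>

lemma triangle_sum:
  fixes w :: "arc \<Rightarrow> 'a::comm_ring_1"
  assumes o: "a < b" "b < c" and t: "{a, b, c} \<subseteq> {..<n}"
  shows "(\<Sum>v<n. triangle_relation w {a, b, c} v * l v) = w (b, c) * l a - w (a, c) * l b + w (a, b) * l c"
proof -
  note s = triangle_simps[OF o]
  have "(\<Sum>v<n. triangle_relation w {a, b, c} v * l v) = (\<Sum>v\<in>{a, b, c}. triangle_relation w {a, b, c} v * l v)"
    by (rule sum.mono_neutral_right) (use t in \<open>auto simp: triangle_relation_def triangle_weight_def s\<close>)
  then show ?thesis using o by (simp add: triangle_relation_def triangle_weight_def s)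
qed

lemma rowfun_relation_matrix:
  fixes w :: "arc \<Rightarrow> complex"
  assumes Z: "Z \<in> carrier_mat n m" and ij: "i < k" "j < m"
  shows "rowfun (relation_matrix k n \<tau> w * cmat Z) i j = (\<Sum>v<n. triangle_relation w (\<tau> i) v * rowfun (cmat Z) v j)"
proof -
  have M: "relation_matrix k n \<tau> w \<in> carrier_mat k n" "cmat Z \<in> carrier_mat n m" using Z by (auto simp: relation_matrix_def)
  show ?thesis unfolding rowfuns_mult[OF M ij]
    by (rule sum.cong[OF HOL.refl]) (use ij in \<open>auto simp: rowfun_def relation_matrix_def\<close>)
qed

text \<open>In terms of the functionals \<open>l\<close>, \<open>m\<close>, membership in \<open>Y\<close> says that \<open>(w\<^sub>b\<^sub>c, -w\<^sub>a\<^sub>c, w\<^sub>a\<^sub>b)\<close> is orthogonal to the two vectors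
\<open>(l a, l b, l c)\<close> and \<open>(m a, m b, m c)\<close>. Their cross product, formed by the twistor coordinates, is; and every such vector
is proportional to it.\<close>
lemma triangle_row_iff:
  assumes Z: "Z \<in> carrier_mat n (k + 2)" and Y: "Y \<in> Gr k (k + 2)" and t: "t \<in> triangles E" "t \<subseteq> {..<n}"
  shows "\<And>\<gamma>. (\<And>e. e \<in> chords t \<Longrightarrow> w e = \<gamma> * twistor k Z Y e) \<Longrightarrow>
      vec (k + 2) (\<lambda>j. \<Sum>v<n. triangle_relation w t v * rowfun (cmat Z) v j) \<in> Y"
    and "vec (k + 2) (\<lambda>j. \<Sum>v<n. triangle_relation w t v * rowfun (cmat Z) v j) \<in> Y \<Longrightarrow> e \<in> chords t \<Longrightarrow> e' \<in> chords t \<Longrightarrow>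
      (\<And>e. e \<in> chords t \<Longrightarrow> w e \<noteq> 0) \<Longrightarrow> twistor k Z Y e / w e = twistor k Z Y e' / w e'"
proof -
  from t(1) obtain a b c where a: "t = {a, b, c}" "a < b" "b < c" "chords t = {(a, b), (b, c), (a, c)}" by (rule trianglesE)
  have n: "a < n" "b < n" "c < n" using a t(2) by auto
  obtain l m where tw: "\<And>a b. a < n \<Longrightarrow> b < n \<Longrightarrow> twistor k Z Y (a, b) = l a * m b - m a * l b"
    and mem: "\<And>S c. finite S \<Longrightarrow> S \<subseteq> {..<n} \<Longrightarrow> vec (k + 2) (\<lambda>j. \<Sum>v\<in>S. c v * rowfun (cmat Z) v j) \<in> Y \<longleftrightarrow>
       (\<Sum>v\<in>S. c v * l v) = 0 \<and> (\<Sum>v\<in>S. c v * m v) = 0"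
    using twistor_functionals[OF Z Y] by blast
  have tw3: "twistor k Z Y (a, b) = l a * m b - m a * l b" "twistor k Z Y (b, c) = l b * m c - m b * l c" "twistor k Z Y (a, c) = l a * m c - m a * l c"
    using tw n by auto
  have iff: "vec (k + 2) (\<lambda>j. \<Sum>v<n. triangle_relation w t v * rowfun (cmat Z) v j) \<in> Y \<longleftrightarrow>
     w (b, c) * l a - w (a, c) * l b + w (a, b) * l c = 0 \<and> w (b, c) * m a - w (a, c) * m b + w (a, b) * m c = 0"
    using mem[of "{..<n}" "triangle_relation w t"] triangle_sum[OF a(2,3), of n w] t(2) unfolding a(1) by simp
  show "vec (k + 2) (\<lambda>j. \<Sum>v<n. triangle_relation w t v * rowfun (cmat Z) v j) \<in> Y"
    if "\<And>e. e \<in> chords t \<Longrightarrow> w e = \<gamma> * twistor k Z Y e" for \<gamma>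
  proof -
    have w: "w (a, b) = \<gamma> * (l a * m b - m a * l b)" "w (b, c) = \<gamma> * (l b * m c - m b * l c)" "w (a, c) = \<gamma> * (l a * m c - m a * l c)"
      using that a(4) tw3 by auto
    show ?thesis unfolding iff w by (simp add: algebra_simps)
  qed
  assume r: "vec (k + 2) (\<lambda>j. \<Sum>v<n. triangle_relation w t v * rowfun (cmat Z) v j) \<in> Y"
    and e: "e \<in> chords t" "e' \<in> chords t" and nz: "\<And>e. e \<in> chords t \<Longrightarrow> w e \<noteq> 0"
  have R: "w (b, c) * l a - w (a, c) * l b + w (a, b) * l c = 0" "w (b, c) * m a - w (a, c) * m b + w (a, b) * m c = 0" using r iff by auto
  have w: "w (a, b) \<noteq> 0" "w (b, c) \<noteq> 0" "w (a, c) \<noteq> 0" using nz a(4) by auto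
  have "w (b, c) * twistor k Z Y (a, b) - w (a, b) * twistor k Z Y (b, c) =
     (w (b, c) * l a - w (a, c) * l b + w (a, b) * l c) * m b - (w (b, c) * m a - w (a, c) * m b + w (a, b) * m c) * l b"
    unfolding tw3 by (simp add: algebra_simps)
  then have 1: "w (b, c) * twistor k Z Y (a, b) = w (a, b) * twistor k Z Y (b, c)" unfolding R by simp
  have "w (a, c) * twistor k Z Y (a, b) - w (a, b) * twistor k Z Y (a, c) =
     (w (b, c) * l a - w (a, c) * l b + w (a, b) * l c) * m a - (w (b, c) * m a - w (a, c) * m b + w (a, b) * m c) * l a"
    unfolding tw3 by (simp add: algebra_simps)
  then have 2: "w (a, c) * twistor k Z Y (a, b) = w (a, b) * twistor k Z Y (a, c)" unfolding R by simp
  have q: "twistor k Z Y f / w f = twistor k Z Y (a, b) / w (a, b)" if "f \<in> chords t" for f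
    using that 1 2 w unfolding a(4) by (auto simp: field_simps)
  show "twistor k Z Y e / w e = twistor k Z Y e' / w e'" using q[OF e(1)] q[OF e(2)] by simp
qed

text \<open>The data of the theorem: a subdivision, a positive matrix and a distinguished side of each black polygon.\<close>
locale tile_setting = subdivision k n S for k n :: nat and S :: bicolored +
  fixes Z :: "real mat" and \<delta> :: "nat set \<Rightarrow> arc"
  assumes kpos: "k > 0" and Zpos: "Z \<in> Mat_pos n (k + 2)" and \<delta>: "P \<in> black S \<Longrightarrow> \<delta> P \<in> sides P"
begin

abbreviation "Gk \<equiv> Gr_variety k (k + 2)"
abbreviation "tws \<equiv> twistor k Z"
abbreviation "xvar \<equiv> cluster_variable k n Z S \<delta>"
abbreviation "seed_of \<equiv> triangulation_seed k n Z S \<delta>"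

lemma Z: "Z \<in> carrier_mat n (k + 2)" using Zpos by (simp add: Mat_pos_def)

lemma polygon_of: "P \<in> black S \<Longrightarrow> e \<in> chords P \<Longrightarrow> (THE P. P \<in> black S \<and> e \<in> chords P) = P"
  by (rule the_equality) (simp, erule conjE, rule B_disj)

lemma xvar_eq:
  assumes "P \<in> black S" "e \<in> chords P"
  shows "xvar e Y = ((-1) ^ area k n S e * tws Y e) / ((-1) ^ area k n S (\<delta> P) * tws Y (\<delta> P))"
  unfolding cluster_variable_def polygon_of[OF assms] Let_def ..

lemma \<delta>_chord: "P \<in> black S \<Longrightarrow> \<delta> P \<in> chords P"
  using \<delta>[of P] by (cases "\<delta> P") (auto simp: sides_def)

lemma inj_\<delta>: "inj_on \<delta> (black S)"
  using \<delta>_chord B_disj by (metis inj_onI)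

lemma \<delta>_boundary: "\<delta> ` black S \<subseteq> boundary_arcs S"
  using \<delta> by (auto simp: boundary_arcs_def)

lemma verts_seed:
  assumes "T \<in> represented_by k n S"
  shows "verts (seed_of T) = black_arcs T - \<delta> ` black S"
  using black_arcsD(2)[OF assms] \<delta>_boundary by (auto simp: verts_def triangulation_seed_def Let_def)

text \<open>A black polygon with \<open>p\<close> vertices has \<open>2 p - 3\<close> arcs, one of which is distinguished, and \<open>p - 2\<close> triangles.\<close>
lemma card_verts:
  assumes T: "T \<in> represented_by k n S"
  shows "finite (verts (seed_of T))" "card (verts (seed_of T)) = 2 * k"
proof -
  note B = black_arcsD[OF T]
  show "finite (verts (seed_of T))" unfolding verts_seed[OF T] using B by auto
  have "card (black_arcs T - \<delta> ` black S) = card (black_arcs T) - card (\<delta> ` black S)"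
    using \<delta>_boundary B finite_B by (intro card_Diff_subset) auto
  also have "\<dots> = (\<Sum>P\<in>black S. 2 * card P - 3) - (\<Sum>P\<in>black S. 1)"
    using B(4) card_image[OF inj_\<delta>] by simp
  also have "\<dots> = 2 * (\<Sum>P\<in>black S. card P - 2)"
  proof -
    have "(\<Sum>P\<in>black S. 2 * card P - 3) = (\<Sum>P\<in>black S. 2 * (card P - 2) + 1)"
      by (rule sum.cong[OF HOL.refl]) (use black_polygonD(3) in force)
    then show ?thesis by (simp only: sum.distrib sum_distrib_left)
  qed
  finally show "card (verts (seed_of T)) = 2 * k" unfolding verts_seed[OF T] using k_sum by simp
qed

lemma arc_bounds:
  assumes "T \<in> represented_by k n S" "e \<in> arcs_of n T"
  shows "fst e < n" "snd e < n" "fst e < snd e"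
  using max_noncrossingD(5)[OF representedD(1)[OF assms(1)], of "fst e" "snd e"] assms(2) by auto

lemma arc_polygon:
  assumes T: "T \<in> represented_by k n S" and e: "e \<in> black_arcs T"
  obtains P where "P \<in> black S" "e \<in> arcs_of n T \<inter> chords P"
  using e black_arcs_eq[OF T] by auto

lemma seed_torusD: "Y \<in> seed_torus k Z T \<Longrightarrow> Y \<in> Gr k (k + 2)"
  by (simp add: seed_torus_def)

lemma seed_torus_iff:
  assumes "T \<in> represented_by k n S"
  shows "Y \<in> seed_torus k Z T \<longleftrightarrow> Y \<in> Gr k (k + 2) \<and> (\<forall>e\<in>black_arcs T. tws Y e \<noteq> 0)"
  using black_arcsD(3)[OF assms] by (auto simp: seed_torus_def)

text \<open>Twistor coordinates are linear forms, hence their product is a form.\<close>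
lemma seed_torus_open:
  assumes T: "T \<in> represented_by k n S"
  shows "zariski_open Gk (seed_torus k Z T)"
proof -
  note B = black_arcsD[OF T]
  have "\<exists>f. f \<in> forms Gk 1 \<and> (\<forall>Y\<in>Gr k (k + 2). f Y = tws Y e)" if e: "e \<in> black_arcs T" for e
    using twistor_form[OF Z arc_bounds(1,2)[OF T]] e B(1) by (metis subsetD)
  then obtain f where f: "\<And>e. e \<in> black_arcs T \<Longrightarrow> f e \<in> forms Gk 1" "\<And>e Y. e \<in> black_arcs T \<Longrightarrow> Y \<in> Gr k (k + 2) \<Longrightarrow> f e Y = tws Y e"
    by metis
  have "(\<lambda>Y. \<Prod>e\<in>black_arcs T. f e Y) \<in> forms Gk (1 * card (black_arcs T))"
    by (rule graded_prod[OF graded_Gr B(3) f(1)])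
  from zariski_open_nonvanishing[OF graded_Gr zariski_open_points[OF graded_Gr] this]
  have "zariski_open Gk {Y \<in> Gr k (k + 2). (\<Prod>e\<in>black_arcs T. f e Y) \<noteq> 0}" by simp
  moreover have "{Y \<in> Gr k (k + 2). (\<Prod>e\<in>black_arcs T. f e Y) \<noteq> 0} = seed_torus k Z T"
    unfolding seed_torus_def using f(2) by (auto simp: B(3))
  ultimately show ?thesis by simp
qed

lemma area_arc:
  assumes T: "T \<in> represented_by k n S" and e: "e \<in> arcs_of n T"
  shows "area k n S e = area_of (black T) e"
  using area_eq[OF assms] by (simp add: area_in_def area_of_def)

end

text \<open>An enumeration \<open>\<tau>\<close> of the black triangles turns the relations of the triangles into the rows of a matrix.\<close>
locale chart = tile_setting k n S Z \<delta> for k n :: nat and S :: bicolored and Z :: "real mat" and \<delta> :: "nat set \<Rightarrow> arc" +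
  fixes T :: bicolored and \<tau> :: "nat \<Rightarrow> nat set"
  assumes T: "T \<in> represented_by k n S" and \<tau>_bij: "bij_betw \<tau> {..<k} (black T)"
begin

abbreviation "I \<equiv> verts (seed_of T)"

sublocale bt: black_triangles "arcs_of n T" "black T" k n \<tau>
  using representedD[OF T] \<tau>_bij max_noncrossingD(2)[OF representedD(1)[OF T]] by unfold_locales

text \<open>The twistor coordinates that the plane with coordinates \<open>x\<close> is meant to have, normalized so that each distinguished arc
has cluster variable \<open>1\<close>. The sign is that of the cluster variable, by \<open>area_arc\<close>.\<close>
definition weight :: "(arc \<Rightarrow> complex) \<Rightarrow> arc \<Rightarrow> complex" where
  "weight x e = (-1) ^ area_of (black T) e * (if e \<in> I then x e else 1)"

definition plane_matrix :: "(arc \<Rightarrow> complex) \<Rightarrow> complex mat" where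
  "plane_matrix x = relation_matrix k n \<tau> (weight x) * cmat Z"

definition plane :: "(arc \<Rightarrow> complex) \<Rightarrow> complex vec set" where
  "plane x = vec_space.row_space (k + 2) (plane_matrix x)"

text \<open>The polynomial that cuts out the points of the torus where the plane is degenerate or leaves the seed torus. As \<open>k > 0\<close>, the
product is not empty, so its nonvanishing also guarantees full rank.\<close>
definition disc :: "(arc \<Rightarrow> complex) \<Rightarrow> complex" where
  "disc x = (\<Prod>e\<in>black_arcs T. tw (plane_matrix x) Z e)"

definition coords :: "complex vec set \<Rightarrow> arc \<Rightarrow> complex" where
  "coords Y = (\<lambda>e\<in>I. xvar e Y)"

lemma plane_matrix_carrier: "plane_matrix x \<in> carrier_mat k (k + 2)"
  using Z by (auto simp: plane_matrix_def relation_matrix_def)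

lemma black_arcs_chords: "black_arcs T = (\<Union>t\<in>black T. chords t)" by (simp add: black_arcs_def)

lemma disc_represents:
  assumes "disc x \<noteq> 0" shows "represents k (k + 2) (plane_matrix x) (plane x)" "plane x \<in> Gr k (k + 2)"
proof -
  have "black T \<noteq> {}" using kpos representedD(6)[OF T] by auto
  then obtain t where t: "t \<in> black T" by auto
  then have "chords t \<noteq> {}" using representedD(5)[OF T] by (auto elim!: trianglesE)
  then obtain e where "e \<in> black_arcs T" using t black_arcs_chords by blast
  then have "tw (plane_matrix x) Z e \<noteq> 0" using assms black_arcsD(3)[OF T] by (auto simp: disc_def)
  then have "vec_space.rank k (plane_matrix x) = k" unfolding tw_def by (rule omega_full_rank[OF plane_matrix_carrier])
  then show "represents k (k + 2) (plane_matrix x) (plane x)" using plane_matrix_carrier by (simp add: represents_def plane_def)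
  then show "plane x \<in> Gr k (k + 2)" by (auto simp: Gr_def)
qed

lemma triangle_arcs:
  assumes "t \<in> black T"
  shows "t \<in> triangles (arcs_of n T)" "t \<subseteq> {..<n}" "chords t \<subseteq> black_arcs T" "chords t \<subseteq> arcs_of n T" "\<exists>P\<in>black S. t \<subseteq> P"
proof -
  show t: "t \<in> triangles (arcs_of n T)" using assms representedD(5)[OF T] by auto
  show "t \<subseteq> {..<n}" by (rule bt.B_vertices[OF assms])
  show "chords t \<subseteq> black_arcs T" using assms black_arcs_chords by auto
  show "chords t \<subseteq> arcs_of n T" using t by (auto elim!: trianglesE)
  show "\<exists>P\<in>black S. t \<subseteq> P" using assms representedD(3)[OF T] by (auto simp: black_of_def)
qed

lemma weight_\<delta>: "P \<in> black S \<Longrightarrow> weight x (\<delta> P) = (-1) ^ area_of (black T) (\<delta> P)"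
  by (simp add: weight_def verts_seed[OF T])

text \<open>Within a black polygon the weights are proportional to the twistor coordinates.\<close>
lemma weight_coords:
  assumes Y: "Y \<in> seed_torus k Z T" and P: "P \<in> black S" and e: "e \<in> arcs_of n T \<inter> chords P"
  shows "weight (coords Y) e = tws Y e * (1 / ((-1) ^ area_of (black T) (\<delta> P) * tws Y (\<delta> P)))"
proof -
  have bd: "\<delta> P \<in> black_arcs T" using \<delta>_boundary black_arcsD(2)[OF T] P by auto
  have nz: "tws Y (\<delta> P) \<noteq> 0" using Y bd seed_torus_iff[OF T] by auto
  have a: "area k n S (\<delta> P) = area_of (black T) (\<delta> P)" by (rule area_arc[OF T]) (use bd black_arcsD(1)[OF T] in auto)
  have eb: "e \<in> black_arcs T" using e P black_arcs_eq[OF T] by auto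
  have sq: "(-1::complex) ^ m * (-1) ^ m = 1" for m by (simp flip: power_add)
  show ?thesis
  proof (cases "e \<in> I")
    case True
    have "xvar e Y = ((-1) ^ area k n S e * tws Y e) / ((-1) ^ area k n S (\<delta> P) * tws Y (\<delta> P))" using xvar_eq[OF P] e by auto
    then have "weight (coords Y) e = ((-1) ^ area_of (black T) e * (-1) ^ area_of (black T) e) * tws Y e / ((-1) ^ area_of (black T) (\<delta> P) * tws Y (\<delta> P))"
      using True area_arc[OF T, of e] a e by (simp add: weight_def coords_def mult.assoc)
    then show ?thesis unfolding sq by simp
  next
    case False
    then obtain Q where Q: "Q \<in> black S" "e = \<delta> Q" using eb verts_seed[OF T] by auto
    have "Q = P" using B_disj[OF Q(1) P, of e] \<delta>_chord[OF Q(1)] Q(2) e by auto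
    then have "weight (coords Y) e = (-1) ^ area_of (black T) (\<delta> P)" using Q weight_\<delta>[OF P] by simp
    moreover have "(-1::complex) ^ area_of (black T) (\<delta> P) = 1 / (-1) ^ area_of (black T) (\<delta> P)"
      using sq[of "area_of (black T) (\<delta> P)"] by (simp add: field_simps)
    ultimately show ?thesis using Q \<open>Q = P\<close> nz by simp
  qed
qed

text \<open>All rows of the matrix lie in \<open>Y\<close>, since the weights are proportional to the twistor coordinates on each triangle.\<close>
lemma plane_coords:
  assumes Y: "Y \<in> seed_torus k Z T" and d: "disc (coords Y) \<noteq> 0"
  shows "represents k (k + 2) (plane_matrix (coords Y)) Y" "plane (coords Y) = Y"
proof -
  have YG: "Y \<in> Gr k (k + 2)" using Y seed_torusD by auto
  show r: "represents k (k + 2) (plane_matrix (coords Y)) Y"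
  proof (rule represents_of_rows(1)[OF rep_represents[OF YG] plane_matrix_carrier])
    show "vec_space.rank k (plane_matrix (coords Y)) = k" using disc_represents(1)[OF d] by (simp add: represents_def)
    fix i assume i: "i < k"
    have t: "\<tau> i \<in> black T" using bt.\<tau>B[OF i] .
    note ta = triangle_arcs[OF t]
    obtain P where P: "P \<in> black S" "\<tau> i \<subseteq> P" using ta(5) by auto
    have "vec (k + 2) (\<lambda>j. \<Sum>v<n. triangle_relation (weight (coords Y)) (\<tau> i) v * rowfun (cmat Z) v j) \<in> Y"
    proof (rule triangle_row_iff(1)[OF Z YG ta(1,2)])
      fix e assume "e \<in> chords (\<tau> i)"
      then have "e \<in> arcs_of n T \<inter> chords P" using ta(4) chords_mono[OF P(2)] by blast
      then show "weight (coords Y) e = (1 / ((-1) ^ area_of (black T) (\<delta> P) * tws Y (\<delta> P))) * tws Y e"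
        using weight_coords[OF Y P(1)] by (simp add: mult.commute)
    qed
    moreover have "vec (k + 2) (rowfun (plane_matrix (coords Y)) i) = vec (k + 2) (\<lambda>j. \<Sum>v<n. triangle_relation (weight (coords Y)) (\<tau> i) v * rowfun (cmat Z) v j)"
      by (rule eq_vecI) (use rowfun_relation_matrix[OF Z i] in \<open>auto simp: plane_matrix_def\<close>)
    ultimately show "vec (k + 2) (rowfun (plane_matrix (coords Y)) i) \<in> Y" by simp
  qed
  then show "plane (coords Y) = Y" by (simp add: represents_def plane_def)
qed

text \<open>On each black triangle the twistor coordinates of the plane are proportional to the weights. The factor is the same for
triangles with a common arc, hence for a whole black polygon, and cancels in the cluster variables.\<close>
lemma coords_plane:
  assumes x: "x \<in> points (algebraic_torus I)" and d: "disc x \<noteq> 0"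
  shows "plane x \<in> seed_torus k Z T" "coords (plane x) = x"
proof -
  let ?Y = "plane x"
  note R = disc_represents[OF d]
  obtain c where c: "c \<noteq> 0" "\<And>e. fst e < n \<Longrightarrow> snd e < n \<Longrightarrow> tws ?Y e = c * tw (plane_matrix x) Z e"
    using twistor_representative[OF Z R(1)] by blast
  have "tws ?Y e \<noteq> 0" if "e \<in> black_arcs T" for e
  proof -
    have "tws ?Y e = c * tw (plane_matrix x) Z e" by (rule c(2); rule arc_bounds[OF T]) (use that black_arcsD(1)[OF T] in auto)
    moreover have "tw (plane_matrix x) Z e \<noteq> 0" using that d black_arcsD(3)[OF T] by (simp add: disc_def)
    ultimately show ?thesis using c(1) by simp
  qed
  then show Y: "?Y \<in> seed_torus k Z T" using seed_torus_iff[OF T] R(2) by auto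
  have x0: "x e \<noteq> 0" if "e \<in> I" for e using x that by (auto simp: algebraic_torus_def)
  have w0: "weight x e \<noteq> 0" for e using x0 by (simp add: weight_def)
  have ratio: "tws ?Y e / weight x e = tws ?Y e' / weight x e'" if t: "t \<in> black T" "e \<in> chords t" "e' \<in> chords t" for t e e'
  proof -
    obtain i where i: "i < k" "t = \<tau> i" using t(1) \<tau>_bij by (auto simp: bij_betw_def)
    have "vec (k + 2) (rowfun (plane_matrix x) i) = vec (k + 2) (\<lambda>j. \<Sum>v<n. triangle_relation (weight x) t v * rowfun (cmat Z) v j)"
      by (rule eq_vecI) (use rowfun_relation_matrix[OF Z i(1)] i(2) in \<open>auto simp: plane_matrix_def\<close>)
    moreover have "vec (k + 2) (rowfun (plane_matrix x) i) \<in> ?Y"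
      unfolding plane_def by (rule row_in_row_space[OF plane_matrix_carrier i(1)])
    ultimately show ?thesis using triangle_row_iff(2)[OF Z R(2) triangle_arcs(1,2)[OF t(1)] _ t(2,3) w0] by simp
  qed
  have const: "tws ?Y (a, b) / weight x (a, b) = tws ?Y (Min P, Max P) / weight x (Min P, Max P)"
    if P: "P \<in> black S" and e: "(a, b) \<in> arcs_of n T \<inter> chords P" for P a b
  proof (rule arc_induct_from_top[OF poly[OF representedD(2,1)[OF T] P] e, where Q = "\<lambda>a b. tws ?Y (a, b) / weight x (a, b) = tws ?Y (Min P, Max P) / weight x (Min P, Max P)"])
    fix u v w assume uvw: "u < v" "v < w" "(u, v) \<in> arcs_of n T \<inter> chords P" "(v, w) \<in> arcs_of n T \<inter> chords P" "(u, w) \<in> arcs_of n T \<inter> chords P"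
      and q: "tws ?Y (u, w) / weight x (u, w) = tws ?Y (Min P, Max P) / weight x (Min P, Max P)"
    have "{u, v, w} \<in> triangles (arcs_of n T)" using uvw by (auto intro!: trianglesI)
    moreover have "{u, v, w} \<subseteq> P" using uvw by (auto simp: chords_def)
    ultimately have t: "{u, v, w} \<in> black T" using P representedD(3)[OF T] by (auto simp: black_of_def)
    note s = triangle_simps(5)[OF uvw(1,2)]
    show "tws ?Y (u, v) / weight x (u, v) = tws ?Y (Min P, Max P) / weight x (Min P, Max P) \<and>
      tws ?Y (v, w) / weight x (v, w) = tws ?Y (Min P, Max P) / weight x (Min P, Max P)"
      using ratio[OF t, of "(u, v)" "(u, w)"] ratio[OF t, of "(v, w)" "(u, w)"] q by (simp add: s)
  qed simp
  have xe: "xvar e ?Y = x e" if e: "e \<in> I" for e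
  proof -
    have eb: "e \<in> black_arcs T" using e verts_seed[OF T] by auto
    obtain P where P: "P \<in> black S" "e \<in> arcs_of n T \<inter> chords P" using arc_polygon[OF T eb] .
    let ?h = "\<delta> P"
    have hb: "?h \<in> black_arcs T" using \<delta>_boundary black_arcsD(2)[OF T] P by auto
    then have hP: "?h \<in> arcs_of n T \<inter> chords P" using \<delta>_chord[OF P(1)] black_arcsD(1)[OF T] by auto
    have r: "tws ?Y e / weight x e = tws ?Y ?h / weight x ?h"
      using const[OF P(1), of "fst e" "snd e"] const[OF P(1), of "fst ?h" "snd ?h"] P(2) hP by simp
    have h0: "tws ?Y ?h \<noteq> 0" using Y hb seed_torus_iff[OF T] by auto
    have "xvar e ?Y = ((-1) ^ area_of (black T) e * tws ?Y e) / ((-1) ^ area_of (black T) ?h * tws ?Y ?h)"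
      using xvar_eq[OF P(1)] P(2) area_arc[OF T, of e] area_arc[OF T, of ?h] hP by auto
    also have "tws ?Y e = weight x e * (tws ?Y ?h / weight x ?h)" using r w0[of e] by (simp add: field_simps)
    also have "((-1) ^ area_of (black T) e * (weight x e * (tws ?Y ?h / weight x ?h))) / ((-1) ^ area_of (black T) ?h * tws ?Y ?h) = x e"
    proof -
      have sq: "(-1::complex) ^ m * ((-1) ^ m * y) = y" for m y by (simp add: mult.assoc[symmetric] flip: power_add)
      have "((-1) ^ area_of (black T) e * (weight x e * (tws ?Y ?h / weight x ?h))) = x e * (tws ?Y ?h / weight x ?h)"
        using e sq[of _ "x e * (tws ?Y ?h / weight x ?h)"] by (simp add: weight_def mult.assoc)
      then show ?thesis unfolding weight_\<delta>[OF P(1)] using h0 sq[of "area_of (black T) ?h" 1] by (simp add: field_simps)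
    qed
    finally show ?thesis .
  qed
  show "coords ?Y = x"
  proof
    fix e show "coords ?Y e = x e"
    proof (cases "e \<in> I")
      case True then show ?thesis using xe by (simp add: coords_def)
    next
      case False
      have "x \<in> (\<Pi>\<^sub>E i\<in>I. - {0})" using x by (simp add: algebraic_torus_def)
      from PiE_arb[OF this False] False show ?thesis by (simp add: coords_def)
    qed
  qed
qed

end

context chart
begin

lemma weight_poly: "(\<lambda>x. weight x e) \<in> poly_functions I"
proof (cases "e \<in> I")
  case True
  then show ?thesis using poly_functions_cmult[OF poly_functions.coord[OF True], of "(-1) ^ area_of (black T) e"] by (simp add: weight_def)
next
  case False then show ?thesis by (simp add: weight_def poly_functions.const)
qed

lemma neg_poly: "F \<in> poly_functions J \<Longrightarrow> (\<lambda>x. - F x) \<in> poly_functions J"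
  using poly_functions_cmult[of F J "-1"] by simp

lemma relation_poly: "(\<lambda>x. triangle_relation (weight x) t v) \<in> poly_functions I"
proof -
  have "(\<lambda>x. triangle_weight (weight x) t v) \<in> poly_functions I"
    unfolding triangle_weight_def by (cases "v = Min t"; cases "v = mid t"; cases "v = Max t") (simp_all add: weight_poly poly_functions.const)
  then show ?thesis unfolding triangle_relation_def by (cases "v = mid t") (simp_all add: neg_poly)
qed

lemma plane_entry_poly: "i < k \<Longrightarrow> j < k + 2 \<Longrightarrow> (\<lambda>x. rowfun (plane_matrix x) i j) \<in> poly_functions I"
  unfolding plane_matrix_def
  by (subst rowfun_relation_matrix[OF Z])
     (auto intro!: poly_functions_sum poly_functions.mult poly_functions.const relation_poly)

lemma plane_plucker_poly:
  assumes "J \<subseteq> {..<k + 2}" "card J = k" shows "(\<lambda>x. plucker (plane_matrix x) J) \<in> poly_functions I"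
proof -
  have e: "plane_matrix x = mat k (k + 2) (\<lambda>(i, j). rowfun (plane_matrix x) i j)" for x
    by (rule eq_matI) (use plane_matrix_carrier[of x] in \<open>auto simp: rowfun_def\<close>)
  show ?thesis by (subst e, rule plucker_poly_function[OF assms]) (rule plane_entry_poly)
qed

lemma disc_poly: "disc \<in> poly_functions I"
proof -
  have "(\<lambda>x. tw (plane_matrix x) Z e) \<in> poly_functions I" for e
    unfolding tw_def omega_plucker[OF plane_matrix_carrier]
    by (intro poly_functions_sum poly_functions.mult poly_functions.const plane_plucker_poly) auto
  then show ?thesis unfolding disc_def[abs_def]
    using poly_functions_prod[OF black_arcsD(3)[OF T], of "\<lambda>e x. tw (plane_matrix x) Z e"] by simp
qed

text \<open>The plane with positive coordinates \<open>x\<close> comes from a matrix \<open>C\<close> representing a point of the positroid cell. In particular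
the polynomial \<open>disc\<close> does not vanish there.\<close>
lemma positive_plane:
  fixes x :: "arc \<Rightarrow> real"
  assumes x: "\<And>e. e \<in> black_arcs T \<Longrightarrow> x e > 0" and xI: "\<And>e. e \<in> black_arcs T - I \<Longrightarrow> x e = 1"
  obtains C where "C \<in> carrier_mat k n"
    and "\<And>J. J \<subseteq> {..<n} \<Longrightarrow> card J = k \<Longrightarrow> (matched (black T) J \<longrightarrow> plucker C J > 0) \<and> (\<not> matched (black T) J \<longrightarrow> plucker C J = 0)"
    and "\<And>e. e \<in> arcs_of n T \<Longrightarrow> (-1) ^ area_of (black T) e * omega (C * Z) (rowfun Z (fst e)) (rowfun Z (snd e)) > 0"
    and "\<exists>G\<in>carrier_mat k k. det G \<noteq> 0 \<and> cmat (C * Z) = G * plane_matrix (\<lambda>e. complex_of_real (x e))"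
    and "disc (\<lambda>e. complex_of_real (x e)) \<noteq> 0"
proof -
  let ?M = "relation_matrix k n \<tau> (\<lambda>e. (-1) ^ area_of (black T) e * x e) :: real mat"
  obtain \<sigma> :: real where \<sigma>: "\<sigma> = 1 \<or> \<sigma> = -1"
    and p: "\<And>x J. (\<And>e. e \<in> (\<Union>t\<in>black T. chords t) \<Longrightarrow> (x e :: real) > 0) \<Longrightarrow> J \<subseteq> {..<n} \<Longrightarrow> card J = k \<Longrightarrow>
      (matched (black T) J \<longrightarrow> \<sigma> * plucker (relation_matrix k n \<tau> (\<lambda>e. (-1) ^ area_of (black T) e * x e)) J > 0) \<and>
      (\<not> matched (black T) J \<longrightarrow> plucker (relation_matrix k n \<tau> (\<lambda>e. (-1) ^ area_of (black T) e * x e)) J = 0)"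
    using bt.relation_matrix_pluckers by blast
  \<comment> \<open>Rescaling one row by \<open>\<sigma>\<close> turns the common sign of the minors into \<open>+\<close>.\<close>
  define G where "G = multrow_mat k 0 \<sigma>"
  have G: "G \<in> carrier_mat k k" "det G = \<sigma>" using det_multrow_mat[OF kpos] by (auto simp: G_def)
  have M: "?M \<in> carrier_mat k n" by (simp add: relation_matrix_def)
  define C where "C = G * ?M"
  have C: "C \<in> carrier_mat k n" using G M by (simp add: C_def)
  have pC: "(matched (black T) J \<longrightarrow> plucker C J > 0) \<and> (\<not> matched (black T) J \<longrightarrow> plucker C J = 0)"
    if "J \<subseteq> {..<n}" "card J = k" for J
    using p[of x J] x that plucker_mult[OF G(1) M that] G(2) unfolding C_def black_arcs_chords by auto
  have tws: "(-1) ^ area_of (black T) e * omega (C * Z) (rowfun Z (fst e)) (rowfun Z (snd e)) > 0" if "e \<in> arcs_of n T" for e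
    using bt.twistor_sign[OF C pC Zpos, of "fst e" "snd e"] that by simp
  have rel: "triangle_relation (weight (\<lambda>e. complex_of_real (x e))) (\<tau> i) v = complex_of_real (triangle_relation (\<lambda>e. (-1) ^ area_of (black T) e * x e) (\<tau> i) v)"
    if i: "i < k" for i v
  proof -
    have w: "weight (\<lambda>e. complex_of_real (x e)) e = complex_of_real ((-1) ^ area_of (black T) e * x e)" if "e \<in> chords (\<tau> i)" for e
    proof -
      have "e \<in> black_arcs T" using triangle_arcs(3)[OF bt.\<tau>B[OF i]] that by auto
      then show ?thesis using xI[of e] by (cases "e \<in> I") (auto simp: weight_def)
    qed
    obtain a b c where a: "\<tau> i = {a, b, c}" "a < b" "b < c" "Min (\<tau> i) = a" "mid (\<tau> i) = b" "Max (\<tau> i) = c" "chords (\<tau> i) = {(a, b), (b, c), (a, c)}"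
      using bt.\<tau>E[OF i] by (rule trianglesE)
    have w3: "weight (\<lambda>e. complex_of_real (x e)) (a, b) = complex_of_real ((-1) ^ area_of (black T) (a, b) * x (a, b))"
      "weight (\<lambda>e. complex_of_real (x e)) (b, c) = complex_of_real ((-1) ^ area_of (black T) (b, c) * x (b, c))"
      "weight (\<lambda>e. complex_of_real (x e)) (a, c) = complex_of_real ((-1) ^ area_of (black T) (a, c) * x (a, c))"
      using w a(7) by auto
    show ?thesis unfolding triangle_relation_def triangle_weight_def a(4-6) w3 by simp
  qed
  have cM: "cmat ?M = relation_matrix k n \<tau> (weight (\<lambda>e. complex_of_real (x e)))"
    by (rule eq_matI) (use rel in \<open>auto simp: relation_matrix_def\<close>)
  have "cmat (C * Z) = cmat C * cmat Z" by (rule of_real_hom.mat_hom_mult[OF C Z])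
  also have "cmat C = cmat G * cmat ?M" unfolding C_def by (rule of_real_hom.mat_hom_mult[OF G(1) M])
  also have "cmat G * cmat ?M * cmat Z = cmat G * (cmat ?M * cmat Z)"
    by (rule assoc_mult_mat[of _ k k _ n _ "k + 2"]) (use G M Z in auto)
  finally have "cmat (C * Z) = cmat G * (cmat ?M * cmat Z)" .
  then have GC: "cmat (C * Z) = cmat G * plane_matrix (\<lambda>e. complex_of_real (x e))"
    unfolding plane_matrix_def cM .
  have dG: "det (cmat G) \<noteq> 0" using \<sigma> G(2) by (auto simp: of_real_hom.hom_det)
  have CZ: "C * Z \<in> carrier_mat k (k + 2)" using C Z by simp
  have tw0: "tw (plane_matrix (\<lambda>e. complex_of_real (x e))) Z e \<noteq> 0" if e: "e \<in> arcs_of n T" for e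
  proof -
    have "tw (cmat (C * Z)) Z e \<noteq> 0"
      using tws[OF e] tw_cmat[OF CZ Z arc_bounds(1,2)[OF T e]] by auto
    moreover have "tw (cmat (C * Z)) Z e = det (cmat G) * tw (plane_matrix (\<lambda>e. complex_of_real (x e))) Z e"
      unfolding GC tw_def by (rule omega_mult) (use G plane_matrix_carrier in auto)
    ultimately show ?thesis by auto
  qed
  have d: "disc (\<lambda>e. complex_of_real (x e)) \<noteq> 0"
    unfolding disc_def using tw0 black_arcsD(1,3)[OF T] by auto
  show ?thesis
    by (rule that[OF C pC tws _ d]) (use GC dG G in \<open>auto intro!: bexI[of _ "cmat G"]\<close>)
qed

text \<open>The nondegeneracy that makes the chart dense is obtained from positivity: \<open>disc\<close> does not vanish at the point with all
coordinates \<open>1\<close>.\<close>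
lemma disc_nonzero: "\<exists>x\<in>points (algebraic_torus I). disc x \<noteq> 0"
proof -
  have "\<exists>x. disc x \<noteq> 0" by (rule positive_plane[of "\<lambda>_. 1"]) auto
  then obtain x where "disc x \<noteq> 0" by auto
  from torus_point_nonzero[OF card_verts(1)[OF T] disc_poly this poly_functions.const[of 1]] show ?thesis
    by (metis zero_neq_one)
qed

lemma coords_torus:
  assumes Y: "Y \<in> seed_torus k Z T" shows "coords Y \<in> points (algebraic_torus I)"
proof -
  have "xvar e Y \<noteq> 0" if e: "e \<in> I" for e
  proof -
    have eb: "e \<in> black_arcs T" using e verts_seed[OF T] by auto
    obtain P where P: "P \<in> black S" "e \<in> arcs_of n T \<inter> chords P" using arc_polygon[OF T eb] .
    have "\<delta> P \<in> black_arcs T" using \<delta>_boundary black_arcsD(2)[OF T] P by auto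
    then show ?thesis using xvar_eq[OF P(1), of e Y] P(2) Y eb seed_torus_iff[OF T] by auto
  qed
  then show ?thesis by (auto simp: coords_def algebraic_torus_def)
qed

text \<open>Cluster variables are quotients of linear forms.\<close>
lemma pulls_back_coords: "pulls_back Gk (seed_torus k Z T) (algebraic_torus I) coords"
proof -
  have "\<exists>f. f \<in> forms Gk 1 \<and> (\<forall>Y\<in>Gr k (k + 2). f Y = tws Y e)" if e: "e \<in> black_arcs T" for e
    using twistor_form[OF Z arc_bounds(1,2)[OF T]] e black_arcsD(1)[OF T] by (metis subsetD)
  then obtain f where f: "\<And>e. e \<in> black_arcs T \<Longrightarrow> f e \<in> forms Gk 1" "\<And>e Y. e \<in> black_arcs T \<Longrightarrow> Y \<in> Gr k (k + 2) \<Longrightarrow> f e Y = tws Y e"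
    by metis
  define P where "P e = (THE P. P \<in> black S \<and> e \<in> chords P)" for e
  have scale: "(\<lambda>Y. (-1) ^ m * f e Y) \<in> forms Gk 1" if "e \<in> black_arcs T" for e m
    using gradedD(3)[OF graded_Gr gradedD(1)[OF graded_Gr, of "(-1) ^ m"] f(1)[OF that]] by simp
  show ?thesis unfolding coords_def
  proof (rule pulls_back_coordinates[OF graded_Gr, where N = "\<lambda>e Y. (-1) ^ area k n S e * f e Y" and M = "\<lambda>e Y. (-1) ^ area k n S (\<delta> (P e)) * f (\<delta> (P e)) Y"])
    fix e assume e: "e \<in> I"
    have eb: "e \<in> black_arcs T" using e verts_seed[OF T] by auto
    obtain Q where Q: "Q \<in> black S" "e \<in> arcs_of n T \<inter> chords Q" using arc_polygon[OF T eb] .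
    have PQ: "P e = Q" unfolding P_def by (rule polygon_of[OF Q(1)]) (use Q in auto)
    have hb: "\<delta> Q \<in> black_arcs T" using \<delta>_boundary black_arcsD(2)[OF T] Q by auto
    show "(\<lambda>Y. (-1) ^ area k n S e * f e Y) \<in> forms Gk 1 \<and> (\<lambda>Y. (-1) ^ area k n S (\<delta> (P e)) * f (\<delta> (P e)) Y) \<in> forms Gk 1 \<and>
      (\<forall>Y\<in>seed_torus k Z T. (-1) ^ area k n S (\<delta> (P e)) * f (\<delta> (P e)) Y \<noteq> 0 \<and>
        xvar e Y = (-1) ^ area k n S e * f e Y / ((-1) ^ area k n S (\<delta> (P e)) * f (\<delta> (P e)) Y))"
    proof (intro conjI ballI)
      show "(\<lambda>Y. (-1) ^ area k n S e * f e Y) \<in> forms Gk 1" by (rule scale[OF eb])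
      show "(\<lambda>Y. (-1) ^ area k n S (\<delta> (P e)) * f (\<delta> (P e)) Y) \<in> forms Gk 1" unfolding PQ by (rule scale[OF hb])
      fix Y assume Y: "Y \<in> seed_torus k Z T"
      note YG = seed_torusD[OF Y]
      show "(-1) ^ area k n S (\<delta> (P e)) * f (\<delta> (P e)) Y \<noteq> 0" unfolding PQ using f(2)[OF hb YG] Y hb seed_torus_iff[OF T] by simp
      show "xvar e Y = (-1) ^ area k n S e * f e Y / ((-1) ^ area k n S (\<delta> (P e)) * f (\<delta> (P e)) Y)"
        unfolding PQ f(2)[OF hb YG] f(2)[OF eb YG] by (rule xvar_eq[OF Q(1)]) (use Q in auto)
    qed
  qed
qed

text \<open>The Pluecker coordinates of the plane are polynomials in \<open>x\<close>; passing to the chosen representative multiplies numerator and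
denominator by the same power of a scalar.\<close>
lemma pulls_back_plane: "pulls_back (algebraic_torus I) {x \<in> points (algebraic_torus I). disc x \<noteq> 0} Gk plane"
  unfolding pulls_back_def
proof (intro allI ballI)
  fix d F G assume F: "F \<in> forms Gk d" and G: "G \<in> forms Gk d"
  let ?Is = "{J. J \<subseteq> {..<k + 2} \<and> card J = k}"
  obtain F0 where F0: "hom_poly_function ?Is d F0" "F = (\<lambda>V. F0 (plucker (rep k (k + 2) V)))" using forms_GrE[OF F] .
  obtain G0 where G0: "hom_poly_function ?Is d G0" "G = (\<lambda>V. G0 (plucker (rep k (k + 2) V)))" using forms_GrE[OF G] .
  have pf: "(\<lambda>x. H (plucker (plane_matrix x))) \<in> forms (algebraic_torus I) 0" if H: "hom_poly_function ?Is d H" for H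
    using poly_functions_compose[OF hom_poly_poly_function[OF H], of "\<lambda>x. plucker (plane_matrix x)" I] plane_plucker_poly
    by (simp add: algebraic_torus_def)
  show "\<exists>e. \<exists>F'\<in>forms (algebraic_torus I) e. \<exists>G'\<in>forms (algebraic_torus I) e.
    \<forall>p\<in>{x \<in> points (algebraic_torus I). disc x \<noteq> 0}. (G' p = 0) = (G (plane p) = 0) \<and> (G (plane p) \<noteq> 0 \<longrightarrow> F (plane p) / G (plane p) = F' p / G' p)"
  proof (rule exI[of _ 0], rule bexI[OF _ pf[OF F0(1)]], rule bexI[OF _ pf[OF G0(1)]], rule ballI)
    fix x assume "x \<in> {x \<in> points (algebraic_torus I). disc x \<noteq> 0}"
    then have "represents k (k + 2) (plane_matrix x) (plane x)" using disc_represents by auto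
    then obtain c where c: "c \<noteq> 0" "\<And>d H. hom_poly_function ?Is d H \<Longrightarrow> H (plucker (rep k (k + 2) (plane x))) = c ^ d * H (plucker (plane_matrix x))"
      using form_at_representative by blast
    show "(G0 (plucker (plane_matrix x)) = 0) = (G (plane x) = 0) \<and>
      (G (plane x) \<noteq> 0 \<longrightarrow> F (plane x) / G (plane x) = F0 (plucker (plane_matrix x)) / G0 (plucker (plane_matrix x)))"
      unfolding F0(2) G0(2) c(2)[OF F0(1)] c(2)[OF G0(1)] using c(1) by simp
  qed
qed

lemma pulls_back_subset: "pulls_back X U Y \<phi> \<Longrightarrow> U' \<subseteq> U \<Longrightarrow> pulls_back X U' Y \<phi>"
  unfolding pulls_back_def by (meson subsetD)

lemma seed_torus_nonempty: "seed_torus k Z T \<noteq> {}"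
  using disc_nonzero coords_plane(1) by blast

lemma pulls_back_open_subvariety: "pulls_back (open_subvariety X V) U Y \<phi> = pulls_back X U Y \<phi>"
  by (simp add: pulls_back_def)

lemma pulls_back_to_open_subvariety: "pulls_back Y U (open_subvariety X V) \<psi> = pulls_back Y U X \<psi>"
  by (simp add: pulls_back_def)

text \<open>The coordinates and the plane are inverse to each other on the open sets where \<open>disc\<close> does not vanish.\<close>
lemma is_seed_torus_triangulation: "is_seed_torus Gk (2 * k) (seed_torus k Z T) (seed_of T)"
proof -
  let ?X = "open_subvariety Gk (seed_torus k Z T)"
  let ?W = "{x \<in> points (algebraic_torus I). disc x \<noteq> 0}"
  let ?U = "{Y \<in> seed_torus k Z T. disc (coords Y) \<noteq> 0}"
  note V = seed_torus_open[OF T]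
  have X: "graded ?X" "irreducible_variety ?X"
    using graded_open_subvariety[OF graded_Gr] irreducible_open_subvariety[OF graded_Gr irreducible_Gr V] by auto
  have fin: "finite I" by (rule card_verts(1)[OF T])
  have dT: "disc \<in> forms (algebraic_torus I) 0" using disc_poly by (simp add: algebraic_torus_def)
  have W: "zariski_open (algebraic_torus I) ?W"
    by (rule zariski_open_nonvanishing[OF graded_torus zariski_open_points[OF graded_torus] dT])
  obtain e D where D: "D \<in> forms Gk e" "\<forall>Y\<in>seed_torus k Z T. D Y = 0 \<longleftrightarrow> disc (coords Y) = 0"
    using pulls_back_coords dT unfolding pulls_back_def by metis
  have "?U = {Y \<in> points ?X. D Y \<noteq> 0}" using D(2) by auto
  moreover have "zariski_open ?X {Y \<in> points ?X. D Y \<noteq> 0}"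
    by (rule zariski_open_nonvanishing[OF X(1) zariski_open_points[OF X(1)]]) (use D(1) in simp)
  ultimately have U: "zariski_open ?X ?U" by simp
  have \<psi>: "plane x \<in> ?U \<and> coords (plane x) = x" if "x \<in> ?W" for x using coords_plane that by auto
  have \<phi>: "coords Y \<in> ?W \<and> plane (coords Y) = Y" if "Y \<in> ?U" for Y using coords_torus plane_coords(2) that by auto
  have "?U \<noteq> {}" using disc_nonzero \<psi> by blast
  have pb: "pulls_back ?X ?U (algebraic_torus I) coords" "pulls_back (algebraic_torus I) ?W ?X plane"
    unfolding pulls_back_open_subvariety pulls_back_to_open_subvariety using pulls_back_subset[OF pulls_back_coords] pulls_back_plane by auto
  note C = torus_chart[OF fin X U \<open>?U \<noteq> {}\<close> W, of xvar plane, folded coords_def, OF \<phi> \<psi> pb]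
  have lab: "label (seed_of T) = xvar" by (simp add: triangulation_seed_def Let_def)
  show ?thesis unfolding is_seed_torus_def lab
    using V card_verts[OF T] C by (simp add: coords_def[abs_def])
qed

end

section \<open>Seeds, flips and mutation\<close>

lemma verts_mutate [simp]: "verts (mutate w \<Sigma>) = verts \<Sigma>"
  and frozen_mutate [simp]: "frozen (mutate w \<Sigma>) = frozen \<Sigma>"
  and mutable_mutate [simp]: "mutable (mutate w \<Sigma>) = mutable \<Sigma>"
  by (simp_all add: mutate_def verts_def)

lemma arrows_mutate [simp]: "arrows (mutate w \<Sigma>) = mutate_arrows w \<Sigma>"
  and label_mutate [simp]: "label (mutate w \<Sigma>) = (label \<Sigma>)(w := exchange w \<Sigma>)"
  by (simp_all add: mutate_def)

lemma seed_iso_via_refl: "graded X \<Longrightarrow> seed_iso_via X id \<Sigma> \<Sigma>"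
  by (simp add: seed_iso_via_def rat_eq_refl)

lemma seed_iso_via_trans:
  assumes X: "graded X" and 1: "seed_iso_via X \<sigma> \<Sigma>1 \<Sigma>2" and 2: "seed_iso_via X \<rho> \<Sigma>2 \<Sigma>3"
  shows "seed_iso_via X (\<rho> \<circ> \<sigma>) \<Sigma>1 \<Sigma>3"
proof -
  have v: "\<sigma> u \<in> verts \<Sigma>2" if "u \<in> verts \<Sigma>1" for u
    using 1 that by (auto simp: seed_iso_via_def bij_betw_def)
  show ?thesis unfolding seed_iso_via_def
  proof (intro conjI ballI)
    show "bij_betw (\<rho> \<circ> \<sigma>) (verts \<Sigma>1) (verts \<Sigma>3)" using 1 2 bij_betw_trans by (auto simp: seed_iso_via_def)
    show "(\<rho> \<circ> \<sigma>) ` frozen \<Sigma>1 = frozen \<Sigma>3" "(\<rho> \<circ> \<sigma>) ` mutable \<Sigma>1 = mutable \<Sigma>3"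
      using 1 2 unfolding seed_iso_via_def image_comp[symmetric] by auto
    show "arrows \<Sigma>3 ((\<rho> \<circ> \<sigma>) u) ((\<rho> \<circ> \<sigma>) w) = arrows \<Sigma>1 u w" if "u \<in> verts \<Sigma>1" "w \<in> verts \<Sigma>1" for u w
      using 1 2 v that by (simp add: seed_iso_via_def)
    show "rat_eq X (label \<Sigma>1 u) (label \<Sigma>3 ((\<rho> \<circ> \<sigma>) u))" if "u \<in> verts \<Sigma>1" for u
      using 1 2 v[OF that] that rat_eq_trans[OF X, of "label \<Sigma>1 u" "label \<Sigma>2 (\<sigma> u)" "label \<Sigma>3 (\<rho> (\<sigma> u))"] by (simp add: seed_iso_via_def)
  qed
qed

text \<open>Mutation is compatible with isomorphisms of seeds. The labels agree on one dense open set for all vertices, so the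
exchange polynomials agree there.\<close>
lemma seed_iso_via_mutate:
  assumes X: "graded X" and iso: "seed_iso_via X \<sigma> \<Sigma> \<Sigma>'" and w: "w \<in> mutable \<Sigma>" and fin: "finite (verts \<Sigma>)"
  shows "seed_iso_via X \<sigma> (mutate w \<Sigma>) (mutate (\<sigma> w) \<Sigma>')"
proof -
  have b: "bij_betw \<sigma> (verts \<Sigma>) (verts \<Sigma>')" and fr: "\<sigma> ` frozen \<Sigma> = frozen \<Sigma>'" and mu: "\<sigma> ` mutable \<Sigma> = mutable \<Sigma>'"
    and arr: "\<And>u v. u \<in> verts \<Sigma> \<Longrightarrow> v \<in> verts \<Sigma> \<Longrightarrow> arrows \<Sigma>' (\<sigma> u) (\<sigma> v) = arrows \<Sigma> u v"
    and lab: "\<And>u. u \<in> verts \<Sigma> \<Longrightarrow> rat_eq X (label \<Sigma> u) (label \<Sigma>' (\<sigma> u))"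
    using iso by (auto simp: seed_iso_via_def)
  have wv: "w \<in> verts \<Sigma>" using w by (simp add: verts_def)
  have inj: "\<sigma> u = \<sigma> v \<longleftrightarrow> u = v" if "u \<in> verts \<Sigma>" "v \<in> verts \<Sigma>" for u v
    using inj_onD[OF bij_betw_imp_inj_on[OF b]] that by blast
  have frz: "\<sigma> u \<in> frozen \<Sigma>' \<longleftrightarrow> u \<in> frozen \<Sigma>" if u: "u \<in> verts \<Sigma>" for u
  proof
    assume "\<sigma> u \<in> frozen \<Sigma>'"
    then obtain v where v: "v \<in> frozen \<Sigma>" "\<sigma> u = \<sigma> v" unfolding fr[symmetric] by blast
    then have "u = v" using inj[OF u, of v] by (simp add: verts_def)
    then show "u \<in> frozen \<Sigma>" using v by simp
  qed (use fr in blast)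
  have "rat_eq X (exchange w \<Sigma>) (exchange (\<sigma> w) \<Sigma>')"
  proof -
    obtain U where U: "dense_open X U" "\<And>u p. u \<in> verts \<Sigma> \<Longrightarrow> p \<in> U \<Longrightarrow> label \<Sigma> u p = label \<Sigma>' (\<sigma> u) p"
      using rat_eq_common[OF X fin, of "label \<Sigma>" "\<lambda>u. label \<Sigma>' (\<sigma> u)"] lab by metis
    have "exchange w \<Sigma> p = exchange (\<sigma> w) \<Sigma>' p" if p: "p \<in> U" for p
    proof -
      have "(\<Prod>u\<in>verts \<Sigma>'. label \<Sigma>' u p ^ arrows \<Sigma>' u (\<sigma> w)) = (\<Prod>u\<in>verts \<Sigma>. label \<Sigma> u p ^ arrows \<Sigma> u w)"
        unfolding prod.reindex_bij_betw[OF b, symmetric] by (rule prod.cong[OF HOL.refl]) (simp add: arr wv U(2) p)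
      moreover have "(\<Prod>u\<in>verts \<Sigma>'. label \<Sigma>' u p ^ arrows \<Sigma>' (\<sigma> w) u) = (\<Prod>u\<in>verts \<Sigma>. label \<Sigma> u p ^ arrows \<Sigma> w u)"
        unfolding prod.reindex_bij_betw[OF b, symmetric] by (rule prod.cong[OF HOL.refl]) (simp add: arr wv U(2) p)
      ultimately show ?thesis unfolding exchange_def by (simp add: U(2)[OF wv p])
    qed
    then show ?thesis using U(1) by (auto simp: rat_eq_def)
  qed
  then show ?thesis
    unfolding seed_iso_via_def verts_mutate frozen_mutate mutable_mutate arrows_mutate label_mutate
    using b fr mu lab by (auto simp: mutate_arrows_def inj wv arr frz)
qed

lemma triangle_chords: "t \<in> triangles E \<Longrightarrow> chords t \<subseteq> E"
  by (erule trianglesE) simp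

lemma next_clockwise_triangle:
  assumes "a < b" "b < c"
  shows "next_clockwise {a, b, c} u v \<longleftrightarrow> (u, v) \<in> {((a, b), (b, c)), ((b, c), (a, c)), ((a, c), (a, b))}"
proof
  assume "next_clockwise {a, b, c} u v"
  then obtain x y z where x: "x < y" "y < z" "{a, b, c} = {x, y, z}" "(u, v) \<in> {((x, y), (y, z)), ((y, z), (x, z)), ((x, z), (x, y))}"
    unfolding next_clockwise_def by blast
  have "x = a" "y = b" "z = c" using triangle_simps[OF assms] triangle_simps[OF x(1,2)] x(3) by auto
  then show "(u, v) \<in> {((a, b), (b, c)), ((b, c), (a, c)), ((a, c), (a, b))}" using x(4) by simp
next
  assume "(u, v) \<in> {((a, b), (b, c)), ((b, c), (a, c)), ((a, c), (a, b))}"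
  then show "next_clockwise {a, b, c} u v" unfolding next_clockwise_def using assms by blast
qed

lemma next_clockwiseD:
  assumes "next_clockwise t u v"
  shows "t = {fst u, snd u, fst v, snd v}" "u \<in> chords t" "v \<in> chords t" "u \<noteq> v" "\<not> next_clockwise t v u" "card t = 3"
proof -
  obtain a b c where a: "a < b" "b < c" "t = {a, b, c}" and uv: "(u, v) \<in> {((a, b), (b, c)), ((b, c), (a, c)), ((a, c), (a, b))}"
    using assms unfolding next_clockwise_def by blast
  show "t = {fst u, snd u, fst v, snd v}" "u \<in> chords t" "v \<in> chords t" "u \<noteq> v" "card t = 3"
    using uv a by (auto simp: chords_def)
  show "\<not> next_clockwise t v u" unfolding a(3) next_clockwise_triangle[OF a(1,2)] using uv a by auto
qed

text \<open>An arrow of the quiver. There is at most one from \<open>u\<close> to \<open>v\<close>, as two sides determine their triangle.\<close>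
definition follows :: "nat set set \<Rightarrow> arc \<Rightarrow> arc \<Rightarrow> bool" where
  "follows B u v \<longleftrightarrow> (\<exists>t\<in>B. next_clockwise t u v)"

lemma card_next_clockwise: "card {t \<in> B. next_clockwise t u v} = of_bool (follows B u v)"
proof (cases "follows B u v")
  case True
  then obtain t where t: "t \<in> B" "next_clockwise t u v" by (auto simp: follows_def)
  have "{t \<in> B. next_clockwise t u v} = {t}" using t next_clockwiseD(1)[of _ u v] by blast
  then show ?thesis using True by simp
next
  case False
  then have "{t \<in> B. next_clockwise t u v} = {}" by (auto simp: follows_def)
  then show ?thesis using False by (simp only: card.empty of_bool_def if_False)
qed

lemma follows_antisym: "follows B u v \<Longrightarrow> \<not> follows B v u"
proof
  assume "follows B u v" "follows B v u"
  then obtain s t where "next_clockwise s u v" "next_clockwise t v u" by (auto simp: follows_def)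
  then have "s = t" using next_clockwiseD(1)[of s u v] next_clockwiseD(1)[of t v u] by auto
  then show False using next_clockwiseD(5)[OF \<open>next_clockwise s u v\<close>] \<open>next_clockwise t v u\<close> by simp
qed

lemma follows_Un: "follows (A \<union> B) u v \<longleftrightarrow> follows A u v \<or> follows B u v"
  unfolding follows_def by blast

text \<open>The effect of a flip on the arrows: the triangles \<open>i1 \<rightarrow> e \<rightarrow> o1\<close> and \<open>i2 \<rightarrow> e \<rightarrow> o2\<close> at the diagonal \<open>e\<close> are replaced by the
triangles \<open>o1 \<rightarrow> e' \<rightarrow> i2\<close> and \<open>o2 \<rightarrow> e' \<rightarrow> i1\<close>. The relation \<open>R\<close> of the remaining triangles
involves neither diagonal and no two sides of the quadrilateral.\<close>
definition reverses_quadrilateral ::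
  "(arc \<Rightarrow> arc \<Rightarrow> bool) \<Rightarrow> (arc \<Rightarrow> arc \<Rightarrow> bool) \<Rightarrow> arc \<Rightarrow> arc \<Rightarrow> arc \<Rightarrow> arc \<Rightarrow> arc \<Rightarrow> arc \<Rightarrow> bool" where
  "reverses_quadrilateral f f' e e' i1 i2 o1 o2 \<longleftrightarrow> distinct [i1, i2, o1, o2, e, e'] \<and>
     (\<exists>R. (\<forall>u v. f u v \<longleftrightarrow> R u v \<or> (u, v) \<in> {(i1, e), (e, o1), (o1, i1), (i2, e), (e, o2), (o2, i2)}) \<and>
          (\<forall>u v. f' u v \<longleftrightarrow> R u v \<or> (u, v) \<in> {(o1, e'), (e', i2), (i2, o1), (o2, e'), (e', i1), (i1, o2)}) \<and>
          (\<forall>u v. R u v \<longrightarrow> {u, v} \<inter> {e, e'} = {} \<and> \<not> {u, v} \<subseteq> {i1, i2, o1, o2}))"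

text \<open>Vertices that were deleted from the quiver have label \<open>1\<close>, so they may be included in the exchange monomials.\<close>
lemma prod_select_two:
  fixes f :: "'a \<Rightarrow> 'b::comm_semiring_1"
  assumes "finite I" "i \<noteq> j" "i \<notin> I \<Longrightarrow> f i = 1" "j \<notin> I \<Longrightarrow> f j = 1"
  shows "(\<Prod>u\<in>I. f u ^ of_bool (u = i \<or> u = j)) = f i * f j"
proof -
  have "(\<Prod>u\<in>I. f u ^ of_bool (u = i \<or> u = j)) = (\<Prod>u\<in>I \<inter> {i, j}. f u)"
    by (rule prod.mono_neutral_cong_right) (use assms(1) in auto)
  also have "\<dots> = (\<Prod>u\<in>{i, j}. f u)"
    by (rule prod.mono_neutral_left) (use assms in auto)
  finally show ?thesis using assms(2) by simp
qed

context tile_setting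
begin

lemma seed_simps:
  "frozen (seed_of T) = boundary_arcs S - \<delta> ` black S" "mutable (seed_of T) = black_arcs T - boundary_arcs S"
  "label (seed_of T) = xvar"
  "arrows (seed_of T) u v = (if u \<in> verts (seed_of T) \<and> v \<in> verts (seed_of T) \<and>
      \<not> (u \<in> frozen (seed_of T) \<and> v \<in> frozen (seed_of T)) then of_bool (follows (black T) u v) else 0)"
  by (simp_all only: triangulation_seed_def Let_def verts_def card_next_clockwise seed.simps)

lemma seed_of_cong: "black T = black T' \<Longrightarrow> seed_of T = seed_of T'"
  by (simp only: triangulation_seed_def black_arcs_def)

lemma xvar_\<delta>:
  assumes P: "P \<in> black S" and Y: "tws Y (\<delta> P) \<noteq> 0"
  shows "xvar (\<delta> P) Y = 1"
  unfolding xvar_eq[OF P \<delta>_chord[OF P]] using Y by simp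

text \<open>In the quadrilateral \<open>a < b < c < d\<close> the sum of the areas of \<open>ac\<close> and \<open>bd\<close> has the parity of \<open>area(ab) + area(cd)\<close>,
and so has the sum of the areas of \<open>ad\<close> and \<open>bc\<close>. Thus the three products carry the same sign. Two triangulations occur since \<open>ac\<close> and \<open>bd\<close> cross.\<close>
lemma xvar_ptolemy:
  assumes P: "P \<in> black S" "{a, b, c, d} \<subseteq> P" and o: "a < b" "b < c" "c < d"
    and T1: "T1 \<in> represented_by k n S" "{a, b, c} \<in> black T1" "{a, c, d} \<in> black T1"
    and T2: "T2 \<in> represented_by k n S" "{b, c, d} \<in> black T2"
    and Y: "Y \<in> Gr k (k + 2)" "tws Y (\<delta> P) \<noteq> 0"
  shows "xvar (a, c) Y * xvar (b, d) Y = xvar (a, b) Y * xvar (c, d) Y + xvar (a, d) Y * xvar (b, c) Y"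
proof -
  have ar: "area k n S (x, z) = area k n S (x, y) + area k n S (y, z) + 1"
    if T: "T \<in> represented_by k n S" "{x, y, z} \<in> black T" and xyz: "x < y" "y < z" for T x y z
  proof -
    note R = representedD[OF T(1)]
    have "{x, y, z} \<in> triangles (arcs_of n T)" using T(2) R(5) by auto
    then have "chords {x, y, z} \<subseteq> arcs_of n T" by (rule triangle_chords)
    then have "(x, y) \<in> arcs_of n T" "(y, z) \<in> arcs_of n T" "(x, z) \<in> arcs_of n T" unfolding triangle_simps(5)[OF xyz] by auto
    then show ?thesis
      using area_triangle[OF R(9,5,7) T(2)] area_arc[OF T(1)] by (simp add: triangle_simps[OF xyz])
  qed
  have 1: "area k n S (a, c) = area k n S (a, b) + area k n S (b, c) + 1" by (rule ar[OF T1(1,2) o(1,2)])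
  have 2: "area k n S (a, d) = area k n S (a, c) + area k n S (c, d) + 1" by (rule ar[OF T1(1,3)]) (use o in auto)
  have 3: "area k n S (b, d) = area k n S (b, c) + area k n S (c, d) + 1" by (rule ar[OF T2 o(2,3)])
  have ch: "(a, b) \<in> chords P" "(b, c) \<in> chords P" "(c, d) \<in> chords P" "(a, c) \<in> chords P" "(b, d) \<in> chords P" "(a, d) \<in> chords P"
    using P(2) o by (auto simp: chords_def)
  define h where "h = (-1) ^ area k n S (\<delta> P) * tws Y (\<delta> P)"
  have h: "h \<noteq> 0" using Y by (simp add: h_def)
  define s where "s = (-1::complex) ^ (area k n S (a, b) + area k n S (c, d))"
  have n: "a < n" "b < n" "c < n" "d < n" using P black_polygonD(1)[OF P(1)] by auto
  have pw: "(-1::complex) ^ (p + q + 1) * (-1) ^ (q + r + 1) = (-1) ^ (p + r)"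
    "(-1::complex) ^ (p + q + 1 + r + 1) * (-1) ^ q = (-1) ^ (p + r)" for p q r :: nat
    by (simp_all add: minus_one_power_iff)
  have sg: "(-1::complex) ^ area k n S (a, c) * (-1) ^ area k n S (b, d) = s" "(-1::complex) ^ area k n S (a, b) * (-1) ^ area k n S (c, d) = s"
    "(-1::complex) ^ area k n S (a, d) * (-1) ^ area k n S (b, c) = s"
    unfolding s_def 2 1 3 by (rule pw(1), rule power_add[symmetric], rule pw(2))
  have m: "x * u / h * (y * w / h) = (x * y) * (u * w) / (h * h)" for x y u w :: complex by simp
  show ?thesis
    unfolding xvar_eq[OF P(1) ch(1)] xvar_eq[OF P(1) ch(2)] xvar_eq[OF P(1) ch(3)] xvar_eq[OF P(1) ch(4)] xvar_eq[OF P(1) ch(5)] xvar_eq[OF P(1) ch(6)]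
      h_def[symmetric] m sg twistor_ptolemy[OF Z Y(1) n] by (simp only: distrib_left add_divide_distrib)
qed

text \<open>What a flip does to the quiver and to the labels. The arcs \<open>i1\<close>, \<open>i2\<close> are opposite sides of the quadrilateral with arrows
into \<open>e\<close>, and \<open>o1\<close>, \<open>o2\<close> are the other two sides.\<close>
lemma flip_quiver:
  assumes T: "T \<in> represented_by k n S" and e: "e \<in> black_arcs T - boundary_arcs S"
  obtains e' i1 i2 o1 o2 P where "P \<in> black S" "e \<in> chords P" "e' \<in> chords P" "e' \<notin> arcs_of n T"
    "{i1, i2, o1, o2} \<subseteq> black_arcs T" "\<exists>T'\<in>represented_by k n S. is_flip T e T' e'"
    "\<forall>T'\<in>represented_by k n S. \<forall>f. is_flip T e T' f \<longrightarrow> f = e' \<and> black_arcs T' = insert e' (black_arcs T - {e}) \<and>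
        reverses_quadrilateral (follows (black T)) (follows (black T')) e e' i1 i2 o1 o2 \<and>
        (\<forall>Y\<in>Gr k (k + 2). tws Y (\<delta> P) \<noteq> 0 \<longrightarrow> xvar e Y * xvar e' Y = xvar i1 Y * xvar i2 Y + xvar o1 Y * xvar o2 Y)"
proof -
  obtain a b c d e' P where o: "a < b" "b < c" "c < d" and P: "P \<in> black S" "{a, b, c, d} \<subseteq> P"
    and ee: "e = (a, c) \<and> e' = (b, d) \<or> e = (b, d) \<and> e' = (a, c)"
    and s: "(a, b) \<in> arcs_of n T" "(b, c) \<in> arcs_of n T" "(c, d) \<in> arcs_of n T" "(a, d) \<in> arcs_of n T"
    and e'n: "e' \<notin> arcs_of n T"
    and bl: "black T = {t \<in> black T. e \<notin> chords t} \<union> (if e = (a, c) then {{a, b, c}, {a, c, d}} else {{a, b, d}, {b, c, d}})"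
    and ex: "\<exists>T'\<in>represented_by k n S. is_flip T e T' e'"
    and fl: "\<And>T' f. T' \<in> represented_by k n S \<Longrightarrow> is_flip T e T' f \<Longrightarrow> f = e' \<and> arcs_of n T' = insert e' (arcs_of n T - {e}) \<and>
      black T' = {t \<in> black T. e \<notin> chords t} \<union> (if e = (a, c) then {{a, b, d}, {b, c, d}} else {{a, b, c}, {a, c, d}})"
    by (rule flip_black[OF T e], rule that) (assumption | rule refl | blast)+
  have ch: "(a, b) \<in> chords P" "(b, c) \<in> chords P" "(c, d) \<in> chords P" "(a, c) \<in> chords P" "(b, d) \<in> chords P" "(a, d) \<in> chords P"
    using P(2) o by (auto simp: chords_def)
  have eP: "e \<in> chords P" "e' \<in> chords P" using ee ch by auto
  have sb: "{(a, b), (b, c), (c, d), (a, d)} \<subseteq> black_arcs T" unfolding black_arcs_eq[OF T] using s ch P(1) by blast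
  define R where "R = {t \<in> black T. e \<notin> chords t}"
  have R0: "{u, v} \<inter> {e, e'} = {} \<and> \<not> {u, v} \<subseteq> {(a, b), (b, c), (c, d), (a, d)}" if f: "follows R u v" for u v
  proof -
    obtain t where t: "t \<in> R" "next_clockwise t u v" using f by (auto simp: follows_def)
    note N = next_clockwiseD[OF t(2)]
    have tT: "t \<in> triangles (arcs_of n T)" using t representedD(5)[OF T] by (auto simp: R_def)
    then have "chords t \<subseteq> arcs_of n T" by (rule triangle_chords)
    then have nn: "e' \<notin> chords t" "e \<notin> chords t" using e'n t by (auto simp: R_def)
    have "\<not> t \<subseteq> {a, b, c, d}"
    proof
      assume ts: "t \<subseteq> {a, b, c, d}"
      have "\<not> (a \<in> t \<and> c \<in> t)" "\<not> (b \<in> t \<and> d \<in> t)" using nn ee o by (auto simp: chords_def)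
      then have "t \<subseteq> {a, b} \<or> t \<subseteq> {a, d} \<or> t \<subseteq> {c, b} \<or> t \<subseteq> {c, d}" using ts by blast
      then obtain x y where "t \<subseteq> {x, y}" by blast
      then have "card t \<le> card {x, y}" by (intro card_mono) auto
      also have "\<dots> \<le> 2" by (simp add: card_insert_if)
      finally show False using N(6) by simp
    qed
    then have "\<not> {u, v} \<subseteq> {(a, b), (b, c), (c, d), (a, d)}" using N(1) by auto
    then show ?thesis using nn N(2,3) by auto
  qed
  have fol: "follows {{x, y, z}, {x', y', z'}} u v \<longleftrightarrow> (u, v) \<in> {((x, y), (y, z)), ((y, z), (x, z)), ((x, z), (x, y))} \<or>
      (u, v) \<in> {((x', y'), (y', z')), ((y', z'), (x', z')), ((x', z'), (x', y'))}"
    if "x < y" "y < z" "x' < y'" "y' < z'" for x y z x' y' z' u v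
    unfolding follows_def using next_clockwise_triangle that by simp
  have fN: "follows {{a, b, c}, {a, c, d}} u v \<longleftrightarrow> (u, v) \<in> {((b, c), (a, c)), ((a, c), (a, b)), ((a, b), (b, c)), ((a, d), (a, c)), ((a, c), (c, d)), ((c, d), (a, d))}" for u v
    using o by (subst fol) auto
  have fN': "follows {{a, b, d}, {b, c, d}} u v \<longleftrightarrow> (u, v) \<in> {((a, b), (b, d)), ((b, d), (a, d)), ((a, d), (a, b)), ((c, d), (b, d)), ((b, d), (b, c)), ((b, c), (c, d))}" for u v
    using o by (subst fol) auto
  have arcs: "black_arcs T' = insert e' (black_arcs T - {e})" if T': "T' \<in> represented_by k n S" "is_flip T e T' f" for T' f
  proof -
    have "e \<notin> chords Q" if "Q \<in> black S" "Q \<noteq> P" for Q using B_disj[OF that(1) P(1), of e] eP that(2) by auto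
    moreover have "e' \<notin> chords Q" if "Q \<in> black S" "Q \<noteq> P" for Q using B_disj[OF that(1) P(1), of e'] eP that(2) by auto
    ultimately show ?thesis unfolding black_arcs_eq[OF T] black_arcs_eq[OF T'(1)] using fl[OF T'] eP P(1) by auto
  qed
  have tri: "{a, b, c} \<in> black T \<and> {a, c, d} \<in> black T" if "e = (a, c)" using bl that by auto
  have tri': "{b, c, d} \<in> black T" if "e = (b, d)" using bl that o by auto
  show ?thesis
    using ee
  proof (elim disjE conjE)
    assume e1: "e = (a, c)" "e' = (b, d)"
    show ?thesis
    proof (rule that[of P e' "(b, c)" "(a, d)" "(a, b)" "(c, d)"])
      have "f = e' \<and> black_arcs T' = insert e' (black_arcs T - {e}) \<and>
        reverses_quadrilateral (follows (black T)) (follows (black T')) e e' (b, c) (a, d) (a, b) (c, d) \<and>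
        (\<forall>Y\<in>Gr k (k + 2). tws Y (\<delta> P) \<noteq> 0 \<longrightarrow> xvar e Y * xvar e' Y = xvar (b, c) Y * xvar (a, d) Y + xvar (a, b) Y * xvar (c, d) Y)"
        if T': "T' \<in> represented_by k n S" "is_flip T e T' f" for T' f
      proof -
      have bT: "black T = R \<union> {{a, b, c}, {a, c, d}}" "black T' = R \<union> {{a, b, d}, {b, c, d}}" using bl fl[OF T'] e1 by (auto simp: R_def)
      have "{b, c, d} \<in> black T'" using bT by auto
      then have pt: "xvar (a, c) Y * xvar (b, d) Y = xvar (a, b) Y * xvar (c, d) Y + xvar (a, d) Y * xvar (b, c) Y"
        if "Y \<in> Gr k (k + 2)" "tws Y (\<delta> P) \<noteq> 0" for Y
        using xvar_ptolemy[OF P o T _ _ T'(1) _ that] tri[OF e1(1)] by auto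
      show ?thesis unfolding reverses_quadrilateral_def
      proof (intro conjI exI[of _ "follows R"] allI ballI impI)
        show "distinct [(b, c), (a, d), (a, b), (c, d), e, e']" using e1 o by auto
        show "f = e'" using fl[OF T'] by simp
        show "black_arcs T' = insert e' (black_arcs T - {e})" by (rule arcs[OF T'])
        show "follows (black T) u v \<longleftrightarrow> follows R u v \<or> (u, v) \<in> {((b, c), e), (e, (a, b)), ((a, b), (b, c)), ((a, d), e), (e, (c, d)), ((c, d), (a, d))}" for u v
          unfolding bT follows_Un fN e1 ..
        show "follows (black T') u v \<longleftrightarrow> follows R u v \<or> (u, v) \<in> {((a, b), e'), (e', (a, d)), ((a, d), (a, b)), ((c, d), e'), (e', (b, c)), ((b, c), (c, d))}" for u v
          unfolding bT follows_Un fN' e1 ..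
        show "{u, v} \<inter> {e, e'} = {}" "\<not> {u, v} \<subseteq> {(b, c), (a, d), (a, b), (c, d)}" if "follows R u v" for u v
          using R0[OF that] by blast+
        show "xvar e Y * xvar e' Y = xvar (b, c) Y * xvar (a, d) Y + xvar (a, b) Y * xvar (c, d) Y" if "Y \<in> Gr k (k + 2)" "tws Y (\<delta> P) \<noteq> 0" for Y
          unfolding e1 pt[OF that] by (simp add: algebra_simps)
      qed
      qed
      then show "\<forall>T'\<in>represented_by k n S. \<forall>f. is_flip T e T' f \<longrightarrow> f = e' \<and> black_arcs T' = insert e' (black_arcs T - {e}) \<and>
        reverses_quadrilateral (follows (black T)) (follows (black T')) e e' (b, c) (a, d) (a, b) (c, d) \<and>
        (\<forall>Y\<in>Gr k (k + 2). tws Y (\<delta> P) \<noteq> 0 \<longrightarrow> xvar e Y * xvar e' Y = xvar (b, c) Y * xvar (a, d) Y + xvar (a, b) Y * xvar (c, d) Y)"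
        by (intro ballI allI impI)
    qed (use P eP e'n sb ch ex in auto)
  next
    assume e1: "e = (b, d)" "e' = (a, c)"
    have ne: "e \<noteq> (a, c)" using e1 o by simp
    show ?thesis
    proof (rule that[of P e' "(a, b)" "(c, d)" "(a, d)" "(b, c)"])
      have "f = e' \<and> black_arcs T' = insert e' (black_arcs T - {e}) \<and>
        reverses_quadrilateral (follows (black T)) (follows (black T')) e e' (a, b) (c, d) (a, d) (b, c) \<and>
        (\<forall>Y\<in>Gr k (k + 2). tws Y (\<delta> P) \<noteq> 0 \<longrightarrow> xvar e Y * xvar e' Y = xvar (a, b) Y * xvar (c, d) Y + xvar (a, d) Y * xvar (b, c) Y)"
        if T': "T' \<in> represented_by k n S" "is_flip T e T' f" for T' f
      proof -
      have bT: "black T = R \<union> {{a, b, d}, {b, c, d}}" "black T' = R \<union> {{a, b, c}, {a, c, d}}" using bl fl[OF T'] ne by (auto simp: R_def)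
      have "{a, b, c} \<in> black T'" "{a, c, d} \<in> black T'" using bT by auto
      then have pt: "xvar (a, c) Y * xvar (b, d) Y = xvar (a, b) Y * xvar (c, d) Y + xvar (a, d) Y * xvar (b, c) Y"
        if "Y \<in> Gr k (k + 2)" "tws Y (\<delta> P) \<noteq> 0" for Y
        using xvar_ptolemy[OF P o T'(1) _ _ T _ that] tri'[OF e1(1)] by auto
      show ?thesis unfolding reverses_quadrilateral_def
      proof (intro conjI exI[of _ "follows R"] allI ballI impI)
        show "distinct [(a, b), (c, d), (a, d), (b, c), e, e']" using e1 o by auto
        show "f = e'" using fl[OF T'] by simp
        show "black_arcs T' = insert e' (black_arcs T - {e})" by (rule arcs[OF T'])
        show "follows (black T) u v \<longleftrightarrow> follows R u v \<or> (u, v) \<in> {((a, b), e), (e, (a, d)), ((a, d), (a, b)), ((c, d), e), (e, (b, c)), ((b, c), (c, d))}" for u v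
          unfolding bT follows_Un fN' e1 ..
        show "follows (black T') u v \<longleftrightarrow> follows R u v \<or> (u, v) \<in> {((a, d), e'), (e', (c, d)), ((c, d), (a, d)), ((b, c), e'), (e', (a, b)), ((a, b), (b, c))}" for u v
          unfolding bT follows_Un fN e1 by blast
        show "{u, v} \<inter> {e, e'} = {}" "\<not> {u, v} \<subseteq> {(a, b), (c, d), (a, d), (b, c)}" if "follows R u v" for u v
          using R0[OF that] by blast+
        show "xvar e Y * xvar e' Y = xvar (a, b) Y * xvar (c, d) Y + xvar (a, d) Y * xvar (b, c) Y" if "Y \<in> Gr k (k + 2)" "tws Y (\<delta> P) \<noteq> 0" for Y
          using pt[OF that] unfolding e1 by (simp add: mult.commute)
      qed
      qed
      then show "\<forall>T'\<in>represented_by k n S. \<forall>f. is_flip T e T' f \<longrightarrow> f = e' \<and> black_arcs T' = insert e' (black_arcs T - {e}) \<and>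
        reverses_quadrilateral (follows (black T)) (follows (black T')) e e' (a, b) (c, d) (a, d) (b, c) \<and>
        (\<forall>Y\<in>Gr k (k + 2). tws Y (\<delta> P) \<noteq> 0 \<longrightarrow> xvar e Y * xvar e' Y = xvar (a, b) Y * xvar (c, d) Y + xvar (a, d) Y * xvar (b, c) Y)"
        by (intro ballI allI impI)
    qed (use P eP e'n sb ch ex in auto)
  qed
qed

end

text \<open>Quiver mutation at \<open>e\<close> reverses the arrows at \<open>e\<close> and composes the arrows from \<open>i1\<close>, \<open>i2\<close> to \<open>e\<close> with those from \<open>e\<close> to \<open>o1\<close>, \<open>o2\<close>.
Two of the four compositions cancel against the arrows of the old triangles; the others are the arrows of the new ones.\<close>
lemma mutation_at_quadrilateral:
  assumes rq: "reverses_quadrilateral f f' e e' i1 i2 o1 o2"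
    and anti: "\<And>u v. f u v \<Longrightarrow> \<not> f v u"
  shows "u \<noteq> e \<Longrightarrow> u \<noteq> e' \<Longrightarrow> f u e \<longleftrightarrow> u = i1 \<or> u = i2" "u \<noteq> e \<Longrightarrow> u \<noteq> e' \<Longrightarrow> f e u \<longleftrightarrow> u = o1 \<or> u = o2"
    "u \<noteq> e \<Longrightarrow> u \<noteq> e' \<Longrightarrow> f' e' u \<longleftrightarrow> f u e" "u \<noteq> e \<Longrightarrow> u \<noteq> e' \<Longrightarrow> f' u e' \<longleftrightarrow> f e u" "\<not> f e e" "\<not> f' e' e'"
    and "u \<noteq> e \<Longrightarrow> u \<noteq> e' \<Longrightarrow> v \<noteq> e \<Longrightarrow> v \<noteq> e' \<Longrightarrow> (of_bool (f' u v) :: nat) =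
      (of_bool (f u v) + of_bool (f u e) * of_bool (f e v)) - (of_bool (f v u) + of_bool (f v e) * of_bool (f e u))"
proof -
  obtain R where d: "distinct [i1, i2, o1, o2, e, e']"
    and f: "\<And>u v. f u v \<longleftrightarrow> R u v \<or> (u, v) \<in> {(i1, e), (e, o1), (o1, i1), (i2, e), (e, o2), (o2, i2)}"
    and f': "\<And>u v. f' u v \<longleftrightarrow> R u v \<or> (u, v) \<in> {(o1, e'), (e', i2), (i2, o1), (o2, e'), (e', i1), (i1, o2)}"
    and R: "\<And>u v. R u v \<Longrightarrow> {u, v} \<inter> {e, e'} = {} \<and> \<not> {u, v} \<subseteq> {i1, i2, o1, o2}"
    using rq unfolding reverses_quadrilateral_def by auto
  have Re: "\<not> R u e" "\<not> R e u" "\<not> R u e'" "\<not> R e' u" for u using R[of u e] R[of e u] R[of u e'] R[of e' u] by auto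
  show fe: "f u e \<longleftrightarrow> u = i1 \<or> u = i2" "f e u \<longleftrightarrow> u = o1 \<or> u = o2" if "u \<noteq> e" "u \<noteq> e'" for u
    using d that Re[of u] unfolding f by auto
  show "f' e' u \<longleftrightarrow> f u e" "f' u e' \<longleftrightarrow> f e u" if "u \<noteq> e" "u \<noteq> e'"
    using d that Re[of u] unfolding fe[OF that] f' by auto
  show "\<not> f e e" "\<not> f' e' e'" using d Re[of e] Re[of e'] unfolding f f' by auto
  assume u: "u \<noteq> e" "u \<noteq> e'" and v: "v \<noteq> e" "v \<noteq> e'"
  note fu = fe[OF u] and fv = fe[OF v]
  show "(of_bool (f' u v) :: nat) =
      (of_bool (f u v) + of_bool (f u e) * of_bool (f e v)) - (of_bool (f v u) + of_bool (f v e) * of_bool (f e u))"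
  proof (cases "{u, v} \<subseteq> {i1, i2, o1, o2}")
    case True
    then have "\<not> R u v" "\<not> R v u" using R[of u v] R[of v u] by auto
    then have 1: "f u v \<longleftrightarrow> (u, v) \<in> {(o1, i1), (o2, i2)}" "f v u \<longleftrightarrow> (v, u) \<in> {(o1, i1), (o2, i2)}" "f' u v \<longleftrightarrow> (u, v) \<in> {(i2, o1), (i1, o2)}"
      using u v unfolding f f' by auto
    have ne: "i1 \<noteq> i2" "i1 \<noteq> o1" "i1 \<noteq> o2" "i2 \<noteq> o1" "i2 \<noteq> o2" "o1 \<noteq> o2" using d by simp_all
    have "\<forall>u\<in>{i1, i2, o1, o2}. \<forall>v\<in>{i1, i2, o1, o2}. (of_bool ((u, v) \<in> {(i2, o1), (i1, o2)}) :: nat) =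
        (of_bool ((u, v) \<in> {(o1, i1), (o2, i2)}) + of_bool (u = i1 \<or> u = i2) * of_bool (v = o1 \<or> v = o2))
        - (of_bool ((v, u) \<in> {(o1, i1), (o2, i2)}) + of_bool (v = i1 \<or> v = i2) * of_bool (u = o1 \<or> u = o2))"
      by (simp add: ne ne[symmetric])
    then show ?thesis unfolding 1 fu fv using True by blast
  next
    case False
    then have 1: "f u v \<longleftrightarrow> R u v" "f' u v \<longleftrightarrow> R u v" using u v unfolding f f' by auto
    have 2: "\<not> (f u e \<and> f e v)" "\<not> (f v e \<and> f e u)" using False unfolding fu fv by auto
    have 3: "f u v \<Longrightarrow> \<not> f v u" by (rule anti)
    have z: "of_bool (f u e) * of_bool (f e v) = (0::nat)" "of_bool (f v e) * of_bool (f e u) = (0::nat)" using 2 by auto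
    show ?thesis unfolding z using 1 3 by (cases "R u v") auto
  qed
qed

context tile_setting
begin

lemma chart_exists:
  assumes T: "T \<in> represented_by k n S"
  obtains \<tau> where "chart k n S Z \<delta> T \<tau>"
proof -
  obtain \<tau> where "bij_betw \<tau> {0..<card (black T)} (black T)" using ex_bij_betw_nat_finite[OF representedD(7)[OF T]] by blast
  then have "bij_betw \<tau> {..<k} (black T)" by (simp add: representedD(6)[OF T] atLeast0LessThan)
  then have "chart k n S Z \<delta> T \<tau>" using T by unfold_locales
  then show thesis by (rule that)
qed

text \<open>Nonempty open subsets of an irreducible variety.\<close>
lemma seed_tori_meet:
  assumes T: "T \<in> represented_by k n S" "T' \<in> represented_by k n S"
  shows "seed_torus k Z T \<inter> seed_torus k Z T' \<noteq> {}" "zariski_open Gk (seed_torus k Z T \<inter> seed_torus k Z T')"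
proof -
  have "seed_torus k Z X \<noteq> {}" if "X \<in> represented_by k n S" for X
    using chart_exists[OF that] chart.seed_torus_nonempty by metis
  then show "seed_torus k Z T \<inter> seed_torus k Z T' \<noteq> {}"
    using dense_openI[OF irreducible_Gr seed_torus_open[OF T(1)]] seed_torus_open[OF T(2)] T unfolding dense_open_def by blast
  show "zariski_open Gk (seed_torus k Z T \<inter> seed_torus k Z T')"
    by (rule zariski_open_Int[OF graded_Gr seed_torus_open[OF T(1)] seed_torus_open[OF T(2)]])
qed

lemma \<delta>_black_arc: "T \<in> represented_by k n S \<Longrightarrow> P \<in> black S \<Longrightarrow> \<delta> P \<in> black_arcs T"
  using black_arcsD(2) \<delta>_boundary by blast

text \<open>The quivers agree by \<open>mutation_at_quadrilateral\<close>. The exchange monomials of the mutation are products over opposite sides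
of the quadrilateral, so by the relation \<open>xvar_ptolemy\<close> the exchanged label agrees with the cluster variable of the new
diagonal wherever both seeds are defined.\<close>
lemma flip_iso:
  assumes T: "T \<in> represented_by k n S" and T': "T' \<in> represented_by k n S"
    and e: "e \<in> mutable (seed_of T)" and fl: "is_flip T e T' e1"
  shows "seed_iso_via Gk (id(e := e1)) (mutate e (seed_of T)) (seed_of T')"
proof -
  have em: "e \<in> black_arcs T - boundary_arcs S" using e by (simp add: seed_simps)
  obtain e' i1 i2 o1 o2 P where P: "P \<in> black S" "e \<in> chords P" "e' \<in> chords P" and e'n: "e' \<notin> arcs_of n T"
    and io: "{i1, i2, o1, o2} \<subseteq> black_arcs T"
    and fq: "\<forall>T'\<in>represented_by k n S. \<forall>f. is_flip T e T' f \<longrightarrow> f = e' \<and> black_arcs T' = insert e' (black_arcs T - {e}) \<and>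
        reverses_quadrilateral (follows (black T)) (follows (black T')) e e' i1 i2 o1 o2 \<and>
        (\<forall>Y\<in>Gr k (k + 2). tws Y (\<delta> P) \<noteq> 0 \<longrightarrow> xvar e Y * xvar e' Y = xvar i1 Y * xvar i2 Y + xvar o1 Y * xvar o2 Y)"
    by (rule flip_quiver[OF T em], rule that) assumption+
  have F: "e1 = e'" "black_arcs T' = insert e' (black_arcs T - {e})"
      "reverses_quadrilateral (follows (black T)) (follows (black T')) e e' i1 i2 o1 o2"
      "\<And>Y. Y \<in> Gr k (k + 2) \<Longrightarrow> tws Y (\<delta> P) \<noteq> 0 \<Longrightarrow> xvar e Y * xvar e' Y = xvar i1 Y * xvar i2 Y + xvar o1 Y * xvar o2 Y"
    using bspec[OF fq T', THEN spec, THEN mp, OF fl] by blast+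
  have d: "distinct [i1, i2, o1, o2, e, e']" using F(3) by (simp add: reverses_quadrilateral_def)
  note Q = mutation_at_quadrilateral[OF F(3) follows_antisym]
  let ?V = "verts (seed_of T)" and ?V' = "verts (seed_of T')"
  note e1 = F(1)
  have e'b: "e' \<notin> black_arcs T" using e'n black_arcsD(1)[OF T] by blast
  have V: "?V = black_arcs T - \<delta> ` black S" by (rule verts_seed[OF T])
  have e'\<delta>: "e' \<notin> \<delta> ` black S" using e'b \<delta>_black_arc[OF T] by blast
  have e\<delta>: "e \<notin> \<delta> ` black S" using em \<delta>_boundary by blast
  have eV: "e \<in> ?V" "e' \<notin> ?V" using em e\<delta> e'b V by auto
  have V': "?V' = insert e' (?V - {e})" unfolding verts_seed[OF T'] V F(2) using e'\<delta> by auto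
  let ?\<sigma> = "id(e := e')"
  have e'B: "e' \<notin> boundary_arcs S" using e'b black_arcsD(2)[OF T] by blast
  have fr: "e \<notin> frozen (seed_of T)" "e' \<notin> frozen (seed_of T)" using em e'B by (auto simp: seed_simps)
  have lab: "rat_eq Gk (exchange e (seed_of T)) (xvar e')"
  proof (rule rat_eqI[OF irreducible_Gr seed_tori_meet(2)[OF T T'] seed_tori_meet(1)[OF T T']])
    fix Y assume "Y \<in> seed_torus k Z T \<inter> seed_torus k Z T'"
    then have Y: "Y \<in> Gr k (k + 2)" "\<And>e. e \<in> black_arcs T \<Longrightarrow> tws Y e \<noteq> 0" using seed_torus_iff[OF T] by auto
    have \<delta>1: "xvar u Y = 1" if "u \<in> black_arcs T" "u \<notin> ?V" for u
    proof -
      obtain P where "P \<in> black S" "u = \<delta> P" using \<open>u \<notin> ?V\<close> \<open>u \<in> black_arcs T\<close> V by blast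
      then show ?thesis using xvar_\<delta>[of P Y] Y(2)[of u] \<open>u \<in> black_arcs T\<close> by simp
    qed
    have fin: "finite ?V" by (rule card_verts(1)[OF T])
    have arr: "arrows (seed_of T) u e = of_bool (u = i1 \<or> u = i2)" "arrows (seed_of T) e u = of_bool (u = o1 \<or> u = o2)" if "u \<in> ?V" for u
    proof -
      have "u \<noteq> e'" using that eV by auto
      then have "follows (black T) u e \<longleftrightarrow> u = i1 \<or> u = i2" "follows (black T) e u \<longleftrightarrow> u = o1 \<or> u = o2"
        using Q(1,2)[of u] Q(5) d by (cases "u = e"; auto)+
      then show "arrows (seed_of T) u e = of_bool (u = i1 \<or> u = i2)" "arrows (seed_of T) e u = of_bool (u = o1 \<or> u = o2)"
        using that eV fr by (simp_all add: seed_simps(4))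
    qed
    have "(\<Prod>u\<in>?V. xvar u Y ^ arrows (seed_of T) u e) = (\<Prod>u\<in>?V. xvar u Y ^ of_bool (u = i1 \<or> u = i2))"
      by (rule prod.cong[OF HOL.refl]) (simp only: arr)
    also have "\<dots> = xvar i1 Y * xvar i2 Y" by (rule prod_select_two) (use fin d \<delta>1 io in auto)
    finally have p1: "(\<Prod>u\<in>?V. xvar u Y ^ arrows (seed_of T) u e) = xvar i1 Y * xvar i2 Y" .
    have "(\<Prod>u\<in>?V. xvar u Y ^ arrows (seed_of T) e u) = (\<Prod>u\<in>?V. xvar u Y ^ of_bool (u = o1 \<or> u = o2))"
      by (rule prod.cong[OF HOL.refl]) (simp only: arr)
    also have "\<dots> = xvar o1 Y * xvar o2 Y" by (rule prod_select_two) (use fin d \<delta>1 io in auto)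
    finally have p2: "(\<Prod>u\<in>?V. xvar u Y ^ arrows (seed_of T) e u) = xvar o1 Y * xvar o2 Y" .
    have h: "tws Y (\<delta> P) \<noteq> 0" by (rule Y(2)[OF \<delta>_black_arc[OF T P(1)]])
    have "xvar e Y \<noteq> 0" unfolding xvar_eq[OF P(1,2)] using h Y(2)[of e] em by auto
    moreover have "xvar e Y * xvar e' Y = xvar i1 Y * xvar i2 Y + xvar o1 Y * xvar o2 Y" by (rule F(4)[OF Y(1) h])
    ultimately show "exchange e (seed_of T) Y = xvar e' Y"
      unfolding exchange_def seed_simps(3) p1 p2 by (simp add: field_simps)
  qed
  show ?thesis unfolding seed_iso_via_def verts_mutate frozen_mutate mutable_mutate arrows_mutate label_mutate e1
  proof (intro conjI ballI)
    show "bij_betw ?\<sigma> ?V ?V'" unfolding bij_betw_def inj_on_def V' using eV by auto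
    show "?\<sigma> ` frozen (seed_of T) = frozen (seed_of T')" using fr by (auto simp: seed_simps image_iff)
    show "?\<sigma> ` mutable (seed_of T) = mutable (seed_of T')"
    proof -
      have "mutable (seed_of T') = insert e' (mutable (seed_of T) - {e})" unfolding seed_simps F(2) using e'B by auto
      then show ?thesis using e e'b by (auto simp: seed_simps image_iff)
    qed
    fix u assume u: "u \<in> ?V"
    then have ue': "u \<noteq> e'" using eV by auto
    show "rat_eq Gk (((label (seed_of T))(e := exchange e (seed_of T))) u) (label (seed_of T') (?\<sigma> u))"
      using lab rat_eq_refl[OF graded_Gr] by (simp add: seed_simps(3))
    fix v assume v: "v \<in> ?V"
    then have ve': "v \<noteq> e'" using eV by auto
    have \<sigma>V: "?\<sigma> u \<in> ?V'" "?\<sigma> v \<in> ?V'" using u v V' by auto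
    have fr': "frozen (seed_of T') = frozen (seed_of T)" by (simp add: seed_simps)
    have ar: "arrows (seed_of T) x y = (if x \<in> frozen (seed_of T) \<and> y \<in> frozen (seed_of T) then 0 else of_bool (follows (black T) x y))"
      if "x \<in> ?V" "y \<in> ?V" for x y using that by (simp add: seed_simps(4))
    have ar': "arrows (seed_of T') x y = (if x \<in> frozen (seed_of T) \<and> y \<in> frozen (seed_of T) then 0 else of_bool (follows (black T') x y))"
      if "x \<in> ?V'" "y \<in> ?V'" for x y using that by (simp add: seed_simps(4) fr')
    show "arrows (seed_of T') (?\<sigma> u) (?\<sigma> v) = mutate_arrows e (seed_of T) u v"
    proof (cases "u = e \<or> v = e")
      case True
      then show ?thesis
        unfolding mutate_arrows_def ar[OF v u] ar'[OF \<sigma>V]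
        using Q(3,4)[of u] Q(3,4)[of v] Q(5,6) ue' ve' fr by auto
    next
      case False
      then show ?thesis
        unfolding mutate_arrows_def ar[OF v u] ar[OF u v] ar[OF u eV(1)] ar[OF eV(1) u] ar[OF v eV(1)] ar[OF eV(1) v] ar'[OF \<sigma>V]
        using Q(7)[of u v] ue' ve' fr by simp
    qed
  qed
qed

lemma flip_exists:
  assumes T: "T \<in> represented_by k n S" and e: "e \<in> mutable (seed_of T)"
  shows "\<exists>T'\<in>represented_by k n S. \<exists>e'. is_flip T e T' e'"
proof -
  have em: "e \<in> black_arcs T - boundary_arcs S" using e by (simp add: seed_simps)
  show ?thesis by (rule flip_quiver[OF T em]) blast
qed

text \<open>Each mutation of a triangulation seed is a flip.\<close>
lemma reachable_seeds_are_triangulation_seeds: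
  assumes s: "s \<in> represented_by k n S" and r: "mutation_reachable (seed_of s) \<Sigma>'"
  shows "\<exists>t\<in>represented_by k n S. \<exists>\<sigma>. seed_iso_via Gk \<sigma> \<Sigma>' (seed_of t)"
  using r
proof (induction rule: mutation_reachable.induct)
  case refl then show ?case using s seed_iso_via_refl[OF graded_Gr] by blast
next
  case (step \<Sigma>' w)
  then obtain t \<sigma> where t: "t \<in> represented_by k n S" and \<sigma>: "seed_iso_via Gk \<sigma> \<Sigma>' (seed_of t)" by blast
  have fin: "finite (verts \<Sigma>')" using \<sigma> card_verts(1)[OF t] by (auto simp: seed_iso_via_def bij_betw_finite)
  have m: "\<sigma> w \<in> mutable (seed_of t)" using \<sigma> step.hyps(2) by (auto simp: seed_iso_via_def)
  obtain t' e' where t': "t' \<in> represented_by k n S" "is_flip t (\<sigma> w) t' e'" using flip_exists[OF t m] by blast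
  show ?case
    using t'(1) seed_iso_via_trans[OF graded_Gr seed_iso_via_mutate[OF graded_Gr \<sigma> step.hyps(2) fin] flip_iso[OF t t'(1) m t'(2)]] by blast
qed

text \<open>Conversely flips, which connect all triangulations, are mutations.\<close>
lemma triangulation_seeds_are_reachable:
  assumes s: "s \<in> represented_by k n S" and t: "t \<in> represented_by k n S"
  shows "\<exists>\<Sigma>' \<sigma>. mutation_reachable (seed_of s) \<Sigma>' \<and> seed_iso_via Gk \<sigma> \<Sigma>' (seed_of t)"
proof (rule represented_induct[OF s t, where \<Phi> = "\<lambda>t. \<exists>\<Sigma>' \<sigma>. mutation_reachable (seed_of s) \<Sigma>' \<and> seed_iso_via Gk \<sigma> \<Sigma>' (seed_of t)"])
  show "\<exists>\<Sigma>' \<sigma>. mutation_reachable (seed_of s) \<Sigma>' \<and> seed_iso_via Gk \<sigma> \<Sigma>' (seed_of s)"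
    using mutation_reachable.refl seed_iso_via_refl[OF graded_Gr] by blast
next
  fix T1 T2 :: bicolored
  assume "\<exists>\<Sigma>' \<sigma>. mutation_reachable (seed_of s) \<Sigma>' \<and> seed_iso_via Gk \<sigma> \<Sigma>' (seed_of T1)" "black T2 = black T1"
  then show "\<exists>\<Sigma>' \<sigma>. mutation_reachable (seed_of s) \<Sigma>' \<and> seed_iso_via Gk \<sigma> \<Sigma>' (seed_of T2)" using seed_of_cong by metis
next
  fix T1 T2 e e'
  assume T1: "T1 \<in> represented_by k n S" and T2: "T2 \<in> represented_by k n S" and e: "e \<in> black_arcs T1 - boundary_arcs S"
    and fl: "is_flip T1 e T2 e'" and "\<exists>\<Sigma>' \<sigma>. mutation_reachable (seed_of s) \<Sigma>' \<and> seed_iso_via Gk \<sigma> \<Sigma>' (seed_of T1)"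
  then obtain \<Sigma>' \<sigma> where r: "mutation_reachable (seed_of s) \<Sigma>'" and \<sigma>: "seed_iso_via Gk \<sigma> \<Sigma>' (seed_of T1)" by blast
  have m: "e \<in> mutable (seed_of T1)" using e by (simp add: seed_simps)
  have "e \<in> \<sigma> ` mutable \<Sigma>'" using m \<sigma> by (simp add: seed_iso_via_def)
  then obtain w where w: "w \<in> mutable \<Sigma>'" "e = \<sigma> w" by blast
  have fin: "finite (verts \<Sigma>')" using \<sigma> card_verts(1)[OF T1] by (auto simp: seed_iso_via_def bij_betw_finite)
  have i: "seed_iso_via Gk \<sigma> (mutate w \<Sigma>') (mutate e (seed_of T1))" unfolding w(2) by (rule seed_iso_via_mutate[OF graded_Gr \<sigma> w(1) fin])
  have "seed_iso_via Gk (id(e := e') \<circ> \<sigma>) (mutate w \<Sigma>') (seed_of T2)"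
    by (rule seed_iso_via_trans[OF graded_Gr i flip_iso[OF T1 T2 m fl]])
  then show "\<exists>\<Sigma>' \<sigma>. mutation_reachable (seed_of s) \<Sigma>' \<and> seed_iso_via Gk \<sigma> \<Sigma>' (seed_of T2)"
    using mutation_reachable.step[OF r w(1)] by blast
qed

lemma cluster_structure:
  "cluster_variety_in Gk (2 * k) (represented_by k n S) (seed_torus k Z) seed_of (cluster_space k n Z S)"
proof -
  have "is_seed_torus Gk (2 * k) (seed_torus k Z T) (seed_of T)" if "T \<in> represented_by k n S" for T
    using chart_exists[OF that] chart.is_seed_torus_triangulation by metis
  then show ?thesis
    unfolding cluster_variety_in_def cluster_space_def same_seed_def
    using reachable_seeds_are_triangulation_seeds triangulation_seeds_are_reachable by blast
qed

end

section \<open>The positive part\<close>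

text \<open>The map on the Grassmannian may be computed with any representative.\<close>
lemma complexify_Z_tilde:
  assumes A: "represents k n A V" and Z: "Z \<in> carrier_mat n (k + 2)" and r: "vec_space.rank k (A * Z) = k"
  shows "complexify k (k + 2) (Z_tilde k n Z V) = vec_space.row_space (k + 2) (cmat (A * Z))"
proof -
  have Ac: "A \<in> carrier_mat k n" using A by (simp add: represents_def)
  have AZ: "A * Z \<in> carrier_mat k (k + 2)" using Ac Z by simp
  obtain G where G: "G \<in> carrier_mat k k" "det G \<noteq> 0" "rep k n V = G * A" by (rule rep_unique[OF A])
  have "Z_tilde k n Z V = vec_space.row_space (k + 2) (G * (A * Z))"
    unfolding Z_tilde_def G(3) assoc_mult_mat[OF G(1) Ac Z] ..
  also have "\<dots> = vec_space.row_space (k + 2) (A * Z)" by (rule row_space_mult_unit[OF AZ G(1,2)])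
  finally have "represents k (k + 2) (A * Z) (Z_tilde k n Z V)" using AZ r by (simp add: represents_def)
  then obtain H where H: "H \<in> carrier_mat k k" "det H \<noteq> 0" "rep k (k + 2) (Z_tilde k n Z V) = H * (A * Z)" by (rule rep_unique)
  have "complexify k (k + 2) (Z_tilde k n Z V) = vec_space.row_space (k + 2) (cmat H * cmat (A * Z))"
    unfolding complexify_def H(3) of_real_hom.mat_hom_mult[OF H(1) AZ] ..
  also have "\<dots> = vec_space.row_space (k + 2) (cmat (A * Z))"
    by (rule row_space_mult_unit) (use AZ H in \<open>auto simp: of_real_hom.hom_det\<close>)
  finally show ?thesis .
qed

context tile_setting
begin

text \<open>A real witness is more convenient in products and quotients than the condition on the real part.\<close>
definition positive_at :: "complex vec set \<Rightarrow> arc \<Rightarrow> bool" where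
  "positive_at Y e \<longleftrightarrow> (\<exists>r>0. xvar e Y = complex_of_real r)"

lemma positive_at_iff: "positive_at Y e \<longleftrightarrow> xvar e Y \<in> \<real> \<and> Re (xvar e Y) > 0"
  unfolding positive_at_def by (metis Re_complex_of_real Reals_cases Reals_of_real)

lemma positive_part_iff:
  "Y \<in> positive_part k n Z S \<delta> \<longleftrightarrow> Y \<in> cluster_space k n Z S \<and> (\<forall>e\<in>cluster_arcs S \<delta>. positive_at Y e)"
  unfolding positive_part_def positive_at_iff by simp

text \<open>The distinguished arcs have nonzero twistor coordinate because \<open>Y\<close> lies in some seed torus; for the other arcs this
follows from the positivity of their cluster variables. So the positive part lies in every seed torus.\<close>
lemma positive_part_in_torus:
  assumes Y: "Y \<in> positive_part k n Z S \<delta>" and T: "T \<in> represented_by k n S"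
  shows "Y \<in> seed_torus k Z T" "\<And>e. e \<in> black_arcs T \<Longrightarrow> positive_at Y e"
proof -
  obtain T0 where T0: "T0 \<in> represented_by k n S" "Y \<in> seed_torus k Z T0"
    using Y unfolding positive_part_iff cluster_space_def by blast
  have Yg: "Y \<in> Gr k (k + 2)" by (rule seed_torusD[OF T0(2)])
  have \<delta>: "tws Y (\<delta> P) \<noteq> 0" if "P \<in> black S" for P
    using T0(2) \<delta>_black_arc[OF T0(1) that] unfolding seed_torus_iff[OF T0(1)] by blast
  have pos: "positive_at Y e \<and> tws Y e \<noteq> 0" if e: "e \<in> black_arcs T" for e
  proof -
    obtain P where P: "P \<in> black S" "e \<in> arcs_of n T \<inter> chords P" by (rule arc_polygon[OF T e])
    show ?thesis
    proof (cases "e = \<delta> P")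
      case True
      have "positive_at Y e" unfolding positive_at_def True xvar_\<delta>[OF P(1) \<delta>[OF P(1)]] by (intro exI[of _ 1]) simp
      then show ?thesis using True \<delta>[OF P(1)] by simp
    next
      case False
      then have p: "positive_at Y e" using P Y unfolding positive_part_iff cluster_arcs_def by blast
      then have "xvar e Y \<noteq> 0" unfolding positive_at_def by auto
      then have "tws Y e \<noteq> 0" using xvar_eq[OF P(1)] P(2) by auto
      then show ?thesis using p by simp
    qed
  qed
  show "Y \<in> seed_torus k Z T" unfolding seed_torus_iff[OF T] using Yg pos by blast
  show "positive_at Y e" if "e \<in> black_arcs T" for e using pos[OF that] by simp
qed

text \<open>Positivity of one seed propagates along flips, because the exchange relations are subtraction free, and each chord of a
black polygon occurs in some triangulation.\<close>
lemma positive_on_all_arcs: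
  assumes Y: "Y \<in> seed_torus k Z T" and T: "T \<in> represented_by k n S" and pos: "\<And>e. e \<in> black_arcs T \<Longrightarrow> positive_at Y e"
  shows "Y \<in> positive_part k n Z S \<delta>"
proof -
  have Yg: "Y \<in> Gr k (k + 2)" by (rule seed_torusD[OF Y])
  have \<delta>: "tws Y (\<delta> P) \<noteq> 0" if "P \<in> black S" for P
    using Y \<delta>_black_arc[OF T that] unfolding seed_torus_iff[OF T] by blast
  have all: "\<forall>e\<in>black_arcs T'. positive_at Y e" if T': "T' \<in> represented_by k n S" for T'
  proof (rule represented_induct[OF T T', where \<Phi> = "\<lambda>T. \<forall>e\<in>black_arcs T. positive_at Y e"])
    show "\<forall>e\<in>black_arcs T. positive_at Y e" using pos by blast
    show "\<forall>e\<in>black_arcs T2. positive_at Y e" if "\<forall>e\<in>black_arcs T1. positive_at Y e" "black T2 = black T1" for T1 T2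
      using that by (simp add: black_arcs_def)
    fix T1 T2 e f
    assume T1: "T1 \<in> represented_by k n S" and T2: "T2 \<in> represented_by k n S" and p: "\<forall>e\<in>black_arcs T1. positive_at Y e"
      and e: "e \<in> black_arcs T1 - boundary_arcs S" and fl: "is_flip T1 e T2 f"
    obtain e' i1 i2 o1 o2 P where P: "P \<in> black S" and io: "{i1, i2, o1, o2} \<subseteq> black_arcs T1"
      and fq: "\<forall>T'\<in>represented_by k n S. \<forall>f. is_flip T1 e T' f \<longrightarrow> f = e' \<and> black_arcs T' = insert e' (black_arcs T1 - {e}) \<and>
        reverses_quadrilateral (follows (black T1)) (follows (black T')) e e' i1 i2 o1 o2 \<and>
        (\<forall>Y\<in>Gr k (k + 2). tws Y (\<delta> P) \<noteq> 0 \<longrightarrow> xvar e Y * xvar e' Y = xvar i1 Y * xvar i2 Y + xvar o1 Y * xvar o2 Y)"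
      by (rule flip_quiver[OF T1 e], rule that) assumption+
    have F: "black_arcs T2 = insert e' (black_arcs T1 - {e})" and x: "xvar e Y * xvar e' Y = xvar i1 Y * xvar i2 Y + xvar o1 Y * xvar o2 Y"
      using bspec[OF fq T2, THEN spec, THEN mp, OF fl] Yg \<delta>[OF P] by blast+
      have "positive_at Y e" "positive_at Y i1" "positive_at Y i2" "positive_at Y o1" "positive_at Y o2" using p e io by auto
      then obtain r r1 r2 s1 s2 where r: "r > 0" "xvar e Y = complex_of_real r" "r1 > 0" "xvar i1 Y = complex_of_real r1"
        "r2 > 0" "xvar i2 Y = complex_of_real r2" "s1 > 0" "xvar o1 Y = complex_of_real s1" "s2 > 0" "xvar o2 Y = complex_of_real s2"
        unfolding positive_at_def by blast
      have "xvar e' Y = complex_of_real ((r1 * r2 + s1 * s2) / r)"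
        using x r(1) unfolding r by (simp add: field_simps)
      moreover have "(r1 * r2 + s1 * s2) / r > 0" using r by (simp add: add_pos_pos)
      ultimately have "positive_at Y e'" unfolding positive_at_def by blast
      then show "\<forall>e\<in>black_arcs T2. positive_at Y e" unfolding F using p by simp
  qed
  have "positive_at Y e" if "e \<in> cluster_arcs S \<delta>" for e
  proof -
    obtain P where P: "P \<in> black S" "e \<in> chords P" using \<open>e \<in> cluster_arcs S \<delta>\<close> unfolding cluster_arcs_def by blast
    obtain T' where T': "T' \<in> represented_by k n S" "e \<in> arcs_of n T'" by (rule chord_in_represented[OF P])
    have "e \<in> black_arcs T'" unfolding black_arcs_eq[OF T'(1)] using P T'(2) by blast
    then show ?thesis using all[OF T'(1)] by blast
  qed
  then show ?thesis unfolding positive_part_iff cluster_space_def using Y T by blast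
qed

end

context chart
begin

text \<open>A matrix with the sign pattern of the cell represents a point of the cell, and its image is a plane: some twistor
coordinate is nonzero by \<open>twistor_sign\<close>.\<close>
lemma cell_point:
  assumes C: "C \<in> carrier_mat k n"
    and p: "\<forall>J. J \<subseteq> {..<n} \<and> card J = k \<longrightarrow> (if matched (black T) J then plucker C J > 0 else plucker C J = 0)"
  shows "represents k n C (vec_space.row_space n C)" "vec_space.row_space n C \<in> positroid_cell k n T"
    "represents k (k + 2) (cmat (C * Z)) (vec_space.row_space (k + 2) (cmat (C * Z)))"
    "complexify k (k + 2) (Z_tilde k n Z (vec_space.row_space n C)) = vec_space.row_space (k + 2) (cmat (C * Z))"
    "\<And>e. e \<in> arcs_of n T \<Longrightarrow> (-1) ^ area_of (black T) e * omega (C * Z) (rowfun Z (fst e)) (rowfun Z (snd e)) > 0"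
proof -
  show om: "(-1) ^ area_of (black T) e * omega (C * Z) (rowfun Z (fst e)) (rowfun Z (snd e)) > 0" if "e \<in> arcs_of n T" for e
  proof -
    have ab: "(fst e, snd e) \<in> arcs_of n T" using that by simp
    have "(-1) ^ area_of (black T) (fst e, snd e) * omega (C * Z) (rowfun Z (fst e)) (rowfun Z (snd e)) > 0"
      by (rule bt.twistor_sign[OF C _ Zpos ab]) (use p in auto)
    then show ?thesis by simp
  qed
  have "\<tau> 0 \<in> black T" using bt.\<tau>B kpos by simp
  then have t: "\<tau> 0 \<in> triangles (arcs_of n T)" using representedD(5)[OF T] by blast
  obtain e where e: "e \<in> arcs_of n T" by (rule trianglesE[OF t]) blast
  have e': "(fst e, snd e) \<in> arcs_of n T" using e by simp
  obtain I where "I \<subseteq> {..<n}" "card I = k" "matched (black T) I" by (rule bt.matched_avoiding[OF e'])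
  then have "\<exists>I. I \<subseteq> {..<n} \<and> card I = k \<and> plucker C I \<noteq> 0" using p by (metis less_irrefl)
  then have r: "vec_space.rank k C = k" unfolding full_rank_plucker[OF C] .
  show rC: "represents k n C (vec_space.row_space n C)" using C r by (simp add: represents_def)
  show "vec_space.row_space n C \<in> positroid_cell k n T"
    unfolding positroid_cell_def matched_def[symmetric] using rC p by auto
  have CZ: "C * Z \<in> carrier_mat k (k + 2)" using C Z by simp
  have o: "omega (C * Z) (rowfun Z (fst e)) (rowfun Z (snd e)) \<noteq> 0" using om[OF e] by auto
  have rZ: "vec_space.rank k (C * Z) = k" by (rule omega_full_rank[OF CZ o])
  show "complexify k (k + 2) (Z_tilde k n Z (vec_space.row_space n C)) = vec_space.row_space (k + 2) (cmat (C * Z))"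
    by (rule complexify_Z_tilde[OF rC Z rZ])
  have "tw (cmat (C * Z)) Z e \<noteq> 0" unfolding tw_cmat[OF CZ Z arc_bounds(1,2)[OF T e]] using o by simp
  then have "vec_space.rank k (cmat (C * Z)) = k" unfolding tw_def by (intro omega_full_rank) (use CZ in auto)
  then show "represents k (k + 2) (cmat (C * Z)) (vec_space.row_space (k + 2) (cmat (C * Z)))"
    using CZ by (simp add: represents_def)
qed

text \<open>By \<open>twistor_sign\<close> the signed twistor coordinates of the arcs of \<open>T\<close> all have the same sign, up to the scalar relating
representatives, so their quotients are positive.\<close>
lemma tile_subset: "open_tile k n Z T \<subseteq> positive_part k n Z S \<delta>"
proof
  fix Y assume "Y \<in> open_tile k n Z T"
  then obtain V where V: "V \<in> positroid_cell k n T" and YV: "Y = complexify k (k + 2) (Z_tilde k n Z V)"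
    unfolding open_tile_def by blast
  obtain A where A: "represents k n A V" and pA: "\<forall>I. I \<subseteq> {..<n} \<and> card I = k \<longrightarrow>
      (if matched (black T) I then plucker A I > 0 else plucker A I = 0)"
    using V unfolding positroid_cell_def matched_def[symmetric] by blast
  have Ac: "A \<in> carrier_mat k n" and VA: "V = vec_space.row_space n A" using A by (auto simp: represents_def)
  note cp = cell_point[OF Ac pA]
  have AZ: "A * Z \<in> carrier_mat k (k + 2)" using Ac Z by simp
  have Yr: "represents k (k + 2) (cmat (A * Z)) Y" using cp(3) unfolding YV VA cp(4) .
  obtain c where c: "c \<noteq> 0" "\<And>e. fst e < n \<Longrightarrow> snd e < n \<Longrightarrow> tws Y e = c * tw (cmat (A * Z)) Z e"
    using twistor_representative[OF Z Yr] by metis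
  define r where "r e = (-1) ^ area_of (black T) e * omega (A * Z) (rowfun Z (fst e)) (rowfun Z (snd e))" for e
  have r: "r e > 0" "(-1) ^ area k n S e * tws Y e = c * complex_of_real (r e)" if e: "e \<in> arcs_of n T" for e
  proof -
    show "r e > 0" unfolding r_def by (rule cp(5)[OF e])
    show "(-1) ^ area k n S e * tws Y e = c * complex_of_real (r e)"
      unfolding r_def area_arc[OF T e] c(2)[OF arc_bounds(1,2)[OF T e]] tw_cmat[OF AZ Z arc_bounds(1,2)[OF T e]] by simp
  qed
  have nz: "tws Y e \<noteq> 0" if "e \<in> arcs_of n T" for e
    using r[OF that] c(1) by (metis less_irrefl mult_eq_0_iff of_real_eq_0_iff)
  have ba: "black_arcs T \<subseteq> arcs_of n T" by (rule black_arcsD(1)[OF T])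
  have "Y \<in> Gr k (k + 2)" using Yr unfolding Gr_def by blast
  then have YT: "Y \<in> seed_torus k Z T" unfolding seed_torus_iff[OF T] using nz ba by blast
  show "Y \<in> positive_part k n Z S \<delta>"
  proof (rule positive_on_all_arcs[OF YT T])
    fix e assume e: "e \<in> black_arcs T"
    obtain P where P: "P \<in> black S" "e \<in> arcs_of n T \<inter> chords P" by (rule arc_polygon[OF T e])
    have \<delta>T: "\<delta> P \<in> arcs_of n T" using \<delta>_black_arc[OF T P(1)] ba by blast
    have eT: "e \<in> arcs_of n T" "e \<in> chords P" using P by auto
    have "xvar e Y = complex_of_real (r e / r (\<delta> P))"
      unfolding xvar_eq[OF P(1) eT(2)] r(2)[OF eT(1)] r(2)[OF \<delta>T] using c(1) by simp
    then show "positive_at Y e" unfolding positive_at_def using r(1)[OF eT(1)] r(1)[OF \<delta>T] by (intro exI[of _ "r e / r (\<delta> P)"]) simp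
  qed
qed

text \<open>A point of the positive part is the plane with its own cluster coordinates, which are positive, so \<open>positive_plane\<close>
applies.\<close>
lemma positive_part_subset: "positive_part k n Z S \<delta> \<subseteq> open_tile k n Z T"
proof
  fix Y assume Y: "Y \<in> positive_part k n Z S \<delta>"
  have YT: "Y \<in> seed_torus k Z T" and pos: "\<And>e. e \<in> black_arcs T \<Longrightarrow> positive_at Y e" using positive_part_in_torus[OF Y T] by auto
  define x where "x e = (if e \<in> I then Re (xvar e Y) else 1)" for e
  have Ib: "I \<subseteq> black_arcs T" using verts_seed[OF T] by blast
  have xpos: "x e > 0" if "e \<in> black_arcs T" for e using pos[OF that] by (auto simp: x_def positive_at_iff)
  have xI: "x e = 1" if "e \<in> black_arcs T - I" for e using that by (simp add: x_def)
  have xc: "complex_of_real (x e) = coords Y e" if "e \<in> I" for e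
    using pos[OF subsetD[OF Ib that]] that unfolding positive_at_def x_def coords_def by auto
  have pm: "plane_matrix (\<lambda>e. complex_of_real (x e)) = plane_matrix (coords Y)"
  proof -
    have "weight (\<lambda>e. complex_of_real (x e)) = weight (coords Y)" unfolding weight_def using xc by auto
    then show ?thesis unfolding plane_matrix_def by simp
  qed
  obtain C where C: "C \<in> carrier_mat k n"
    "\<And>J. J \<subseteq> {..<n} \<Longrightarrow> card J = k \<Longrightarrow> (matched (black T) J \<longrightarrow> plucker C J > 0) \<and> (\<not> matched (black T) J \<longrightarrow> plucker C J = 0)"
    "\<exists>G\<in>carrier_mat k k. det G \<noteq> 0 \<and> cmat (C * Z) = G * plane_matrix (\<lambda>e. complex_of_real (x e))"
    "disc (\<lambda>e. complex_of_real (x e)) \<noteq> 0"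
    by (rule positive_plane[OF xpos xI], assumption, assumption, rule that) (assumption | blast)+
  obtain G where G: "G \<in> carrier_mat k k" "det G \<noteq> 0" "cmat (C * Z) = G * plane_matrix (coords Y)" using C(3) unfolding pm by blast
  have d: "disc (coords Y) \<noteq> 0" using C(4) unfolding disc_def pm .
  have p: "\<forall>J. J \<subseteq> {..<n} \<and> card J = k \<longrightarrow> (if matched (black T) J then plucker C J > 0 else plucker C J = 0)"
    using C(2) by auto
  note cp = cell_point[OF C(1) p]
  have "Y = vec_space.row_space (k + 2) (plane_matrix (coords Y))" using plane_coords(1)[OF YT d] by (simp add: represents_def)
  also have "\<dots> = vec_space.row_space (k + 2) (cmat (C * Z))"
    unfolding G(3) row_space_mult_unit[OF plane_matrix_carrier G(1,2)] ..
  also have "\<dots> = complexify k (k + 2) (Z_tilde k n Z (vec_space.row_space n C))" by (rule cp(4)[symmetric])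
  finally show "Y \<in> open_tile k n Z T" unfolding open_tile_def using cp(2) by blast
qed

end

theorem theorem6p8:
  fixes k n :: nat and Z :: "real mat" and S :: bicolored and \<delta> :: "nat set \<Rightarrow> nat \<times> nat"
  assumes "k > 0" and "n > 0" and "k + 2 \<le> n"
    and "Z \<in> Mat_pos n (k + 2)"
    and "bicolored_subdivision k n S"
    and "\<forall>P\<in>black S. \<delta> P \<in> sides P"
  shows "cluster_variety_in (Gr_variety k (k + 2)) (2 * k) (represented_by k n S)
           (seed_torus k Z) (triangulation_seed k n Z S \<delta>) (cluster_space k n Z S) \<and>
         (\<forall>T \<in> represented_by k n S. \<forall>e \<in> mutable (triangulation_seed k n Z S \<delta> T).
            (\<exists>T' \<in> represented_by k n S. \<exists>e'. is_flip T e T' e') \<and>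
            (\<forall>T' \<in> represented_by k n S. \<forall>e'. is_flip T e T' e' \<longrightarrow>
               seed_iso_via (Gr_variety k (k + 2)) (id(e := e'))
                 (mutate e (triangulation_seed k n Z S \<delta> T)) (triangulation_seed k n Z S \<delta> T'))) \<and>
         (\<forall>T \<in> represented_by k n S. positive_part k n Z S \<delta> = open_tile k n Z T)"
proof -
  interpret subdivision k n S by (rule subdivisionI[OF assms(5)])
  interpret tile_setting k n S Z \<delta> by unfold_locales (use assms in auto)
  have "positive_part k n Z S \<delta> = open_tile k n Z T" if T: "T \<in> represented_by k n S" for T
  proof -
    obtain \<tau> where "chart k n S Z \<delta> T \<tau>" by (rule chart_exists[OF T])
    then interpret chart k n S Z \<delta> T \<tau> .
    show ?thesis using tile_subset positive_part_subset by (rule equalityI[rotated])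
  qed
  then show ?thesis using cluster_structure flip_exists flip_iso by blast
qed

end
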